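(* Let $G$ be a finite group and let $\Omega$ be a space of repetitive tilings of $\mathbb{R}^d$ with finite local complexity, written as an inverse limit $\Omega=\varprojlim\Gamma_n$ of approximants. Then the regular covers of $\Omega$ whose group of deck transformations is isomorphic to $G$, modulo homeomorphisms that are lifts of the identity on $\Omega$, are parametrized by (i.e. are in natural bijection with) $$\varinjlim \mathrm{Sur}(\pi_1(\Gamma_n),G)/\mathrm{Aut}(G).$$
   Context: Tilings. A tile is a closed topological ball in $\mathbb{R}^d$, possibly labeled; a tiling is a collection of tiles with disjoint interiors whose union is $\mathbb{R}^d$; a patch is a finite collection of tiles of a tiling. $\mathbb{R}^d$ acts by translation. A tiling has finite local complexity (FLC) if up to translation there are only finitely many patches of diameter below any given bound. Two tilings are close if, up to a small translation, they agree on a large ball around the origin. The hull $\Omega=\Omega_T$ of a tiling $T$ is the set of all tilings all of whose patches occur in $T$ up to translation; $T$ is repetitive if every patch $P$ of $T$ occurs in every ball of radius $R(P)$ for some $R(P)$ (equivalently, the translation action on $\Omega_T$ is minimal). The tiling space is such a hull $\Omega$. Approximants. $\Omega=\varprojlim\Gamma_n$, where the $\Gamma_n$ are finite connected CW complexes (collared Anderson–Putnam complexes or variants), with forgetful maps $\sigma_{n+1}:\Gamma_{n+1}\to\Gamma_n$. For every radius $r$, for all large $n$ a point of $\Gamma_n$ determines the tiling in the ball of radius $r$ about the origin; and for each $n$ a sufficiently large patch around the origin determines the image of a tiling in $\Gamma_n$. Base points of the $\Gamma_n$ are chosen compatibly (e.g. as the images of a fixed tiling in $\Omega$). $\mathrm{Sur}(\pi_1(\Gamma_n),G)$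 is the set of surjective homomorphisms $\pi_1(\Gamma_n)\to G$. An element of $\varinjlim\mathrm{Sur}(\pi_1(\Gamma_n),G)$ is represented by a homomorphism $\phi_n:\pi_1(\Gamma_n)\to G$ for some $n$ such that all the induced homomorphisms $\phi_m=\phi_n\circ(\sigma_{n+1}\circ\cdots\circ\sigma_m)_*:\pi_1(\Gamma_m)\to G$, $m\ge n$, are surjective; $\phi_n$ and $\phi'_m$ represent the same element if the induced homomorphisms $\phi_N,\phi'_N$ are equal for some $N\geq n,m$. $\mathrm{Aut}(G)$ acts by post-composition. Covers are connected covering spaces; a cover is regular if its group of deck transformations acts transitively on fibers. Two covers $p:\tilde\Omega\to\Omega$, $p':\tilde\Omega'\to\Omega$ are identified if there is a homeomorphism $h:\tilde\Omega\to\tilde\Omega'$ with $p'\circ h=p$ (a lift of the identity). *)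

theory Defs
  imports "HOL-Analysis.Analysis" "HOL-Algebra.Bij" "HOL-Algebra.Group_Action"
begin

section \<open>Tilings of Euclidean space\<close>

text \<open>A tile is a closed set together with a label; unlabeled tiles are the case where the
  label type is \<^typ>\<open>unit\<close>.\<close>

type_synonym ('d, 'l) tile = "(real ^ 'd) set \<times> 'l"
type_synonym ('d, 'l) tiling = "('d, 'l) tile set"

definition is_tile :: "('d::finite, 'l) tile \<Rightarrow> bool" where
  "is_tile t \<longleftrightarrow> fst t homeomorphic (cball 0 1 :: (real ^ 'd) set)"

definition is_tiling :: "('d::finite, 'l) tiling \<Rightarrow> bool" where
  "is_tiling T \<longleftrightarrow>
     (\<forall>t\<in>T. is_tile t) \<and>
     (\<forall>s\<in>T. \<forall>t\<in>T. s \<noteq> t \<longrightarrow> interior (fst s) \<inter> interior (fst t) = {}) \<and>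
     (\<Union>t\<in>T. fst t) = UNIV"

definition patch_of :: "('d, 'l) tiling \<Rightarrow> ('d, 'l) tile set \<Rightarrow> bool" where
  "patch_of T P \<longleftrightarrow> finite P \<and> P \<subseteq> T"

definition support :: "('d, 'l) tile set \<Rightarrow> (real ^ 'd) set" where
  "support P = (\<Union>t\<in>P. fst t)"

definition translate :: "real ^ 'd \<Rightarrow> ('d, 'l) tile set \<Rightarrow> ('d, 'l) tile set" where
  "translate v P = (\<lambda>(s, l). ((\<lambda>x. v + x) ` s, l)) ` P"

definition finite_local_complexity :: "('d::finite, 'l) tiling \<Rightarrow> bool" where
  "finite_local_complexity T \<longleftrightarrow>
     (\<forall>D. \<exists>F. finite F \<and>
        (\<forall>P. patch_of T P \<and> diameter (support P) < D \<longrightarrow> (\<exists>Q\<in>F. \<exists>v. P = translate v Q)))"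

definition repetitive :: "('d::finite, 'l) tiling \<Rightarrow> bool" where
  "repetitive T \<longleftrightarrow>
     (\<forall>P. patch_of T P \<longrightarrow>
        (\<exists>R. \<forall>x. \<exists>v. translate v P \<subseteq> T \<and> support (translate v P) \<subseteq> ball x R))"

definition tiling_hull :: "('d::finite, 'l) tiling \<Rightarrow> ('d, 'l) tiling set" where
  "tiling_hull T = {S. is_tiling S \<and> (\<forall>P. patch_of S P \<longrightarrow> (\<exists>v. translate v P \<subseteq> T))}"

text \<open>Two tilings agree on the ball of radius \<open>r\<close> about the origin if they have the same tiles
  meeting that ball.\<close>

definition agree :: "real \<Rightarrow> ('d::finite, 'l) tiling \<Rightarrow> ('d, 'l) tiling \<Rightarrow> bool" where
  "agree r S T \<longleftrightarrow> {t\<in>S. fst t \<inter> cball 0 r \<noteq> {}} = {t\<in>T. fst t \<inter> cball 0 r \<noteq> {}}"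

definition tiling_nbhd :: "('d::finite, 'l) tiling \<Rightarrow> real \<Rightarrow> ('d, 'l) tiling set" where
  "tiling_nbhd T \<epsilon> = {S. \<exists>v. norm v < \<epsilon> \<and> agree (1 / \<epsilon>) (translate v S) T}"

definition hull_topology :: "('d::finite, 'l) tiling \<Rightarrow> ('d, 'l) tiling topology" where
  "hull_topology T =
     topology (\<lambda>U. U \<subseteq> tiling_hull T \<and> (\<forall>S\<in>U. \<exists>\<epsilon>>0. tiling_nbhd S \<epsilon> \<inter> tiling_hull T \<subseteq> U))"

lemma agree_mono: "agree r S T \<Longrightarrow> r' \<le> r \<Longrightarrow> agree r' S T"
  unfolding agree_def using subset_cball[of r' r "0::real ^ 'd"] by blast

lemma tiling_nbhd_mono:
  assumes "0 < \<delta>" "\<delta> \<le> \<epsilon>"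
  shows "tiling_nbhd T \<delta> \<subseteq> tiling_nbhd T \<epsilon>"
proof
  fix S assume "S \<in> tiling_nbhd T \<delta>"
  then obtain v where v: "norm v < \<delta>" "agree (1 / \<delta>) (translate v S) T"
    unfolding tiling_nbhd_def by blast
  have "1 / \<epsilon> \<le> 1 / \<delta>" using assms by (simp add: frac_le)
  then have "norm v < \<epsilon> \<and> agree (1 / \<epsilon>) (translate v S) T"
    using v assms agree_mono by fastforce
  then show "S \<in> tiling_nbhd T \<epsilon>" unfolding tiling_nbhd_def by blast
qed

lemma openin_hull_topology:
  "openin (hull_topology T) U \<longleftrightarrow>
     U \<subseteq> tiling_hull T \<and> (\<forall>S\<in>U. \<exists>\<epsilon>>0. tiling_nbhd S \<epsilon> \<inter> tiling_hull T \<subseteq> U)"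
proof -
  have "istopology (\<lambda>U. U \<subseteq> tiling_hull T \<and> (\<forall>S\<in>U. \<exists>\<epsilon>>0. tiling_nbhd S \<epsilon> \<inter> tiling_hull T \<subseteq> U))"
    unfolding istopology_def
  proof (intro conjI allI impI)
    fix U V
    assume U: "U \<subseteq> tiling_hull T \<and> (\<forall>S\<in>U. \<exists>\<epsilon>>0. tiling_nbhd S \<epsilon> \<inter> tiling_hull T \<subseteq> U)"
      and V: "V \<subseteq> tiling_hull T \<and> (\<forall>S\<in>V. \<exists>\<epsilon>>0. tiling_nbhd S \<epsilon> \<inter> tiling_hull T \<subseteq> V)"
    show "U \<inter> V \<subseteq> tiling_hull T" using U by blast
    show "\<forall>S\<in>U \<inter> V. \<exists>\<epsilon>>0. tiling_nbhd S \<epsilon> \<inter> tiling_hull T \<subseteq> U \<inter> V"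
    proof
      fix S assume S: "S \<in> U \<inter> V"
      obtain a b where a: "a > 0" "tiling_nbhd S a \<inter> tiling_hull T \<subseteq> U"
        and b: "b > 0" "tiling_nbhd S b \<inter> tiling_hull T \<subseteq> V"
        using S U V by (metis IntD1 IntD2)
      have "tiling_nbhd S (min a b) \<subseteq> tiling_nbhd S a \<inter> tiling_nbhd S b"
        using a(1) b(1) by (simp add: tiling_nbhd_mono)
      then show "\<exists>\<epsilon>>0. tiling_nbhd S \<epsilon> \<inter> tiling_hull T \<subseteq> U \<inter> V"
        using a b by (intro exI[of _ "min a b"]) auto
    qed
  qed (meson Sup_least, meson Union_iff Union_upper order_trans)
  then show ?thesis
    unfolding hull_topology_def by simp
qed

lemma topspace_hull_topology [simp]: "topspace (hull_topology T) = tiling_hull T"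
proof -
  have "openin (hull_topology T) (tiling_hull T)"
    by (auto simp: openin_hull_topology intro: exI[of _ 1])
  then show ?thesis
    by (metis openin_hull_topology openin_subset openin_topspace subset_antisym)
qed


section \<open>Finite CW complexes\<close>

text \<open>The closed unit ball and its interior in \<^term>\<open>Euclidean_space k\<close>; for \<open>k = 0\<close> both
  are a single point.\<close>

definition closed_disk :: "nat \<Rightarrow> (nat \<Rightarrow> real) topology" where
  "closed_disk k = subtopology (Euclidean_space k) {x. (\<Sum>i<k. (x i)\<^sup>2) \<le> 1}"

definition open_disk :: "nat \<Rightarrow> (nat \<Rightarrow> real) topology" where
  "open_disk k = subtopology (Euclidean_space k) {x. (\<Sum>i<k. (x i)\<^sup>2) < 1}"

text \<open>Whitehead's definition. For finitely many cells, closure finiteness and the weak topology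
  are automatic: a Hausdorff space that is a finite union of compact sets has the weak topology
  they determine.\<close>

definition finite_CW_complex :: "'a topology \<Rightarrow> bool" where
  "finite_CW_complex X \<longleftrightarrow> Hausdorff_space X \<and>
     (\<exists>(I :: nat set) (k :: nat \<Rightarrow> nat) (\<Phi> :: nat \<Rightarrow> (nat \<Rightarrow> real) \<Rightarrow> 'a).
        finite I \<and>
        (\<forall>i\<in>I. continuous_map (closed_disk (k i)) X (\<Phi> i)) \<and>
        (\<forall>i\<in>I. embedding_map (open_disk (k i)) X (\<Phi> i)) \<and>
        disjoint_family_on (\<lambda>i. \<Phi> i ` topspace (open_disk (k i))) I \<and>
        (\<Union>i\<in>I. \<Phi> i ` topspace (open_disk (k i))) = topspace X \<and>
        (\<forall>i\<in>I. \<Phi> i ` (topspace (closed_disk (k i)) - topspace (open_disk (k i)))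
                 \<subseteq> (\<Union>j\<in>{j\<in>I. k j < k i}. \<Phi> j ` topspace (open_disk (k j)))))"


section \<open>Approximants\<close>

text \<open>The map \<open>\<sigma> (Suc n)\<close> goes from \<open>\<Gamma> (Suc n)\<close> to \<open>\<Gamma> n\<close>; the value \<open>\<sigma> 0\<close> is irrelevant.\<close>

definition inverse_limit ::
  "(nat \<Rightarrow> 'c topology) \<Rightarrow> (nat \<Rightarrow> 'c \<Rightarrow> 'c) \<Rightarrow> (nat \<Rightarrow> 'c) topology" where
  "inverse_limit \<Gamma> \<sigma> =
     subtopology (product_topology \<Gamma> UNIV) {x. \<forall>n. \<sigma> (Suc n) (x (Suc n)) = x n}"

text \<open>\<open>\<pi> n\<close> is the projection from the tiling space to \<open>\<Gamma> n\<close>. The last two conditions say that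
  points of far out approximants determine large patches around the origin, and that large
  patches around the origin determine points of the approximants.\<close>

definition approximants ::
  "('d::finite, 'l) tiling \<Rightarrow> (nat \<Rightarrow> 'c topology) \<Rightarrow> (nat \<Rightarrow> 'c \<Rightarrow> 'c) \<Rightarrow>
    (nat \<Rightarrow> ('d, 'l) tiling \<Rightarrow> 'c) \<Rightarrow> bool" where
  "approximants T \<Gamma> \<sigma> \<pi> \<longleftrightarrow>
     (\<forall>n. finite_CW_complex (\<Gamma> n) \<and> connected_space (\<Gamma> n)) \<and>
     (\<forall>n. continuous_map (\<Gamma> (Suc n)) (\<Gamma> n) (\<sigma> (Suc n))) \<and>
     homeomorphic_map (hull_topology T) (inverse_limit \<Gamma> \<sigma>) (\<lambda>S n. \<pi> n S) \<and>
     (\<forall>r. \<exists>N. \<forall>n\<ge>N. \<forall>S\<in>tiling_hull T. \<forall>S'\<in>tiling_hull T. \<pi> n S = \<pi> n S' \<longrightarrow> agree r S S') \<and>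
     (\<forall>n. \<exists>r. \<forall>S\<in>tiling_hull T. \<forall>S'\<in>tiling_hull T. agree r S S' \<longrightarrow> \<pi> n S = \<pi> n S')"

definition compatible_base_points ::
  "(nat \<Rightarrow> 'c topology) \<Rightarrow> (nat \<Rightarrow> 'c \<Rightarrow> 'c) \<Rightarrow> (nat \<Rightarrow> 'c) \<Rightarrow> bool" where
  "compatible_base_points \<Gamma> \<sigma> b \<longleftrightarrow>
     (\<forall>n. b n \<in> topspace (\<Gamma> n) \<and> \<sigma> (Suc n) (b (Suc n)) = b n)"

text \<open>For \<open>n \<le> m\<close>, \<open>bonding_map \<sigma> n m\<close> is the composite \<open>\<sigma> (n + 1) \<circ> \<dots> \<circ> \<sigma> m\<close> from
  \<open>\<Gamma> m\<close> to \<open>\<Gamma> n\<close>.\<close>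

primrec bonding_map :: "(nat \<Rightarrow> 'c \<Rightarrow> 'c) \<Rightarrow> nat \<Rightarrow> nat \<Rightarrow> 'c \<Rightarrow> 'c" where
  "bonding_map \<sigma> n 0 = id"
| "bonding_map \<sigma> n (Suc m) = (if n \<le> m then bonding_map \<sigma> n m \<circ> \<sigma> (Suc m) else id)"


section \<open>Fundamental groups\<close>

definition loops :: "'a topology \<Rightarrow> 'a \<Rightarrow> (real \<Rightarrow> 'a) set" where
  "loops X a = {p. pathin X p \<and> p 0 = a \<and> p 1 = a}"

definition loop_homotopy :: "'a topology \<Rightarrow> 'a \<Rightarrow> ((real \<Rightarrow> 'a) \<times> (real \<Rightarrow> 'a)) set" where
  "loop_homotopy X a =
     {(p, q). homotopic_with (\<lambda>r. r 0 = a \<and> r 1 = a) (top_of_set {0..1}) X p q}"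

text \<open>The library's \<^const>\<open>joinpaths\<close> is confined to types of class \<^class>\<open>topological_space\<close>.\<close>

definition loop_concat :: "(real \<Rightarrow> 'a) \<Rightarrow> (real \<Rightarrow> 'a) \<Rightarrow> real \<Rightarrow> 'a" where
  "loop_concat p q = (\<lambda>t. if t \<le> 1/2 then p (2 * t) else q (2 * t - 1))"

definition fundamental_group :: "'a topology \<Rightarrow> 'a \<Rightarrow> (real \<Rightarrow> 'a) set monoid" where
  "fundamental_group X a =
     \<lparr>carrier = loops X a // loop_homotopy X a,
      mult = \<lambda>A B. loop_homotopy X a `` {loop_concat p q | p q. p \<in> A \<and> q \<in> B},
      one = loop_homotopy X a `` {\<lambda>_. a}\<rparr>"

text \<open>The homomorphism into the fundamental group of \<open>(Y, b)\<close> induced by a map \<open>f\<close>.\<close>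

definition induced_hom ::
  "'b topology \<Rightarrow> 'b \<Rightarrow> ('a \<Rightarrow> 'b) \<Rightarrow> (real \<Rightarrow> 'a) set \<Rightarrow> (real \<Rightarrow> 'b) set" where
  "induced_hom Y b f A = loop_homotopy Y b `` ((\<lambda>p. f \<circ> p) ` A)"


section \<open>The direct limit of surjections onto a group\<close>

definition pushed_hom ::
  "(nat \<Rightarrow> 'c topology) \<Rightarrow> (nat \<Rightarrow> 'c \<Rightarrow> 'c) \<Rightarrow> (nat \<Rightarrow> 'c) \<Rightarrow> nat \<Rightarrow> nat \<Rightarrow>
    ((real \<Rightarrow> 'c) set \<Rightarrow> 'g) \<Rightarrow> (real \<Rightarrow> 'c) set \<Rightarrow> 'g" where
  "pushed_hom \<Gamma> \<sigma> b n m \<phi> = \<phi> \<circ> induced_hom (\<Gamma> n) (b n) (bonding_map \<sigma> n m)"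

definition sur_reps ::
  "(nat \<Rightarrow> 'c topology) \<Rightarrow> (nat \<Rightarrow> 'c \<Rightarrow> 'c) \<Rightarrow> (nat \<Rightarrow> 'c) \<Rightarrow> ('g, 'm) monoid_scheme \<Rightarrow>
    (nat \<times> ((real \<Rightarrow> 'c) set \<Rightarrow> 'g)) set" where
  "sur_reps \<Gamma> \<sigma> b G =
     {(n, \<phi>). \<phi> \<in> hom (fundamental_group (\<Gamma> n) (b n)) G \<and>
        (\<forall>m\<ge>n. pushed_hom \<Gamma> \<sigma> b n m \<phi> \<in> epi (fundamental_group (\<Gamma> m) (b m)) G)}"

text \<open>Homomorphisms are only meaningful on carriers, so they are compared there.\<close>

definition sur_rel ::
  "(nat \<Rightarrow> 'c topology) \<Rightarrow> (nat \<Rightarrow> 'c \<Rightarrow> 'c) \<Rightarrow> (nat \<Rightarrow> 'c) \<Rightarrow> ('g, 'm) monoid_scheme \<Rightarrow>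
    ((nat \<times> ((real \<Rightarrow> 'c) set \<Rightarrow> 'g)) \<times> (nat \<times> ((real \<Rightarrow> 'c) set \<Rightarrow> 'g))) set" where
  "sur_rel \<Gamma> \<sigma> b G =
     {((n, \<phi>), (m, \<psi>)). (n, \<phi>) \<in> sur_reps \<Gamma> \<sigma> b G \<and> (m, \<psi>) \<in> sur_reps \<Gamma> \<sigma> b G \<and>
        (\<exists>N. n \<le> N \<and> m \<le> N \<and>
           (\<forall>x\<in>carrier (fundamental_group (\<Gamma> N) (b N)).
              pushed_hom \<Gamma> \<sigma> b n N \<phi> x = pushed_hom \<Gamma> \<sigma> b m N \<psi> x))}"

definition lim_Sur ::
  "(nat \<Rightarrow> 'c topology) \<Rightarrow> (nat \<Rightarrow> 'c \<Rightarrow> 'c) \<Rightarrow> (nat \<Rightarrow> 'c) \<Rightarrow> ('g, 'm) monoid_scheme \<Rightarrow>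
    (nat \<times> ((real \<Rightarrow> 'c) set \<Rightarrow> 'g)) set set" where
  "lim_Sur \<Gamma> \<sigma> b G = sur_reps \<Gamma> \<sigma> b G // sur_rel \<Gamma> \<sigma> b G"

definition aut_action ::
  "(nat \<Rightarrow> 'c topology) \<Rightarrow> (nat \<Rightarrow> 'c \<Rightarrow> 'c) \<Rightarrow> (nat \<Rightarrow> 'c) \<Rightarrow> ('g, 'm) monoid_scheme \<Rightarrow>
    ('g \<Rightarrow> 'g) \<Rightarrow> (nat \<times> ((real \<Rightarrow> 'c) set \<Rightarrow> 'g)) set \<Rightarrow>
    (nat \<times> ((real \<Rightarrow> 'c) set \<Rightarrow> 'g)) set" where
  "aut_action \<Gamma> \<sigma> b G \<alpha> C = sur_rel \<Gamma> \<sigma> b G `` ((\<lambda>(n, \<phi>). (n, \<alpha> \<circ> \<phi>)) ` C)"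

abbreviation lim_Sur_mod_Aut ::
  "(nat \<Rightarrow> 'c topology) \<Rightarrow> (nat \<Rightarrow> 'c \<Rightarrow> 'c) \<Rightarrow> (nat \<Rightarrow> 'c) \<Rightarrow> ('g, 'm) monoid_scheme \<Rightarrow>
    (nat \<times> ((real \<Rightarrow> 'c) set \<Rightarrow> 'g)) set set set" where
  "lim_Sur_mod_Aut \<Gamma> \<sigma> b G \<equiv> orbits (AutoGroup G) (lim_Sur \<Gamma> \<sigma> b G) (aut_action \<Gamma> \<sigma> b G)"


section \<open>Covers\<close>

text \<open>The library's \<^const>\<open>covering_space\<close>, transcribed to abstract topologies.\<close>

definition covering_map :: "'e topology \<Rightarrow> 'x topology \<Rightarrow> ('e \<Rightarrow> 'x) \<Rightarrow> bool" where
  "covering_map E X p \<longleftrightarrow>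
     continuous_map E X p \<and> p ` topspace E = topspace X \<and>
     (\<forall>x\<in>topspace X. \<exists>U. x \<in> U \<and> openin X U \<and>
        (\<exists>\<V>. \<Union>\<V> = {e\<in>topspace E. p e \<in> U} \<and>
             (\<forall>V\<in>\<V>. openin E V) \<and>
             pairwise disjnt \<V> \<and>
             (\<forall>V\<in>\<V>. homeomorphic_map (subtopology E V) (subtopology X U) p)))"

definition is_cover :: "'x topology \<Rightarrow> 'e topology \<times> ('e \<Rightarrow> 'x) \<Rightarrow> bool" where
  "is_cover X = (\<lambda>(E, p). connected_space E \<and> covering_map E X p)"

definition deck_transformations :: "'e topology \<times> ('e \<Rightarrow> 'x) \<Rightarrow> ('e \<Rightarrow> 'e) set" where
  "deck_transformations = (\<lambda>(E, p).
     {h \<in> extensional (topspace E). homeomorphic_map E E h \<and> (\<forall>e\<in>topspace E. p (h e) = p e)})"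

definition deck_group :: "'e topology \<times> ('e \<Rightarrow> 'x) \<Rightarrow> ('e \<Rightarrow> 'e) monoid" where
  "deck_group C = BijGroup (topspace (fst C)) \<lparr>carrier := deck_transformations C\<rparr>"

definition is_regular :: "'e topology \<times> ('e \<Rightarrow> 'x) \<Rightarrow> bool" where
  "is_regular = (\<lambda>(E, p).
     \<forall>e\<in>topspace E. \<forall>e'\<in>topspace E. p e = p e' \<longrightarrow>
       (\<exists>h\<in>deck_transformations (E, p). h e = e'))"

definition regular_covers ::
  "'x topology \<Rightarrow> ('g, 'm) monoid_scheme \<Rightarrow> ('e topology \<times> ('e \<Rightarrow> 'x)) set" where
  "regular_covers X G = {C. is_cover X C \<and> is_regular C \<and> deck_group C \<cong> G}"

definition cover_equiv :: "'e topology \<times> ('e \<Rightarrow> 'x) \<Rightarrow> 'f topology \<times> ('f \<Rightarrow> 'x) \<Rightarrow> bool" where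
  "cover_equiv = (\<lambda>(E, p) (E', p').
     \<exists>h. homeomorphic_map E E' h \<and> (\<forall>e\<in>topspace E. p' (h e) = p e))"

definition cover_equiv_rel ::
  "'x topology \<Rightarrow> ('g, 'm) monoid_scheme \<Rightarrow>
    (('e topology \<times> ('e \<Rightarrow> 'x)) \<times> ('e topology \<times> ('e \<Rightarrow> 'x))) set" where
  "cover_equiv_rel X G =
     {(C, D). C \<in> regular_covers X G \<and> D \<in> regular_covers X G \<and> cover_equiv C D}"

definition pullback_cover ::
  "'x topology \<Rightarrow> ('x \<Rightarrow> 'y) \<Rightarrow> 'e topology \<times> ('e \<Rightarrow> 'y) \<Rightarrow>
    ('x \<times> 'e) topology \<times> ('x \<times> 'e \<Rightarrow> 'x)" where
  "pullback_cover X f = (\<lambda>(E, p).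
     (subtopology (prod_topology X E) {(x, e). f x = p e}, fst))"

text \<open>\<open>(E, p)\<close> is the cover of \<open>(X, a)\<close> that belongs to the normal subgroup \<open>ker \<phi>\<close> of the
  fundamental group.\<close>

definition cover_of_hom ::
  "'y topology \<Rightarrow> 'y \<Rightarrow> ('g, 'm) monoid_scheme \<Rightarrow> ((real \<Rightarrow> 'y) set \<Rightarrow> 'g) \<Rightarrow>
    'e topology \<times> ('e \<Rightarrow> 'y) \<Rightarrow> bool" where
  "cover_of_hom X a G \<phi> = (\<lambda>(E, p).
     is_cover X (E, p) \<and>
     (\<exists>e\<in>topspace E. p e = a \<and>
        induced_hom X a p ` carrier (fundamental_group E e) =
          kernel (fundamental_group X a) G \<phi>))"

text \<open>A cover of the tiling space corresponds to an orbit \<open>c\<close> of the automorphism group on the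
  direct limit if it is the pullback, under the projection to some approximant \<open>\<Gamma> n\<close>, of the
  cover of \<open>\<Gamma> n\<close> belonging to a representative \<open>\<phi>\<close> of an element of \<open>c\<close>. That cover has
  fibers of the size of \<open>G\<close>, so it can be realized with points in \<^typ>\<open>'c \<times> 'g\<close>.\<close>

definition corresponds ::
  "('d::finite, 'l) tiling \<Rightarrow> (nat \<Rightarrow> 'c topology) \<Rightarrow> (nat \<Rightarrow> ('d, 'l) tiling \<Rightarrow> 'c) \<Rightarrow>
    (nat \<Rightarrow> 'c) \<Rightarrow> ('g, 'm) monoid_scheme \<Rightarrow>
    (nat \<times> ((real \<Rightarrow> 'c) set \<Rightarrow> 'g)) set set \<Rightarrow>
    'e topology \<times> ('e \<Rightarrow> ('d, 'l) tiling) \<Rightarrow> bool" where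
  "corresponds T \<Gamma> \<pi> b G c C \<longleftrightarrow>
     (\<exists>(n, \<phi>) \<in> \<Union>c. \<exists>D :: ('c \<times> 'g) topology \<times> ('c \<times> 'g \<Rightarrow> 'c).
        cover_of_hom (\<Gamma> n) (b n) G \<phi> D \<and>
        cover_equiv C (pullback_cover (hull_topology T) (\<pi> n) D))"

end

theory Submission
  imports Defs
begin

text \<open>Let \<open>X\<^sub>n\<close> be the approximants and \<open>L\<close> their inverse limit. A surjection of
  the fundamental group of \<open>X\<^sub>n\<close> onto \<open>G\<close> is the monodromy of a regular cover of
  \<open>X\<^sub>n\<close>, since a finite CW complex is locally contractible; its pullback to \<open>L\<close> is the cover
  that we assign to it. Since the \<open>X\<^sub>n\<close> are compact Hausdorff, a clopen subset of an inverse limit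
  already comes from a finite stage. Hence the pullback is connected if and only if all its
  analogues over \<open>X\<^sub>m\<close> with \<open>m \<ge> n\<close> are, that is, if all the induced homomorphisms are
  surjective. An equivalence between two pullbacks is a clopen graph in their fibre product, so it
  too comes from a finite stage, where two surjections have equivalent covers if and only if
  they have the same kernel, i.e. differ by an automorphism of \<open>G\<close>. Finally every regular cover
  of \<open>L\<close> comes from a finite stage, because it is given by finitely many transition constants.\<close>

section \<open>Covering maps and lifting\<close>

text \<open>The limit is in general neither path connected nor locally connected, so neither its
  fundamental group nor a lifting criterion over it classifies its covers. Paths are therefore
  lifted only over the approximants; over the limit the arguments are about open, clopen and compact
  sets. To move a bundle between stages it is encoded by a function \<open>\<kappa>\<close> of two
  points that is constrained only for nearby points. Such a function pulls back by composition,
  without an open cover to carry along and without any continuous choice. Finiteness of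
  \<open>G\<close> makes the total spaces compact, so the bundles over the stages form an inverse
  system themselves and the statement on clopen sets applies to them too; fibre products are treated
  as bundles with group \<open>G \<times>\<times> G\<close>. Surjections are compared through their
  kernels, since an equivalence of covers may shift the base point of a fibre and so is not tied to
  a particular homomorphism.\<close>

text \<open>The set \<open>sec e ` U\<close> is the sheet over \<open>U\<close> through the point \<open>e\<close>.\<close>

definition trivializing ::
  "'e topology \<Rightarrow> 'x topology \<Rightarrow> ('e \<Rightarrow> 'x) \<Rightarrow> 'x set \<Rightarrow> ('e \<Rightarrow> 'x \<Rightarrow> 'e) \<Rightarrow> bool" where
  "trivializing E X p U sec \<longleftrightarrow> openin X U \<and>
     (\<forall>e\<in>topspace E. p e \<in> U \<longrightarrow>
        continuous_map (subtopology X U) E (sec e) \<and> (\<forall>y\<in>U. p (sec e y) = y) \<and>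
        sec e (p e) = e \<and> openin E (sec e ` U) \<and> (\<forall>y\<in>U. sec (sec e y) = sec e))"

lemma trivializing_in:
  assumes "trivializing E X p U sec" "e \<in> topspace E" "p e \<in> U" "y \<in> U"
  shows "sec e y \<in> topspace E"
  using assms openin_subset[of E "sec e ` U"] unfolding trivializing_def by blast

lemma trivializing_sheet_inv:
  assumes "trivializing E X p U sec" "e \<in> topspace E" "p e \<in> U" "e' \<in> sec e ` U"
  shows "p e' \<in> U" "sec e (p e') = e'" "sec e' = sec e"
  using assms unfolding trivializing_def by auto

text \<open>By the last clause of \<open>trivializing\<close>, every point of a sheet returns the
  same section, so a common point of two sheets forces their sections to be equal.\<close>

lemma trivializing_disjoint:
  assumes t: "trivializing E X p U sec" and e: "e \<in> topspace E" "p e \<in> U"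
    "e' \<in> topspace E" "p e' \<in> U" and "sec e ` U \<inter> sec e' ` U \<noteq> {}"
  shows "sec e = sec e'"
proof -
  obtain y z where yz: "y \<in> U" "z \<in> U" "sec e y = sec e' z" using assms(6) by auto
  have "sec (sec e y) = sec e" "sec (sec e' z) = sec e'"
    using t e yz unfolding trivializing_def by blast+
  then show ?thesis using yz by simp
qed

lemma covering_map_continuous: "covering_map E X p \<Longrightarrow> continuous_map E X p"
  by (simp add: covering_map_def)

lemma covering_map_in: "covering_map E X p \<Longrightarrow> e \<in> topspace E \<Longrightarrow> p e \<in> topspace X"
  by (auto simp: covering_map_def)

text \<open>Each sheet of an evenly covered set has an inverse of \<open>p\<close>;
  \<open>sec e\<close> is the inverse belonging to the sheet that contains \<open>e\<close>.
  Sections indexed by points of \<open>E\<close> compose with maps more easily than a family of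
  disjoint sets.\<close>

lemma covering_map_trivializing:
  assumes p: "covering_map E X p" and x: "x \<in> topspace X"
  obtains U sec where "x \<in> U" "trivializing E X p U sec"
proof -
  have "\<exists>U. x \<in> U \<and> openin X U \<and>
        (\<exists>\<V>. \<Union>\<V> = {e\<in>topspace E. p e \<in> U} \<and> (\<forall>V\<in>\<V>. openin E V) \<and> pairwise disjnt \<V> \<and>
             (\<forall>V\<in>\<V>. homeomorphic_map (subtopology E V) (subtopology X U) p))"
    using p x unfolding covering_map_def by blast
  then obtain U \<V> where U: "x \<in> U" "openin X U" and V: "\<Union>\<V> = {e\<in>topspace E. p e \<in> U}"
    "\<forall>V\<in>\<V>. openin E V" "pairwise disjnt \<V>"
    and Vh: "\<forall>V\<in>\<V>. homeomorphic_map (subtopology E V) (subtopology X U) p"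
    by (elim exE conjE) (rule that)
  note V = V(1) bspec[OF V(2)] V(3) bspec[OF Vh]
  have "\<exists>V s. V \<in> \<V> \<and> e \<in> V \<and> homeomorphic_maps (subtopology E V) (subtopology X U) p s"
    if "e \<in> topspace E" "p e \<in> U" for e
  proof -
    have "e \<in> \<Union>\<V>" using that V(1) by simp
    then obtain V where "V \<in> \<V>" "e \<in> V" by blast
    then show ?thesis using V(4) homeomorphic_map_maps by blast
  qed
  then have ex: "\<exists>s. \<forall>V\<in>\<V>. V = W \<longrightarrow> homeomorphic_maps (subtopology E V) (subtopology X U) p s" for W
    using V(4) homeomorphic_map_maps by blast
  then obtain s where s: "\<And>V. V \<in> \<V> \<Longrightarrow> homeomorphic_maps (subtopology E V) (subtopology X U) p (s V)"
    by metis
  \<comment> \<open>Disjointness makes the sheet through \<open>e\<close> unique; outside the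
    preimage of \<open>U\<close> the value is arbitrary.\<close>
  define sh where "sh e = (THE V. V \<in> \<V> \<and> e \<in> V)" for e
  have sh: "sh e = V" if "V \<in> \<V>" "e \<in> V" for e V
    unfolding sh_def
    by (rule the_equality) (use that V(3) in \<open>auto simp: pairwise_def disjnt_iff\<close>)
  define sec where "sec e = s (sh e)" for e
  have tU: "topspace (subtopology X U) = U" using U openin_subset by fastforce
  have "trivializing E X p U sec"
    unfolding trivializing_def
  proof (intro conjI ballI impI)
    fix e assume e: "e \<in> topspace E" "p e \<in> U"
    then obtain W where W: "W \<in> \<V>" "e \<in> W" using V(1) by blast
    have shW: "sh e = W" using sh W by blast
    have tW: "topspace (subtopology E W) = W" using V(2) W openin_subset by fastforce
    have h: "homeomorphic_maps (subtopology E W) (subtopology X U) p (s W)" using s W by blast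
    then have c: "continuous_map (subtopology X U) (subtopology E W) (s W)"
      and ps: "\<And>y. y \<in> U \<Longrightarrow> p (s W y) = y" and sp: "\<And>y. y \<in> W \<Longrightarrow> s W (p y) = y"
      and cp: "continuous_map (subtopology E W) (subtopology X U) p"
      using tU tW unfolding homeomorphic_maps_def by auto
    show "continuous_map (subtopology X U) E (sec e)"
      unfolding sec_def shW using c by (simp add: continuous_map_into_fulltopology)
    show "p (sec e y) = y" if "y \<in> U" for y unfolding sec_def shW using ps that by blast
    show "sec e (p e) = e" unfolding sec_def shW using sp W by blast
    have sW: "s W y \<in> W" if "y \<in> U" for y
      using c that tU tW continuous_map_image_subset_topspace by fastforce
    have "p y \<in> U" if "y \<in> W" for y using V(1) W that by blast
    then have "sec e ` U = W" unfolding sec_def shW using sW sp image_iff by fastforce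
    then show "openin E (sec e ` U)" using V W by simp
    show "sec (sec e y) = sec e" if "y \<in> U" for y
      using sh[OF W(1) sW[OF that]] shW unfolding sec_def by simp
  qed (use U in auto)
  then show ?thesis using that U by blast
qed

text \<open>The sheets are recovered as the images of the sections;
  \<open>trivializing_disjoint\<close> keeps them apart.\<close>

lemma covering_mapI:
  assumes c: "continuous_map E X p" and s: "p ` topspace E = topspace X"
    and t: "\<And>x. x \<in> topspace X \<Longrightarrow> \<exists>U sec. x \<in> U \<and> trivializing E X p U sec"
  shows "covering_map E X p"
  unfolding covering_map_def
proof (intro conjI ballI c s)
  fix x assume "x \<in> topspace X"
  then obtain U sec where U: "x \<in> U" and T: "trivializing E X p U sec" using t by blast
  have oU: "openin X U" using T by (simp add: trivializing_def)
  have tU: "topspace (subtopology X U) = U" using oU openin_subset by fastforce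
  define \<V> where "\<V> = {sec e ` U |e. e \<in> topspace E \<and> p e \<in> U}"
  have "\<Union>\<V> = {e\<in>topspace E. p e \<in> U}"
  proof
    show "\<Union>\<V> \<subseteq> {e\<in>topspace E. p e \<in> U}"
      using trivializing_in[OF T] trivializing_sheet_inv(1)[OF T] unfolding \<V>_def by blast
    show "{e\<in>topspace E. p e \<in> U} \<subseteq> \<Union>\<V>"
    proof
      fix e assume e: "e \<in> {e\<in>topspace E. p e \<in> U}"
      then have "e = sec e (p e)" using T unfolding trivializing_def by auto
      then have "e \<in> sec e ` U" using e by blast
      then show "e \<in> \<Union>\<V>" using e unfolding \<V>_def by blast
    qed
  qed
  moreover have "\<forall>V\<in>\<V>. openin E V" using T unfolding \<V>_def trivializing_def by auto
  moreover have "pairwise disjnt \<V>"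
  proof (unfold pairwise_def disjnt_def, intro ballI impI)
    fix A B assume "A \<in> \<V>" "B \<in> \<V>" and ne: "A \<noteq> B"
    then obtain e e' where e: "e \<in> topspace E" "p e \<in> U" "A = sec e ` U"
      and e': "e' \<in> topspace E" "p e' \<in> U" "B = sec e' ` U" unfolding \<V>_def by blast
    show "A \<inter> B = {}"
    proof (rule ccontr)
      assume "A \<inter> B \<noteq> {}"
      then have "sec e = sec e'" using trivializing_disjoint[OF T e(1,2) e'(1,2)] e(3) e'(3) by simp
      then show False using ne e(3) e'(3) by simp
    qed
  qed
  moreover have "\<forall>V\<in>\<V>. homeomorphic_map (subtopology E V) (subtopology X U) p"
  proof
    fix V assume "V \<in> \<V>"
    then obtain e where e: "e \<in> topspace E" "p e \<in> U" "V = sec e ` U" unfolding \<V>_def by blast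
    have cs: "continuous_map (subtopology X U) (subtopology E V) (sec e)"
      using T e by (intro continuous_map_into_subtopology) (auto simp: trivializing_def)
    have "continuous_map (subtopology E V) (subtopology X U) p"
      by (intro continuous_map_into_subtopology continuous_map_from_subtopology c)
        (use trivializing_sheet_inv(1)[OF T e(1,2)] e(3) in auto)
    then have "homeomorphic_maps (subtopology E V) (subtopology X U) p (sec e)"
      using cs T e tU unfolding homeomorphic_maps_def trivializing_def by auto
    then show "homeomorphic_map (subtopology E V) (subtopology X U) p"
      using homeomorphic_maps_map by blast
  qed
  ultimately show "\<exists>U. x \<in> U \<and> openin X U \<and>
        (\<exists>\<V>. \<Union>\<V> = {e\<in>topspace E. p e \<in> U} \<and> (\<forall>V\<in>\<V>. openin E V) \<and> pairwise disjnt \<V> \<and>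
             (\<forall>V\<in>\<V>. homeomorphic_map (subtopology E V) (subtopology X U) p))"
    using U oU by blast
qed

text \<open>Near a point each of the two maps stays in one sheet over a common evenly covered set,
  where it is determined by its projection. Equal sheets give agreement nearby, different sheets are
  disjoint. This serves for uniqueness of lifts, for locally constant transition functions and for
  the graph of an equivalence of covers.\<close>

lemma openin_continuous_map_agree:
  assumes p: "covering_map E X p" and f: "continuous_map Y E f" and g: "continuous_map Y E g"
    and eq: "\<And>y. y \<in> topspace Y \<Longrightarrow> p (f y) = p (g y)"
  shows "openin Y {y \<in> topspace Y. f y = g y}" "openin Y {y \<in> topspace Y. f y \<noteq> g y}"
proof -
  have nb: "\<exists>W. openin Y W \<and> y \<in> W \<and> (\<forall>z\<in>W. f z = g z \<longleftrightarrow> f y = g y)" if y: "y \<in> topspace Y" for y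
  proof -
    have fy: "f y \<in> topspace E" "g y \<in> topspace E" using f g y by (auto simp: continuous_map_def)
    obtain U sec where U: "p (f y) \<in> U" "trivializing E X p U sec"
      using covering_map_trivializing[OF p covering_map_in[OF p fy(1)]] by blast
    have U': "p (g y) \<in> U" using U eq y by simp
    define W where "W = {z\<in>topspace Y. f z \<in> sec (f y) ` U} \<inter> {z\<in>topspace Y. g z \<in> sec (g y) ` U}"
    have oW: "openin Y W" unfolding W_def
      using U U' fy f g by (intro openin_Int openin_continuous_map_preimage[of Y E])
        (auto simp: trivializing_def)
    have "f y = sec (f y) (p (f y))" "g y = sec (g y) (p (g y))"
      using U U' fy unfolding trivializing_def by auto
    then have "y \<in> W" unfolding W_def using y U U' by blast
    moreover have "f z = g z \<longleftrightarrow> f y = g y" if z: "z \<in> W" for z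
    proof -
      have 1: "f z = sec (f y) (p (f z))" "g z = sec (g y) (p (g z))"
        using z trivializing_sheet_inv(2)[OF U(2)] fy U U' unfolding W_def by auto
      have 2: "p (f z) = p (g z)" using eq z unfolding W_def by blast
      show ?thesis
      proof
        assume "f y = g y" then show "f z = g z" using 1 2 by metis
      next
        assume "f z = g z"
        then have "sec (f y) = sec (g y)"
          using trivializing_disjoint[OF U(2) fy(1) U(1) fy(2) U'] z unfolding W_def by auto
        then show "f y = g y" using \<open>f y = sec (f y) (p (f y))\<close> \<open>g y = sec (g y) (p (g y))\<close> eq y by metis
      qed
    qed
    ultimately show ?thesis using oW by blast
  qed
  have op: "openin Y {y \<in> topspace Y. (f y = g y) = c}" for c
  proof (subst openin_subopen, intro ballI)
    fix y assume y: "y \<in> {y \<in> topspace Y. (f y = g y) = c}"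
    then obtain W where W: "openin Y W" "y \<in> W" "\<forall>z\<in>W. f z = g z \<longleftrightarrow> f y = g y" using nb by blast
    have "W \<subseteq> {y \<in> topspace Y. (f y = g y) = c}"
    proof
      fix z assume z: "z \<in> W"
      then have "z \<in> topspace Y" using openin_subset[OF W(1)] by blast
      then show "z \<in> {y \<in> topspace Y. (f y = g y) = c}" using W(3) z y by simp
    qed
    then show "\<exists>T. openin Y T \<and> y \<in> T \<and> T \<subseteq> {y \<in> topspace Y. (f y = g y) = c}"
      using W(1,2) by blast
  qed
  show "openin Y {y \<in> topspace Y. f y = g y}" "openin Y {y \<in> topspace Y. f y \<noteq> g y}"
    using op[of True] op[of False] by simp_all
qed

lemma lift_unique:
  assumes p: "covering_map E X p" and f: "continuous_map Y E f" and g: "continuous_map Y E g"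
    and eq: "\<And>y. y \<in> topspace Y \<Longrightarrow> p (f y) = p (g y)"
    and Y: "connected_space Y" and a: "a \<in> topspace Y" "f a = g a" and y: "y \<in> topspace Y"
  shows "f y = g y"
proof -
  let ?A = "{y \<in> topspace Y. f y = g y}"
  have "openin Y ?A" "openin Y (topspace Y - ?A)"
    using openin_continuous_map_agree[OF p f g eq] by (auto simp: set_diff_eq conj_commute cong: conj_cong)
  then have "?A = {} \<or> ?A = topspace Y"
    using Y unfolding connected_space_clopen_in closedin_def by blast
  then show ?thesis using a y by blast
qed

text \<open>The lift may be prescribed at any point \<open>z\<close> of \<open>R\<close> and not
  just at a chosen corner, so that rectangles can be glued in either order.\<close>

definition lifts_on :: "'e topology \<Rightarrow> ('e \<Rightarrow> 'x) \<Rightarrow> ('b::topological_space \<Rightarrow> 'x) \<Rightarrow> 'b set \<Rightarrow> bool" where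
  "lifts_on E p H R \<longleftrightarrow> (\<forall>z\<in>R. \<forall>e\<in>topspace E. p e = H z \<longrightarrow>
     (\<exists>l. continuous_map (top_of_set R) E l \<and> (\<forall>w\<in>R. p (l w) = H w) \<and> l z = e))"

lemma lifts_onD:
  assumes "lifts_on E p H R" "z \<in> R" "e \<in> topspace E" "p e = H z"
  shows "\<exists>l. continuous_map (top_of_set R) E l \<and> (\<forall>w\<in>R. p (l w) = H w) \<and> l z = e"
  using assms unfolding lifts_on_def by simp

lemma lifts_on_mono:
  assumes "lifts_on E p H R" "R' \<subseteq> R"
  shows "lifts_on E p H R'"
  unfolding lifts_on_def
proof (intro ballI impI)
  fix z e assume z: "z \<in> R'" and e: "e \<in> topspace E" "p e = H z"
  obtain l where l: "continuous_map (top_of_set R) E l" "\<forall>w\<in>R. p (l w) = H w" "l z = e"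
    using lifts_onD[OF assms(1) subsetD[OF assms(2) z] e] by blast
  show "\<exists>l. continuous_map (top_of_set R') E l \<and> (\<forall>w\<in>R'. p (l w) = H w) \<and> l z = e"
    using l assms(2) continuous_map_from_subtopology_mono[OF l(1) assms(2)] by (intro exI[of _ l]) auto
qed

text \<open>A lift over \<open>R1\<close> is continued over \<open>R2\<close> from its value at a
  common point \<open>w0\<close>. Connectedness of the intersection and uniqueness of lifts make the
  two pieces agree on all of it, and closedness allows pasting.\<close>

lemma lifts_on_Un_aux:
  assumes p: "covering_map E X p" and cl: "closed R1" "closed R2" and con: "connected (R1 \<inter> R2)"
    and ne: "R1 \<inter> R2 \<noteq> {}" and l: "lifts_on E p H R1" "lifts_on E p H R2"
    and z: "z \<in> R1" "e \<in> topspace E" "p e = H z"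
  shows "\<exists>l. continuous_map (top_of_set (R1 \<union> R2)) E l \<and> (\<forall>w\<in>R1 \<union> R2. p (l w) = H w) \<and> l z = e"
proof -
  obtain l1 where l1: "continuous_map (top_of_set R1) E l1" "\<forall>w\<in>R1. p (l1 w) = H w" "l1 z = e"
    using l(1) z unfolding lifts_on_def by blast
  obtain w0 where w0: "w0 \<in> R1" "w0 \<in> R2" using ne by blast
  have "l1 w0 \<in> topspace E" using l1(1) w0 by (auto simp: continuous_map_def)
  then obtain l2 where l2: "continuous_map (top_of_set R2) E l2" "\<forall>w\<in>R2. p (l2 w) = H w"
    "l2 w0 = l1 w0"
    using l(2) w0 l1(2) unfolding lifts_on_def by (metis (no_types, lifting))
  have ag: "l1 w = l2 w" if w: "w \<in> R1 \<inter> R2" for w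
  proof (rule lift_unique[OF p, of "top_of_set (R1 \<inter> R2)" l1 l2 w0])
    show "continuous_map (top_of_set (R1 \<inter> R2)) E l1" "continuous_map (top_of_set (R1 \<inter> R2)) E l2"
      by (rule continuous_map_from_subtopology_mono[OF l1(1) inf_le1])
        (rule continuous_map_from_subtopology_mono[OF l2(1) inf_le2])
    show "connected_space (top_of_set (R1 \<inter> R2))"
      using con by (metis connectedin_def connectedin_iff_connected)
  qed (use w w0 l1 l2 in auto)
  define l where "l w = (if w \<in> R1 then l1 w else l2 w)" for w
  let ?Z = "top_of_set (R1 \<union> R2)"
  have "continuous_map ?Z E l"
  proof (rule pasting_lemma_closed[of "{R1, R2}" ?Z "\<lambda>R. R" E "\<lambda>R. if R = R1 then l1 else l2"])
    show "closedin ?Z i" if "i \<in> {R1, R2}" for i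
      using that cl by (auto intro: closed_subset)
    have "(R1 \<union> R2) \<inter> R1 = R1" "(R1 \<union> R2) \<inter> R2 = R2" by auto
    then show "continuous_map (subtopology ?Z i) E (if i = R1 then l1 else l2)" if "i \<in> {R1, R2}" for i
      using that l1(1) l2(1) by (auto simp: subtopology_subtopology)
  qed (use ag in \<open>auto simp: l_def\<close>)
  moreover have "\<forall>w\<in>R1 \<union> R2. p (l w) = H w" using l1 l2 by (auto simp: l_def)
  moreover have "l z = e" using z l1 by (simp add: l_def)
  ultimately show ?thesis by blast
qed

lemma lifts_on_Un:
  assumes "covering_map E X p" "closed R1" "closed R2" "connected (R1 \<inter> R2)"
    "R1 \<inter> R2 \<noteq> {}" "lifts_on E p H R1" "lifts_on E p H R2"
  shows "lifts_on E p H (R1 \<union> R2)"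
  unfolding lifts_on_def
proof (intro ballI impI)
  fix z e assume z: "z \<in> R1 \<union> R2" and e: "e \<in> topspace E" "p e = H z"
  show "\<exists>l. continuous_map (top_of_set (R1 \<union> R2)) E l \<and> (\<forall>w\<in>R1 \<union> R2. p (l w) = H w) \<and> l z = e"
  proof (cases "z \<in> R1")
    case True then show ?thesis using lifts_on_Un_aux[OF assms] e by blast
  next
    case False
    then have "z \<in> R2" using z by blast
    then show ?thesis using lifts_on_Un_aux[of E X p R2 R1 H z e] assms e by (simp add: Int_commute Un_commute)
  qed
qed

lemma lifts_on_trivializing:
  assumes t: "trivializing E X p U sec" and H: "continuous_map (top_of_set R) X H" and R: "H ` R \<subseteq> U"
  shows "lifts_on E p H R"
  unfolding lifts_on_def
proof (intro ballI impI)
  fix z e assume z: "z \<in> R" and e: "e \<in> topspace E" "p e = H z"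
  have "continuous_map (top_of_set R) (subtopology X U) H"
    using H R by (intro continuous_map_into_subtopology) auto
  moreover have "continuous_map (subtopology X U) E (sec e)"
    using t e z R unfolding trivializing_def by auto
  ultimately have "continuous_map (top_of_set R) E (sec e \<circ> H)" by (rule continuous_map_compose)
  moreover have "\<forall>w\<in>R. p ((sec e \<circ> H) w) = H w" "(sec e \<circ> H) z = e"
    using t e z R unfolding trivializing_def by (auto simp: image_subset_iff)
  ultimately show "\<exists>l. continuous_map (top_of_set R) E l \<and> (\<forall>w\<in>R. p (l w) = H w) \<and> l z = e"
    by blast
qed

text \<open>Bisection in both coordinates replaces a Lebesgue number: the inner induction lifts over
  a strip of positive width around \<open>{s} \<times> {c..d}\<close>, the outer one glues strips.
  Strips may stick out of the rectangle, which is why \<open>H\<close> is continuous on the whole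
  plane.\<close>

lemma lifts_on_rectangle:
  fixes H :: "real \<times> real \<Rightarrow> 'x"
  assumes p: "covering_map E X p" and H: "continuous_map euclidean X H" and ab: "a \<le> b" "c \<le> d"
  shows "lifts_on E p H ({a..b} \<times> {c..d})"
  using ab(1)
proof (induction rule: Bolzano)
  case (trans s1 s2 s3)
  have "{s1..s2} \<times> {c..d} \<inter> {s2..s3} \<times> {c..d} = {s2} \<times> {c..d}" using trans by auto
  moreover have "{s1..s2} \<times> {c..d} \<union> {s2..s3} \<times> {c..d} = {s1..s3} \<times> {c..d}" using trans by auto
  ultimately show ?case
    using lifts_on_Un[OF p _ _ _ _ trans(1,2)] ab(2)
    by (simp add: closed_Times connected_Times)
next
  case (local s)
  have "\<exists>r>0. lifts_on E p H ({s-r..s+r} \<times> {c..d})"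
    using ab(2)
  proof (induction rule: Bolzano)
    case (trans t1 t2 t3)
    then obtain r1 r2 where r: "r1 > 0" "lifts_on E p H ({s-r1..s+r1} \<times> {t1..t2})"
      "r2 > 0" "lifts_on E p H ({s-r2..s+r2} \<times> {t2..t3})" by blast
    define r where "r = min r1 r2"
    have mono: "lifts_on E p H ({s-r..s+r} \<times> {u..v})"
      if "lifts_on E p H ({s-r'..s+r'} \<times> {u..v})" "r \<le> r'" for r' u v
      by (rule lifts_on_mono[OF that(1)]) (use that(2) in auto)
    have rp: "r > 0" "r \<le> r1" "r \<le> r2" using r by (auto simp: r_def)
    have i: "{s-r..s+r} \<times> {t1..t2} \<inter> {s-r..s+r} \<times> {t2..t3} = {s-r..s+r} \<times> {t2}"
      and u: "{s-r..s+r} \<times> {t1..t2} \<union> {s-r..s+r} \<times> {t2..t3} = {s-r..s+r} \<times> {t1..t3}"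
      using trans by auto
    have "lifts_on E p H ({s-r..s+r} \<times> {t1..t2} \<union> {s-r..s+r} \<times> {t2..t3})"
      by (rule lifts_on_Un[OF p _ _ _ _ mono[OF r(2) rp(2)] mono[OF r(4) rp(3)]])
        (use rp in \<open>simp_all add: i closed_Times connected_Times\<close>)
    then show ?case using rp u by (intro exI[of _ r]) simp
  next
    case (local t)
    have "H (s, t) \<in> topspace X" using H by (auto simp: continuous_map_def)
    then obtain U sec where U: "H (s, t) \<in> U" "trivializing E X p U sec"
      using covering_map_trivializing[OF p] by blast
    have "openin euclidean {z \<in> topspace euclidean. H z \<in> U}"
      using H U(2) by (intro openin_continuous_map_preimage[of _ X]) (auto simp: trivializing_def)
    then have "open {z. H z \<in> U}" by simp
    then obtain \<epsilon> where e: "\<epsilon> > 0" "ball (s, t) \<epsilon> \<subseteq> {z. H z \<in> U}"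
      using U(1) open_contains_ball by blast
    \<comment> \<open>A deviation of at most \<open>\<epsilon>/3\<close> in the first coordinate and
      one below \<open>\<epsilon>/2\<close> in the second add up to less than
      \<open>\<epsilon>\<close>.\<close>
    have "\<exists>r>0. lifts_on E p H ({s-r..s+r} \<times> {u..v})" if "u \<le> t \<and> t \<le> v \<and> v - u < \<epsilon>/2" for u v
    proof (intro exI[of _ "\<epsilon>/3"] conjI)
      have "{s-\<epsilon>/3..s+\<epsilon>/3} \<times> {u..v} \<subseteq> ball (s, t) \<epsilon>"
      proof
        fix w assume w: "w \<in> {s-\<epsilon>/3..s+\<epsilon>/3} \<times> {u..v}"
        obtain w1 w2 where ww: "w = (w1, w2)" by fastforce
        have "s-\<epsilon>/3 \<le> w1" "w1 \<le> s+\<epsilon>/3" "u \<le> w2" "w2 \<le> v" using w ww by auto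
        then have "dist s w1 \<le> \<epsilon>/3" "dist t w2 < \<epsilon>/2" using that unfolding dist_real_def by linarith+
        then have "dist s w1 + dist t w2 < \<epsilon>" using e by simp
        moreover have "dist (s, t) w \<le> dist s w1 + dist t w2"
          unfolding ww dist_Pair_Pair by (rule sqrt_sum_squares_le_sum) auto
        ultimately show "w \<in> ball (s, t) \<epsilon>" by simp
      qed
      then have "H ` ({s-\<epsilon>/3..s+\<epsilon>/3} \<times> {u..v}) \<subseteq> U" using e by auto
      then show "lifts_on E p H ({s-\<epsilon>/3..s+\<epsilon>/3} \<times> {u..v})"
        using lifts_on_trivializing[OF U(2)] H continuous_map_from_subtopology by blast
    qed (use e in simp)
    then show ?case using e by (intro exI[of _ "\<epsilon>/2"]) auto
  qed
  then obtain r where r: "r > 0" "lifts_on E p H ({s-r..s+r} \<times> {c..d})" by blast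
  have "lifts_on E p H ({u..v} \<times> {c..d})" if uv: "u \<le> s \<and> s \<le> v \<and> v - u < r" for u v
    by (rule lifts_on_mono[OF r(2)]) (use uv in auto)
  then show ?case using r by blast
qed

section \<open>Lifting of paths and of homotopies between paths\<close>

lemma pathin_in: "pathin X p \<Longrightarrow> t \<in> {0..1} \<Longrightarrow> p t \<in> topspace X"
  by (auto simp: pathin_def continuous_map_def)

lemma connected_space_unit_interval: "connected_space (top_of_set {0..1::real})"
  by (metis connected_Icc connectedin_def connectedin_iff_connected)

lemma path_lift:
  assumes p: "covering_map E X p" and q: "pathin X q" and e: "e \<in> topspace E" "p e = q 0"
  obtains l where "pathin E l" "\<And>t. t \<in> {0..1} \<Longrightarrow> p (l t) = q t" "l 0 = e"
proof -
  \<comment> \<open>Clamping to the unit interval extends the path to the whole plane, as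
    \<open>lifts_on_rectangle\<close> demands; the path is then lifted over the degenerate rectangle
    \<open>{0..0} \<times> {0..1}\<close>.\<close>
  define c where "c s = max 0 (min 1 s)" for s :: real
  have c01: "c s \<in> {0..1}" and cid: "s \<in> {0..1} \<Longrightarrow> c s = s" for s by (auto simp: c_def)
  have "continuous_on UNIV (\<lambda>z::real\<times>real. c (snd z))"
    unfolding c_def by (intro continuous_intros)
  then have "continuous_map euclidean (top_of_set {0..1}) (\<lambda>z::real\<times>real. c (snd z))"
    using c01 by (simp add: continuous_map_in_subtopology image_subset_iff)
  then have H: "continuous_map euclidean X (\<lambda>z::real\<times>real. q (c (snd z)))"
    using q continuous_map_compose[of _ _ "\<lambda>z::real\<times>real. c (snd z)" X q] by (simp add: pathin_def o_def)
  have "lifts_on E p (\<lambda>z::real\<times>real. q (c (snd z))) ({0..0} \<times> {0..1})"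
    by (rule lifts_on_rectangle[OF p H]) auto
  moreover have "(0, 0) \<in> {0..0::real} \<times> {0..1::real}" "p e = q (c (snd (0::real, 0)))"
    using e(2) cid[of 0] by simp_all
  ultimately obtain l :: "real \<times> real \<Rightarrow> _" where l: "continuous_map (top_of_set ({0..0} \<times> {0..1})) E l"
    "\<forall>w\<in>{0..0} \<times> {0..1}. p (l w) = q (c (snd w))" "l (0,0) = e"
    using lifts_onD[OF _ _ e(1)] by blast
  show ?thesis
  proof
    have "continuous_map (top_of_set {0..1}) (top_of_set ({0..0} \<times> {0..1})) (\<lambda>t::real. (0::real, t))"
      by (auto simp: continuous_map_in_subtopology intro!: continuous_intros)
    then show "pathin E (\<lambda>t. l (0, t))"
      using continuous_map_compose[OF _ l(1)] unfolding pathin_def o_def by blast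
    show "p (l (0, t)) = q t" if t: "t \<in> {0..1}" for t
    proof -
      have "(0, t) \<in> {0..0::real} \<times> {0..1}" using t by simp
      from bspec[OF l(2) this] show ?thesis using cid[OF t] by simp
    qed
  qed (use l in simp)
qed

lemma path_lift_unique:
  assumes p: "covering_map E X p" and "pathin E l" "pathin E l'" "l 0 = l' 0"
    and "\<And>t. t \<in> {0..1} \<Longrightarrow> p (l t) = p (l' t)" and "t \<in> {0..1}"
  shows "l t = l' t"
  using lift_unique[OF p, of "top_of_set {0..1}" l l' 0 t] assms connected_space_unit_interval
  by (auto simp: pathin_def)

text \<open>The homotopy is lifted over the square, starting at \<open>l 0\<close>. The two edges on
  which it is constant lift to constant paths, the other two lift to \<open>l\<close> and
  \<open>l'\<close>; so the constant edge at the end joins \<open>l 1\<close> to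
  \<open>l' 1\<close>.\<close>

lemma homotopic_lift_endpoint:
  assumes p: "covering_map E X p"
    and h: "homotopic_with (\<lambda>r. r 0 = a \<and> r 1 = b) (top_of_set {0..1}) X (p \<circ> l) (p \<circ> l')"
    and l: "pathin E l" "pathin E l'" "l 0 = l' 0"
  shows "l 1 = l' 1"
proof -
  obtain h :: "real \<times> real \<Rightarrow> _" where h: "continuous_map (prod_topology (top_of_set {0..1}) (top_of_set {0..1})) X h"
    "\<And>x. h (0, x) = (p \<circ> l) x" "\<And>x. h (1, x) = (p \<circ> l') x"
    "\<And>t. t \<in> {0..1} \<Longrightarrow> h (t, 0) = a \<and> h (t, 1) = b"
    using h unfolding homotopic_with_def by blast
  define c where "c s = max 0 (min 1 s)" for s :: real
  have c01: "c s \<in> {0..1}" and cid: "s \<in> {0..1} \<Longrightarrow> c s = s" for s by (auto simp: c_def)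
  have "continuous_on UNIV (\<lambda>z::real\<times>real. (c (fst z), c (snd z)))"
    unfolding c_def by (intro continuous_intros)
  then have "continuous_map euclidean (top_of_set ({0..1} \<times> {0..1})) (\<lambda>z::real\<times>real. (c (fst z), c (snd z)))"
    using c01 by (simp add: continuous_map_in_subtopology image_subset_iff)
  moreover have "prod_topology (top_of_set {0..1::real}) (top_of_set {0..1::real}) = top_of_set ({0..1} \<times> {0..1})"
    by (simp add: prod_topology_subtopology subtopology_subtopology Times_Int_Times prod_topology_subtopology_eu)
  ultimately have H: "continuous_map euclidean X (\<lambda>z::real\<times>real. h (c (fst z), c (snd z)))"
    using h(1) continuous_map_compose[of euclidean _ "\<lambda>z::real\<times>real. (c (fst z), c (snd z))" X h]
    by (simp add: o_def)
  have e: "l 0 \<in> topspace E" using l by (simp add: pathin_in)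
  have "lifts_on E p (\<lambda>z::real\<times>real. h (c (fst z), c (snd z))) ({0..1} \<times> {0..1})"
    by (rule lifts_on_rectangle[OF p H]) auto
  moreover have "p (l 0) = h (c (fst (0::real,0::real)), c (snd (0::real,0::real)))"
    using h(2) cid[of 0] by simp
  moreover have "(0, 0) \<in> {0..1::real} \<times> {0..1::real}" by simp
  ultimately obtain L where L: "continuous_map (top_of_set ({0..1} \<times> {0..1})) E L"
    "\<forall>w\<in>{0..1} \<times> {0..1}. p (L w) = h (c (fst w), c (snd w))" "L (0,0) = l 0"
    using lifts_onD[OF _ _ e] by blast
  have comp: "pathin E (\<lambda>t. L (f t))"
    if "continuous_on {0..1} f" "f ` {0..1} \<subseteq> {0..1} \<times> {0..1}" for f
    using continuous_map_compose[OF _ L(1), of "top_of_set {0..1}" f] that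
    by (auto simp: pathin_def o_def continuous_map_in_subtopology)
  have r: "pathin E (\<lambda>t. L (0, t))" "pathin E (\<lambda>t. L (1, t))" "pathin E (\<lambda>t. L (t, 0))" "pathin E (\<lambda>t. L (t, 1))"
    by (rule comp; force intro!: continuous_intros)+
  have pL: "p (L (s, t)) = h (s, t)" if "s \<in> {0..1}" "t \<in> {0..1}" for s t
    using L(2) that cid by simp
  have 1: "L (0, 1) = l 1"
    by (rule path_lift_unique[OF p r(1) l(1)]) (use L(3) pL h(2) in auto)
  have a: "p (l 0) = a" using h(4)[of 0] h(2) by simp
  have 2: "L (1, 0) = l' 0"
    using path_lift_unique[OF p r(3), of "\<lambda>_. l 0" 1] e L(3) pL h(4) l(3) a by auto
  have 3: "L (1, 1) = l' 1"
    by (rule path_lift_unique[OF p r(2) l(2)]) (use 2 pL h(3) in auto)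
  have b: "p (l 1) = b" using h(4)[of 0] h(2) by simp
  have "l 1 \<in> topspace E" using l by (simp add: pathin_in)
  then have "L (1, 1) = L (0, 1)"
    using path_lift_unique[OF p r(4), of "\<lambda>_. l 1" 1] 1 pL h(4) b by auto
  then show ?thesis using 1 3 by simp
qed

lemma lift_of_path_end_unique:
  assumes "covering_map E X p" "pathin E l" "pathin E l'" "l 0 = l' 0"
    and "\<And>t. t \<in> {0..1} \<Longrightarrow> p (l t) = p (l' t)"
  shows "l 1 = l' 1"
  using path_lift_unique[OF assms, of 1] by simp

section \<open>Path homotopy and the fundamental group\<close>

definition path_homotopic :: "'a topology \<Rightarrow> 'a \<Rightarrow> 'a \<Rightarrow> (real \<Rightarrow> 'a) \<Rightarrow> (real \<Rightarrow> 'a) \<Rightarrow> bool" where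
  "path_homotopic X a b = homotopic_with (\<lambda>r. r 0 = a \<and> r 1 = b) (top_of_set {0..1}) X"

lemma path_homotopic_refl: "pathin X p \<Longrightarrow> p 0 = a \<Longrightarrow> p 1 = b \<Longrightarrow> path_homotopic X a b p p"
  by (simp add: path_homotopic_def pathin_def)

lemma path_homotopic_imp:
  assumes "path_homotopic X a b p q"
  shows "pathin X p" "pathin X q" "p 0 = a" "p 1 = b" "q 0 = a" "q 1 = b"
  using homotopic_with_imp_property[OF assms[unfolded path_homotopic_def]]
    homotopic_with_imp_continuous_maps[OF assms[unfolded path_homotopic_def]]
  by (auto simp: pathin_def)

lemma path_homotopic_sym: "path_homotopic X a b p q \<Longrightarrow> path_homotopic X a b q p"
  by (simp add: path_homotopic_def homotopic_with_symD)

lemma path_homotopic_trans [trans]: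
  "path_homotopic X a b p q \<Longrightarrow> path_homotopic X a b q r \<Longrightarrow> path_homotopic X a b p r"
  unfolding path_homotopic_def by (rule homotopic_with_trans)

lemma path_homotopic_eq:
  assumes "path_homotopic X a b p q"
    and "\<And>t. t \<in> {0..1} \<Longrightarrow> p' t = p t" "\<And>t. t \<in> {0..1} \<Longrightarrow> q' t = q t"
  shows "path_homotopic X a b p' q'"
  unfolding path_homotopic_def
  by (rule homotopic_with_eq[OF assms(1)[unfolded path_homotopic_def]]) (use assms(2,3) in auto)

lemma path_homotopic_compose:
  assumes "path_homotopic X a b p q" "continuous_map X Y f"
  shows "path_homotopic Y (f a) (f b) (f \<circ> p) (f \<circ> q)"
  unfolding path_homotopic_def
  by (rule homotopic_with_compose_continuous_map_left[OF assms(1)[unfolded path_homotopic_def] assms(2)]) auto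

text \<open>The straight line from \<open>u\<close> to \<open>v\<close> stays in the convex set
  \<open>S\<close>, and \<open>f\<close> turns it into the homotopy. Associativity, cancellation and
  subdivision of paths are instances with piecewise linear \<open>u\<close> and
  \<open>v\<close>.\<close>

lemma path_homotopic_reparam:
  fixes f :: "real \<Rightarrow> 'a"
  assumes f: "continuous_map (top_of_set S) X f" and S: "convex S"
    and u: "continuous_on {0..1} u" "u ` {0..1} \<subseteq> S" and v: "continuous_on {0..1} v" "v ` {0..1} \<subseteq> S"
    and "u 0 = v 0" "u 1 = v 1"
    and p: "\<And>t. t \<in> {0..1} \<Longrightarrow> p t = f (u t)" and q: "\<And>t. t \<in> {0..1} \<Longrightarrow> q t = f (v t)"
  shows "path_homotopic X (p 0) (p 1) p q"
proof -
  let ?k = "\<lambda>z::real\<times>real. (1 - fst z) * u (snd z) + fst z * v (snd z)"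
  have "continuous_on ({0..1} \<times> {0..1}) (\<lambda>z. u (snd z))" "continuous_on ({0..1} \<times> {0..1}) (\<lambda>z. v (snd z))"
    by (rule continuous_on_compose2[OF u(1)] continuous_on_compose2[OF v(1)]; auto intro!: continuous_intros)+
  then have "continuous_on ({0..1} \<times> {0..1}) ?k" by (intro continuous_intros)
  moreover have "?k z \<in> S" if "z \<in> {0..1} \<times> {0..1}" for z
    using convexD[OF S, of "u (snd z)" "v (snd z)" "1 - fst z" "fst z"] that u(2) v(2)
    by (auto simp: image_subset_iff)
  moreover have "prod_topology (top_of_set {0..1::real}) (top_of_set {0..1::real}) = top_of_set ({0..1} \<times> {0..1})"
    by (simp add: prod_topology_subtopology subtopology_subtopology Times_Int_Times prod_topology_subtopology_eu)
  ultimately have "continuous_map (prod_topology (top_of_set {0..1}) (top_of_set {0..1})) (top_of_set S) ?k"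
    by (auto simp: continuous_map_in_subtopology)
  then have c: "continuous_map (prod_topology (top_of_set {0..1}) (top_of_set {0..1})) X (\<lambda>z. f (?k z))"
    using continuous_map_compose[OF _ f] unfolding o_def by blast
  have "path_homotopic X (p 0) (p 1) (\<lambda>t. f (u t)) (\<lambda>t. f (v t))"
    unfolding path_homotopic_def homotopic_with_def
  proof (intro exI[of _ "\<lambda>z. f (?k z)"] conjI c)
    show "\<forall>t\<in>{0..1}. f (?k (t, 0)) = p 0 \<and> f (?k (t, 1)) = p 1"
      using assms(7,8) p[of 0] p[of 1] by (simp add: algebra_simps)
  qed auto
  then show ?thesis by (rule path_homotopic_eq) (use p q in auto)
qed

lemma loop_concat_ends [simp]: "loop_concat p q 0 = p 0" "loop_concat p q 1 = q 1"
  by (simp_all add: loop_concat_def)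

lemma path_homotopic_concat:
  assumes p: "path_homotopic X a b p p'" and q: "path_homotopic X b c q q'"
  shows "path_homotopic X a c (loop_concat p q) (loop_concat p' q')"
proof -
  let ?I = "top_of_set {0..1::real}"
  obtain h k :: "real \<times> real \<Rightarrow> 'a" where
    h: "continuous_map (prod_topology ?I ?I) X h" "\<forall>x. h (0, x) = p x" "\<forall>x. h (1, x) = p' x"
      "\<forall>t\<in>{0..1}. h (t, 0) = a \<and> h (t, 1) = b" and
    k: "continuous_map (prod_topology ?I ?I) X k" "\<forall>x. k (0, x) = q x" "\<forall>x. k (1, x) = q' x"
      "\<forall>t\<in>{0..1}. k (t, 0) = b \<and> k (t, 1) = c"
    using p q unfolding path_homotopic_def homotopic_with_def by blast
  define H where "H = (\<lambda>z::real\<times>real. if snd z \<le> 1/2 then h (fst z, 2 * snd z) else k (fst z, 2 * snd z - 1))"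
  have eu: "prod_topology ?I ?I = top_of_set ({0..1} \<times> {0..1})"
    by (simp add: prod_topology_subtopology subtopology_subtopology Times_Int_Times prod_topology_subtopology_eu)
  have "continuous_map (top_of_set ({0..1} \<times> {0..1})) X H"
    unfolding H_def
  proof (rule continuous_map_cases_le)
    show "continuous_map (top_of_set ({0..1} \<times> {0..1})) euclideanreal snd"
      "continuous_map (top_of_set ({0..1} \<times> {0..1::real})) euclideanreal (\<lambda>x::real\<times>real. 1/2)"
      by (auto intro: continuous_intros)
    have "continuous_map (subtopology (top_of_set ({0..1} \<times> {0..1})) {x \<in> topspace (top_of_set ({0..1} \<times> {0..1})). snd x \<le> 1/2})
      (top_of_set ({0..1} \<times> {0..1})) (\<lambda>z::real\<times>real. (fst z, 2 * snd z))"
      by (auto simp: subtopology_subtopology continuous_map_in_subtopology intro!: continuous_intros)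
    from continuous_map_compose[OF this h(1)[unfolded eu]]
    show "continuous_map (subtopology (top_of_set ({0..1} \<times> {0..1})) {x \<in> topspace (top_of_set ({0..1} \<times> {0..1})). snd x \<le> 1/2})
      X (\<lambda>z. h (fst z, 2 * snd z))" by (simp add: o_def)
    have "continuous_map (subtopology (top_of_set ({0..1} \<times> {0..1})) {x \<in> topspace (top_of_set ({0..1} \<times> {0..1})). 1/2 \<le> snd x})
      (top_of_set ({0..1} \<times> {0..1})) (\<lambda>z::real\<times>real. (fst z, 2 * snd z - 1))"
      by (auto simp: subtopology_subtopology continuous_map_in_subtopology intro!: continuous_intros)
    from continuous_map_compose[OF this k(1)[unfolded eu]]
    show "continuous_map (subtopology (top_of_set ({0..1} \<times> {0..1})) {x \<in> topspace (top_of_set ({0..1} \<times> {0..1})). 1/2 \<le> snd x})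
      X (\<lambda>z. k (fst z, 2 * snd z - 1))" by (simp add: o_def)
    show "h (fst x, 2 * snd x) = k (fst x, 2 * snd x - 1)"
      if "x \<in> topspace (top_of_set ({0..1} \<times> {0..1}))" "snd x = 1/2" for x
    proof -
      have x: "fst x \<in> {0..1}" "2 * snd x = 1" using that by (auto simp: mem_Times_iff)
      then show ?thesis using h(4) k(4) by simp
    qed
  qed
  then show ?thesis
    unfolding path_homotopic_def homotopic_with_def
    using h k by (intro exI[of _ H]) (auto simp: eu H_def loop_concat_def fun_eq_iff)
qed

lemma pathin_concat:
  assumes "pathin X p" "pathin X q" "p 1 = q 0"
  shows "pathin X (loop_concat p q)"
  using path_homotopic_imp(1)[OF path_homotopic_concat[OF path_homotopic_refl[OF assms(1) refl refl]
        path_homotopic_refl[OF assms(2) assms(3)[symmetric] refl]]] .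

definition path_rev :: "(real \<Rightarrow> 'a) \<Rightarrow> real \<Rightarrow> 'a" where
  "path_rev p = (\<lambda>t. p (1 - t))"

lemma path_rev_ends [simp]: "path_rev p 0 = p 1" "path_rev p 1 = p 0"
  by (simp_all add: path_rev_def)

lemma pathin_reparam:
  assumes "pathin X p" "continuous_on {0..1} u" "u ` {0..1} \<subseteq> {0..1}"
  shows "pathin X (\<lambda>t. p (u t))"
proof -
  have "continuous_map (top_of_set {0..1}) (top_of_set {0..1}) u"
    using assms(2,3) by (auto simp: continuous_map_in_subtopology)
  then show ?thesis using assms(1) continuous_map_compose unfolding pathin_def o_def[symmetric] by blast
qed

lemma pathin_rev: "pathin X p \<Longrightarrow> pathin X (path_rev p)"
  unfolding path_rev_def by (rule pathin_reparam) (auto intro!: continuous_intros)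

lemma path_homotopic_reparam_path:
  assumes "pathin X f" "continuous_on {0..1} u" "u ` {0..1} \<subseteq> {0..1}"
    "continuous_on {0..1} v" "v ` {0..1} \<subseteq> {0..1}" "u 0 = v 0" "u 1 = v 1"
    and "\<And>t. t \<in> {0..1} \<Longrightarrow> p t = f (u t)" "\<And>t. t \<in> {0..1} \<Longrightarrow> q t = f (v t)"
  shows "path_homotopic X (p 0) (p 1) p q"
  using path_homotopic_reparam[of "{0..1}" X f u v p q] assms by (auto simp: pathin_def)

lemma path_homotopic_assoc:
  assumes "pathin X p" "pathin X q" "pathin X r" "p 1 = q 0" "q 1 = r 0"
  shows "path_homotopic X (p 0) (r 1) (loop_concat (loop_concat p q) r) (loop_concat p (loop_concat q r))"
proof -
  let ?F = "loop_concat p (loop_concat q r)"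
  \<comment> \<open>The reparametrization is piecewise linear with breaks at 1/4 and 1/2 and slopes
    2, 1, 1/2. The slopes decrease, so it is the minimum of its three linear pieces.\<close>
  define v where "v t = min (2 * t) (min (t + 1/4) (1/2 + t/2))" for t :: real
  have "path_homotopic X (loop_concat (loop_concat p q) r 0) (loop_concat (loop_concat p q) r 1)
      (loop_concat (loop_concat p q) r) ?F"
  proof (rule path_homotopic_reparam_path[of X ?F v id])
    show "pathin X ?F" using assms by (intro pathin_concat) auto
    show "continuous_on {0..1} v" unfolding v_def by (intro continuous_intros) auto
    show "loop_concat (loop_concat p q) r t = ?F (v t)" if "t \<in> {0..1}" for t
    proof -
      consider "t \<le> 1/4" | "1/4 < t" "t \<le> 1/2" | "1/2 < t" by linarith
      then show ?thesis
      proof cases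
        case 1 then have "v t = 2 * t" by (simp add: v_def)
        then show ?thesis using 1 by (simp add: loop_concat_def)
      next
        case 2 then have "v t = t + 1/4" by (simp add: v_def)
        then show ?thesis using 2 by (simp add: loop_concat_def algebra_simps)
      next
        case 3 then have "v t = 1/2 + t/2" by (simp add: v_def)
        then show ?thesis using 3 by (simp add: loop_concat_def algebra_simps)
      qed
    qed
  qed (auto simp: v_def)
  then show ?thesis by simp
qed

lemma path_homotopic_cancel:
  assumes "pathin X p" "pathin X q" "p 1 = q 1"
  shows "path_homotopic X (p 0) (p 1) (loop_concat (loop_concat p (path_rev q)) q) p"
proof -
  let ?F = "loop_concat p (path_rev q)"
  \<comment> \<open>The path runs once through \<open>?F\<close> and then back along its second
    half, ending at parameter 1/2, where \<open>p\<close> ends inside \<open>?F\<close>.\<close>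
  define v where "v t = min (2 * t) (3/2 - t)" for t :: real
  have "path_homotopic X (loop_concat ?F q 0) (loop_concat ?F q 1) (loop_concat ?F q) p"
  proof (rule path_homotopic_reparam_path[of X ?F v "\<lambda>t. t/2"])
    show "pathin X ?F" using assms by (intro pathin_concat pathin_rev) auto
    show "continuous_on {0..1} v" unfolding v_def by (intro continuous_intros)
    show "loop_concat ?F q t = ?F (v t)" if "t \<in> {0..1}" for t
    proof (cases "t \<le> 1/2")
      case True then have "v t = 2 * t" by (simp add: v_def)
      then show ?thesis using True by (simp add: loop_concat_def)
    next
      case False then have "v t = 3/2 - t" by (simp add: v_def)
      \<comment> \<open>At \<open>t = 1\<close> the parameter \<open>v t = 1/2\<close> falls into
        the branch \<open>p\<close> of \<open>?F\<close>; there the equation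
        \<open>p 1 = q 1\<close> is used.\<close>
      then have "2 * v t = 3 - 2 * t" "v t \<le> 1/2 \<longleftrightarrow> t = 1" using that by auto
      then show ?thesis using False assms(3)
        by (cases "t = 1") (simp_all add: loop_concat_def path_rev_def)
    qed
    show "continuous_on {0..1} (\<lambda>t::real. t / 2)" by (rule continuous_on_divide) (auto intro: continuous_intros)
  qed (auto simp: v_def loop_concat_def)
  then show ?thesis using assms by simp
qed

lemma path_homotopic_rev:
  assumes "pathin X p"
  shows "path_homotopic X (p 0) (p 0) (loop_concat p (path_rev p)) (\<lambda>_. p 0)"
proof -
  define v where "v t = min (2 * t) (2 - 2 * t)" for t :: real
  have "path_homotopic X (loop_concat p (path_rev p) 0) (loop_concat p (path_rev p) 1) (loop_concat p (path_rev p)) (\<lambda>_. p 0)"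
  proof (rule path_homotopic_reparam_path[of X p v "\<lambda>_. 0"])
    show "continuous_on {0..1} v" unfolding v_def by (intro continuous_intros)
    show "loop_concat p (path_rev p) t = p (v t)" if "t \<in> {0..1}" for t
    proof (cases "t \<le> 1/2")
      case True then have "v t = 2 * t" by (simp add: v_def)
      then show ?thesis using True by (simp add: loop_concat_def)
    next
      case False then have "v t = 1 - (2 * t - 1)" by (simp add: v_def)
      then show ?thesis using False by (simp add: loop_concat_def path_rev_def)
    qed
  qed (use assms in \<open>auto simp: v_def\<close>)
  then show ?thesis by simp
qed

text \<open>For \<open>t < s\<close> the segment runs backwards, so that both sides of a parameter
  \<open>s\<close> can be treated alike.\<close>

definition path_segment :: "(real \<Rightarrow> 'a) \<Rightarrow> real \<Rightarrow> real \<Rightarrow> real \<Rightarrow> 'a" where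
  "path_segment p s t = (\<lambda>x. p (s + x * (t - s)))"

lemma path_segment_ends [simp]: "path_segment p s t 0 = p s" "path_segment p s t 1 = p t"
  by (simp_all add: path_segment_def)

lemma segment_param_in:
  fixes s t x :: real
  assumes "s \<in> {a..b}" "t \<in> {a..b}" "x \<in> {0..1}"
  shows "s + x * (t - s) \<in> {a..b}"
  using convexD[of "{a..b}" s t "1 - x" x] assms by (auto simp: algebra_simps)

lemma pathin_segment:
  assumes "pathin X p" "s \<in> {0..1}" "t \<in> {0..1}"
  shows "pathin X (path_segment p s t)"
  unfolding path_segment_def
proof (rule pathin_reparam[OF assms(1)])
  show "(\<lambda>x. s + x * (t - s)) ` {0..1} \<subseteq> {0..1}" using segment_param_in[OF assms(2,3)] by blast
qed (intro continuous_intros)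

lemma path_homotopic_segments:
  assumes p: "pathin X p" and st: "r \<in> {0..1}" "s \<in> {0..1}" "t \<in> {0..1}"
  shows "path_homotopic X (p r) (p t) (loop_concat (path_segment p r s) (path_segment p s t)) (path_segment p r t)"
proof -
  \<comment> \<open>\<open>v\<close> moves linearly from \<open>r\<close> to \<open>s\<close> on the
    first half and from \<open>s\<close> to \<open>t\<close> on the second; \<open>min\<close> and
    \<open>max\<close> switch the two motions off and on. No order among \<open>r\<close>,
    \<open>s\<close>, \<open>t\<close> is assumed.\<close>
  define v where "v x = r + min (2 * x) 1 * (s - r) + max 0 (2 * x - 1) * (t - s)" for x :: real
  let ?c = "loop_concat (path_segment p r s) (path_segment p s t)"
  have "path_homotopic X (?c 0) (?c 1) ?c (path_segment p r t)"
  proof (rule path_homotopic_reparam_path[OF p, of v "\<lambda>x. r + x * (t - r)"])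
    show "continuous_on {0..1} v" unfolding v_def by (intro continuous_intros)
    show "v ` {0..1} \<subseteq> {0..1}"
    proof clarify
      fix x :: real assume x: "x \<in> {0..1}"
      show "v x \<in> {0..1}"
      proof (cases "x \<le> 1/2")
        case True then have "v x = r + (2 * x) * (s - r)" by (simp add: v_def)
        then show ?thesis using segment_param_in[OF st(1,2), of "2 * x"] x True by simp
      next
        case False then have "v x = s + (2 * x - 1) * (t - s)" by (simp add: v_def)
        then show ?thesis using segment_param_in[OF st(2,3), of "2 * x - 1"] x False by simp
      qed
    qed
    show "?c x = p (v x)" if "x \<in> {0..1}" for x
      by (cases "x \<le> 1/2") (simp_all add: v_def loop_concat_def path_segment_def)
    show "(\<lambda>x. r + x * (t - r)) ` {0..1} \<subseteq> {0..1}" using segment_param_in[OF st(1,3)] by blast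
  qed (auto simp: v_def path_segment_def intro!: continuous_intros)
  then show ?thesis by simp
qed

definition loop_class :: "'a topology \<Rightarrow> 'a \<Rightarrow> (real \<Rightarrow> 'a) \<Rightarrow> (real \<Rightarrow> 'a) set" where
  "loop_class X a p = loop_homotopy X a `` {p}"

lemma loop_homotopy_iff: "(p, q) \<in> loop_homotopy X a \<longleftrightarrow> path_homotopic X a a p q"
  by (simp add: loop_homotopy_def path_homotopic_def)

lemma mem_loop_class: "q \<in> loop_class X a p \<longleftrightarrow> path_homotopic X a a p q"
  by (simp add: loop_class_def loop_homotopy_iff)

lemma loop_class_self: "p \<in> loops X a \<Longrightarrow> p \<in> loop_class X a p"
  by (simp add: mem_loop_class loops_def path_homotopic_refl)

lemma loop_class_eqI: "path_homotopic X a a p q \<Longrightarrow> loop_class X a p = loop_class X a q"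
  using path_homotopic_sym path_homotopic_trans unfolding set_eq_iff mem_loop_class by metis

lemma carrier_fundamental_group: "carrier (fundamental_group X a) = loop_class X a ` loops X a"
  by (auto simp: fundamental_group_def quotient_def loop_class_def)

lemma loops_concat: "p \<in> loops X a \<Longrightarrow> q \<in> loops X a \<Longrightarrow> loop_concat p q \<in> loops X a"
  by (simp add: loops_def pathin_concat)

lemma loops_rev: "p \<in> loops X a \<Longrightarrow> path_rev p \<in> loops X a"
  by (simp add: loops_def pathin_rev)

lemma loops_const: "a \<in> topspace X \<Longrightarrow> (\<lambda>_. a) \<in> loops X a"
  by (simp add: loops_def)

text \<open>Products and induced maps of classes are defined as images of whole sets of loops; once
  these loops are all homotopic, the image is a single class.\<close>

lemma Image_loop_homotopy_eqI:
  assumes "A \<noteq> {}" "\<And>p. p \<in> A \<Longrightarrow> path_homotopic X a a q p"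
  shows "loop_homotopy X a `` A = loop_class X a q"
proof -
  have "loop_homotopy X a `` {p} = loop_class X a q" if "p \<in> A" for p
    using loop_class_eqI[OF assms(2)[OF that]] by (simp add: loop_class_def)
  then show ?thesis using assms(1) by blast
qed

lemma fundamental_group_mult:
  assumes "p \<in> loops X a" "q \<in> loops X a"
  shows "loop_class X a p \<otimes>\<^bsub>fundamental_group X a\<^esub> loop_class X a q = loop_class X a (loop_concat p q)"
  unfolding fundamental_group_def monoid.simps
  by (rule Image_loop_homotopy_eqI)
    (use loop_class_self[OF assms(1)] loop_class_self[OF assms(2)] in
      \<open>auto simp: mem_loop_class intro: path_homotopic_concat\<close>)

lemma induced_hom_loop_class:
  assumes f: "continuous_map X Y f" "f a = b" and p: "p \<in> loops X a"
  shows "induced_hom Y b f (loop_class X a p) = loop_class Y b (f \<circ> p)"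
  unfolding induced_hom_def
  by (rule Image_loop_homotopy_eqI)
    (use loop_class_self[OF p] path_homotopic_compose[OF _ f(1)] f(2) in \<open>fastforce simp: mem_loop_class\<close>)+

lemma loops_compose: "continuous_map X Y f \<Longrightarrow> f a = b \<Longrightarrow> p \<in> loops X a \<Longrightarrow> f \<circ> p \<in> loops Y b"
  by (auto simp: loops_def pathin_compose)

section \<open>Classification of covers\<close>

lemma continuous_map_locally:
  assumes "\<And>y. y \<in> topspace Y \<Longrightarrow> \<exists>W. openin Y W \<and> y \<in> W \<and> continuous_map (subtopology Y W) E g"
  shows "continuous_map Y E g"
proof -
  obtain W where W: "\<And>y. y \<in> topspace Y \<Longrightarrow> openin Y (W y) \<and> y \<in> W y \<and> continuous_map (subtopology Y (W y)) E g"
    using assms by metis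
  show ?thesis
    by (rule pasting_lemma[of "topspace Y" Y W E "\<lambda>_. g"]) (use W in auto)
qed

lemma trivializingD:
  assumes "trivializing E X p U sec"
  shows "openin X U"
    and "e \<in> topspace E \<Longrightarrow> p e \<in> U \<Longrightarrow> continuous_map (subtopology X U) E (sec e)"
    and "e \<in> topspace E \<Longrightarrow> p e \<in> U \<Longrightarrow> y \<in> U \<Longrightarrow> p (sec e y) = y"
    and "e \<in> topspace E \<Longrightarrow> p e \<in> U \<Longrightarrow> sec e (p e) = e"
    and "e \<in> topspace E \<Longrightarrow> p e \<in> U \<Longrightarrow> openin E (sec e ` U)"
  using assms unfolding trivializing_def by blast+

lemma openin_trivializing_image:
  assumes t: "trivializing E X p U sec" and c: "continuous_map E X p" and e: "e \<in> topspace E" "p e \<in> U"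
    and Q: "openin X Q" "Q \<subseteq> U"
  shows "openin E (sec e ` Q)"
proof -
  have "sec e ` Q = sec e ` U \<inter> {e' \<in> topspace E. p e' \<in> Q}"
    using t e Q trivializing_in[OF t e] unfolding trivializing_def by auto
  then show ?thesis
    using t e openin_continuous_map_preimage[OF c Q(1)] unfolding trivializing_def by auto
qed

lemma openin_trivializing_preimage:
  assumes t: "trivializing E X p U sec" and e: "e \<in> topspace E" "p e \<in> U" and V: "openin E V"
  shows "openin X {y \<in> U. sec e y \<in> V}"
proof -
  have U: "openin X U" "continuous_map (subtopology X U) E (sec e)"
    using t e unfolding trivializing_def by auto
  have "openin (subtopology X U) {y \<in> topspace (subtopology X U). sec e y \<in> V}"
    by (rule openin_continuous_map_preimage[OF U(2) V])
  moreover have "topspace (subtopology X U) = U" using openin_subset[OF U(1)] by auto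
  ultimately have "openin (subtopology X U) {y \<in> U. sec e y \<in> V}" by (simp only:)
  then show ?thesis by (rule openin_trans_full[OF _ U(1)])
qed

text \<open>A section carries a small path connected open set of the base to a path connected set
  above, which is open because it is the part of a sheet over an open set.\<close>

lemma covering_locally_path_connected:
  assumes p: "covering_map E X p" and X: "locally_path_connected_space X"
  shows "locally_path_connected_space E"
  unfolding locally_path_connected_space
proof (intro allI impI)
  fix V e assume V: "openin E V \<and> e \<in> V"
  then have e: "e \<in> topspace E" using openin_subset by blast
  obtain U sec where U: "p e \<in> U" and t: "trivializing E X p U sec"
    using covering_map_trivializing[OF p covering_map_in[OF p e]] by blast
  let ?O = "{y \<in> U. sec e y \<in> V}"
  have "openin X ?O" using openin_trivializing_preimage[OF t e U] V by blast
  moreover have se: "sec e (p e) = e" using trivializingD(4)[OF t e U] .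
  then have "p e \<in> ?O" using U V by simp
  ultimately obtain Q where Q: "openin X Q" "path_connectedin X Q" "p e \<in> Q" "Q \<subseteq> ?O"
    using X[unfolded locally_path_connected_space] by meson
  have QU: "Q \<subseteq> U" using Q by blast
  have "path_connectedin (subtopology X U) Q" using Q QU by (simp add: path_connectedin_subtopology)
  moreover have "continuous_map (subtopology X U) E (sec e)"
    by (rule trivializingD(2)[OF t e U])
  ultimately have "path_connectedin E (sec e ` Q)" by (rule path_connectedin_continuous_map_image[rotated])
  moreover have "openin E (sec e ` Q)"
    by (rule openin_trivializing_image[OF t covering_map_continuous[OF p] e U Q(1) QU])
  moreover have "e \<in> sec e ` Q" using se Q(3) image_iff by fastforce
  moreover have "sec e ` Q \<subseteq> V" using Q(4) by blast
  ultimately show "\<exists>U. openin E U \<and> path_connectedin E U \<and> e \<in> U \<and> U \<subseteq> V" by blast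
qed

text \<open>What remains is that \<open>h\<close> is open. Over a small set of \<open>X\<close> both
  the sheet through \<open>e\<close> and the sheet through \<open>h e\<close> are parametrized by
  sections, and \<open>h\<close> carries one section to the other.\<close>

lemma covering_bijective_imp_homeomorphic:
  assumes p: "covering_map E X p" and r: "covering_map F X r" and h: "continuous_map E F h"
    and bij: "bij_betw h (topspace E) (topspace F)" and rh: "\<And>e. e \<in> topspace E \<Longrightarrow> r (h e) = p e"
  shows "homeomorphic_map E F h"
proof (rule bijective_open_imp_homeomorphic_map[OF h])
  show "open_map E F h"
    unfolding open_map_def
  proof (intro allI impI)
    fix O' assume O': "openin E O'"
    show "openin F (h ` O')"
    proof (subst openin_subopen, intro ballI)
      fix f assume "f \<in> h ` O'"
      then obtain e where e: "e \<in> O'" "f = h e" by blast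
      have eE: "e \<in> topspace E" using e O' openin_subset by blast
      then have fF: "h e \<in> topspace F" using h by (auto simp: continuous_map_def)
      obtain U sec where U: "p e \<in> U" and t: "trivializing E X p U sec"
        using covering_map_trivializing[OF p covering_map_in[OF p eE]] by blast
      obtain U' sec' where U': "r (h e) \<in> U'" and t': "trivializing F X r U' sec'"
        using covering_map_trivializing[OF r covering_map_in[OF r fF]] by blast
      have o1: "openin F (sec' (h e) ` U')" using trivializingD(5)[OF t' fF U'] .
      have oV: "openin E (O' \<inter> {x \<in> topspace E. h x \<in> sec' (h e) ` U'})"
        using O' openin_continuous_map_preimage[OF h o1] by blast
      let ?V = "O' \<inter> {x \<in> topspace E. h x \<in> sec' (h e) ` U'}"
      let ?N = "{y \<in> U. sec e y \<in> ?V}"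
      have oN: "openin X ?N" by (rule openin_trivializing_preimage[OF t eE U oV])
      have "openin X U'" using t' by (simp add: trivializing_def)
      then have oN': "openin X (?N \<inter> U')" by (rule openin_Int[OF oN])
      have "sec' (h e) (r (h e)) = h e" using trivializingD(4)[OF t' fF U'] .
      note he = this[symmetric]
      have se: "sec e (p e) = e" using trivializingD(4)[OF t eE U] .
      have "h e \<in> sec' (h e) ` U'" using he U' by blast
      then have pe: "p e \<in> ?N \<inter> U'" using U se e eE U' rh[OF eE] by simp
      \<comment> \<open>Consequently the image of \<open>O'\<close> contains the open piece of the
        sheet through \<open>h e\<close> that lies over \<open>?N \<inter> U'\<close>.\<close>
      have key: "sec' (h e) y = h (sec e y)" if y: "y \<in> ?N \<inter> U'" for y
      proof -
        have s: "sec e y \<in> topspace E" "p (sec e y) = y"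
          using y trivializing_in[OF t eE U] t eE U unfolding trivializing_def by auto
        have "h (sec e y) \<in> sec' (h e) ` U'" using y by simp
        then have "sec' (h e) (r (h (sec e y))) = h (sec e y)"
          by (rule trivializing_sheet_inv(2)[OF t' fF U'])
        then show ?thesis using rh[OF s(1)] s(2) by simp
      qed
      have "openin F (sec' (h e) ` (?N \<inter> U'))"
        by (rule openin_trivializing_image[OF t' covering_map_continuous[OF r] fF U' oN']) blast
      moreover have "sec' (h e) (p e) = f" using he[symmetric] rh[OF eE] e(2) by simp
      then have "f \<in> sec' (h e) ` (?N \<inter> U')" using pe by (intro image_eqI[of _ _ "p e"]) simp_all
      moreover have "sec' (h e) ` (?N \<inter> U') \<subseteq> h ` O'"
      proof (rule image_subsetI)
        fix y assume y: "y \<in> ?N \<inter> U'"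
        then have "sec e y \<in> O'" by simp
        then show "sec' (h e) y \<in> h ` O'" unfolding key[OF y] by (rule imageI)
      qed
      ultimately show "\<exists>T. openin F T \<and> f \<in> T \<and> T \<subseteq> h ` O'" by blast
    qed
  qed
qed (use bij in \<open>auto simp: bij_betw_def\<close>)

section \<open>Equivalence of covers and its invariants\<close>

lemma cover_equiv_refl: "cover_equiv C C"
  unfolding cover_equiv_def by (auto intro!: exI[of _ id] simp: split_beta)

lemma cover_equiv_sym:
  assumes "cover_equiv C D" shows "cover_equiv D C"
proof -
  obtain E p F r where C: "C = (E, p)" "D = (F, r)" by fastforce
  obtain h where h: "homeomorphic_map E F h" "\<forall>e\<in>topspace E. r (h e) = p e"
    using assms unfolding C cover_equiv_def by auto
  then obtain g where g: "homeomorphic_maps E F h g" using homeomorphic_map_maps by blast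
  then have "homeomorphic_map F E g" using homeomorphic_maps_map homeomorphic_maps_sym by blast
  moreover have "p (g f) = r f" if "f \<in> topspace F" for f
  proof -
    have "g f \<in> topspace E" "h (g f) = f" using g that unfolding homeomorphic_maps_def continuous_map_def by auto
    then show ?thesis using h(2) by metis
  qed
  ultimately show ?thesis unfolding C cover_equiv_def by auto
qed

lemma cover_equiv_trans:
  assumes "cover_equiv C D" "cover_equiv D B" shows "cover_equiv C B"
proof -
  obtain E p F r K q where C: "C = (E, p)" "D = (F, r)" "B = (K, q)" by (metis surj_pair)
  obtain h where h: "homeomorphic_map E F h" "\<forall>e\<in>topspace E. r (h e) = p e"
    using assms(1) unfolding C cover_equiv_def by auto
  obtain g where g: "homeomorphic_map F K g" "\<forall>e\<in>topspace F. q (g e) = r e"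
    using assms(2) unfolding C cover_equiv_def by auto
  have "homeomorphic_map E K (g \<circ> h)" using h g homeomorphic_map_compose by blast
  moreover have "q ((g \<circ> h) e) = p e" if "e \<in> topspace E" for e
  proof -
    have "h e \<in> topspace F" using h(1) that homeomorphic_imp_surjective_map by blast
    then show ?thesis using h(2) g(2) that by simp
  qed
  ultimately show ?thesis unfolding C cover_equiv_def by auto
qed

lemma cover_equiv_pullback:
  assumes "cover_equiv (E, p) (F, r)"
  shows "cover_equiv (pullback_cover X f (E, p)) (pullback_cover X f (F, r))"
proof -
  obtain h where h: "homeomorphic_map E F h" "\<forall>e\<in>topspace E. r (h e) = p e"
    using assms unfolding cover_equiv_def by auto
  then obtain g where g: "homeomorphic_maps E F h g" using homeomorphic_map_maps by blast
  let ?P = "subtopology (prod_topology X E) {z. f (fst z) = p (snd z)}"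
  let ?Q = "subtopology (prod_topology X F) {z. f (fst z) = r (snd z)}"
  have cg: "continuous_map E F h" "continuous_map F E g" and
    hg: "\<And>e. e \<in> topspace E \<Longrightarrow> g (h e) = e" "\<And>e. e \<in> topspace F \<Longrightarrow> h (g e) = e"
    using g unfolding homeomorphic_maps_def by auto
  have pg: "p (g e) = r e" if "e \<in> topspace F" for e
    using h(2) hg(2)[OF that] continuous_map_image_subset_topspace[OF cg(2)] that by (metis image_subset_iff)
  have "continuous_map ?P ?Q (\<lambda>z. (fst z, h (snd z)))"
  proof (rule continuous_map_into_subtopology)
    show "continuous_map ?P (prod_topology X F) (\<lambda>z. (fst z, h (snd z)))"
      using continuous_map_compose[OF continuous_map_snd cg(1), unfolded o_def]
      by (intro continuous_map_from_subtopology continuous_map_pairedI continuous_map_fst)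
  qed (use h(2) in auto)
  moreover have "continuous_map ?Q ?P (\<lambda>z. (fst z, g (snd z)))"
  proof (rule continuous_map_into_subtopology)
    show "continuous_map ?Q (prod_topology X E) (\<lambda>z. (fst z, g (snd z)))"
      using continuous_map_compose[OF continuous_map_snd cg(2), unfolded o_def]
      by (intro continuous_map_from_subtopology continuous_map_pairedI continuous_map_fst)
  qed (use pg in auto)
  ultimately have "homeomorphic_maps ?P ?Q (\<lambda>z. (fst z, h (snd z))) (\<lambda>z. (fst z, g (snd z)))"
    unfolding homeomorphic_maps_def using hg by auto
  then have "homeomorphic_map ?P ?Q (\<lambda>z. (fst z, h (snd z)))" using homeomorphic_maps_map by blast
  then show ?thesis unfolding cover_equiv_def pullback_cover_def case_prod_unfold by auto
qed

text \<open>By homotopy lifting the end of a lift depends only on the class of \<open>q\<close>.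
  Membership in the image subgroup thus becomes a condition on closed lifts, the form in which
  subgroups are handled from here on.\<close>

lemma mem_induced_hom_image_iff:
  assumes p: "covering_map E X p" and e: "e \<in> topspace E" "p e = a" and q: "q \<in> loops X a"
  shows "loop_class X a q \<in> induced_hom X a p ` carrier (fundamental_group E e) \<longleftrightarrow>
    (\<exists>l\<in>loops E e. \<forall>t\<in>{0..1}. p (l t) = q t)"
proof
  note c = covering_map_continuous[OF p]
  assume "loop_class X a q \<in> induced_hom X a p ` carrier (fundamental_group E e)"
  then obtain l' where l': "l' \<in> loops E e" "loop_class X a q = loop_class X a (p \<circ> l')"
    unfolding carrier_fundamental_group using induced_hom_loop_class[OF c e(2)] by auto
  have q0: "pathin X q" "q 0 = a" "q 1 = a" using q by (auto simp: loops_def)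
  then have "p e = q 0" using e by simp
  then obtain l where l: "pathin E l" "\<And>t. t \<in> {0..1} \<Longrightarrow> p (l t) = q t" "l 0 = e"
    using path_lift[OF p q0(1) e(1)] by blast
  have "path_homotopic X a a (p \<circ> l') q"
    using l'(2) loop_class_self[OF q] by (simp add: mem_loop_class)
  then have "path_homotopic X a a (p \<circ> l') (p \<circ> l)"
    by (rule path_homotopic_eq) (use l in auto)
  then have "l' 1 = l 1"
    using homotopic_lift_endpoint[OF p, of a a l' l] l l' by (auto simp: path_homotopic_def loops_def)
  then have "l \<in> loops E e" using l l' by (auto simp: loops_def)
  then show "\<exists>l\<in>loops E e. \<forall>t\<in>{0..1}. p (l t) = q t" using l by blast
next
  note c = covering_map_continuous[OF p]
  assume "\<exists>l\<in>loops E e. \<forall>t\<in>{0..1}. p (l t) = q t"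
  then obtain l where l: "l \<in> loops E e" "\<forall>t\<in>{0..1}. p (l t) = q t" by blast
  have "path_homotopic X a a q q" using q by (intro path_homotopic_refl) (auto simp: loops_def)
  then have "path_homotopic X a a q (p \<circ> l)" by (rule path_homotopic_eq) (use l in auto)
  then have "loop_class X a q = loop_class X a (p \<circ> l)" by (rule loop_class_eqI)
  also have "\<dots> = induced_hom X a p (loop_class E e l)"
    using induced_hom_loop_class[OF c e(2) l(1)] by simp
  finally show "loop_class X a q \<in> induced_hom X a p ` carrier (fundamental_group E e)"
    using l(1) unfolding carrier_fundamental_group by blast
qed

text \<open>The value \<open>g y\<close> is the end of the lift of \<open>f\<close> along a path
  from \<open>y0\<close> to \<open>y\<close>. Two such paths form a loop, whose lift is closed by
  \<open>lp\<close>, so the end does not depend on the path; local path connectedness gives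
  continuity.\<close>

lemma lifting_criterion:
  assumes p: "covering_map E X p" and f: "continuous_map Y X f"
    and Y: "path_connected_space Y" "locally_path_connected_space Y" and y0: "y0 \<in> topspace Y"
    and e: "e \<in> topspace E" "p e = f y0"
    and lp: "\<And>l. l \<in> loops Y y0 \<Longrightarrow> \<exists>l'\<in>loops E e. \<forall>t\<in>{0..1}. p (l' t) = f (l t)"
  obtains g where "continuous_map Y E g" "\<And>y. y \<in> topspace Y \<Longrightarrow> p (g y) = f y" "g y0 = e"
proof -
  define L where "L w l \<longleftrightarrow> pathin E l \<and> l 0 = e \<and> (\<forall>t\<in>{0..1}. p (l t) = f (w t))" for w :: "real \<Rightarrow> 'c" and l
  have "\<exists>w. pathin Y w \<and> w 0 = y0 \<and> w 1 = y" if "y \<in> topspace Y" for y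
    using Y(1) y0 that unfolding path_connected_space_def by blast
  then obtain w where w: "\<And>y. y \<in> topspace Y \<Longrightarrow> pathin Y (w y) \<and> w y 0 = y0 \<and> w y 1 = y" by metis
  have exL: "\<exists>l. L v l" if v: "pathin Y v" "v 0 = y0" for v
  proof -
    have "pathin X (f \<circ> v)" using v f by (simp add: pathin_compose)
    moreover have "p e = (f \<circ> v) 0" using e v by simp
    ultimately obtain l where "pathin E l" "\<And>t. t \<in> {0..1} \<Longrightarrow> p (l t) = (f \<circ> v) t" "l 0 = e"
      using path_lift[OF p _ e(1)] by blast
    then have "pathin E l \<and> l 0 = e \<and> (\<forall>t\<in>{0..1}. p (l t) = f (v t))" by simp
    then show ?thesis unfolding L_def by (intro exI[of _ l])
  qed
  define ly where "ly y = (SOME l. L (w y) l)" for y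
  define g where "g y = ly y 1" for y
  have Lw: "L (w y) (ly y)" if "y \<in> topspace Y" for y
    using exL[of "w y"] w[OF that] someI_ex unfolding ly_def by metis
  have wd: "l 1 = g y" if v: "pathin Y v" "v 0 = y0" "v 1 = y" and l: "L v l" for v l y
  proof -
    have y: "y \<in> topspace Y" using v pathin_in[OF v(1), of 1] by simp
    have "loop_concat v (path_rev (w y)) \<in> loops Y y0"
      using v w[OF y] by (auto simp: loops_def intro!: pathin_concat pathin_rev)
    then obtain m where m: "m \<in> loops E e" "\<And>t. t \<in> {0..1} \<Longrightarrow> p (m t) = f (loop_concat v (path_rev (w y)) t)"
      using lp by blast
    have mp: "pathin E m" "m 0 = e" "m 1 = e" using m by (auto simp: loops_def)
    \<comment> \<open>The first half of the closed lift \<open>m\<close> covers \<open>v\<close>,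
      the second half run backwards covers \<open>w y\<close>; both start at \<open>e\<close> and
      both end at \<open>m (1/2)\<close>.\<close>
    have h1: "pathin E (\<lambda>t. m (1/2 * t))" "pathin E (\<lambda>t. m (1 - 1/2 * t))"
      by (rule pathin_reparam[OF mp(1)]; (intro continuous_intros | force))+
    have "l 1 = m (1/2 * 1)"
    proof (rule lift_of_path_end_unique[OF p _ h1(1)])
      show "p (l t) = p (m (1/2 * t))" if "t \<in> {0..1}" for t
        using l that m(2)[of "1/2 * t"] unfolding L_def by (simp add: loop_concat_def)
    qed (use l mp in \<open>auto simp: L_def\<close>)
    moreover have "ly y 1 = m (1 - 1/2 * 1)"
    proof (rule lift_of_path_end_unique[OF p _ h1(2)])
      show "p ((ly y) t) = p (m (1 - 1/2 * t))" if t: "t \<in> {0..1}" for t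
      proof -
        have "p (m (1 - 1/2 * t)) = f (loop_concat v (path_rev (w y)) (1 - 1/2 * t))"
          using t by (intro m(2)) auto
        also have "\<dots> = f (w y t)"
          using t v w[OF y] by (cases "t = 1") (auto simp: loop_concat_def path_rev_def)
        finally show ?thesis using Lw[OF y] t unfolding L_def by simp
      qed
    qed (use Lw[OF y] mp in \<open>auto simp: L_def\<close>)
    ultimately show ?thesis unfolding g_def by simp
  qed
  have pg: "p (g y) = f y" if y: "y \<in> topspace Y" for y
    using Lw[OF y] w[OF y] unfolding L_def g_def by simp
  have gE: "g y \<in> topspace E" if y: "y \<in> topspace Y" for y
    using Lw[OF y] pathin_in[of E "ly y" 1] unfolding L_def g_def by simp
  have "L (\<lambda>_. y0) (\<lambda>_. e)" using e by (simp add: L_def)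
  then have g0: "g y0 = e" using wd[of "\<lambda>_. y0" y0 "\<lambda>_. e"] y0 by simp
  have "continuous_map Y E g"
  proof (rule continuous_map_locally)
    fix y assume y: "y \<in> topspace Y"
    obtain U sec where U: "p (g y) \<in> U" and t: "trivializing E X p U sec"
      using covering_map_trivializing[OF p covering_map_in[OF p gE[OF y]]] by blast
    have oU: "openin X U" using t by (simp add: trivializing_def)
    have "openin Y {z \<in> topspace Y. f z \<in> U}" by (rule openin_continuous_map_preimage[OF f oU])
    moreover have "y \<in> {z \<in> topspace Y. f z \<in> U}" using y U pg[OF y] by simp
    ultimately obtain W where W: "openin Y W" "path_connectedin Y W" "y \<in> W" "W \<subseteq> {z \<in> topspace Y. f z \<in> U}"
      using Y(2)[unfolded locally_path_connected_space] by meson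
    have cs: "continuous_map (subtopology X U) E (sec (g y))"
      by (rule trivializingD(2)[OF t gE[OF y] U])
    have "continuous_map (subtopology Y W) (subtopology X U) f"
      using f W(4) by (intro continuous_map_into_subtopology continuous_map_from_subtopology) auto
    then have csf: "continuous_map (subtopology Y W) E (sec (g y) \<circ> f)"
      by (rule continuous_map_compose[OF _ cs])
    \<comment> \<open>Inside \<open>W\<close> a path from \<open>y\<close> to \<open>z\<close> is
      lifted by the section through \<open>g y\<close>; appended to the lift along
      \<open>w y\<close> it computes \<open>g z\<close>.\<close>
    have key: "g z = sec (g y) (f z)" if z: "z \<in> W" for z
    proof -
      obtain v where v: "pathin (subtopology Y W) v" "v 0 = y" "v 1 = z"
        using W(2,3) z unfolding path_connectedin_def path_connected_space_def by fastforce
      have vY: "pathin Y v" using v(1) by (simp add: pathin_subtopology)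
        have 1: "pathin E (sec (g y) \<circ> f \<circ> v)" using pathin_compose[OF v(1) csf] .
      have se: "sec (g y) (p (g y)) = g y" by (rule trivializingD(4)[OF t gE[OF y] U])
      have vW: "v s \<in> W" if "s \<in> {0..1}" for s using v(1) that unfolding pathin_subtopology by blast
      have 2: "L (loop_concat (w y) v) (loop_concat (ly y) (sec (g y) \<circ> f \<circ> v))"
        unfolding L_def
      proof (intro conjI ballI)
        show "pathin E (loop_concat (ly y) (sec (g y) \<circ> f \<circ> v))"
          by (rule pathin_concat[OF _ 1]) (use Lw[OF y] se v pg[OF y] in \<open>auto simp: L_def g_def\<close>)
        show "loop_concat (ly y) (sec (g y) \<circ> f \<circ> v) 0 = e" using Lw[OF y] by (simp add: L_def)
        fix s :: real assume s: "s \<in> {0..1}"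
        have "p (sec (g y) (f (v s'))) = f (v s')" if "s' \<in> {0..1}" for s'
        proof -
          have "f (v s') \<in> U" using vW[OF that] W(4) by blast
          then show ?thesis by (rule trivializingD(3)[OF t gE[OF y] U])
        qed
        then show "p (loop_concat (ly y) (sec (g y) \<circ> f \<circ> v) s) = f (loop_concat (w y) v s)"
          using s Lw[OF y] by (auto simp: loop_concat_def L_def)
      qed
      have "pathin Y (loop_concat (w y) v)" using w[OF y] vY v by (intro pathin_concat) auto
      from wd[OF this _ _ 2] show ?thesis using w[OF y] v by simp
    qed
    have "continuous_map (subtopology Y W) E g"
      by (rule continuous_map_eq[OF csf]) (use key in auto)
    then show "\<exists>W. openin Y W \<and> y \<in> W \<and> continuous_map (subtopology Y W) E g" using W by blast
  qed
  then show ?thesis using that pg g0 by blast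
qed

text \<open>The lifting criterion applies in both directions with base points \<open>e\<close> and
  \<open>f\<close>. Both composites agree with the identity at the base point and lie over the
  identity of \<open>X\<close>, so uniqueness of lifts makes them identities.\<close>

lemma cover_equiv_if_same_closed_lifts:
  assumes p: "covering_map E X p" and r: "covering_map F X r"
    and con: "connected_space E" "connected_space F" and X: "locally_path_connected_space X"
    and e: "e \<in> topspace E" "p e = a" and f: "f \<in> topspace F" "r f = a"
    and same: "\<And>q. q \<in> loops X a \<Longrightarrow>
      (\<exists>l\<in>loops E e. \<forall>t\<in>{0..1}. p (l t) = q t) \<longleftrightarrow> (\<exists>l\<in>loops F f. \<forall>t\<in>{0..1}. r (l t) = q t)"
  shows "cover_equiv (E, p) (F, r)"
proof -
  have lE: "locally_path_connected_space E" "locally_path_connected_space F"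
    using covering_locally_path_connected[OF p X] covering_locally_path_connected[OF r X] .
  then have pE: "path_connected_space E" "path_connected_space F"
    using con path_connected_eq_connected_space by blast+
  have "\<exists>l'\<in>loops F f. \<forall>t\<in>{0..1}. r (l' t) = p (l t)" if l: "l \<in> loops E e" for l
  proof -
    have "p \<circ> l \<in> loops X a" by (rule loops_compose[OF covering_map_continuous[OF p] e(2) l])
    then show ?thesis using same[of "p \<circ> l"] l by auto
  qed
  moreover have "r f = p e" using e f by simp
  ultimately obtain g where g: "continuous_map E F g" "\<And>y. y \<in> topspace E \<Longrightarrow> r (g y) = p y" "g e = f"
    using lifting_criterion[OF r covering_map_continuous[OF p] pE(1) lE(1) e(1) f(1)] by blast
  have "\<exists>l'\<in>loops E e. \<forall>t\<in>{0..1}. p (l' t) = r (l t)" if l: "l \<in> loops F f" for l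
  proof -
    have "r \<circ> l \<in> loops X a" by (rule loops_compose[OF covering_map_continuous[OF r] f(2) l])
    then show ?thesis using same[of "r \<circ> l"] l by auto
  qed
  moreover have "p e = r f" using e f by simp
  ultimately obtain h where h: "continuous_map F E h" "\<And>y. y \<in> topspace F \<Longrightarrow> p (h y) = r y" "h f = e"
    using lifting_criterion[OF p covering_map_continuous[OF r] pE(2) lE(2) f(1) e(1)] by blast
  have gF: "g y \<in> topspace F" if "y \<in> topspace E" for y using g(1) that by (auto simp: continuous_map_def)
  have hE: "h y \<in> topspace E" if "y \<in> topspace F" for y using h(1) that by (auto simp: continuous_map_def)
  have "(h \<circ> g) y = id y" if "y \<in> topspace E" for y
    by (rule lift_unique[OF p continuous_map_compose[OF g(1) h(1)] continuous_map_id _ con(1) e(1) _ that])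
      (use g h gF in auto)
  moreover have "(g \<circ> h) y = id y" if "y \<in> topspace F" for y
    by (rule lift_unique[OF r continuous_map_compose[OF h(1) g(1)] continuous_map_id _ con(2) f(1) _ that])
      (use g h hE in auto)
  ultimately have "homeomorphic_maps E F g h" using g(1) h(1) unfolding homeomorphic_maps_def by simp
  then have "homeomorphic_map E F g" using homeomorphic_maps_map by blast
  then show ?thesis using g(2) unfolding cover_equiv_def by auto
qed

section \<open>Bundles defined by germs of cocycles\<close>

text \<open>A principal \<open>G\<close>-bundle together with a, not necessarily continuous, choice of a point in
  each fibre is the same thing as a function \<open>\<kappa>\<close> such that \<open>\<kappa> x z = \<kappa> x y \<otimes> \<kappa> y z\<close>
  for all \<open>y\<close> near \<open>x\<close> and all \<open>z\<close> near \<open>y\<close>. The bundle consists of the pairs \<open>(x, g)\<close>, and the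
  sheet through \<open>(x, g)\<close> is \<open>{(y, g \<otimes> \<kappa> x y) | y near x}\<close>.\<close>

definition germ_nhd :: "'x topology \<Rightarrow> ('g, 'm) monoid_scheme \<Rightarrow> ('x \<Rightarrow> 'x \<Rightarrow> 'g) \<Rightarrow> 'x \<Rightarrow> 'x set \<Rightarrow> bool" where
  "germ_nhd X G \<kappa> x U \<longleftrightarrow> openin X U \<and> x \<in> U \<and>
     (\<forall>y\<in>U. \<kappa> x y \<in> carrier G \<and>
        (\<exists>W. openin X W \<and> y \<in> W \<and> (\<forall>z\<in>W. \<kappa> x z = \<kappa> x y \<otimes>\<^bsub>G\<^esub> \<kappa> y z)))"

definition germ_cocycle :: "'x topology \<Rightarrow> ('g, 'm) monoid_scheme \<Rightarrow> ('x \<Rightarrow> 'x \<Rightarrow> 'g) \<Rightarrow> bool" where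
  "germ_cocycle X G \<kappa> \<longleftrightarrow> (\<forall>x\<in>topspace X. \<exists>U. germ_nhd X G \<kappa> x U)"

definition gbundle :: "'x topology \<Rightarrow> ('g, 'm) monoid_scheme \<Rightarrow> ('x \<Rightarrow> 'x \<Rightarrow> 'g) \<Rightarrow> ('x \<times> 'g) topology" where
  "gbundle X G \<kappa> = topology (\<lambda>S. S \<subseteq> topspace X \<times> carrier G \<and>
     (\<forall>(x, g)\<in>S. \<exists>U. openin X U \<and> x \<in> U \<and> (\<forall>y\<in>U. (y, g \<otimes>\<^bsub>G\<^esub> \<kappa> x y) \<in> S)))"

lemma openin_gbundle:
  "openin (gbundle X G \<kappa>) S \<longleftrightarrow> S \<subseteq> topspace X \<times> carrier G \<and>
     (\<forall>x g. (x, g) \<in> S \<longrightarrow> (\<exists>U. openin X U \<and> x \<in> U \<and> (\<forall>y\<in>U. (y, g \<otimes>\<^bsub>G\<^esub> \<kappa> x y) \<in> S)))"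
proof -
  let ?P = "\<lambda>S. S \<subseteq> topspace X \<times> carrier G \<and>
     (\<forall>(x, g)\<in>S. \<exists>U. openin X U \<and> x \<in> U \<and> (\<forall>y\<in>U. (y, g \<otimes>\<^bsub>G\<^esub> \<kappa> x y) \<in> S))"
  have "istopology ?P"
    unfolding istopology_def
  proof (intro conjI allI impI)
    fix S T assume S: "?P S" and T: "?P T"
    show "S \<inter> T \<subseteq> topspace X \<times> carrier G" using S by blast
    show "\<forall>(x, g)\<in>S \<inter> T. \<exists>U. openin X U \<and> x \<in> U \<and> (\<forall>y\<in>U. (y, g \<otimes>\<^bsub>G\<^esub> \<kappa> x y) \<in> S \<inter> T)"
    proof clarify
      fix x g assume "(x, g) \<in> S" "(x, g) \<in> T"
      obtain U where "openin X U" "x \<in> U" "\<forall>y\<in>U. (y, g \<otimes>\<^bsub>G\<^esub> \<kappa> x y) \<in> S"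
        using bspec[OF conjunct2[OF S] \<open>(x, g) \<in> S\<close>] by auto
      moreover obtain V where "openin X V" "x \<in> V" "\<forall>y\<in>V. (y, g \<otimes>\<^bsub>G\<^esub> \<kappa> x y) \<in> T"
        using bspec[OF conjunct2[OF T] \<open>(x, g) \<in> T\<close>] by auto
      ultimately show "\<exists>U. openin X U \<and> x \<in> U \<and> (\<forall>y\<in>U. (y, g \<otimes>\<^bsub>G\<^esub> \<kappa> x y) \<in> S \<inter> T)"
        by (intro exI[of _ "U \<inter> V"]) auto
    qed
  next
    fix K assume K: "\<forall>S\<in>K. ?P S"
    show "\<Union>K \<subseteq> topspace X \<times> carrier G" using K by blast
    show "\<forall>(x, g)\<in>\<Union>K. \<exists>U. openin X U \<and> x \<in> U \<and> (\<forall>y\<in>U. (y, g \<otimes>\<^bsub>G\<^esub> \<kappa> x y) \<in> \<Union>K)"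
    proof clarify
      fix x g S assume S: "S \<in> K" "(x, g) \<in> S"
      obtain U where "openin X U" "x \<in> U" "\<forall>y\<in>U. (y, g \<otimes>\<^bsub>G\<^esub> \<kappa> x y) \<in> S"
        using bspec[OF conjunct2[OF bspec[OF K S(1)]] S(2)] by auto
      then show "\<exists>U. openin X U \<and> x \<in> U \<and> (\<forall>y\<in>U. (y, g \<otimes>\<^bsub>G\<^esub> \<kappa> x y) \<in> \<Union>K)" using S by blast
    qed
  qed
  then have "openin (gbundle X G \<kappa>) S \<longleftrightarrow> ?P S" unfolding gbundle_def by simp
  then show ?thesis by (simp add: Ball_def)
qed

lemma germ_nhdD:
  assumes c: "germ_cocycle X G \<kappa>" and U: "germ_nhd X G \<kappa> x U" and y: "y \<in> U"
  shows "\<kappa> x y \<in> carrier G"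
    and "\<exists>W. openin X W \<and> y \<in> W \<and> W \<subseteq> U \<and> (\<forall>z\<in>W. \<kappa> y z \<in> carrier G \<and> \<kappa> x z = \<kappa> x y \<otimes>\<^bsub>G\<^esub> \<kappa> y z)"
proof -
  show "\<kappa> x y \<in> carrier G" using U y unfolding germ_nhd_def by blast
  obtain W where W: "openin X W" "y \<in> W" "\<forall>z\<in>W. \<kappa> x z = \<kappa> x y \<otimes>\<^bsub>G\<^esub> \<kappa> y z"
    using U y unfolding germ_nhd_def by blast
  have oU: "openin X U" using U by (simp add: germ_nhd_def)
  then have "y \<in> topspace X" using y openin_subset by blast
  then obtain V where V: "germ_nhd X G \<kappa> y V" using c unfolding germ_cocycle_def by blast
  then have "openin X V" "y \<in> V" "\<forall>z\<in>V. \<kappa> y z \<in> carrier G" unfolding germ_nhd_def by blast+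
  then show "\<exists>W. openin X W \<and> y \<in> W \<and> W \<subseteq> U \<and> (\<forall>z\<in>W. \<kappa> y z \<in> carrier G \<and> \<kappa> x z = \<kappa> x y \<otimes>\<^bsub>G\<^esub> \<kappa> y z)"
    using W oU y by (intro exI[of _ "W \<inter> V \<inter> U"] conjI openin_Int) blast+
qed

text \<open>With all three points equal, the cocycle identity makes \<open>\<kappa> x x\<close>
  idempotent.\<close>

lemma germ_cocycle_diag:
  fixes G (structure)
  assumes "group G" and c: "germ_cocycle X G \<kappa>" and x: "x \<in> topspace X"
  shows "\<kappa> x x = \<one>\<^bsub>G\<^esub>"
proof -
  interpret group G by fact
  obtain U where U: "germ_nhd X G \<kappa> x U" using c x unfolding germ_cocycle_def by blast
  have xU: "x \<in> U" using U by (simp add: germ_nhd_def)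
  have "\<kappa> x x = \<kappa> x x \<otimes> \<kappa> x x" using germ_nhdD(2)[OF c U xU] by blast
  then show ?thesis using germ_nhdD(1)[OF c U xU] r_cancel_one' by metis
qed

lemma topspace_gbundle [simp]:
  fixes G (structure)
  assumes "group G" and c: "germ_cocycle X G \<kappa>"
  shows "topspace (gbundle X G \<kappa>) = topspace X \<times> carrier G"
proof -
  interpret group G by fact
  have "openin (gbundle X G \<kappa>) (topspace X \<times> carrier G)"
    unfolding openin_gbundle
  proof (intro conjI allI impI)
    fix x g assume xg: "(x, g) \<in> topspace X \<times> carrier G"
    then obtain U where U: "germ_nhd X G \<kappa> x U" using c unfolding germ_cocycle_def by blast
    then have "openin X U" "x \<in> U" "\<forall>y\<in>U. \<kappa> x y \<in> carrier G" unfolding germ_nhd_def by blast+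
    then show "\<exists>U. openin X U \<and> x \<in> U \<and> (\<forall>y\<in>U. (y, g \<otimes> \<kappa> x y) \<in> topspace X \<times> carrier G)"
      using xg openin_subset by (intro exI[of _ U]) fastforce
  qed simp
  then show ?thesis
    by (metis openin_gbundle openin_subset openin_topspace subset_antisym)
qed

text \<open>By the cocycle identity the sheet through a point
  \<open>(y, g \<otimes> \<kappa> x y)\<close> coincides near \<open>y\<close> with the sheet
  through \<open>(x, g)\<close>.\<close>

lemma openin_sheet:
  fixes G (structure)
  assumes "group G" and c: "germ_cocycle X G \<kappa>" and U: "germ_nhd X G \<kappa> x U" and g: "g \<in> carrier G"
  shows "openin (gbundle X G \<kappa>) ((\<lambda>y. (y, g \<otimes>\<^bsub>G\<^esub> \<kappa> x y)) ` U)"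
  unfolding openin_gbundle
proof (intro conjI allI impI)
  interpret group G by fact
  have oU: "U \<subseteq> topspace X" using U openin_subset unfolding germ_nhd_def by blast
  show "(\<lambda>y. (y, g \<otimes> \<kappa> x y)) ` U \<subseteq> topspace X \<times> carrier G"
    using oU germ_nhdD(1)[OF c U] g by auto
  fix y h assume "(y, h) \<in> (\<lambda>y. (y, g \<otimes> \<kappa> x y)) ` U"
  then have y: "y \<in> U" "h = g \<otimes> \<kappa> x y" by auto
  obtain W where W: "openin X W" "y \<in> W" "W \<subseteq> U"
    "\<forall>z\<in>W. \<kappa> y z \<in> carrier G \<and> \<kappa> x z = \<kappa> x y \<otimes> \<kappa> y z" using germ_nhdD(2)[OF c U y(1)] by blast
  have "(z, h \<otimes> \<kappa> y z) \<in> (\<lambda>y. (y, g \<otimes> \<kappa> x y)) ` U" if z: "z \<in> W" for z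
  proof -
    have "\<kappa> y z \<in> carrier G" "\<kappa> x z = \<kappa> x y \<otimes> \<kappa> y z" using W(4) z by blast+
    then have "h \<otimes> \<kappa> y z = g \<otimes> \<kappa> x z" using y(2) g germ_nhdD(1)[OF c U y(1)] by (simp only: m_assoc)
    then show ?thesis using z W(3) by (intro image_eqI[of _ _ z]) auto
  qed
  then show "\<exists>V. openin X V \<and> y \<in> V \<and> (\<forall>z\<in>V. (z, h \<otimes> \<kappa> y z) \<in> (\<lambda>y. (y, g \<otimes> \<kappa> x y)) ` U)"
    using W by blast
qed

lemma continuous_map_sheet:
  fixes G (structure)
  assumes "group G" and c: "germ_cocycle X G \<kappa>" and U: "germ_nhd X G \<kappa> x U" and g: "g \<in> carrier G"
  shows "continuous_map (subtopology X U) (gbundle X G \<kappa>) (\<lambda>y. (y, g \<otimes>\<^bsub>G\<^esub> \<kappa> x y))"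
  unfolding continuous_map_def
proof (intro conjI allI impI)
  interpret group G by fact
  have oU: "openin X U" "U \<subseteq> topspace X" using U openin_subset unfolding germ_nhd_def by blast+
  have tU: "topspace (subtopology X U) = U" using oU by auto
  show "(\<lambda>y. (y, g \<otimes> \<kappa> x y)) \<in> topspace (subtopology X U) \<rightarrow> topspace (gbundle X G \<kappa>)"
    using oU germ_nhdD(1)[OF c U] g assms(1) c by auto
  fix S assume S: "openin (gbundle X G \<kappa>) S"
  have "openin X {y \<in> U. (y, g \<otimes> \<kappa> x y) \<in> S}"
  proof (subst openin_subopen, intro ballI)
    fix y assume y: "y \<in> {y \<in> U. (y, g \<otimes> \<kappa> x y) \<in> S}"
    then have yU: "y \<in> U" by simp
    obtain V where V: "openin X V" "y \<in> V" "\<forall>z\<in>V. (z, g \<otimes> \<kappa> x y \<otimes> \<kappa> y z) \<in> S"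
      using S y unfolding openin_gbundle by blast
    obtain W where W: "openin X W" "y \<in> W" "W \<subseteq> U"
      "\<forall>z\<in>W. \<kappa> y z \<in> carrier G \<and> \<kappa> x z = \<kappa> x y \<otimes> \<kappa> y z" using germ_nhdD(2)[OF c U yU] by blast
    have "(z, g \<otimes> \<kappa> x z) \<in> S" if "z \<in> V \<inter> W" for z
    proof -
      have k: "\<kappa> y z \<in> carrier G" "\<kappa> x z = \<kappa> x y \<otimes> \<kappa> y z" using W(4) that by blast+
      have "g \<otimes> \<kappa> x z = g \<otimes> \<kappa> x y \<otimes> \<kappa> y z"
        unfolding k(2) using m_assoc[OF g germ_nhdD(1)[OF c U yU] k(1)] by simp
      moreover have "(z, g \<otimes> \<kappa> x y \<otimes> \<kappa> y z) \<in> S" using V(3) that by blast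
      ultimately show ?thesis by simp
    qed
    then have "V \<inter> W \<subseteq> {y \<in> U. (y, g \<otimes> \<kappa> x y) \<in> S}" using W(3) by blast
    then show "\<exists>T. openin X T \<and> y \<in> T \<and> T \<subseteq> {y \<in> U. (y, g \<otimes> \<kappa> x y) \<in> S}"
      using openin_Int[OF V(1) W(1)] V(2) W(2) by blast
  qed
  then show "openin (subtopology X U) {y \<in> topspace (subtopology X U). (y, g \<otimes> \<kappa> x y) \<in> S}"
    unfolding tU openin_subtopology by (intro exI[of _ "{y \<in> U. (y, g \<otimes> \<kappa> x y) \<in> S}"]) auto
qed

text \<open>The factor \<open>snd e \<otimes> inv \<kappa> x (fst e)\<close> is the coordinate over
  the centre \<open>x\<close> of the sheet through \<open>e\<close>. It is constant along the sheet,
  whence the last clause of \<open>trivializing\<close>.\<close>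

lemma gbundle_trivializing:
  fixes G (structure)
  assumes "group G" and c: "germ_cocycle X G \<kappa>" and U: "germ_nhd X G \<kappa> x U"
  shows "trivializing (gbundle X G \<kappa>) X fst U
    (\<lambda>e y. (y, snd e \<otimes>\<^bsub>G\<^esub> inv\<^bsub>G\<^esub> \<kappa> x (fst e) \<otimes>\<^bsub>G\<^esub> \<kappa> x y))"
  unfolding trivializing_def
proof (intro conjI ballI impI)
  interpret group G by fact
  show "openin X U" using U by (simp add: germ_nhd_def)
  fix e assume e: "e \<in> topspace (gbundle X G \<kappa>)" "fst e \<in> U"
  have k: "\<kappa> x y \<in> carrier G" if "y \<in> U" for y using germ_nhdD(1)[OF c U that] .
  have g: "snd e \<in> carrier G" "snd e \<otimes> inv \<kappa> x (fst e) \<in> carrier G"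
    using e k assms(1) c by (auto simp: mem_Times_iff)
  show "continuous_map (subtopology X U) (gbundle X G \<kappa>) (\<lambda>y. (y, snd e \<otimes> inv \<kappa> x (fst e) \<otimes> \<kappa> x y))"
    by (rule continuous_map_sheet[OF assms g(2)])
  show "openin (gbundle X G \<kappa>) ((\<lambda>y. (y, snd e \<otimes> inv \<kappa> x (fst e) \<otimes> \<kappa> x y)) ` U)"
    by (rule openin_sheet[OF assms g(2)])
  show "(fst e, snd e \<otimes> inv \<kappa> x (fst e) \<otimes> \<kappa> x (fst e)) = e"
    using g k[OF e(2)] by (simp add: m_assoc prod_eq_iff)
  show "(\<lambda>ya. (ya, snd (y, snd e \<otimes> inv \<kappa> x (fst e) \<otimes> \<kappa> x y) \<otimes>
      inv \<kappa> x (fst (y, snd e \<otimes> inv \<kappa> x (fst e) \<otimes> \<kappa> x y)) \<otimes> \<kappa> x ya)) =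
    (\<lambda>y. (y, snd e \<otimes> inv \<kappa> x (fst e) \<otimes> \<kappa> x y))" if "y \<in> U" for y
    using g k[OF that] k[OF e(2)] by (simp add: m_assoc)
qed simp

lemma gbundle_covering:
  fixes G (structure)
  assumes "group G" and c: "germ_cocycle X G \<kappa>"
  shows "covering_map (gbundle X G \<kappa>) X fst"
proof (rule covering_mapI)
  interpret group G by fact
  show "continuous_map (gbundle X G \<kappa>) X fst"
    unfolding continuous_map_def
  proof (intro conjI allI impI)
    fix V assume V: "openin X V"
    show "openin (gbundle X G \<kappa>) {e \<in> topspace (gbundle X G \<kappa>). fst e \<in> V}"
      unfolding openin_gbundle
    proof (intro conjI allI impI)
      fix x g assume xg: "(x, g) \<in> {e \<in> topspace (gbundle X G \<kappa>). fst e \<in> V}"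
      then have xg': "x \<in> topspace X" "g \<in> carrier G" "x \<in> V" using assms by auto
      then obtain U where U: "germ_nhd X G \<kappa> x U" using c unfolding germ_cocycle_def by blast
      then have oU: "openin X U" "x \<in> U" "U \<subseteq> topspace X"
        using openin_subset unfolding germ_nhd_def by blast+
      then show "\<exists>U. openin X U \<and> x \<in> U \<and> (\<forall>y\<in>U. (y, g \<otimes> \<kappa> x y) \<in> {e \<in> topspace (gbundle X G \<kappa>). fst e \<in> V})"
        using V xg' germ_nhdD(1)[OF c U] assms by (intro exI[of _ "U \<inter> V"]) auto
    qed (use assms in auto)
  qed (use assms in auto)
  show "fst ` topspace (gbundle X G \<kappa>) = topspace X" using assms by (simp add: ex_in_conv[symmetric]) blast
  show "\<exists>U sec. x \<in> U \<and> trivializing (gbundle X G \<kappa>) X fst U sec" if x: "x \<in> topspace X" for x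
  proof -
    obtain U where U: "germ_nhd X G \<kappa> x U" using c x unfolding germ_cocycle_def by blast
    then have "x \<in> U" by (simp add: germ_nhd_def)
    then show ?thesis using gbundle_trivializing[OF assms U] by blast
  qed
qed

lemma germ_cocycle_pullback:
  assumes c: "germ_cocycle X G \<kappa>" and f: "continuous_map Y X f"
  shows "germ_cocycle Y G (\<lambda>x y. \<kappa> (f x) (f y))"
  unfolding germ_cocycle_def
proof
  fix x assume x: "x \<in> topspace Y"
  then have "f x \<in> topspace X" using f by (auto simp: continuous_map_def)
  then obtain U where U: "germ_nhd X G \<kappa> (f x) U" using c unfolding germ_cocycle_def by blast
  have pre: "openin Y {y \<in> topspace Y. f y \<in> V}" if "openin X V" for V
    by (rule openin_continuous_map_preimage[OF f that])
  have "germ_nhd Y G (\<lambda>x y. \<kappa> (f x) (f y)) x {y \<in> topspace Y. f y \<in> U}"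
    unfolding germ_nhd_def
  proof (intro conjI ballI)
    show "openin Y {y \<in> topspace Y. f y \<in> U}" using U pre unfolding germ_nhd_def by blast
    show "x \<in> {y \<in> topspace Y. f y \<in> U}" using U x unfolding germ_nhd_def by blast
    fix y assume y: "y \<in> {y \<in> topspace Y. f y \<in> U}"
    then show "\<kappa> (f x) (f y) \<in> carrier G" using germ_nhdD(1)[OF c U] by blast
    obtain W where W: "openin X W" "f y \<in> W" "\<forall>z\<in>W. \<kappa> (f x) z = \<kappa> (f x) (f y) \<otimes>\<^bsub>G\<^esub> \<kappa> (f y) z"
      using y germ_nhdD(2)[OF c U, of "f y"] by blast
    show "\<exists>V. openin Y V \<and> y \<in> V \<and> (\<forall>z\<in>V. \<kappa> (f x) (f z) = \<kappa> (f x) (f y) \<otimes>\<^bsub>G\<^esub> \<kappa> (f y) (f z))"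
    proof (intro exI[of _ "{y \<in> topspace Y. f y \<in> W}"] conjI)
      show "openin Y {y \<in> topspace Y. f y \<in> W}" by (rule pre[OF W(1)])
    qed (use W(2,3) y in blast)+
  qed
  then show "\<exists>U. germ_nhd Y G (\<lambda>x y. \<kappa> (f x) (f y)) x U" by blast
qed

lemma continuous_map_gbundle_pullback:
  fixes G (structure)
  assumes "group G" and c: "germ_cocycle X G \<kappa>" and f: "continuous_map Y X f"
  shows "continuous_map (gbundle Y G (\<lambda>x y. \<kappa> (f x) (f y))) (gbundle X G \<kappa>) (\<lambda>e. (f (fst e), snd e))"
  unfolding continuous_map_def
proof (intro conjI allI impI)
  note c' = germ_cocycle_pullback[OF c f]
  have fX: "f y \<in> topspace X" if "y \<in> topspace Y" for y using f that by (auto simp: continuous_map_def)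
  show "(\<lambda>e. (f (fst e), snd e)) \<in> topspace (gbundle Y G (\<lambda>x y. \<kappa> (f x) (f y))) \<rightarrow> topspace (gbundle X G \<kappa>)"
    using assms(1) c c' fX by auto
  fix S assume S: "openin (gbundle X G \<kappa>) S"
  have loc: "\<exists>U. openin Y U \<and> x \<in> U \<and> (\<forall>y\<in>U. y \<in> topspace Y \<and> (f y, g \<otimes>\<^bsub>G\<^esub> \<kappa> (f x) (f y)) \<in> S)"
    if x: "x \<in> topspace Y" "(f x, g) \<in> S" for x g
  proof -
    obtain V where V: "openin X V" "f x \<in> V" "\<forall>y\<in>V. (y, g \<otimes>\<^bsub>G\<^esub> \<kappa> (f x) y) \<in> S"
      using S x unfolding openin_gbundle by blast
    then show ?thesis using openin_continuous_map_preimage[OF f V(1)] x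
      by (intro exI[of _ "{y \<in> topspace Y. f y \<in> V}"]) auto
  qed
  have "S \<subseteq> topspace X \<times> carrier G" using S unfolding openin_gbundle by blast
  show "openin (gbundle Y G (\<lambda>x y. \<kappa> (f x) (f y)))
      {e \<in> topspace (gbundle Y G (\<lambda>x y. \<kappa> (f x) (f y))). (f (fst e), snd e) \<in> S}"
    unfolding openin_gbundle topspace_gbundle[OF assms(1) c']
  proof (intro conjI allI impI)
    fix x g assume "(x, g) \<in> {e \<in> topspace Y \<times> carrier G. (f (fst e), snd e) \<in> S}"
    then have x: "x \<in> topspace Y" "(f x, g) \<in> S" by auto
    obtain U where U: "openin Y U" "x \<in> U" "\<forall>y\<in>U. y \<in> topspace Y \<and> (f y, g \<otimes> \<kappa> (f x) (f y)) \<in> S"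
      using loc[OF x] by blast
    then have "\<forall>y\<in>U. g \<otimes> \<kappa> (f x) (f y) \<in> carrier G"
      using \<open>S \<subseteq> topspace X \<times> carrier G\<close> by blast
    then show "\<exists>U. openin Y U \<and> x \<in> U \<and>
        (\<forall>y\<in>U. (y, g \<otimes> \<kappa> (f x) (f y)) \<in> {e \<in> topspace Y \<times> carrier G. (f (fst e), snd e) \<in> S})"
      using U by (intro exI[of _ U]) simp
  qed blast
qed

text \<open>The inverse map forgets the redundant point of \<open>X\<close>. For its continuity,
  \<open>V\<close> times a sheet over \<open>U\<close> is cut with the fibre product: there the
  fibre coordinate over \<open>y'\<close> is forced to be
  \<open>g \<otimes> \<kappa> (f y) (f y')\<close>.\<close>

lemma gbundle_pullback_equiv:
  fixes G (structure)
  assumes "group G" and c: "germ_cocycle X G \<kappa>" and f: "continuous_map Y X f"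
  shows "cover_equiv (gbundle Y G (\<lambda>x y. \<kappa> (f x) (f y)), fst) (pullback_cover Y f (gbundle X G \<kappa>, fst))"
proof -
  interpret group G by fact
  note c' = germ_cocycle_pullback[OF c f]
  let ?E = "gbundle Y G (\<lambda>x y. \<kappa> (f x) (f y))"
  let ?P = "subtopology (prod_topology Y (gbundle X G \<kappa>)) {(x, e). f x = fst e}"
  have fX: "f y \<in> topspace X" if "y \<in> topspace Y" for y using f that by (auto simp: continuous_map_def)
  have tE: "topspace ?E = topspace Y \<times> carrier G" using topspace_gbundle[OF assms(1) c'] .
  have tP: "topspace ?P = {(y, e). y \<in> topspace Y \<and> e \<in> topspace X \<times> carrier G \<and> f y = fst e}"
    using topspace_gbundle[OF assms(1) c] by auto
  have "continuous_map ?E ?P (\<lambda>e. (fst e, (f (fst e), snd e)))"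
    by (intro continuous_map_into_subtopology continuous_map_pairedI
        continuous_map_gbundle_pullback[OF assms] covering_map_continuous[OF gbundle_covering[OF assms(1) c']]) auto
  moreover have "continuous_map ?P ?E (\<lambda>z. (fst z, snd (snd z)))"
    unfolding continuous_map_def
  proof (intro conjI allI impI)
    show "(\<lambda>z. (fst z, snd (snd z))) \<in> topspace ?P \<rightarrow> topspace ?E" unfolding tE tP by auto
    fix S assume S: "openin ?E S"
    show "openin ?P {z \<in> topspace ?P. (fst z, snd (snd z)) \<in> S}"
    proof (subst openin_subopen, intro ballI)
      fix z assume "z \<in> {z \<in> topspace ?P. (fst z, snd (snd z)) \<in> S}"
      then obtain y g where z: "z = (y, (f y, g))" "y \<in> topspace Y" "g \<in> carrier G" "(y, g) \<in> S"
        unfolding tP by auto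
      obtain U where U: "germ_nhd X G \<kappa> (f y) U" using c fX[OF z(2)] unfolding germ_cocycle_def by blast
      have Uy: "f y \<in> U" using U by (simp add: germ_nhd_def)
      obtain V where V: "openin Y V" "y \<in> V" "\<forall>y'\<in>V. (y', g \<otimes> \<kappa> (f y) (f y')) \<in> S"
        using S z unfolding openin_gbundle by blast
      let ?B = "V \<times> (\<lambda>y'. (y', g \<otimes> \<kappa> (f y) y')) ` U"
      have "openin (prod_topology Y (gbundle X G \<kappa>)) ?B"
        using V(1) openin_sheet[OF assms(1) c U z(3)] by (simp add: openin_prod_Times_iff)
      then have "openin ?P (?B \<inter> {(x, e). f x = fst e})" by (rule openin_subtopology_Int)
      moreover have "\<kappa> (f y) (f y) = \<one>" by (rule germ_cocycle_diag[OF assms(1) c fX[OF z(2)]])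
      then have "(f y, g) \<in> (\<lambda>y'. (y', g \<otimes> \<kappa> (f y) y')) ` U" using Uy z(3) by (intro image_eqI[of _ _ "f y"]) auto
      then have "z \<in> ?B \<inter> {(x, e). f x = fst e}" using z V(2) by auto
      moreover have "?B \<inter> {(x, e). f x = fst e} \<subseteq> {z \<in> topspace ?P. (fst z, snd (snd z)) \<in> S}"
      proof
        fix w assume w: "w \<in> ?B \<inter> {(x, e). f x = fst e}"
        then have "w \<in> topspace ?P" using \<open>openin ?P (?B \<inter> {(x, e). f x = fst e})\<close> openin_subset by blast
        moreover have "(fst w, snd (snd w)) \<in> S" using w V(3) by auto
        ultimately show "w \<in> {z \<in> topspace ?P. (fst z, snd (snd z)) \<in> S}" by simp
      qed
      ultimately show "\<exists>T. openin ?P T \<and> z \<in> T \<and> T \<subseteq> {z \<in> topspace ?P. (fst z, snd (snd z)) \<in> S}" by blast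
    qed
  qed
  ultimately have "homeomorphic_maps ?E ?P (\<lambda>e. (fst e, (f (fst e), snd e))) (\<lambda>z. (fst z, snd (snd z)))"
    unfolding homeomorphic_maps_def tP tE by auto
  then have "homeomorphic_map ?E ?P (\<lambda>e. (fst e, (f (fst e), snd e)))" using homeomorphic_maps_map by blast
  then show ?thesis unfolding cover_equiv_def pullback_cover_def by auto
qed

text \<open>Left translations commute with the right multiplications by \<open>\<kappa>\<close> that
  define the sheets.\<close>

lemma homeomorphic_map_gbundle_translation:
  fixes G (structure)
  assumes "group G" and c: "germ_cocycle X G \<kappa>" and h: "h \<in> carrier G"
  shows "homeomorphic_map (gbundle X G \<kappa>) (gbundle X G \<kappa>) (\<lambda>e. (fst e, h \<otimes>\<^bsub>G\<^esub> snd e))"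
proof -
  interpret group G by fact
  have cont: "continuous_map (gbundle X G \<kappa>) (gbundle X G \<kappa>) (\<lambda>e. (fst e, k \<otimes> snd e))"
    if k: "k \<in> carrier G" for k
    unfolding continuous_map_def
  proof (intro conjI allI impI)
    show "(\<lambda>e. (fst e, k \<otimes> snd e)) \<in> topspace (gbundle X G \<kappa>) \<rightarrow> topspace (gbundle X G \<kappa>)"
      using assms(1) c k by auto
    fix S assume S: "openin (gbundle X G \<kappa>) S"
    have "\<exists>U. openin X U \<and> x \<in> U \<and> (\<forall>y\<in>U. y \<in> topspace X \<and> g \<otimes> \<kappa> x y \<in> carrier G \<and> (y, k \<otimes> (g \<otimes> \<kappa> x y)) \<in> S)"
      if x: "x \<in> topspace X" "g \<in> carrier G" "(x, k \<otimes> g) \<in> S" for x g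
    proof -
      obtain V where V: "openin X V" "x \<in> V" "\<forall>y\<in>V. (y, k \<otimes> g \<otimes> \<kappa> x y) \<in> S"
        using S x unfolding openin_gbundle by blast
      obtain U where U: "germ_nhd X G \<kappa> x U" using c x unfolding germ_cocycle_def by blast
      then have oU: "openin X U" "x \<in> U" "U \<subseteq> topspace X" using openin_subset unfolding germ_nhd_def by blast+
      then show ?thesis using V germ_nhdD(1)[OF c U] k x
        by (intro exI[of _ "U \<inter> V"]) (auto simp: m_assoc)
    qed
    then show "openin (gbundle X G \<kappa>) {e \<in> topspace (gbundle X G \<kappa>). (fst e, k \<otimes> snd e) \<in> S}"
      unfolding openin_gbundle topspace_gbundle[OF assms(1) c] by (auto 0 4)
  qed
  have "homeomorphic_maps (gbundle X G \<kappa>) (gbundle X G \<kappa>) (\<lambda>e. (fst e, h \<otimes> snd e)) (\<lambda>e. (fst e, inv h \<otimes> snd e))"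
    unfolding homeomorphic_maps_def using cont[OF h] cont[OF inv_closed[OF h]] h assms(1) c
    by (auto simp: m_assoc[symmetric])
  then show ?thesis using homeomorphic_maps_map by blast
qed

text \<open>Left translations act simply transitively on the fibres. On a connected total space one
  value determines a deck transformation \<open>d\<close>, so \<open>d\<close> is the translation by
  \<open>F d\<close>, the fibre coordinate of the image of \<open>(x0, \<one>)\<close>.\<close>

lemma gbundle_regular_cover:
  fixes G :: "('g, 'm) monoid_scheme" (structure) and X :: "'x topology"
  assumes "group G" and c: "germ_cocycle X G \<kappa>" and con: "connected_space (gbundle X G \<kappa>)"
    and ne: "topspace X \<noteq> {}"
  shows "(gbundle X G \<kappa>, fst) \<in> regular_covers X G"
proof -
  interpret group G by fact
  let ?E = "gbundle X G \<kappa>"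
  let ?D = "deck_transformations (?E, fst :: _ \<times> _ \<Rightarrow> _)"
  have tE: "topspace ?E = topspace X \<times> carrier G" using topspace_gbundle[OF assms(1) c] .
  \<comment> \<open>The restriction is there because deck transformations are extensional
    functions.\<close>
  define tr where "tr h = restrict (\<lambda>e. (fst e, h \<otimes> snd e)) (topspace ?E)" for h
  have tr_app: "tr h (x, g) = (x, h \<otimes> g)" if "x \<in> topspace X" "g \<in> carrier G" for h x g
    using that by (simp add: tr_def tE)
  have trD: "tr h \<in> ?D" if h: "h \<in> carrier G" for h
  proof -
    have "homeomorphic_map ?E ?E (tr h)"
      by (rule homeomorphic_map_eq[OF homeomorphic_map_gbundle_translation[OF assms(1) c h]]) (simp add: tr_def)
    then show ?thesis unfolding deck_transformations_def by (auto simp: tr_def)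
  qed
  obtain x0 where x0: "x0 \<in> topspace X" using ne by blast
  have uniq: "d = d'" if d: "d \<in> ?D" "d' \<in> ?D" and eq: "d e = d' e" "e \<in> topspace ?E" for d d' e
  proof (rule extensionalityI)
    show "d \<in> extensional (topspace ?E)" "d' \<in> extensional (topspace ?E)"
      using d unfolding deck_transformations_def by auto
    have cd: "continuous_map ?E ?E d" "continuous_map ?E ?E d'"
      using d homeomorphic_imp_continuous_map unfolding deck_transformations_def by auto
    show "d y = d' y" if "y \<in> topspace ?E" for y
      by (rule lift_unique[OF gbundle_covering[OF assms(1) c] cd _ con eq(2,1) that])
        (use d in \<open>auto simp: deck_transformations_def\<close>)
  qed
  define F where "F d = snd (d (x0, \<one>))" for d :: "'x \<times> 'g \<Rightarrow> 'x \<times> 'g"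
  have e0: "(x0, \<one>) \<in> topspace ?E" using x0 tE by simp
  have deck: "F d \<in> carrier G \<and> d = tr (F d)" if d: "d \<in> ?D" for d
  proof -
    have "homeomorphic_map ?E ?E d" using d unfolding deck_transformations_def by auto
    then have "d (x0, \<one>) \<in> topspace ?E" using e0 homeomorphic_imp_surjective_map by blast
    then have F: "F d \<in> carrier G" unfolding F_def tE by auto
    have "fst (d (x0, \<one>)) = fst (x0, \<one>)" using d e0 unfolding deck_transformations_def by blast
    then have "d (x0, \<one>) = (x0, F d)" unfolding F_def by (simp add: prod_eq_iff)
    also have "\<dots> = tr (F d) (x0, \<one>)" using tr_app[OF x0 one_closed] F by simp
    finally show ?thesis using uniq[OF d trD[OF F] _ e0] F by blast
  qed
  have FT: "F (tr h) = h" if "h \<in> carrier G" for h using that tr_app[OF x0 one_closed] by (simp add: F_def)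
  have "is_regular (?E, fst :: _ \<times> _ \<Rightarrow> _)"
    unfolding is_regular_def prod.case
  proof (intro ballI impI)
    fix e e' assume e: "e \<in> topspace ?E" "e' \<in> topspace ?E" "fst e = fst e'"
    then have g: "snd e \<in> carrier G" "snd e' \<in> carrier G" "fst e \<in> topspace X" unfolding tE by auto
    have "tr (snd e' \<otimes> inv snd e) (fst e, snd e) = (fst e, snd e' \<otimes> inv snd e \<otimes> snd e)"
      by (rule tr_app[OF g(3) g(1)])
    moreover have "snd e' \<otimes> inv snd e \<otimes> snd e = snd e'" using g by (simp add: m_assoc)
    ultimately have "tr (snd e' \<otimes> inv snd e) e = (fst e, snd e')" by (simp only: prod.collapse)
    then have "tr (snd e' \<otimes> inv snd e) e = e'" using e(3) by (simp add: prod_eq_iff)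
    then show "\<exists>h\<in>?D. h e = e'" using trD[of "snd e' \<otimes> inv snd e"] g by auto
  qed
  moreover have "is_cover X (?E, fst)"
    unfolding is_cover_def using con gbundle_covering[OF assms(1) c] by simp
  moreover have "deck_group (?E, fst :: _ \<times> _ \<Rightarrow> _) \<cong> G"
  proof -
    have carr: "carrier (deck_group (?E, fst :: _ \<times> _ \<Rightarrow> _)) = ?D" by (simp add: deck_group_def)
    have bij: "d \<in> Bij (topspace ?E)" if "d \<in> ?D" for d
      using that homeomorphic_imp_injective_map homeomorphic_imp_surjective_map
      unfolding deck_transformations_def Bij_def bij_betw_def by blast
    have mult: "d \<otimes>\<^bsub>deck_group (?E, fst :: _ \<times> _ \<Rightarrow> _)\<^esub> d' = compose (topspace ?E) d d'"
      if "d \<in> ?D" "d' \<in> ?D" for d d'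
      using bij[OF that(1)] bij[OF that(2)] by (simp add: deck_group_def BijGroup_def)
    have "F (compose (topspace ?E) d d') = F d \<otimes> F d'" if d: "d \<in> ?D" "d' \<in> ?D" for d d'
    proof -
      have "d' (x0, \<one>) = (x0, F d')" using deck[OF d(2)] tr_app[OF x0 one_closed] by (metis r_one)
      moreover have "d (x0, F d') = (x0, F d \<otimes> F d')" using deck[OF d(1)] deck[OF d(2)] tr_app[OF x0] by metis
      ultimately show ?thesis unfolding F_def by (simp add: compose_def e0 F_def[symmetric])
    qed
    then have "F \<in> hom (deck_group (?E, fst :: _ \<times> _ \<Rightarrow> _)) G"
      unfolding hom_def carr using deck mult by auto
    moreover have "bij_betw F ?D (carrier G)"
      by (rule bij_betwI[where g = tr]) (use deck trD FT in auto)
    ultimately have "F \<in> iso (deck_group (?E, fst :: _ \<times> _ \<Rightarrow> _)) G" unfolding iso_def carr by blast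
    then show ?thesis unfolding is_iso_def by blast
  qed
  ultimately show ?thesis unfolding regular_covers_def by blast
qed

section \<open>Separation, compactness and fibre products of bundles\<close>

lemma Hausdorff_space_covering:
  assumes p: "covering_map E X p" and X: "Hausdorff_space X"
  shows "Hausdorff_space E"
  unfolding Hausdorff_space_def
proof (intro allI impI, elim conjE)
  fix e f assume e: "e \<in> topspace E" and f: "f \<in> topspace E" and ne: "e \<noteq> f"
  have c: "continuous_map E X p" using p by (rule covering_map_continuous)
  have pe: "p e \<in> topspace X" "p f \<in> topspace X" using covering_map_in[OF p] e f by blast+
  show "\<exists>U V. openin E U \<and> openin E V \<and> e \<in> U \<and> f \<in> V \<and> disjnt U V"
  proof (cases "p e = p f")
    case False
    then obtain U V where UV: "openin X U" "openin X V" "p e \<in> U" "p f \<in> V" "disjnt U V"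
      using X pe unfolding Hausdorff_space_def by blast
    let ?U = "{x \<in> topspace E. p x \<in> U}" and ?V = "{x \<in> topspace E. p x \<in> V}"
    have "openin E ?U" "openin E ?V" using openin_continuous_map_preimage[OF c] UV by blast+
    moreover have "e \<in> ?U" "f \<in> ?V" "disjnt ?U ?V" using e f UV by (auto simp: disjnt_iff)
    ultimately show ?thesis by blast
  next
    case True
    obtain U sec where U: "p e \<in> U" and t: "trivializing E X p U sec"
      using covering_map_trivializing[OF p pe(1)] by blast
    have U': "p f \<in> U" using U True by simp
    have "openin E (sec e ` U)" "openin E (sec f ` U)"
      using trivializingD(5)[OF t e U] trivializingD(5)[OF t f U'] .
    moreover have se: "sec e (p e) = e" "sec f (p f) = f"
      using trivializingD(4)[OF t e U] trivializingD(4)[OF t f U'] .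
    then have "e \<in> sec e ` U" "f \<in> sec f ` U" using U U' image_eqI by metis+
    moreover have "disjnt (sec e ` U) (sec f ` U)"
    proof (rule ccontr)
      assume "\<not> disjnt (sec e ` U) (sec f ` U)"
      then have "sec e = sec f" using trivializing_disjoint[OF t e U f U'] by (simp add: disjnt_def)
      then show False using se True ne by metis
    qed
    ultimately show ?thesis by blast
  qed
qed

text \<open>A tube argument: one member of the open cover for each \<open>g\<close> contains the
  pieces of the sheets through the fibre over \<open>x\<close>. Right multiplication by
  \<open>\<kappa> x y\<close> permutes \<open>G\<close>, so these finitely many pieces exhaust the
  fibre over every nearby \<open>y\<close>.\<close>

lemma compact_space_gbundle:
  fixes G (structure)
  assumes "group G" and c: "germ_cocycle X G \<kappa>" and fin: "finite (carrier G)" and X: "compact_space X"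
  shows "compact_space (gbundle X G \<kappa>)"
  unfolding compact_space_alt
proof (intro allI impI, elim conjE)
  interpret group G by fact
  let ?E = "gbundle X G \<kappa>"
  have tE: "topspace ?E = topspace X \<times> carrier G" using topspace_gbundle[OF assms(1) c] .
  fix \<U> assume op: "\<forall>U\<in>\<U>. openin ?E U" and cov: "topspace ?E \<subseteq> \<Union>\<U>"
  have ex: "\<exists>U \<F>. openin X U \<and> x \<in> U \<and> finite \<F> \<and> \<F> \<subseteq> \<U> \<and> U \<times> carrier G \<subseteq> \<Union>\<F>"
    if x: "x \<in> topspace X" for x
  proof -
    have "\<forall>g\<in>carrier G. \<exists>S U. S \<in> \<U> \<and> openin X U \<and> x \<in> U \<and> (\<forall>y\<in>U. (y, g \<otimes> \<kappa> x y) \<in> S)"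
    proof
      fix g assume g: "g \<in> carrier G"
      then obtain S where S: "S \<in> \<U>" "(x, g) \<in> S" using cov x tE by blast
      then have "openin ?E S" using op by blast
      then show "\<exists>S U. S \<in> \<U> \<and> openin X U \<and> x \<in> U \<and> (\<forall>y\<in>U. (y, g \<otimes> \<kappa> x y) \<in> S)"
        using S unfolding openin_gbundle by blast
    qed
    then obtain S U where SU: "\<And>g. g \<in> carrier G \<Longrightarrow> S g \<in> \<U> \<and> openin X (U g) \<and> x \<in> U g \<and> (\<forall>y\<in>U g. (y, g \<otimes> \<kappa> x y) \<in> S g)"
      by metis
    obtain V where V: "germ_nhd X G \<kappa> x V" using c x unfolding germ_cocycle_def by blast
    let ?U = "V \<inter> \<Inter>(U ` carrier G)"
    have "openin X (\<Inter>(U ` carrier G))"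
      using SU fin one_closed by (intro openin_Inter) auto
    then have "openin X ?U" using V unfolding germ_nhd_def by blast
    moreover have "x \<in> ?U" using V SU unfolding germ_nhd_def by auto
    moreover have "?U \<times> carrier G \<subseteq> \<Union>(S ` carrier G)"
    proof
      fix z assume "z \<in> ?U \<times> carrier G"
      then obtain y g where z: "z = (y, g)" "y \<in> ?U" "g \<in> carrier G" by blast
      have k: "\<kappa> x y \<in> carrier G" using germ_nhdD(1)[OF c V] z by blast
      let ?h = "g \<otimes> inv \<kappa> x y"
      have h: "?h \<in> carrier G" "?h \<otimes> \<kappa> x y = g" using k z by (simp_all add: m_assoc)
      have "y \<in> U ?h" using z(2) h(1) by blast
      then have "(y, ?h \<otimes> \<kappa> x y) \<in> S ?h" using SU[OF h(1)] by blast
      then have "z \<in> S ?h" using h(2) z(1) by simp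
      then show "z \<in> \<Union>(S ` carrier G)" using h(1) by blast
    qed
    moreover have "finite (S ` carrier G)" "S ` carrier G \<subseteq> \<U>" using fin SU by auto
    ultimately show ?thesis by blast
  qed
  then obtain U \<F> where UF: "\<And>x. x \<in> topspace X \<Longrightarrow> openin X (U x) \<and> x \<in> U x \<and> finite (\<F> x) \<and> \<F> x \<subseteq> \<U> \<and> U x \<times> carrier G \<subseteq> \<Union>(\<F> x)"
    by metis
  have "(\<forall>V\<in>U ` topspace X. openin X V) \<and> topspace X \<subseteq> \<Union>(U ` topspace X)" using UF by blast
  then obtain \<K> where K: "finite \<K>" "\<K> \<subseteq> U ` topspace X" "topspace X \<subseteq> \<Union>\<K>"
    using X unfolding compact_space_alt by meson
  obtain C where C: "C \<subseteq> topspace X" "finite C" "\<K> = U ` C" using finite_subset_image[OF K(1,2)] by blast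
  have "topspace ?E \<subseteq> \<Union>(\<Union>(\<F> ` C))"
  proof
    fix z assume z: "z \<in> topspace ?E"
    then obtain x where x: "x \<in> C" "fst z \<in> U x" using K C tE by auto
    have "z \<in> U x \<times> carrier G" using z x tE by auto
    moreover have "U x \<times> carrier G \<subseteq> \<Union>(\<F> x)" using UF C x by blast
    ultimately show "z \<in> \<Union>(\<Union>(\<F> ` C))" using x(1) by blast
  qed
  moreover have "finite (\<Union>(\<F> ` C))" using C UF by blast
  moreover have "\<Union>(\<F> ` C) \<subseteq> \<U>" using C UF by blast
  ultimately show "\<exists>\<F>. finite \<F> \<and> \<F> \<subseteq> \<U> \<and> topspace ?E \<subseteq> \<Union>\<F>" by blast
qed

text \<open>The bundle of the paired cocycle is the fibre product of the two bundles; it will carry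
  the graph of an equivalence between them.\<close>

lemma germ_cocycle_DirProd:
  fixes G (structure)
  assumes c: "germ_cocycle X G \<kappa>" and d: "germ_cocycle X G \<mu>"
  shows "germ_cocycle X (G \<times>\<times> G) (\<lambda>x y. (\<kappa> x y, \<mu> x y))"
  unfolding germ_cocycle_def
proof
  fix x assume x: "x \<in> topspace X"
  obtain U V where U: "germ_nhd X G \<kappa> x U" and V: "germ_nhd X G \<mu> x V"
    using x c d unfolding germ_cocycle_def by blast
  have "germ_nhd X (G \<times>\<times> G) (\<lambda>x y. (\<kappa> x y, \<mu> x y)) x (U \<inter> V)"
    unfolding germ_nhd_def
  proof (intro conjI ballI)
    show "openin X (U \<inter> V)" "x \<in> U \<inter> V" using U V unfolding germ_nhd_def by auto
    fix y assume y: "y \<in> U \<inter> V"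
    then show "(\<kappa> x y, \<mu> x y) \<in> carrier (G \<times>\<times> G)" using germ_nhdD(1)[OF c U] germ_nhdD(1)[OF d V] by auto
    obtain W where W: "openin X W" "y \<in> W" "\<forall>z\<in>W. \<kappa> y z \<in> carrier G \<and> \<kappa> x z = \<kappa> x y \<otimes> \<kappa> y z"
      using germ_nhdD(2)[OF c U] y by blast
    obtain W' where W': "openin X W'" "y \<in> W'" "\<forall>z\<in>W'. \<mu> y z \<in> carrier G \<and> \<mu> x z = \<mu> x y \<otimes> \<mu> y z"
      using germ_nhdD(2)[OF d V] y by blast
    have "(\<kappa> x z, \<mu> x z) = (\<kappa> x y, \<mu> x y) \<otimes>\<^bsub>G \<times>\<times> G\<^esub> (\<kappa> y z, \<mu> y z)" if "z \<in> W \<inter> W'" for z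
    proof -
      have "\<kappa> x z = \<kappa> x y \<otimes> \<kappa> y z" "\<mu> x z = \<mu> x y \<otimes> \<mu> y z" using that W(3) W'(3) by blast+
      then show ?thesis unfolding mult_DirProd by (rule arg_cong2)
    qed
    then show "\<exists>W. openin X W \<and> y \<in> W \<and>
        (\<forall>z\<in>W. (\<kappa> x z, \<mu> x z) = (\<kappa> x y, \<mu> x y) \<otimes>\<^bsub>G \<times>\<times> G\<^esub> (\<kappa> y z, \<mu> y z))"
      using openin_Int[OF W(1) W'(1)] W(2) W'(2) by (intro exI[of _ "W \<inter> W'"]) blast
  qed
  then show "\<exists>U. germ_nhd X (G \<times>\<times> G) (\<lambda>x y. (\<kappa> x y, \<mu> x y)) x U" by blast
qed

section \<open>Monodromy\<close>

text \<open>The homotopy may leave \<open>V\<close>. Loops at the centre \<open>x\<close> are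
  enough, since only paths that start at \<open>x\<close> will be compared.\<close>

definition small_loops_null :: "'x topology \<Rightarrow> 'x set \<Rightarrow> 'x \<Rightarrow> bool" where
  "small_loops_null X V x \<longleftrightarrow>
     (\<forall>p. pathin X p \<and> p ` {0..1} \<subseteq> V \<and> p 0 = x \<and> p 1 = x \<longrightarrow> path_homotopic X x x p (\<lambda>_. x))"

definition semilocally_simply_connected :: "'x topology \<Rightarrow> bool" where
  "semilocally_simply_connected X \<longleftrightarrow>
     (\<forall>x\<in>topspace X. \<exists>V. openin X V \<and> x \<in> V \<and> small_loops_null X V x)"

text \<open>Sheets multiply on the right and translations act on the left. Hence the ends of lifts
  multiply in the order of the loops, and monodromy is a homomorphism rather than an
  antihomomorphism.\<close>

definition has_monodromy ::
  "'x topology \<Rightarrow> ('g, 'm) monoid_scheme \<Rightarrow> ('x \<Rightarrow> 'x \<Rightarrow> 'g) \<Rightarrow> 'x \<Rightarrow> ((real \<Rightarrow> 'x) set \<Rightarrow> 'g) \<Rightarrow> bool" where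
  "has_monodromy X G \<kappa> a \<phi> \<longleftrightarrow> (\<forall>q\<in>loops X a. \<exists>l. pathin (gbundle X G \<kappa>) l \<and> l 0 = (a, \<one>\<^bsub>G\<^esub>) \<and>
     l 1 = (a, \<phi> (loop_class X a q)) \<and> (\<forall>t\<in>{0..1}. fst (l t) = q t))"

text \<open>A homomorphism on the fundamental group extends to a functor on paths, by joining all
  points to the base point.\<close>

lemma ex_path_functional:
  fixes G (structure)
  assumes "group G" and \<phi>: "\<phi> \<in> hom (fundamental_group X a) G" and X: "path_connected_space X"
    and a: "a \<in> topspace X"
  obtains F where "\<And>p. pathin X p \<Longrightarrow> F p \<in> carrier G"
    and "\<And>p q. path_homotopic X (p 0) (p 1) p q \<Longrightarrow> F p = F q"
    and "\<And>p q. pathin X p \<Longrightarrow> pathin X q \<Longrightarrow> p 1 = q 0 \<Longrightarrow> F (loop_concat p q) = F p \<otimes> F q"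
    and "\<And>q. q \<in> loops X a \<Longrightarrow> F q = \<phi> (loop_class X a q)"
proof -
  interpret group G by fact
  have "\<exists>w. pathin X w \<and> w 0 = a \<and> w 1 = x" if "x \<in> topspace X" for x
    using X a that unfolding path_connected_space_def by blast
  then obtain w where w: "\<And>x. x \<in> topspace X \<Longrightarrow> pathin X (w x) \<and> w x 0 = a \<and> w x 1 = x" by metis
  \<comment> \<open>At the base point the constant path is taken, so that on loops \<open>F\<close>
    is exactly \<open>\<phi>\<close> of the class and not a conjugate of it.\<close>
  define \<gamma> where "\<gamma> x = (if x = a then (\<lambda>_. a) else w x)" for x
  have \<gamma>: "pathin X (\<gamma> x)" "\<gamma> x 0 = a" "\<gamma> x 1 = x" if "x \<in> topspace X" for x
    using w[OF that] a by (auto simp: \<gamma>_def)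
  define L where "L p = loop_concat (loop_concat (\<gamma> (p 0)) p) (path_rev (\<gamma> (p 1)))" for p
  define F where "F p = \<phi> (loop_class X a (L p))" for p
  have ends: "p 0 \<in> topspace X" "p 1 \<in> topspace X" if "pathin X p" for p
    using pathin_in[OF that] by simp_all
  have Lloop: "L p \<in> loops X a" if p: "pathin X p" for p
    using p \<gamma>[OF ends(1)[OF p]] \<gamma>[OF ends(2)[OF p]]
    by (auto simp: L_def loops_def intro!: pathin_concat pathin_rev)
  have car: "loop_class X a q \<in> carrier (fundamental_group X a)" if "q \<in> loops X a" for q
    using that by (simp add: carrier_fundamental_group)
  have hc: "path_homotopic X (p 0) (p 1) p p" if "pathin X p" for p using that by (simp add: path_homotopic_refl)
  have F1: "F p \<in> carrier G" if "pathin X p" for p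
    using \<phi> car[OF Lloop[OF that]] unfolding F_def hom_def by blast
  have F2: "F p = F q" if h: "path_homotopic X (p 0) (p 1) p q" for p q
  proof -
    note i = path_homotopic_imp[OF h]
    note g = \<gamma>[OF ends(1)[OF i(1)]] \<gamma>[OF ends(2)[OF i(1)]]
    have "path_homotopic X a (p 1) (loop_concat (\<gamma> (p 0)) p) (loop_concat (\<gamma> (p 0)) q)"
      by (rule path_homotopic_concat[OF _ h]) (use g in \<open>auto intro: path_homotopic_refl\<close>)
    moreover have "path_homotopic X (p 1) a (path_rev (\<gamma> (p 1))) (path_rev (\<gamma> (p 1)))"
      using g by (intro path_homotopic_refl pathin_rev) auto
    ultimately have "path_homotopic X a a (L p) (L q)"
      unfolding L_def i(5,6) by (rule path_homotopic_concat)
    then show ?thesis unfolding F_def by (simp add: loop_class_eqI)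
  qed
  have F3: "F (loop_concat p q) = F p \<otimes> F q" if p: "pathin X p" and q: "pathin X q" and pq: "p 1 = q 0" for p q
  proof -
    let ?A = "\<gamma> (p 0)" and ?Y = "\<gamma> (p 1)" and ?Z = "\<gamma> (q 1)"
    note g = \<gamma>[OF ends(1)[OF p]] \<gamma>[OF ends(2)[OF p]] \<gamma>[OF ends(2)[OF q]]
    have pa: "pathin X (loop_concat ?A p)" using g p by (intro pathin_concat) auto
    have pz: "pathin X (loop_concat q (path_rev ?Z))" using g q by (intro pathin_concat pathin_rev) auto
    have py: "pathin X (path_rev ?Y)" "pathin X (path_rev ?Z)" using g by (auto intro: pathin_rev)
    have "F p \<otimes> F q = \<phi> (loop_class X a (loop_concat (L p) (L q)))"
      using hom_mult[OF \<phi> car[OF Lloop[OF p]] car[OF Lloop[OF q]]]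
        fundamental_group_mult[OF Lloop[OF p] Lloop[OF q]] by (simp add: F_def)
    also have "path_homotopic X a a (loop_concat (L p) (L q)) (L (loop_concat p q))"
    proof -
      \<comment> \<open>The product of \<open>L p\<close> and \<open>L q\<close> is regrouped until
        the reverse of \<open>?Y\<close>, at the end of \<open>L p\<close>, meets \<open>?Y\<close>,
        at the start of \<open>L q\<close>, and cancels. The five homotopies are chained at the
        end.\<close>
      have Lq: "L q = loop_concat (loop_concat ?Y q) (path_rev ?Z)" using pq by (simp add: L_def)
      have "path_homotopic X a a (L q) (loop_concat ?Y (loop_concat q (path_rev ?Z)))"
        unfolding Lq using path_homotopic_assoc[of X ?Y q "path_rev ?Z"] g q py pq by simp
      moreover have "path_homotopic X a a (L p) (L p)" using Lloop[OF p] by (auto simp: loops_def intro: path_homotopic_refl)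
      ultimately have 1: "path_homotopic X a a (loop_concat (L p) (L q))
          (loop_concat (L p) (loop_concat ?Y (loop_concat q (path_rev ?Z))))"
        by (rule path_homotopic_concat[rotated])
      have 2: "path_homotopic X a a (loop_concat (loop_concat (L p) ?Y) (loop_concat q (path_rev ?Z)))
          (loop_concat (L p) (loop_concat ?Y (loop_concat q (path_rev ?Z))))"
        using path_homotopic_assoc[of X "L p" ?Y "loop_concat q (path_rev ?Z)"] Lloop[OF p] g pz pq
        by (simp add: loops_def)
      have "path_homotopic X a (p 1) (loop_concat (L p) ?Y) (loop_concat ?A p)"
        using path_homotopic_cancel[of X "loop_concat ?A p" ?Y] pa g by (simp add: L_def)
      moreover have "path_homotopic X (p 1) a (loop_concat q (path_rev ?Z)) (loop_concat q (path_rev ?Z))"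
        using pz pq g by (intro path_homotopic_refl) auto
      ultimately have 3: "path_homotopic X a a (loop_concat (loop_concat (L p) ?Y) (loop_concat q (path_rev ?Z)))
          (loop_concat (loop_concat ?A p) (loop_concat q (path_rev ?Z)))"
        by (rule path_homotopic_concat)
      have 4: "path_homotopic X a a (loop_concat (loop_concat (loop_concat ?A p) q) (path_rev ?Z))
          (loop_concat (loop_concat ?A p) (loop_concat q (path_rev ?Z)))"
        using path_homotopic_assoc[of X "loop_concat ?A p" q "path_rev ?Z"] pa q py pq g by simp
      have "path_homotopic X a (q 1) (loop_concat (loop_concat ?A p) q) (loop_concat ?A (loop_concat p q))"
        using path_homotopic_assoc[of X ?A p q] p q pq g by simp
      moreover have "path_homotopic X (q 1) a (path_rev ?Z) (path_rev ?Z)"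
        using py g by (intro path_homotopic_refl) auto
      ultimately have 5: "path_homotopic X a a (loop_concat (loop_concat (loop_concat ?A p) q) (path_rev ?Z)) (L (loop_concat p q))"
        unfolding L_def loop_concat_ends by (rule path_homotopic_concat)
      show ?thesis using 1 2 3 4 5 path_homotopic_sym path_homotopic_trans by metis
    qed
    then have "loop_class X a (loop_concat (L p) (L q)) = loop_class X a (L (loop_concat p q))"
      by (rule loop_class_eqI)
    finally show ?thesis by (simp add: F_def)
  qed
  have F4: "F q = \<phi> (loop_class X a q)" if q: "q \<in> loops X a" for q
  proof -
    have qp: "pathin X q" "q 0 = a" "q 1 = a" using q by (auto simp: loops_def)
    have Lq: "L q = loop_concat (loop_concat (\<lambda>_. a) q) (path_rev (\<lambda>_. a))" using qp by (simp add: L_def \<gamma>_def)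
    \<comment> \<open>The loop \<open>L q\<close> rests on the first quarter, runs through
      \<open>q\<close> on the second and rests on the last half.\<close>
    define v where "v t = max 0 (min (4 * t - 1) 1)" for t :: real
    have "path_homotopic X (L q 0) (L q 1) (L q) q"
    proof (rule path_homotopic_reparam_path[OF qp(1), of v id])
      show "continuous_on {0..1} v" unfolding v_def by (intro continuous_intros)
      show "L q t = q (v t)" if "t \<in> {0..1}" for t
      proof -
        consider "t \<le> 1/4" | "1/4 < t" "t \<le> 1/2" | "1/2 < t" by linarith
        then show ?thesis
          by cases (use that qp in \<open>simp_all add: Lq loop_concat_def path_rev_def v_def\<close>)
      qed
    qed (auto simp: v_def)
    then have "path_homotopic X a a (L q) q" using qp by (simp add: Lq path_rev_def)
    then show ?thesis unfolding F_def by (simp add: loop_class_eqI)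
  qed
  show ?thesis using that F1 F2 F3 F4 by blast
qed

text \<open>\<open>\<kappa> x y\<close> is \<open>F\<close> of any path from \<open>x\<close> to
  \<open>y\<close> inside a small neighbourhood \<open>V x\<close>; two such paths differ by a loop
  at \<open>x\<close> in \<open>V x\<close>, which is null-homotopic. Appending a path near
  \<open>y\<close> gives the cocycle identity. The lift of a loop \<open>q\<close> has
  \<open>F\<close> of the initial segments of \<open>q\<close> as fibre coordinate.\<close>

lemma ex_cocycle_with_monodromy:
  fixes G (structure)
  assumes "group G" and \<phi>: "\<phi> \<in> hom (fundamental_group X a) G"
    and X: "path_connected_space X" "locally_path_connected_space X" "semilocally_simply_connected X"
    and a: "a \<in> topspace X"
  obtains \<kappa> where "germ_cocycle X G \<kappa>" "has_monodromy X G \<kappa> a \<phi>"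
proof -
  interpret group G by fact
  obtain F where F1: "\<And>p. pathin X p \<Longrightarrow> F p \<in> carrier G"
    and F2: "\<And>p q. path_homotopic X (p 0) (p 1) p q \<Longrightarrow> F p = F q"
    and F3: "\<And>p q. pathin X p \<Longrightarrow> pathin X q \<Longrightarrow> p 1 = q 0 \<Longrightarrow> F (loop_concat p q) = F p \<otimes> F q"
    and F4: "\<And>q. q \<in> loops X a \<Longrightarrow> F q = \<phi> (loop_class X a q)"
    using ex_path_functional[OF assms(1) \<phi> X(1) a] by blast
  \<comment> \<open>A constant path concatenated with itself is literally itself, so its value is
    idempotent.\<close>
  have Fc: "F (\<lambda>_. x) = \<one>" if x: "x \<in> topspace X" for x
  proof -
    have "loop_concat (\<lambda>_. x) (\<lambda>_. x) = (\<lambda>_. x)" by (simp add: loop_concat_def)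
    then have "F (\<lambda>_. x) = F (\<lambda>_. x) \<otimes> F (\<lambda>_. x)" using F3[of "\<lambda>_. x" "\<lambda>_. x"] x by simp
    then show ?thesis using F1[of "\<lambda>_. x"] x by (metis pathin_const r_cancel_one')
  qed
  have ex: "\<exists>V. openin X V \<and> x \<in> V \<and> path_connectedin X V \<and> small_loops_null X V x"
    if x: "x \<in> topspace X" for x
  proof -
    obtain W where W: "openin X W" "x \<in> W" "small_loops_null X W x"
      using X(3) x unfolding semilocally_simply_connected_def by blast
    obtain V where V: "openin X V" "path_connectedin X V" "x \<in> V" "V \<subseteq> W"
      using X(2)[unfolded locally_path_connected_space] W(1,2) by meson
    have "small_loops_null X V x"
      unfolding small_loops_null_def
    proof (intro allI impI, elim conjE)
      fix p assume p: "pathin X p" "p ` {0..1} \<subseteq> V" "p 0 = x" "p 1 = x"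
      have "p ` {0..1} \<subseteq> W" using p(2) V(4) by (rule subset_trans)
      then show "path_homotopic X x x p (\<lambda>_. x)" using W(3) p unfolding small_loops_null_def by blast
    qed
    then show ?thesis using V by blast
  qed
  then obtain V where V: "\<And>x. x \<in> topspace X \<Longrightarrow> openin X (V x) \<and> x \<in> V x \<and> path_connectedin X (V x)"
    and Vn: "\<And>x. x \<in> topspace X \<Longrightarrow> small_loops_null X (V x) x" by metis
  have Vl: "path_homotopic X x x p (\<lambda>_. x)"
    if "x \<in> topspace X" "pathin X p" "p ` {0..1} \<subseteq> V x" "p 0 = x" "p 1 = x" for x p
    using Vn[OF that(1)] that(2-) unfolding small_loops_null_def by blast
  define P where "P x y p \<longleftrightarrow> pathin X p \<and> p ` {0..1} \<subseteq> V x \<and> p 0 = x \<and> p 1 = y" for x y p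
  have exP: "\<exists>p. pathin X p \<and> p ` {0..1} \<subseteq> W \<and> p 0 = x \<and> p 1 = y"
    if W: "path_connectedin X W" and "x \<in> W" "y \<in> W" for W x y
  proof -
    have "x \<in> topspace (subtopology X W)" "y \<in> topspace (subtopology X W)"
      using that unfolding path_connectedin_def by auto
    then obtain p where "pathin (subtopology X W) p" "p 0 = x" "p 1 = y"
      using W unfolding path_connectedin_def path_connected_space_def by blast
    then show ?thesis unfolding pathin_subtopology by blast
  qed
  define \<kappa> where "\<kappa> x y = F (SOME p. P x y p)" for x y
  have \<kappa>: "\<kappa> x y = F p" if x: "x \<in> topspace X" and p: "P x y p" for x y p
  proof -
    define q where "q = (SOME p. P x y p)"
    have q: "P x y q" unfolding q_def using someI[of "P x y" p] p by blast
    have pq: "pathin X p" "pathin X q" "p 0 = x" "q 0 = x" "p 1 = y" "q 1 = y"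
      "p ` {0..1} \<subseteq> V x" "q ` {0..1} \<subseteq> V x" using p q unfolding P_def by auto
    have rq: "pathin X (path_rev q)" using pq by (simp add: pathin_rev)
    have "loop_concat p (path_rev q) ` {0..1} \<subseteq> V x"
      using pq(7,8) by (auto simp: loop_concat_def path_rev_def image_subset_iff)
    then have "path_homotopic X x x (loop_concat p (path_rev q)) (\<lambda>_. x)"
      using pq rq by (intro Vl[OF x] pathin_concat) auto
    then have "F (loop_concat p (path_rev q)) = \<one>" using F2[of "loop_concat p (path_rev q)" "\<lambda>_. x"] Fc[OF x] pq by simp
    then have 1: "F p \<otimes> F (path_rev q) = \<one>" using F3[OF pq(1) rq] pq by simp
    have "path_homotopic X x x (loop_concat q (path_rev q)) (\<lambda>_. x)" using path_homotopic_rev[OF pq(2)] pq by simp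
    then have "F (loop_concat q (path_rev q)) = \<one>" using F2[of "loop_concat q (path_rev q)" "\<lambda>_. x"] Fc[OF x] pq by simp
    then have 2: "F q \<otimes> F (path_rev q) = \<one>" using F3[OF pq(2) rq] pq by simp
    show ?thesis unfolding \<kappa>_def q_def[symmetric]
      using 1 2 F1[OF pq(1)] F1[OF pq(2)] F1[OF rq] right_cancel by metis
  qed
  have nhd: "germ_nhd X G \<kappa> x (V x)" if x: "x \<in> topspace X" for x
    unfolding germ_nhd_def
  proof (intro conjI ballI)
    show "openin X (V x)" "x \<in> V x" using V[OF x] by auto
    fix y assume y: "y \<in> V x"
    then have yX: "y \<in> topspace X" using V[OF x] openin_subset by blast
    have "path_connectedin X (V x)" "x \<in> V x" using V[OF x] by auto
    then obtain p where p: "P x y p" using exP[of "V x" x y] y unfolding P_def by blast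
    then have pp: "pathin X p" "p ` {0..1} \<subseteq> V x" "p 0 = x" "p 1 = y" unfolding P_def by auto
    show "\<kappa> x y \<in> carrier G" using \<kappa>[OF x p] F1 p unfolding P_def by auto
    have "openin X (V x \<inter> V y)" "y \<in> V x \<inter> V y" using V[OF x] V[OF yX] y by auto
    \<comment> \<open>Paths inside \<open>W\<close> lie in \<open>V x\<close> and in
      \<open>V y\<close>: they compute \<open>\<kappa> y z\<close> and, appended to
      \<open>p\<close>, also \<open>\<kappa> x z\<close>.\<close>
    then obtain W where W: "openin X W" "path_connectedin X W" "y \<in> W" "W \<subseteq> V x \<inter> V y"
      using X(2) unfolding locally_path_connected_space by meson
    have "\<kappa> x z = \<kappa> x y \<otimes> \<kappa> y z" if z: "z \<in> W" for z
    proof -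
      obtain q where q: "pathin X q" "q ` {0..1} \<subseteq> W" "q 0 = y" "q 1 = z" using exP[OF W(2,3) z] by blast
      then have "P y z q" unfolding P_def using W(4) by auto
      moreover have "loop_concat p q ` {0..1} \<subseteq> V x"
        using pp(2) q(2) W(4) by (auto simp: loop_concat_def image_subset_iff)
      then have "P x z (loop_concat p q)" unfolding P_def using pp q by (auto intro: pathin_concat)
      ultimately show ?thesis using \<kappa>[OF x] \<kappa>[OF yX] p F3[OF pp(1) q(1)] pp q by metis
    qed
    then show "\<exists>W. openin X W \<and> y \<in> W \<and> (\<forall>z\<in>W. \<kappa> x z = \<kappa> x y \<otimes> \<kappa> y z)" using W by blast
  qed
  then have c: "germ_cocycle X G \<kappa>" unfolding germ_cocycle_def by blast
  have "has_monodromy X G \<kappa> a \<phi>"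
    unfolding has_monodromy_def
  proof
    fix q assume q: "q \<in> loops X a"
    then have qp: "pathin X q" "q 0 = a" "q 1 = a" by (auto simp: loops_def)
    define l where "l t = (q t, F (path_segment q 0 t))" for t
    have q0: "path_segment q 0 0 = (\<lambda>_. a)" "path_segment q 0 1 = q" using qp by (auto simp: path_segment_def)
    have seg: "F (path_segment q 0 t) = F (path_segment q 0 s) \<otimes> F (path_segment q s t)"
      if st: "s \<in> {0..1}" "t \<in> {0..1}" for s t
    proof -
      have z: "(0::real) \<in> {0..1}" by simp
      have "F (loop_concat (path_segment q 0 s) (path_segment q s t)) = F (path_segment q 0 t)"
        by (rule F2) (use path_homotopic_segments[OF qp(1) z st] in simp)
      then show ?thesis
        using F3[OF pathin_segment[OF qp(1) z st(1)] pathin_segment[OF qp(1) st]] by simp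
    qed
    have "pathin (gbundle X G \<kappa>) l"
      unfolding pathin_def
    proof (rule continuous_map_locally)
      fix s :: real assume "s \<in> topspace (top_of_set {0..1})"
      then have s: "s \<in> {0..1}" by simp
      then have qs: "q s \<in> topspace X" using qp pathin_in by metis
      have oV: "openin X (V (q s))" "q s \<in> V (q s)" using V[OF qs] by auto
      have "openin (top_of_set {0..1}) {t \<in> topspace (top_of_set {0..1}). q t \<in> V (q s)}"
        using openin_continuous_map_preimage[OF qp(1)[unfolded pathin_def] oV(1)] .
      then obtain T where T: "open T" "{t \<in> {0..1}. q t \<in> V (q s)} = {0..1} \<inter> T"
        by (auto simp: openin_open)
      then have "s \<in> T" using s oV by auto
      then obtain \<epsilon> where \<epsilon>: "\<epsilon> > 0" "ball s \<epsilon> \<subseteq> T" using T(1) open_contains_ball by blast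
      have near: "q t \<in> V (q s)" if "t \<in> {0..1} \<inter> ball s \<epsilon>" for t using that T(2) \<epsilon>(2) by blast
      let ?g = "F (path_segment q 0 s)"
      have gG: "?g \<in> carrier G" using F1 pathin_segment[OF qp(1) _ s, of 0] by simp
      \<comment> \<open>For \<open>t\<close> near \<open>s\<close>, on either side, the segment from
        \<open>s\<close> to \<open>t\<close> stays in \<open>V (q s)\<close>, so its value is
        \<open>\<kappa> (q s) (q t)\<close> and \<open>l\<close> runs in a single sheet.\<close>
      have lt: "l t = (q t, ?g \<otimes> \<kappa> (q s) (q t))" if t: "t \<in> {0..1} \<inter> ball s \<epsilon>" for t
      proof -
        have "P (q s) (q t) (path_segment q s t)"
          unfolding P_def
        proof (intro conjI)
          show "pathin X (path_segment q s t)" using pathin_segment[OF qp(1) s] t by blast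
          show "path_segment q s t ` {0..1} \<subseteq> V (q s)"
          proof (rule image_subsetI)
            fix x :: real assume x: "x \<in> {0..1}"
            have "s + x * (t - s) \<in> {0..1}" using segment_param_in[OF s _ x, of t] t by blast
            moreover have "\<bar>x * (t - s)\<bar> \<le> 1 * \<bar>t - s\<bar>" unfolding abs_mult using x by (intro mult_right_mono) auto
            then have "s + x * (t - s) \<in> ball s \<epsilon>" using t by (auto simp: dist_real_def)
            ultimately show "path_segment q s t x \<in> V (q s)" unfolding path_segment_def using near by blast
          qed
        qed simp_all
        then have "\<kappa> (q s) (q t) = F (path_segment q s t)" by (rule \<kappa>[OF qs])
        then show ?thesis using seg[OF s, of t] t by (simp add: l_def)
      qed
      have "continuous_map (subtopology X (V (q s))) (gbundle X G \<kappa>) (\<lambda>y. (y, ?g \<otimes> \<kappa> (q s) y))"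
        by (rule continuous_map_sheet[OF assms(1) c nhd[OF qs] gG])
      moreover have "continuous_map (subtopology (top_of_set {0..1}) ({0..1} \<inter> ball s \<epsilon>)) (subtopology X (V (q s))) q"
        by (rule continuous_map_into_subtopology[OF continuous_map_from_subtopology[OF qp(1)[unfolded pathin_def]]])
          (use near in auto)
      ultimately have "continuous_map (subtopology (top_of_set {0..1}) ({0..1} \<inter> ball s \<epsilon>)) (gbundle X G \<kappa>)
          ((\<lambda>y. (y, ?g \<otimes> \<kappa> (q s) y)) \<circ> q)" by (rule continuous_map_compose[rotated])
      then have "continuous_map (subtopology (top_of_set {0..1}) ({0..1} \<inter> ball s \<epsilon>)) (gbundle X G \<kappa>) l"
        by (rule continuous_map_eq) (use lt in auto)
      moreover have "openin (top_of_set {0..1}) ({0..1} \<inter> ball s \<epsilon>)" by (auto simp: openin_open)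
      ultimately show "\<exists>W. openin (top_of_set {0..1}) W \<and> s \<in> W \<and>
          continuous_map (subtopology (top_of_set {0..1}) W) (gbundle X G \<kappa>) l"
        using s \<epsilon>(1) by (intro exI[of _ "{0..1} \<inter> ball s \<epsilon>"]) auto
    qed
    moreover have "l 0 = (a, \<one>)" using q0 qp Fc[OF a] by (simp add: l_def)
    moreover have "l 1 = (a, \<phi> (loop_class X a q))" using q0 qp F4[OF q] by (simp add: l_def)
    ultimately show "\<exists>l. pathin (gbundle X G \<kappa>) l \<and> l 0 = (a, \<one>) \<and> l 1 = (a, \<phi> (loop_class X a q)) \<and>
        (\<forall>t\<in>{0..1}. fst (l t) = q t)" by (auto simp: l_def)
  qed
  with c show ?thesis using that by blast
qed

section \<open>Monodromy of a given bundle\<close>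

lemma monodromy_lift:
  fixes G (structure)
  assumes "group G" and c: "germ_cocycle X G \<kappa>" and m: "has_monodromy X G \<kappa> a \<phi>" and q: "q \<in> loops X a"
    and l: "pathin (gbundle X G \<kappa>) l" "l 0 = (a, g)" "\<And>t. t \<in> {0..1} \<Longrightarrow> fst (l t) = q t"
  shows "l 1 = (a, g \<otimes> \<phi> (loop_class X a q))"
proof -
  interpret group G by fact
  let ?E = "gbundle X G \<kappa>"
  have tE: "topspace ?E = topspace X \<times> carrier G" using topspace_gbundle[OF assms(1) c] .
  obtain l0 where l0: "pathin ?E l0" "l0 0 = (a, \<one>)" "l0 1 = (a, \<phi> (loop_class X a q))"
    "\<forall>t\<in>{0..1}. fst (l0 t) = q t" using m q unfolding has_monodromy_def by blast
  have g: "g \<in> carrier G" using pathin_in[OF l(1), of 0] l(2) tE by simp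
  have "pathin ?E ((\<lambda>e. (fst e, g \<otimes> snd e)) \<circ> l0)"
    using pathin_compose[OF l0(1)] homeomorphic_imp_continuous_map[OF homeomorphic_map_gbundle_translation[OF assms(1) c g]]
    by blast
  then have "l 1 = ((\<lambda>e. (fst e, g \<otimes> snd e)) \<circ> l0) 1"
    by (rule lift_of_path_end_unique[OF gbundle_covering[OF assms(1) c] l(1)]) (use l l0 g in auto)
  then show ?thesis using l0 by simp
qed

text \<open>Homotopy lifting shows that the end of the lift of a loop depends only on its class. The
  lift of a concatenation continues with a left translate of the second lift, which gives
  multiplicativity.\<close>

lemma ex_monodromy:
  fixes G (structure)
  assumes "group G" and c: "germ_cocycle X G \<kappa>" and a: "a \<in> topspace X"
  obtains \<phi> where "\<phi> \<in> hom (fundamental_group X a) G" "has_monodromy X G \<kappa> a \<phi>"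
proof -
  interpret group G by fact
  let ?E = "gbundle X G \<kappa>"
  have cov: "covering_map ?E X fst" using gbundle_covering[OF assms(1) c] .
  have tE: "topspace ?E = topspace X \<times> carrier G" using topspace_gbundle[OF assms(1) c] .
  define L where "L q l \<longleftrightarrow> pathin ?E l \<and> l 0 = (a, \<one>) \<and> (\<forall>t\<in>{0..1}. fst (l t) = q t)" for q :: "real \<Rightarrow> _" and l
  have exL: "\<exists>l. L q l" if q: "q \<in> loops X a" for q
  proof -
    have qp: "pathin X q" "q 0 = a" using q by (auto simp: loops_def)
    have e: "(a, \<one>) \<in> topspace ?E" "fst (a, \<one>) = q 0" using a tE qp by auto
    obtain l where "pathin ?E l" "\<And>t. t \<in> {0..1} \<Longrightarrow> fst (l t) = q t" "l 0 = (a, \<one>)"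
      using path_lift[OF cov qp(1) e] by blast
    then show ?thesis unfolding L_def by blast
  qed
  \<comment> \<open>A representative of the class and a lift of it are chosen; \<open>val\<close>
    shows that neither choice matters.\<close>
  define \<phi> where "\<phi> A = snd ((SOME l. L (SOME q. q \<in> A) l) 1)" for A
  have val: "snd (l 1) = \<phi> (loop_class X a q)" if q: "q \<in> loops X a" and l: "L q l" for q l
  proof -
    define q' where "q' = (SOME q'. q' \<in> loop_class X a q)"
    have "q' \<in> loop_class X a q" unfolding q'_def using someI[of "\<lambda>q'. q' \<in> loop_class X a q" q] loop_class_self[OF q] by blast
    then have h: "path_homotopic X a a q q'" by (simp add: mem_loop_class)
    have "q' \<in> loops X a" using path_homotopic_imp[OF h] by (simp add: loops_def)
    define l' where "l' = (SOME l. L q' l)"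
    have l': "L q' l'" unfolding l'_def using exL[OF \<open>q' \<in> loops X a\<close>] by (rule someI_ex)
    have "path_homotopic X a a (fst \<circ> l) (fst \<circ> l')"
      by (rule path_homotopic_eq[OF h]) (use l l' in \<open>auto simp: L_def\<close>)
    then have "l 1 = l' 1"
      using homotopic_lift_endpoint[OF cov, of a a l l'] l l' by (simp add: path_homotopic_def L_def)
    then show ?thesis by (simp add: \<phi>_def q'_def l'_def)
  qed
  have end1: "l 1 = (a, \<phi> (loop_class X a q)) \<and> \<phi> (loop_class X a q) \<in> carrier G"
    if q: "q \<in> loops X a" and l: "L q l" for q l
  proof -
    have "fst (l 1) = a" using l q by (simp add: L_def loops_def)
    moreover have "l 1 \<in> topspace ?E" using l pathin_in[of ?E l 1] by (simp add: L_def)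
    ultimately show ?thesis using val[OF q l] tE by (auto simp: prod_eq_iff mem_Times_iff)
  qed
  have m: "has_monodromy X G \<kappa> a \<phi>"
    unfolding has_monodromy_def
  proof
    fix q assume q: "q \<in> loops X a"
    then obtain l where l: "L q l" using exL by blast
    then show "\<exists>l. pathin ?E l \<and> l 0 = (a, \<one>) \<and> l 1 = (a, \<phi> (loop_class X a q)) \<and> (\<forall>t\<in>{0..1}. fst (l t) = q t)"
      using end1[OF q l] unfolding L_def by blast
  qed
  have "\<phi> \<in> hom (fundamental_group X a) G"
  proof (rule homI)
    fix x assume "x \<in> carrier (fundamental_group X a)"
    then obtain q where q: "q \<in> loops X a" "x = loop_class X a q" unfolding carrier_fundamental_group by blast
    then show "\<phi> x \<in> carrier G" using exL end1 by blast
  next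
    fix x y assume "x \<in> carrier (fundamental_group X a)" "y \<in> carrier (fundamental_group X a)"
    then obtain p q where p: "p \<in> loops X a" "x = loop_class X a p" and q: "q \<in> loops X a" "y = loop_class X a q"
      unfolding carrier_fundamental_group by blast
    obtain l k where l: "L p l" and k: "L q k" using exL p q by blast
    let ?g = "\<phi> x"
    have g: "?g \<in> carrier G" "l 1 = (a, ?g)" using end1[OF p(1) l] p(2) by auto
    let ?k = "(\<lambda>e. (fst e, ?g \<otimes> snd e)) \<circ> k"
    have "pathin ?E ?k"
      using k homeomorphic_imp_continuous_map[OF homeomorphic_map_gbundle_translation[OF assms(1) c g(1)]]
      by (auto simp: L_def intro: pathin_compose)
    moreover have "?k 0 = l 1" using k g by (simp add: L_def)
    ultimately have "pathin ?E (loop_concat l ?k)" using l by (intro pathin_concat) (auto simp: L_def)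
    then have "L (loop_concat p q) (loop_concat l ?k)"
      unfolding L_def using l k by (auto simp: L_def loop_concat_def)
    then have "snd (?k 1) = \<phi> (loop_class X a (loop_concat p q))"
      using val[OF loops_concat[OF p(1) q(1)]] by fastforce
    then show "\<phi> (x \<otimes>\<^bsub>fundamental_group X a\<^esub> y) = \<phi> x \<otimes> \<phi> y"
      using end1[OF q(1) k] fundamental_group_mult[OF p(1) q(1)] p q by simp
  qed
  then show ?thesis using that m by blast
qed

text \<open>The bundle map over \<open>f\<close> keeps fibre coordinates, so it carries the lift of
  \<open>q\<close> to a lift of the image loop with the same end coordinate.\<close>

lemma has_monodromy_pullback:
  fixes G (structure)
  assumes "group G" and c: "germ_cocycle X G \<kappa>" and m: "has_monodromy X G \<kappa> a \<phi>"
    and f: "continuous_map Y X f" "f b = a" and b: "b \<in> topspace Y"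
  shows "has_monodromy Y G (\<lambda>x y. \<kappa> (f x) (f y)) b (\<phi> \<circ> induced_hom X a f)"
  unfolding has_monodromy_def
proof
  interpret group G by fact
  note c' = germ_cocycle_pullback[OF c f(1)]
  let ?E = "gbundle Y G (\<lambda>x y. \<kappa> (f x) (f y))"
  fix q assume q: "q \<in> loops Y b"
  then have qp: "pathin Y q" "q 0 = b" "q 1 = b" by (auto simp: loops_def)
  have e: "(b, \<one>) \<in> topspace ?E" "fst (b, \<one>) = q 0" using b topspace_gbundle[OF assms(1) c'] qp by auto
  obtain l where l: "pathin ?E l" "\<And>t. t \<in> {0..1} \<Longrightarrow> fst (l t) = q t" "l 0 = (b, \<one>)"
    using path_lift[OF gbundle_covering[OF assms(1) c'] qp(1) e] by blast
  have fq: "f \<circ> q \<in> loops X a" by (rule loops_compose[OF f q])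
  have "pathin (gbundle X G \<kappa>) ((\<lambda>e. (f (fst e), snd e)) \<circ> l)"
    by (rule pathin_compose[OF l(1) continuous_map_gbundle_pullback[OF assms(1) c f(1)]])
  from monodromy_lift[OF assms(1) c m fq this, of \<one>]
  have "(f (fst (l 1)), snd (l 1)) = (a, \<one> \<otimes> \<phi> (loop_class X a (f \<circ> q)))" using l f(2) by simp
  moreover have "\<phi> (loop_class X a (f \<circ> q)) \<in> carrier G"
  proof -
    obtain l0 where "pathin (gbundle X G \<kappa>) l0" "l0 1 = (a, \<phi> (loop_class X a (f \<circ> q)))"
      using m fq unfolding has_monodromy_def by blast
    then show ?thesis using pathin_in[of _ l0 1] topspace_gbundle[OF assms(1) c] by fastforce
  qed
  ultimately have "l 1 = (b, (\<phi> \<circ> induced_hom X a f) (loop_class Y b q))"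
    using l(2)[of 1] qp induced_hom_loop_class[OF f q] by (simp add: prod_eq_iff)
  then show "\<exists>l. pathin ?E l \<and> l 0 = (b, \<one>) \<and> l 1 = (b, (\<phi> \<circ> induced_hom X a f) (loop_class Y b q)) \<and>
      (\<forall>t\<in>{0..1}. fst (l t) = q t)" using l by blast
qed

text \<open>Every point is first moved into the fibre over \<open>a\<close> along a lifted path. If
  it arrives with coordinate \<open>g\<close>, a loop with monodromy \<open>inv g\<close> brings it
  to \<open>(a, \<one>)\<close>.\<close>

lemma gbundle_connected_if_surj:
  fixes G (structure)
  assumes "group G" and c: "germ_cocycle X G \<kappa>" and m: "has_monodromy X G \<kappa> a \<phi>"
    and X: "path_connected_space X" and a: "a \<in> topspace X"
    and sur: "carrier G \<subseteq> \<phi> ` carrier (fundamental_group X a)"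
  shows "connected_space (gbundle X G \<kappa>)"
proof (rule path_connected_imp_connected_space)
  interpret group G by fact
  let ?E = "gbundle X G \<kappa>"
  have tE: "topspace ?E = topspace X \<times> carrier G" using topspace_gbundle[OF assms(1) c] .
  have cov: "covering_map ?E X fst" using gbundle_covering[OF assms(1) c] .
  have base: "\<exists>l. pathin ?E l \<and> l 0 = e \<and> l 1 = (a, \<one>)" if e: "e \<in> topspace ?E" for e
  proof -
    have "fst e \<in> topspace X" using e tE by auto
    then obtain p where p: "pathin X p" "p 0 = fst e" "p 1 = a" using X a unfolding path_connected_space_def by blast
    obtain l where l: "pathin ?E l" "\<And>t. t \<in> {0..1} \<Longrightarrow> fst (l t) = p t" "l 0 = e"
      using path_lift[OF cov p(1) e p(2)[symmetric]] by blast
    have l1: "fst (l 1) = a" "l 1 \<in> topspace ?E" using l(2)[of 1] p pathin_in[OF l(1), of 1] by auto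
    let ?g = "snd (l 1)"
    have g: "?g \<in> carrier G" using l1(2) unfolding tE by (simp add: mem_Times_iff)
    then have "inv ?g \<in> \<phi> ` carrier (fundamental_group X a)" using sur by blast
    then obtain q where q: "q \<in> loops X a" "\<phi> (loop_class X a q) = inv ?g"
      unfolding carrier_fundamental_group by auto
    have qp: "pathin X q" "fst (l 1) = q 0" using q l1 by (auto simp: loops_def)
    obtain k where k: "pathin ?E k" "\<And>t. t \<in> {0..1} \<Longrightarrow> fst (k t) = q t" "k 0 = l 1"
      using path_lift[OF cov qp(1) l1(2) qp(2)] by blast
    have "k 0 = (a, ?g)" using k(3) l1(1) by (simp add: prod_eq_iff)
    then have "k 1 = (a, ?g \<otimes> \<phi> (loop_class X a q))"
      using monodromy_lift[OF assms(1) c m q(1) k(1)] k(2) by blast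
    then have "k 1 = (a, \<one>)" using q(2) g by simp
    then show ?thesis using pathin_concat[OF l(1) k(1)] k(3) l(3) by (intro exI[of _ "loop_concat l k"]) simp
  qed
  show "path_connected_space ?E"
    unfolding path_connected_space_def
  proof (intro ballI)
    fix e f assume "e \<in> topspace ?E" "f \<in> topspace ?E"
    then obtain l k where "pathin ?E l" "l 0 = e" "l 1 = (a, \<one>)" "pathin ?E k" "k 0 = f" "k 1 = (a, \<one>)"
      using base by meson
    then show "\<exists>g. pathin ?E g \<and> g 0 = e \<and> g 1 = f"
      by (intro exI[of _ "loop_concat l (path_rev k)"]) (auto intro: pathin_concat pathin_rev)
  qed
qed

text \<open>A path from \<open>(a, \<one>)\<close> to \<open>(a, g)\<close> projects to a loop with
  monodromy \<open>g\<close>; local path connectedness supplies such a path in a connected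
  bundle.\<close>

lemma surj_if_gbundle_connected:
  fixes G (structure)
  assumes "group G" and c: "germ_cocycle X G \<kappa>" and m: "has_monodromy X G \<kappa> a \<phi>"
    and X: "locally_path_connected_space X" and a: "a \<in> topspace X"
    and con: "connected_space (gbundle X G \<kappa>)"
  shows "carrier G \<subseteq> \<phi> ` carrier (fundamental_group X a)"
proof
  interpret group G by fact
  let ?E = "gbundle X G \<kappa>"
  have tE: "topspace ?E = topspace X \<times> carrier G" using topspace_gbundle[OF assms(1) c] .
  have cov: "covering_map ?E X fst" using gbundle_covering[OF assms(1) c] .
  fix g assume g: "g \<in> carrier G"
  have "path_connected_space ?E"
    using covering_locally_path_connected[OF cov X] con path_connected_eq_connected_space by blast
  moreover have "(a, \<one>) \<in> topspace ?E" "(a, g) \<in> topspace ?E" using a g tE by auto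
  ultimately obtain l where l: "pathin ?E l" "l 0 = (a, \<one>)" "l 1 = (a, g)"
    unfolding path_connected_space_def by blast
  have q: "fst \<circ> l \<in> loops X a"
    using pathin_compose[OF l(1) covering_map_continuous[OF cov]] l by (simp add: loops_def)
  from monodromy_lift[OF assms(1) c m q l(1,2)] l(3) have "g = \<one> \<otimes> \<phi> (loop_class X a (fst \<circ> l))" by simp
  moreover have "\<phi> (loop_class X a (fst \<circ> l)) \<in> carrier G"
  proof -
    obtain l0 where "pathin ?E l0" "l0 1 = (a, \<phi> (loop_class X a (fst \<circ> l)))"
      using m q unfolding has_monodromy_def by blast
    then show ?thesis using pathin_in[of _ l0 1] tE by fastforce
  qed
  ultimately have "g = \<phi> (loop_class X a (fst \<circ> l))" by simp
  then show "g \<in> \<phi> ` carrier (fundamental_group X a)" using q unfolding carrier_fundamental_group by blast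
qed

lemma closed_lift_gbundle_iff:
  fixes G (structure)
  assumes "group G" and c: "germ_cocycle X G \<kappa>" and m: "has_monodromy X G \<kappa> a \<phi>" and q: "q \<in> loops X a"
  shows "(\<exists>l\<in>loops (gbundle X G \<kappa>) (a, \<one>). \<forall>t\<in>{0..1}. fst (l t) = q t) \<longleftrightarrow> \<phi> (loop_class X a q) = \<one>"
proof -
  interpret group G by fact
  obtain l0 where l0: "pathin (gbundle X G \<kappa>) l0" "l0 0 = (a, \<one>)" "l0 1 = (a, \<phi> (loop_class X a q))"
    "\<forall>t\<in>{0..1}. fst (l0 t) = q t" using m q unfolding has_monodromy_def by blast
  have car: "\<phi> (loop_class X a q) \<in> carrier G"
    using l0 pathin_in[of _ l0 1] topspace_gbundle[OF assms(1) c] by fastforce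
  show ?thesis
  proof
    assume "\<exists>l\<in>loops (gbundle X G \<kappa>) (a, \<one>). \<forall>t\<in>{0..1}. fst (l t) = q t"
    then obtain l where l: "pathin (gbundle X G \<kappa>) l" "l 0 = (a, \<one>)" "l 1 = (a, \<one>)"
      "\<forall>t\<in>{0..1}. fst (l t) = q t" by (auto simp: loops_def)
    show "\<phi> (loop_class X a q) = \<one>"
      using monodromy_lift[OF assms(1) c m q l(1,2)] l(3,4) car by simp
  next
    assume "\<phi> (loop_class X a q) = \<one>"
    then show "\<exists>l\<in>loops (gbundle X G \<kappa>) (a, \<one>). \<forall>t\<in>{0..1}. fst (l t) = q t"
      using l0 by (intro bexI[of _ l0]) (auto simp: loops_def)
  qed
qed

text \<open>The image subgroup and the kernel both consist of the classes of loops whose lift at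
  \<open>(a, \<one>)\<close> is closed.\<close>

lemma cover_of_hom_gbundle:
  fixes G (structure)
  assumes "group G" and c: "germ_cocycle X G \<kappa>" and m: "has_monodromy X G \<kappa> a \<phi>"
    and a: "a \<in> topspace X" and con: "connected_space (gbundle X G \<kappa>)"
  shows "cover_of_hom X a G \<phi> (gbundle X G \<kappa>, fst)"
proof -
  interpret group G by fact
  let ?E = "gbundle X G \<kappa>"
  have cov: "covering_map ?E X fst" using gbundle_covering[OF assms(1) c] .
  have e: "(a, \<one>) \<in> topspace ?E" "fst (a, \<one>) = a" using a topspace_gbundle[OF assms(1) c] by auto
  have "induced_hom X a fst ` carrier (fundamental_group ?E (a, \<one>)) = kernel (fundamental_group X a) G \<phi>"
  proof (intro equalityI subsetI)
    fix x assume x: "x \<in> induced_hom X a fst ` carrier (fundamental_group ?E (a, \<one>))"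
    then obtain l where l: "l \<in> loops ?E (a, \<one>)" "x = loop_class X a (fst \<circ> l)"
      using induced_hom_loop_class[OF covering_map_continuous[OF cov] e(2)]
      unfolding carrier_fundamental_group by auto
    have q: "fst \<circ> l \<in> loops X a" by (rule loops_compose[OF covering_map_continuous[OF cov] e(2) l(1)])
    then show "x \<in> kernel (fundamental_group X a) G \<phi>"
      using x mem_induced_hom_image_iff[OF cov e q] closed_lift_gbundle_iff[OF assms(1) c m q] l(2)
      by (simp add: kernel_def carrier_fundamental_group)
  next
    fix x assume x: "x \<in> kernel (fundamental_group X a) G \<phi>"
    then obtain q where q: "q \<in> loops X a" "x = loop_class X a q"
      unfolding kernel_def carrier_fundamental_group by blast
    then show "x \<in> induced_hom X a fst ` carrier (fundamental_group ?E (a, \<one>))"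
      using x mem_induced_hom_image_iff[OF cov e q(1)] closed_lift_gbundle_iff[OF assms(1) c m q(1)]
      by (simp add: kernel_def)
  qed
  then show ?thesis
    using con cov e unfolding cover_of_hom_def is_cover_def prod.case
    by (intro conjI bexI[of _ "(a, \<one>)"]) auto
qed

text \<open>Only the kernel decides which loops lift to closed ones, so homomorphisms that differ by
  an automorphism of \<open>G\<close> belong to equivalent covers.\<close>

lemma cover_of_hom_unique:
  assumes C: "cover_of_hom X a G \<phi> C" and D: "cover_of_hom X a G \<psi> D" and X: "locally_path_connected_space X"
    and ker: "kernel (fundamental_group X a) G \<phi> = kernel (fundamental_group X a) G \<psi>"
  shows "cover_equiv C D"
proof -
  obtain E p F r where CD: "C = (E, p)" "D = (F, r)" by fastforce
  obtain e where e: "connected_space E" "covering_map E X p" "e \<in> topspace E" "p e = a"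
    "induced_hom X a p ` carrier (fundamental_group E e) = kernel (fundamental_group X a) G \<phi>"
    using C unfolding CD cover_of_hom_def is_cover_def by auto
  obtain f where f: "connected_space F" "covering_map F X r" "f \<in> topspace F" "r f = a"
    "induced_hom X a r ` carrier (fundamental_group F f) = kernel (fundamental_group X a) G \<psi>"
    using D unfolding CD cover_of_hom_def is_cover_def by auto
  show ?thesis
    unfolding CD
    by (rule cover_equiv_if_same_closed_lifts[OF e(2) f(2) e(1) f(1) X e(3,4) f(3,4)])
      (use mem_induced_hom_image_iff[OF e(2-4)] mem_induced_hom_image_iff[OF f(2-4)] e(5) f(5) ker in simp)
qed

section \<open>Local contractibility of finite CW complexes\<close>

text \<open>The contraction keeps \<open>x\<close> fixed, so it contracts loops at \<open>x\<close>
  with fixed ends; it takes place in \<open>U\<close>, so its tracks join the points of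
  \<open>V\<close> to \<open>x\<close> inside \<open>U\<close>. The first property gives semilocal
  simple connectedness, the second local path connectedness.\<close>

definition locally_contractible :: "'x topology \<Rightarrow> bool" where
  "locally_contractible X \<longleftrightarrow> (\<forall>x U. openin X U \<and> x \<in> U \<longrightarrow> (\<exists>V. openin X V \<and> x \<in> V \<and> V \<subseteq> U \<and>
     homotopic_with (\<lambda>f. f x = x) (subtopology X V) (subtopology X U) id (\<lambda>_. x)))"

lemma homotopic_fixingI:
  assumes "x \<in> topspace Z" "continuous_map (prod_topology (top_of_set {0..1::real}) Z) Y h"
    "\<And>y. y \<in> topspace Z \<Longrightarrow> h (0, y) = f y" "\<And>y. y \<in> topspace Z \<Longrightarrow> h (1, y) = g y"
    "\<And>t. t \<in> {0..1} \<Longrightarrow> h (t, x) = x"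
  shows "homotopic_with (\<lambda>f. f x = x) Z Y f g"
proof (subst homotopic_with)
  show "\<exists>h. continuous_map (prod_topology (top_of_set {0..1::real}) Z) Y h \<and> (\<forall>x\<in>topspace Z. h (0, x) = f x) \<and>
      (\<forall>x\<in>topspace Z. h (1, x) = g x) \<and> (\<forall>t\<in>{0..1}. h (t, x) = x)"
    by (intro exI[of _ h]) (use assms in auto)
qed (use assms(1) in auto)

lemma locally_contractible_imp_locally_path_connected:
  assumes X: "locally_contractible X"
  shows "locally_path_connected_space X"
  unfolding locally_path_connected_space_im_kleinen
proof (intro allI impI)
  fix U x assume U: "openin X U \<and> x \<in> U"
  obtain V where V: "openin X V" "x \<in> V" "V \<subseteq> U"
    "homotopic_with (\<lambda>f. f x = x) (subtopology X V) (subtopology X U) id (\<lambda>_. x)"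
    using X U unfolding locally_contractible_def by blast
  obtain h :: "real \<times> 'a \<Rightarrow> 'a" where h: "continuous_map (prod_topology (top_of_set {0..1}) (subtopology X V)) (subtopology X U) h"
    "\<forall>y. h (0, y) = id y" "\<forall>y. h (1, y) = x" using V(4) unfolding homotopic_with_def by blast
  have "\<exists>C. path_connectedin X C \<and> C \<subseteq> U \<and> x \<in> C \<and> y \<in> C" if y: "y \<in> V" for y
  proof -
    have "y \<in> topspace (subtopology X V)" using y V(1) openin_subset by fastforce
    then have "continuous_map (top_of_set {0..1}) (prod_topology (top_of_set {0..1}) (subtopology X V)) (\<lambda>t. (t, y))"
      by (intro continuous_map_pairedI) auto
    then have p: "pathin (subtopology X U) (h \<circ> (\<lambda>t. (t, y)))"
      unfolding pathin_def by (rule continuous_map_compose[OF _ h(1)])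
    define C where "C = (h \<circ> (\<lambda>t. (t, y))) ` {0..1}"
    have "path_connectedin (subtopology X U) C" unfolding C_def by (rule path_connectedin_path_image[OF p])
    then have "path_connectedin X C" "C \<subseteq> U" by (auto simp: path_connectedin_subtopology)
    moreover have "h (0, y) \<in> C" "h (1, y) \<in> C" unfolding C_def by auto
    then have "x \<in> C" "y \<in> C" using h(2,3) by simp_all
    ultimately show ?thesis by blast
  qed
  then show "\<exists>V. openin X V \<and> x \<in> V \<and> V \<subseteq> U \<and> (\<forall>y\<in>V. \<exists>C. path_connectedin X C \<and> C \<subseteq> U \<and> x \<in> C \<and> y \<in> C)"
    using V by blast
qed

lemma locally_contractible_imp_semilocally_simply_connected:
  assumes X: "locally_contractible X"
  shows "semilocally_simply_connected X"
  unfolding semilocally_simply_connected_def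
proof
  fix x assume "x \<in> topspace X"
  then obtain V where V: "openin X V" "x \<in> V"
    "homotopic_with (\<lambda>f. f x = x) (subtopology X V) (subtopology X (topspace X)) id (\<lambda>_. x)"
    using X unfolding locally_contractible_def by blast
  have "path_homotopic X x x p (\<lambda>_. x)" if p: "pathin X p" "p ` {0..1} \<subseteq> V" "p 0 = x" "p 1 = x" for p
  proof -
    have "pathin (subtopology X V) p" using p by (auto simp: pathin_subtopology)
    then have "homotopic_with (\<lambda>r. r 0 = x \<and> r 1 = x) (top_of_set {0..1}) (subtopology X (topspace X)) (id \<circ> p) ((\<lambda>_. x) \<circ> p)"
      unfolding pathin_def by (rule homotopic_with_compose_continuous_map_right[OF V(3)]) (use p in auto)
    then show ?thesis by (simp add: path_homotopic_def o_def)
  qed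
  then show "\<exists>V. openin X V \<and> x \<in> V \<and> small_loops_null X V x"
    using V unfolding small_loops_null_def by blast
qed

text \<open>The tube lemma: projection along the compact unit interval is closed, and the complement
  is the projection of the closed set of bad pairs.\<close>

lemma openin_all_times:
  assumes H: "continuous_map (prod_topology (top_of_set {0..1::real}) Y) Z H" and U: "openin Z U"
  shows "openin Y {y \<in> topspace Y. \<forall>t\<in>{0..1}. H (t, y) \<in> U}"
proof -
  let ?P = "prod_topology (top_of_set {0..1::real}) Y"
  have "closedin ?P {z \<in> topspace ?P. H z \<in> topspace Z - U}"
    by (rule closedin_continuous_map_preimage[OF H]) (use U in auto)
  moreover have "compact_space (top_of_set {0..1::real})"
    by (metis compact_Icc compact_space_subtopology compactin_euclidean_iff)
  ultimately have "closedin Y (snd ` {z \<in> topspace ?P. H z \<in> topspace Z - U})"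
    using Abstract_Topological_Spaces.closed_map_snd unfolding closed_map_def by blast
  moreover have "{y \<in> topspace Y. \<forall>t\<in>{0..1}. H (t, y) \<in> U} = topspace Y - snd ` {z \<in> topspace ?P. H z \<in> topspace Z - U}"
  proof (intro equalityI subsetI)
    fix y assume y: "y \<in> {y \<in> topspace Y. \<forall>t\<in>{0..1}. H (t, y) \<in> U}"
    have "y \<noteq> snd z" if "z \<in> topspace ?P" "H z \<in> topspace Z - U" for z
      using that y by (cases z) auto
    then show "y \<in> topspace Y - snd ` {z \<in> topspace ?P. H z \<in> topspace Z - U}" using y by blast
  next
    fix y assume y: "y \<in> topspace Y - snd ` {z \<in> topspace ?P. H z \<in> topspace Z - U}"
    have "H (t, y) \<in> U" if t: "t \<in> {0..1}" for t
    proof (rule ccontr)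
      assume n: "H (t, y) \<notin> U"
      have P: "(t, y) \<in> topspace ?P" using y t by simp
      then have "H (t, y) \<in> topspace Z" using H by (auto simp: continuous_map_def)
      then have "snd (t, y) \<in> snd ` {z \<in> topspace ?P. H z \<in> topspace Z - U}"
        using n P by (intro imageI) blast
      then show False using y by simp
    qed
    then show "y \<in> {y \<in> topspace Y. \<forall>t\<in>{0..1}. H (t, y) \<in> U}" using y by blast
  qed
  ultimately show ?thesis by (simp add: openin_diff)
qed

text \<open>From a contraction of the whole space that fixes \<open>x\<close>, \<open>V\<close> is
  obtained as the set of points whose entire track stays in \<open>U\<close>.\<close>

lemma locally_contractible_at_center:
  assumes H: "continuous_map (prod_topology (top_of_set {0..1::real}) X) X H"
    "\<And>y. y \<in> topspace X \<Longrightarrow> H (0, y) = y" "\<And>y. y \<in> topspace X \<Longrightarrow> H (1, y) = x"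
    "\<And>t. t \<in> {0..1} \<Longrightarrow> H (t, x) = x" and U: "openin X U" "x \<in> U"
  shows "\<exists>V. openin X V \<and> x \<in> V \<and> V \<subseteq> U \<and>
     homotopic_with (\<lambda>f. f x = x) (subtopology X V) (subtopology X U) id (\<lambda>_. x)"
proof -
  let ?V = "{y \<in> topspace X. \<forall>t\<in>{0..1}. H (t, y) \<in> U}"
  have V: "openin X ?V" by (rule openin_all_times[OF H(1) U(1)])
  have xX: "x \<in> topspace X" using U openin_subset by blast
  have xV: "x \<in> ?V" using U(2) H(4) xX by simp
  have VU: "?V \<subseteq> U"
  proof
    fix y assume y: "y \<in> ?V"
    then have "H (0, y) \<in> U" by simp
    then show "y \<in> U" using H(2) y by simp
  qed
  have "homotopic_with (\<lambda>f. f x = x) (subtopology X ?V) (subtopology X U) id (\<lambda>_. x)"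
  proof (rule homotopic_fixingI)
    have "continuous_map (prod_topology (top_of_set {0..1::real}) (subtopology X ?V)) (prod_topology (top_of_set {0..1}) X) id"
      unfolding id_def by (subst prod.collapse[symmetric], intro continuous_map_pairedI)
        (auto intro: continuous_map_into_fulltopology[OF continuous_map_snd] continuous_map_fst)
    then have "continuous_map (prod_topology (top_of_set {0..1}) (subtopology X ?V)) X (H \<circ> id)"
      by (rule continuous_map_compose[OF _ H(1)])
    then show "continuous_map (prod_topology (top_of_set {0..1}) (subtopology X ?V)) (subtopology X U) H"
      by (intro continuous_map_into_subtopology) auto
  qed (use H xV xX in auto)
  then show ?thesis using V xV VU by blast
qed

lemma locally_contractible_at_open_embedding:
  assumes h: "homeomorphic_map Y (subtopology X e) h" and e: "openin X e" and Y: "locally_contractible Y"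
    and U: "openin X U" "x \<in> U" "x \<in> e"
  shows "\<exists>V. openin X V \<and> x \<in> V \<and> V \<subseteq> U \<and>
     homotopic_with (\<lambda>f. f x = x) (subtopology X V) (subtopology X U) id (\<lambda>_. x)"
proof -
  obtain g where g: "homeomorphic_maps Y (subtopology X e) h g" using h homeomorphic_map_maps by blast
  have te: "topspace (subtopology X e) = e" using e openin_subset by fastforce
  have ch: "continuous_map Y X h" and cg: "continuous_map (subtopology X e) Y g"
    and hg: "\<And>y. y \<in> e \<Longrightarrow> h (g y) = y" and gh: "\<And>y. y \<in> topspace Y \<Longrightarrow> g (h y) = y"
    using g te unfolding homeomorphic_maps_def by (auto intro: continuous_map_into_fulltopology)
  let ?U = "{y \<in> topspace Y. h y \<in> U}"
  have gY: "g y \<in> topspace Y" if "y \<in> e" for y using cg that te by (auto simp: continuous_map_def)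
  have "openin Y ?U" by (rule openin_continuous_map_preimage[OF ch U(1)])
  moreover have "g x \<in> ?U" using U gY hg by simp
  ultimately obtain V where V: "openin Y V" "g x \<in> V" "V \<subseteq> ?U"
    "homotopic_with (\<lambda>f. f (g x) = g x) (subtopology Y V) (subtopology Y ?U) id (\<lambda>_. g x)"
    using Y unfolding locally_contractible_def by meson
  have "openin (subtopology X e) (h ` V)"
    using h V(1) homeomorphic_imp_open_map open_map_def by blast
  then have oV: "openin X (h ` V)" by (rule openin_trans_full[OF _ e])
  have VY: "V \<subseteq> topspace Y" using V(1) openin_subset by blast
  have hV: "h ` V \<subseteq> e" using h VY homeomorphic_imp_surjective_map te by blast
  have gV: "g y \<in> V" if y: "y \<in> h ` V" for y using y gh VY by auto
  have "continuous_map (subtopology (subtopology X e) (h ` V)) (subtopology Y V) g"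
    by (rule continuous_map_into_subtopology[OF continuous_map_from_subtopology[OF cg]]) (use gV in auto)
  moreover have "subtopology (subtopology X e) (h ` V) = subtopology X (h ` V)"
    using hV by (simp add: subtopology_subtopology Int_absorb1)
  ultimately have cg': "continuous_map (subtopology X (h ` V)) (subtopology Y V) g" by simp
  have ch': "continuous_map (subtopology Y ?U) (subtopology X U) h"
    by (rule continuous_map_into_subtopology[OF continuous_map_from_subtopology[OF ch]]) auto
  have "homotopic_with (\<lambda>f. f x = g x) (subtopology X (h ` V)) (subtopology Y ?U) (id \<circ> g) ((\<lambda>_. g x) \<circ> g)"
    by (rule homotopic_with_compose_continuous_map_right[OF V(4) cg']) simp
  then have "homotopic_with (\<lambda>f. f x = x) (subtopology X (h ` V)) (subtopology X U) (h \<circ> (id \<circ> g)) (h \<circ> ((\<lambda>_. g x) \<circ> g))"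
    by (rule homotopic_with_compose_continuous_map_left[OF _ ch']) (use hg U in simp)
  moreover have "x \<in> h ` V" using V(2) hg[OF U(3)] image_eqI by metis
  moreover have "x \<in> topspace (subtopology X (h ` V))" using \<open>x \<in> h ` V\<close> oV openin_subset by fastforce
  ultimately have "homotopic_with (\<lambda>f. f x = x) (subtopology X (h ` V)) (subtopology X U) id (\<lambda>_. x)"
  proof (elim homotopic_with_eq)
    fix y assume "y \<in> topspace (subtopology X (h ` V))"
    then have "y \<in> e" using hV by auto
    then show "id y = (h \<circ> (id \<circ> g)) y" "x = (h \<circ> ((\<lambda>_. g x) \<circ> g)) y" using hg U(3) by simp_all
  qed auto
  moreover have "h ` V \<subseteq> U" using V(3) by blast
  ultimately show ?thesis using oV \<open>x \<in> h ` V\<close> by blast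
qed

section \<open>Disks and the attachment of a cell\<close>

definition disk :: "nat \<Rightarrow> (nat \<Rightarrow> real) set" where
  "disk k = {x. (\<forall>i\<ge>k. x i = 0) \<and> (\<Sum>i<k. (x i)\<^sup>2) \<le> 1}"

definition odisk :: "nat \<Rightarrow> (nat \<Rightarrow> real) set" where
  "odisk k = {x. (\<forall>i\<ge>k. x i = 0) \<and> (\<Sum>i<k. (x i)\<^sup>2) < 1}"

lemma closed_disk_eq: "closed_disk k = top_of_set (disk k)"
  and open_disk_eq: "open_disk k = top_of_set (odisk k)"
  by (simp_all add: closed_disk_def open_disk_def Euclidean_space_def disk_def odisk_def subtopology_subtopology
      euclidean_product_topology Collect_conj_eq)

lemma L2_set_lessThan_le_1: "(\<Sum>i<k. (x i)\<^sup>2) \<le> 1 \<longleftrightarrow> L2_set x {..<k} \<le> 1"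
  and L2_set_lessThan_less_1: "(\<Sum>i<k. (x i)\<^sup>2) < 1 \<longleftrightarrow> L2_set x {..<k} < 1"
  by (simp_all add: L2_set_def)

lemma L2_set_convex:
  assumes "t \<in> {0..1}"
  shows "L2_set (\<lambda>i. (1 - t) * x i + t * y i) A \<le> (1 - t) * L2_set x A + t * L2_set y A"
proof -
  have "L2_set (\<lambda>i. (1 - t) * x i + t * y i) A \<le> L2_set (\<lambda>i. (1 - t) * x i) A + L2_set (\<lambda>i. t * y i) A"
    by (rule L2_set_triangle_ineq)
  then show ?thesis using assms by (simp add: L2_set_right_distrib)
qed

lemma continuous_on_coordinate:
  fixes f :: "'a::topological_space \<Rightarrow> nat \<Rightarrow> real"
  assumes "continuous_on S f"
  shows "continuous_on S (\<lambda>x. f x i)"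
  using continuous_on_product_then_coordinatewise[OF assms] .

lemma compact_disk: "compact (disk k)"
proof -
  have "compactin (product_topology (\<lambda>i::nat. euclideanreal) UNIV) (PiE UNIV (\<lambda>_. {-1..1}))"
    by (auto simp: compactin_PiE)
  then have "compact (PiE UNIV (\<lambda>_::nat. {-1..1::real}))"
    by (simp add: euclidean_product_topology)
  moreover have "closed (disk k)"
  proof -
    have "disk k = (\<Inter>i\<in>{k..}. {x. x i = 0}) \<inter> {x. (\<Sum>i<k. (x i)\<^sup>2) \<le> 1}" by (auto simp: disk_def)
    moreover have "closed {x::nat \<Rightarrow> real. x i = 0}" for i
      by (rule closed_Collect_eq) (simp_all add: continuous_on_const)
    moreover have "closed {x::nat \<Rightarrow> real. (\<Sum>i<k. (x i)\<^sup>2) \<le> 1}"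
      by (rule closed_Collect_le; intro continuous_intros continuous_on_product_coordinates)
    moreover from calculation(2) have "closed (\<Inter>i\<in>{k..}. {x::nat \<Rightarrow> real. x i = 0})"
      by (intro closed_INT ballI)
    ultimately show ?thesis by (simp only: closed_Int)
  qed
  moreover have "disk k \<subseteq> PiE UNIV (\<lambda>_. {-1..1})"
  proof
    fix x assume x: "x \<in> disk k"
    have "\<bar>x i\<bar> \<le> 1" for i
    proof (cases "i < k")
      case True
      then have "(x i)\<^sup>2 \<le> (\<Sum>i<k. (x i)\<^sup>2)" by (intro member_le_sum) auto
      then have "(x i)\<^sup>2 \<le> 1" using x by (simp add: disk_def)
      then show ?thesis by (simp add: abs_square_le_1)
    qed (use x in \<open>simp add: disk_def\<close>)
    then show "x \<in> PiE UNIV (\<lambda>_. {-1..1})" by (auto simp: abs_le_iff minus_le_iff)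
  qed
  ultimately show ?thesis by (metis Int_absorb1 compact_Int_closed)
qed

text \<open>By convexity of the norm, straight lines contract the open disk onto any of its
  points.\<close>

lemma locally_contractible_open_disk: "locally_contractible (open_disk k)"
  unfolding locally_contractible_def open_disk_eq
proof (intro allI impI, elim conjE)
  fix x U assume U: "openin (top_of_set (odisk k)) U" "x \<in> U"
  then have x: "x \<in> odisk k" using openin_subset by fastforce
  define H :: "real \<times> (nat \<Rightarrow> real) \<Rightarrow> nat \<Rightarrow> real" where "H z i = (1 - fst z) * snd z i + fst z * x i" for z i
  have "continuous_on ({0..1} \<times> odisk k) H"
    unfolding H_def
    by (rule continuous_on_coordinatewise_then_product)
      (intro continuous_intros continuous_on_coordinate[OF continuous_on_snd[OF continuous_on_id]])
  moreover have "H (t, y) \<in> odisk k" if "t \<in> {0..1}" "y \<in> odisk k" for t y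
  proof -
    have "L2_set (H (t, y)) {..<k} \<le> (1 - t) * L2_set y {..<k} + t * L2_set x {..<k}"
      unfolding H_def using L2_set_convex[OF that(1)] by simp
    also have "\<dots> < 1"
      using that x convex_bound_lt[of "L2_set y {..<k}" 1 "L2_set x {..<k}" "1 - t" t]
      by (simp add: odisk_def L2_set_lessThan_less_1)
    finally show ?thesis using that x by (simp add: odisk_def L2_set_lessThan_less_1 H_def)
  qed
  ultimately have "continuous_map (prod_topology (top_of_set {0..1}) (top_of_set (odisk k))) (top_of_set (odisk k)) H"
    by (auto simp: prod_topology_subtopology_eu continuous_map_in_subtopology)
  then show "\<exists>V. openin (top_of_set (odisk k)) V \<and> x \<in> V \<and> V \<subseteq> U \<and>
     homotopic_with (\<lambda>f. f x = x) (subtopology (top_of_set (odisk k)) V) (subtopology (top_of_set (odisk k)) U) id (\<lambda>_. x)"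
    by (rule locally_contractible_at_center) (use U in \<open>auto simp: H_def algebra_simps\<close>)
qed

lemma prod_topology_subtopology_UNIV:
  "prod_topology T (subtopology Y V) = subtopology (prod_topology T Y) (UNIV \<times> V)"
proof -
  have "topspace (prod_topology T Y) \<inter> (topspace T \<times> V) = topspace (prod_topology T Y) \<inter> (UNIV \<times> V)" by auto
  then show ?thesis
    using prod_topology_subtopology(2)[of T Y V] subtopology_restrict by metis
qed

lemma continuous_map_prod_subtopology:
  assumes "continuous_map (prod_topology T Y) Z H"
  shows "continuous_map (prod_topology T (subtopology Y V)) Z H"
  using continuous_map_from_subtopology[OF assms] unfolding prod_topology_subtopology_UNIV .

text \<open>A point of the open cell is handled inside the cell. Around a point of \<open>A\<close>,
  the cell without its centre is pushed radially onto \<open>A\<close> by \<open>R\<close>, and a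
  contraction inside \<open>A\<close> follows; the neighbourhood is cut down so that both motions
  stay in \<open>U\<close>.\<close>

lemma locally_contractible_attach_cell:
  assumes X: "Hausdorff_space X" and A: "closedin X A" "locally_contractible (subtopology X A)"
    and \<Phi>: "continuous_map (top_of_set (disk k)) X \<Phi>"
    and emb: "embedding_map (top_of_set (odisk k)) X \<Phi>"
    and un: "topspace X = A \<union> \<Phi> ` odisk k" and dis: "A \<inter> \<Phi> ` odisk k = {}"
    and bd: "\<Phi> ` (disk k - odisk k) \<subseteq> A"
  shows "locally_contractible X"
  unfolding locally_contractible_def
proof (intro allI impI, elim conjE)
  fix x U assume U: "openin X U" "x \<in> U"
  let ?e = "\<Phi> ` odisk k"
  have hom: "homeomorphic_map (top_of_set (odisk k)) (subtopology X ?e) \<Phi>"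
    using emb unfolding embedding_map_def by simp
  have oe: "openin X ?e"
  proof -
    have "?e = topspace X - A" using un dis by blast
    then show ?thesis using A(1) by (simp add: openin_diff)
  qed
  show "\<exists>V. openin X V \<and> x \<in> V \<and> V \<subseteq> U \<and>
     homotopic_with (\<lambda>f. f x = x) (subtopology X V) (subtopology X U) id (\<lambda>_. x)"
  proof (cases "x \<in> ?e")
    case True
    then show ?thesis
      using locally_contractible_at_open_embedding[OF hom oe] locally_contractible_open_disk[of k] U
      by (simp add: open_disk_eq)
  next
    case False
    then have xA: "x \<in> A" using U un openin_subset by blast
    let ?I = "top_of_set {0..1::real}" and ?D = "top_of_set (disk k)"
    let ?n = "\<lambda>z::nat \<Rightarrow> real. L2_set z {..<k}"
    let ?o = "(\<lambda>_. 0) :: nat \<Rightarrow> real"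
    define c where "c = \<Phi> ?o"
    define \<psi> where "\<psi> = inv_into (odisk k) \<Phi>"
    \<comment> \<open>The scaling factor is such that the radius \<open>?n\<close> moves linearly to
      1, see \<open>nrad\<close>; points of the boundary sphere stay fixed at all times.\<close>
    define rad :: "real \<times> (nat \<Rightarrow> real) \<Rightarrow> nat \<Rightarrow> real" where
      "rad w = (\<lambda>i. ((1 - fst w) + fst w / ?n (snd w)) * snd w i)" for w
    define R :: "real \<times> 'a \<Rightarrow> 'a" where
      "R w = (if snd w \<in> A then snd w else \<Phi> (rad (fst w, \<psi> (snd w))))" for w
    have inj: "inj_on \<Phi> (odisk k)" using homeomorphic_imp_injective_map[OF hom] by simp
    have disk_n: "z \<in> disk k \<longleftrightarrow> (\<forall>i\<ge>k. z i = 0) \<and> ?n z \<le> 1"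
      and odisk_n: "z \<in> odisk k \<longleftrightarrow> (\<forall>i\<ge>k. z i = 0) \<and> ?n z < 1" for z
      by (auto simp: disk_def odisk_def L2_set_lessThan_le_1 L2_set_lessThan_less_1)
    have od: "odisk k \<subseteq> disk k" "?o \<in> odisk k" by (auto simp: disk_def odisk_def)
    have ce: "c \<in> ?e" "c \<notin> A" using od(2) dis unfolding c_def by blast+
    have npos: "?n z > 0" if z: "z \<in> disk k" "z \<noteq> ?o" for z
    proof -
      obtain i where "z i \<noteq> 0" using z(2) by fastforce
      moreover from this have "i < k" using z(1) by (auto simp: disk_def not_le[symmetric])
      ultimately have "?n z \<noteq> 0" by (auto simp: L2_set_eq_0_iff)
      then show ?thesis using L2_set_nonneg[of z "{..<k}"] by linarith
    qed
    have nrad: "?n (rad (t, z)) = (1 - t) * ?n z + t" if "t \<in> {0..1}" "z \<in> disk k" "z \<noteq> ?o" for t z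
    proof -
      have p: "?n z > 0" using npos that by blast
      then have "0 \<le> (1 - t) + t / ?n z" using that(1) by simp
      then have "?n (rad (t, z)) = ((1 - t) + t / ?n z) * ?n z"
        unfolding rad_def by (simp add: L2_set_right_distrib)
      also have "\<dots> = (1 - t) * ?n z + t" using p by (simp add: distrib_right)
      finally show ?thesis .
    qed
    have rad_disk: "rad (t, z) \<in> disk k" if "t \<in> {0..1}" "z \<in> disk k" "z \<noteq> ?o" for t z
    proof -
      have "(1 - t) * ?n z \<le> (1 - t) * 1" using that disk_n by (intro mult_left_mono) auto
      then have "?n (rad (t, z)) \<le> 1" using nrad[OF that] by simp
      then show ?thesis using that(2) unfolding disk_n by (simp add: rad_def)
    qed
    have rad1: "rad (1, z) \<in> disk k - odisk k" if "z \<in> disk k" "z \<noteq> ?o" for z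
      using rad_disk[of 1 z] nrad[of 1 z] that odisk_n by simp
    have rad_bd: "rad (t, z) = z" if "z \<in> disk k" "z \<notin> odisk k" for t z
    proof -
      have "?n z = 1" using that disk_n odisk_n by fastforce
      then show ?thesis by (simp add: rad_def)
    qed
    have \<psi>: "\<psi> (\<Phi> z) = z" if "z \<in> odisk k" for z unfolding \<psi>_def using inj that by simp
    have R\<Phi>: "R (t, \<Phi> z) = \<Phi> (rad (t, z))" if "z \<in> disk k" for t z
    proof (cases "z \<in> odisk k")
      case True
      then have "\<Phi> z \<notin> A" using dis by blast
      then show ?thesis using \<psi>[OF True] by (simp add: R_def)
    next
      case False
      then have "\<Phi> z \<in> A" using bd that by blast
      then show ?thesis using rad_bd[OF that False] by (simp add: R_def)
    qed
    have zero: "z = ?o" if "z \<in> disk k" "\<Phi> z = c" for z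
    proof (cases "z \<in> odisk k")
      case True
      then show ?thesis using that(2) inj od(2) unfolding c_def inj_on_def by blast
    next
      case False
      then have "\<Phi> z \<in> A" using bd that by blast
      then show ?thesis using that(2) ce by simp
    qed
    have dX: "\<Phi> z \<in> topspace X" if "z \<in> disk k" for z using \<Phi> that by (auto simp: continuous_map_def)
    \<comment> \<open>The centre \<open>c\<close> is removed, since it has no radial
      direction.\<close>
    let ?S = "UNIV \<times> (- {c}) :: (real \<times> 'a) set"
    let ?P = "prod_topology ?I X"
    let ?W = "subtopology ?P ?S"
    let ?T1 = "{w \<in> topspace ?W. snd w \<in> A}" and ?T2 = "{w \<in> topspace ?W. snd w \<in> \<Phi> ` disk k}"
    have cD: "compact_space ?D" using compact_disk by (simp add: compact_space_subtopology)
    have cI: "compact_space ?I" by (metis compact_Icc compact_space_subtopology compactin_euclidean_iff)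
    have csnd: "continuous_map ?W X snd"
      by (intro continuous_map_from_subtopology continuous_map_snd)
    have "compactin X (\<Phi> ` disk k)"
      using image_compactin[OF _ \<Phi>, of "disk k"] cD compact_disk by (simp add: compactin_subtopology)
    then have cl\<Phi>: "closedin X (\<Phi> ` disk k)" using X compactin_imp_closedin by blast
    have cT1: "closedin ?W ?T1" by (rule closedin_continuous_map_preimage[OF csnd A(1)])
    have cT2: "closedin ?W ?T2" by (rule closedin_continuous_map_preimage[OF csnd cl\<Phi>])
    have R1: "continuous_map (subtopology ?W ?T1) X R"
      by (rule continuous_map_eq[OF continuous_map_from_subtopology[OF csnd]]) (auto simp: R_def)
    have R2: "continuous_map (subtopology ?W ?T2) X R"
    proof -
      \<comment> \<open>\<open>R\<close> lives on \<open>X\<close> but is computed on the disk. The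
        map \<open>q\<close> is closed, going from a compact to a Hausdorff space, so its
        restriction over the image of the disk without \<open>c\<close> is a quotient map, and
        continuity of \<open>R\<close> can be tested on \<open>R \<circ> q\<close>.\<close>
      define q where "q w = (fst w, \<Phi> (snd w))" for w :: "real \<times> (nat \<Rightarrow> real)"
      let ?U = "{w \<in> topspace (prod_topology ?I ?D). q w \<in> ?T2}"
      have cq: "continuous_map (prod_topology ?I ?D) ?P q"
        unfolding q_def using continuous_map_compose[OF continuous_map_snd \<Phi>, unfolded o_def]
        by (intro continuous_map_pairedI continuous_map_fst)
      have "compact_space (prod_topology ?I ?D)"
        by (simp add: prod_topology_subtopology_eu compact_space_subtopology compact_Times compact_disk)
      moreover have "Hausdorff_space ?P" using X by (simp add: Hausdorff_space_prod_topology Hausdorff_space_subtopology)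
      ultimately have clq: "closed_map (prod_topology ?I ?D) ?P q"
        using T1_Spaces.continuous_imp_closed_map[OF cq] by blast
      have sub: "subtopology ?W ?T2 = subtopology ?P ?T2"
        by (simp add: subtopology_subtopology) (rule arg_cong[where f = "subtopology ?P"], auto)
      have "closed_map (subtopology (prod_topology ?I ?D) ?U) (subtopology ?P ?T2) q"
        by (rule closed_map_restriction[OF clq]) simp
      moreover have "continuous_map (subtopology (prod_topology ?I ?D) ?U) (subtopology ?P ?T2) q"
        by (rule continuous_map_into_subtopology[OF continuous_map_from_subtopology[OF cq]]) auto
      moreover have "q ` topspace (subtopology (prod_topology ?I ?D) ?U) = topspace (subtopology ?P ?T2)"
      proof (intro equalityI subsetI)
        fix w assume "w \<in> q ` topspace (subtopology (prod_topology ?I ?D) ?U)"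
        then show "w \<in> topspace (subtopology ?P ?T2)" by auto
      next
        fix w assume "w \<in> topspace (subtopology ?P ?T2)"
        then have w: "w \<in> ?T2" "fst w \<in> {0..1}" by auto
        then obtain z where z: "z \<in> disk k" "snd w = \<Phi> z" by blast
        then have wq: "w = q (fst w, z)" by (simp add: q_def prod_eq_iff)
        have "q (fst w, z) \<in> ?T2" using w(1) unfolding wq[symmetric] .
        then have "(fst w, z) \<in> ?U" using w(2) z(1) by simp
        then have "(fst w, z) \<in> topspace (subtopology (prod_topology ?I ?D) ?U)" by simp
        then show "w \<in> q ` topspace (subtopology (prod_topology ?I ?D) ?U)" using wq image_eqI by blast
      qed
      ultimately have qm: "quotient_map (subtopology (prod_topology ?I ?D) ?U) (subtopology ?P ?T2) q"
        by (intro continuous_closed_imp_quotient_map)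
      have Umem: "fst w \<in> {0..1} \<and> snd w \<in> disk k \<and> snd w \<noteq> ?o" if "w \<in> ?U" for w
        using that unfolding q_def c_def by auto
      have "continuous_on ?U rad"
        unfolding rad_def
      proof (rule continuous_on_coordinatewise_then_product)
        fix i
        have co: "continuous_on ?U (\<lambda>w. snd w j)" for j
          by (intro continuous_on_coordinate continuous_on_snd continuous_on_id)
        then have "continuous_on ?U (\<lambda>w. ?n (snd w))"
          unfolding L2_set_def by (intro continuous_intros)
        then show "continuous_on ?U (\<lambda>w. ((1 - fst w) + fst w / ?n (snd w)) * snd w i)"
        proof (intro continuous_intros co)
          show "\<forall>w\<in>?U. ?n (snd w) \<noteq> 0"
          proof
            fix w assume "w \<in> ?U"
            then have "?n (snd w) > 0" using npos[of "snd w"] Umem by blast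
            then show "?n (snd w) \<noteq> 0" by simp
          qed
        qed
      qed
      moreover have "subtopology (prod_topology ?I ?D) ?U = top_of_set ?U"
      proof -
        have "prod_topology ?I ?D = top_of_set ({0..1} \<times> disk k)" by (simp add: prod_topology_subtopology_eu)
        moreover have "({0..1} \<times> disk k) \<inter> ?U = ?U" by auto
        ultimately show ?thesis by (simp only: subtopology_subtopology)
      qed
      moreover have "rad ` ?U \<subseteq> disk k" using rad_disk Umem by (metis (no_types, lifting) image_subsetI prod.collapse)
      ultimately have "continuous_map (subtopology (prod_topology ?I ?D) ?U) ?D rad"
        by (simp add: continuous_map_in_subtopology image_subset_iff_funcset)
      then have "continuous_map (subtopology (prod_topology ?I ?D) ?U) X (\<Phi> \<circ> rad)"
        by (rule continuous_map_compose[OF _ \<Phi>])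
      then have "continuous_map (subtopology (prod_topology ?I ?D) ?U) X (R \<circ> q)"
      proof (rule continuous_map_eq)
        fix w assume "w \<in> topspace (subtopology (prod_topology ?I ?D) ?U)"
        then have "w \<in> ?U" by auto
        then have "snd w \<in> disk k" using Umem by blast
        then show "(\<Phi> \<circ> rad) w = (R \<circ> q) w" using R\<Phi>[of "snd w" "fst w"] by (simp add: q_def)
      qed
      then show ?thesis unfolding sub by (rule continuous_compose_quotient_map[OF qm])
    qed
    \<comment> \<open>The two closed pieces are \<open>A\<close>, where \<open>R\<close> forgets the
      time, and the image of the closed disk, where \<open>R\<close> comes from
      \<open>rad\<close>.\<close>
    have RW: "continuous_map ?W X R"
    proof (rule pasting_lemma_closed[of "{?T1, ?T2}" ?W "\<lambda>T. T" X "\<lambda>_. R"])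
      show "\<exists>j. j \<in> {?T1, ?T2} \<and> w \<in> j \<and> R w = R w" if "w \<in> topspace ?W" for w
      proof -
        have "snd w \<in> A \<or> snd w \<in> \<Phi> ` disk k" using that un od(1) by auto
        then show ?thesis using that by blast
      qed
    qed (use cT1 cT2 R1 R2 in auto)
    let ?Y = "subtopology X (- {c})"
    have RY: "continuous_map (prod_topology ?I ?Y) X R" using RW unfolding prod_topology_subtopology_UNIV .
    have Y: "topspace ?Y = topspace X - {c}" by auto
    have oY: "openin X (topspace X - {c})"
    proof -
      have "closedin X {c}" using X closedin_Hausdorff_singleton oe ce(1) openin_subset by fastforce
      then show ?thesis by (simp add: openin_diff)
    qed
    have YY: "?Y = subtopology X (topspace X - {c})"
      by (simp add: Diff_eq subtopology_restrict)
    define r where "r y = R (1, y)" for y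
    have "continuous_map ?Y (prod_topology ?I ?Y) (\<lambda>y. (1, y))" by (intro continuous_map_pairedI) auto
    from continuous_map_compose[OF this RY] have "continuous_map ?Y X r" unfolding o_def r_def .
    moreover have "r y \<in> A" if y: "y \<in> topspace ?Y" for y
    proof (cases "y \<in> A")
      case False
      then obtain z where z: "z \<in> odisk k" "y = \<Phi> z" using y un by auto
      then have "z \<in> disk k" "z \<noteq> ?o" using od y unfolding c_def by auto
      then show ?thesis using rad1 R\<Phi>[of z 1] bd z unfolding r_def by blast
    qed (simp add: r_def R_def)
    ultimately have cr: "continuous_map ?Y (subtopology X A) r" by (intro continuous_map_into_subtopology) auto
    have RA: "R (t, y) = y" if "y \<in> A" for t y using that by (simp add: R_def)
    have R0: "R (0, y) = y" if y: "y \<in> topspace X" for y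
    proof (cases "y \<in> A")
      case False
      then obtain z where z: "z \<in> odisk k" "y = \<Phi> z" using y un by auto
      then show ?thesis using R\<Phi>[of z 0] od by (auto simp: rad_def)
    qed (simp add: RA)
    have "openin (subtopology X A) (U \<inter> A)" using U by (auto simp: openin_subtopology)
    then obtain VA where VA: "openin (subtopology X A) VA" "x \<in> VA" "VA \<subseteq> U \<inter> A"
      "homotopic_with (\<lambda>f. f x = x) (subtopology (subtopology X A) VA) (subtopology (subtopology X A) (U \<inter> A)) id (\<lambda>_. x)"
      using A(2) U(2) xA unfolding locally_contractible_def by (metis IntI)
    \<comment> \<open>The first condition keeps the radial push inside \<open>U\<close>; the second
      makes it end in \<open>VA\<close>, the neighbourhood that contracts inside
      \<open>A\<close>.\<close>
    define V where "V = {y \<in> topspace ?Y. \<forall>t\<in>{0..1}. R (t, y) \<in> U} \<inter> {y \<in> topspace ?Y. r y \<in> VA}"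
    have "openin ?Y V"
      unfolding V_def using openin_all_times[OF RY U(1)] openin_continuous_map_preimage[OF cr VA(1)] by blast
    then have oV: "openin X V" unfolding YY by (rule openin_trans_full[OF _ oY])
    have xV: "x \<in> V" using U xA RA ce VA(2) openin_subset[OF U(1)] unfolding V_def r_def by auto
    have VU: "V \<subseteq> U"
    proof
      fix y assume y: "y \<in> V"
      then have "R (0, y) \<in> U" unfolding V_def by simp
      then show "y \<in> U" using R0[of y] y unfolding V_def by simp
    qed
    have subV: "subtopology ?Y V = subtopology X V"
      unfolding subtopology_subtopology by (rule arg_cong[where f = "subtopology X"]) (auto simp: V_def)
    have xtV: "x \<in> topspace (subtopology X V)" using xV oV openin_subset by fastforce
    have "homotopic_with (\<lambda>f. f x = x) (subtopology X V) (subtopology X U) id r"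
    proof (rule homotopic_fixingI[OF xtV])
      have "continuous_map (prod_topology ?I (subtopology X V)) X R"
        using continuous_map_prod_subtopology[OF RY, of V] unfolding subV .
      then show "continuous_map (prod_topology ?I (subtopology X V)) (subtopology X U) R"
        by (rule continuous_map_into_subtopology) (auto simp: V_def)
    qed (use R0 RA xA in \<open>auto simp: r_def\<close>)
    moreover have "homotopic_with (\<lambda>f. f x = x) (subtopology X V) (subtopology X U) r (\<lambda>_. x)"
    proof -
      have "continuous_map (subtopology X V) (subtopology (subtopology X A) VA) r"
        using continuous_map_from_subtopology[OF cr, of V] unfolding subV
        by (rule continuous_map_into_subtopology) (auto simp: V_def)
      then have "homotopic_with (\<lambda>f. f x = x) (subtopology X V) (subtopology (subtopology X A) (U \<inter> A)) (id \<circ> r) ((\<lambda>_. x) \<circ> r)"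
        by (rule homotopic_with_compose_continuous_map_right[OF VA(4)]) (simp add: r_def RA xA)
      moreover have "continuous_map (subtopology (subtopology X A) (U \<inter> A)) (subtopology X U) id"
        by (rule continuous_map_into_subtopology[OF continuous_map_from_subtopology[OF continuous_map_from_subtopology[OF continuous_map_id]]]) auto
      ultimately have "homotopic_with (\<lambda>f. f x = x) (subtopology X V) (subtopology X U) (id \<circ> (id \<circ> r)) (id \<circ> ((\<lambda>_. x) \<circ> r))"
        by (rule homotopic_with_compose_continuous_map_left) simp
      then show ?thesis by (simp add: o_def)
    qed
    ultimately have "homotopic_with (\<lambda>f. f x = x) (subtopology X V) (subtopology X U) id (\<lambda>_. x)"
      by (rule homotopic_with_trans)
    then show ?thesis using oV xV VU by blast
  qed
qed

definition cw_structure :: "'a topology \<Rightarrow> nat set \<Rightarrow> (nat \<Rightarrow> nat) \<Rightarrow> (nat \<Rightarrow> (nat \<Rightarrow> real) \<Rightarrow> 'a) \<Rightarrow> bool" where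
  "cw_structure X I k \<Phi> \<longleftrightarrow> finite I \<and>
        (\<forall>i\<in>I. continuous_map (top_of_set (disk (k i))) X (\<Phi> i)) \<and>
        (\<forall>i\<in>I. embedding_map (top_of_set (odisk (k i))) X (\<Phi> i)) \<and>
        disjoint_family_on (\<lambda>i. \<Phi> i ` odisk (k i)) I \<and>
        (\<Union>i\<in>I. \<Phi> i ` odisk (k i)) = topspace X \<and>
        (\<forall>i\<in>I. \<Phi> i ` (disk (k i) - odisk (k i)) \<subseteq> (\<Union>j\<in>{j\<in>I. k j < k i}. \<Phi> j ` odisk (k j)))"

text \<open>Induction on the number of cells, removing one of maximal dimension. No boundary meets
  it, so the other cells form a closed subcomplex to which it is attached.\<close>

lemma cw_structure_locally_contractible:
  assumes "Hausdorff_space X" "cw_structure X I k \<Phi>"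
  shows "locally_contractible X"
  using assms
proof (induction "card I" arbitrary: X I)
  case 0
  then have "topspace X = {}" unfolding cw_structure_def by auto
  then show ?case unfolding locally_contractible_def using openin_subset by fastforce
next
  case (Suc n)
  note X = \<open>Hausdorff_space X\<close>
  have fin: "finite I" and cont: "\<And>i. i \<in> I \<Longrightarrow> continuous_map (top_of_set (disk (k i))) X (\<Phi> i)"
    and emb: "\<And>i. i \<in> I \<Longrightarrow> embedding_map (top_of_set (odisk (k i))) X (\<Phi> i)"
    and dis: "disjoint_family_on (\<lambda>i. \<Phi> i ` odisk (k i)) I"
    and un: "(\<Union>i\<in>I. \<Phi> i ` odisk (k i)) = topspace X"
    and bd: "\<And>i. i \<in> I \<Longrightarrow> \<Phi> i ` (disk (k i) - odisk (k i)) \<subseteq> (\<Union>j\<in>{j\<in>I. k j < k i}. \<Phi> j ` odisk (k j))"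
    using Suc.prems(2) unfolding cw_structure_def by auto
  have "I \<noteq> {}" using Suc.hyps(2) by auto
  then have "Max (k ` I) \<in> k ` I" using fin by (intro Max_in) auto
  then obtain i where i: "i \<in> I" "k i = Max (k ` I)" by auto
  have mx: "k j \<le> k i" if "j \<in> I" for j using that fin i(2) by simp
  let ?J = "I - {i}"
  define A where "A = (\<Union>j\<in>?J. \<Phi> j ` odisk (k j))"
  have bdA: "\<Phi> j ` (disk (k j) - odisk (k j)) \<subseteq> (\<Union>l\<in>{l\<in>?J. k l < k j}. \<Phi> l ` odisk (k l))" if j: "j \<in> I" for j
  proof -
    \<comment> \<open>No cell has dimension above \<open>k i\<close>, so \<open>i\<close> is not
      among the cells of dimension below \<open>k j\<close>.\<close>
    have "{l\<in>I. k l < k j} = {l\<in>?J. k l < k j}" using mx[OF j] by auto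
    then show ?thesis using bd[OF j] by simp
  qed
  have bdA': "\<Phi> j ` (disk (k j) - odisk (k j)) \<subseteq> A" if j: "j \<in> I" for j
    using bdA[OF j] unfolding A_def by blast
  have od: "odisk m \<subseteq> disk m" for m by (auto simp: disk_def odisk_def)
  have diskA: "\<Phi> j ` disk (k j) \<subseteq> A" if j: "j \<in> ?J" for j
  proof -
    have "disk (k j) = odisk (k j) \<union> (disk (k j) - odisk (k j))" using od by blast
    then show ?thesis using bdA'[of j] j unfolding A_def by blast
  qed
  have "A = (\<Union>j\<in>?J. \<Phi> j ` disk (k j))"
  proof
    show "A \<subseteq> (\<Union>j\<in>?J. \<Phi> j ` disk (k j))" unfolding A_def using od by blast
    show "(\<Union>j\<in>?J. \<Phi> j ` disk (k j)) \<subseteq> A" using diskA by blast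
  qed
  moreover have "closedin X (\<Phi> j ` disk (k j))" if j: "j \<in> ?J" for j
  proof -
    have "compactin X (\<Phi> j ` disk (k j))"
      by (rule image_compactin[OF _ cont]) (use compact_disk j in \<open>auto simp: compactin_subtopology\<close>)
    then show ?thesis using X compactin_imp_closedin by blast
  qed
  then have "closedin X (\<Union>j\<in>?J. \<Phi> j ` disk (k j))" using fin by (intro closedin_Union) auto
  ultimately have clA: "closedin X A" by simp
  have AX: "A \<subseteq> topspace X" using un unfolding A_def by blast
  have "cw_structure (subtopology X A) ?J k \<Phi>"
    unfolding cw_structure_def
  proof (intro conjI ballI)
    show "finite ?J" using fin by simp
    fix j assume j: "j \<in> ?J"
    show "continuous_map (top_of_set (disk (k j))) (subtopology X A) (\<Phi> j)"
      using cont[of j] j diskA[OF j] by (intro continuous_map_into_subtopology) auto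
    have "\<Phi> j ` odisk (k j) \<subseteq> A" unfolding A_def using j by blast
    then have "subtopology (subtopology X A) (\<Phi> j ` odisk (k j)) = subtopology X (\<Phi> j ` odisk (k j))"
      by (simp add: subtopology_subtopology Int_absorb1)
    then show "embedding_map (top_of_set (odisk (k j))) (subtopology X A) (\<Phi> j)"
      using emb[of j] j unfolding embedding_map_def by simp
    show "\<Phi> j ` (disk (k j) - odisk (k j)) \<subseteq> (\<Union>l\<in>{l\<in>?J. k l < k j}. \<Phi> l ` odisk (k l))"
      using bdA[of j] j by blast
  next
    show "disjoint_family_on (\<lambda>i. \<Phi> i ` odisk (k i)) ?J"
      using dis by (rule disjoint_family_on_mono[rotated]) blast
    show "(\<Union>i\<in>?J. \<Phi> i ` odisk (k i)) = topspace (subtopology X A)"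
      using AX unfolding A_def by auto
  qed
  moreover have "Hausdorff_space (subtopology X A)" using X by (rule Hausdorff_space_subtopology)
  moreover have "n = card ?J" using Suc.hyps(2) fin i(1) by simp
  ultimately have LA: "locally_contractible (subtopology X A)" using Suc.hyps(1) by blast
  have "topspace X = A \<union> \<Phi> i ` odisk (k i)" using un i(1) unfolding A_def by blast
  moreover have "A \<inter> \<Phi> i ` odisk (k i) = {}" using dis i(1) unfolding A_def disjoint_family_on_def by blast
  ultimately show ?case
    by (rule locally_contractible_attach_cell[OF X clA LA cont[OF i(1)] emb[OF i(1)] _ _ bdA'[OF i(1)]])
qed

lemma finite_CW_complex_imp:
  assumes "finite_CW_complex X"
  shows "Hausdorff_space X" "compact_space X" "locally_contractible X"
proof -
  show X: "Hausdorff_space X" using assms by (simp add: finite_CW_complex_def)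
  obtain I k \<Phi> where cw: "cw_structure X I k \<Phi>"
    using assms unfolding finite_CW_complex_def cw_structure_def closed_disk_eq open_disk_eq
    by (auto simp: topspace_euclidean_subtopology)
  then show "locally_contractible X" by (rule cw_structure_locally_contractible[OF X])
  have od: "odisk m \<subseteq> disk m" for m by (auto simp: disk_def odisk_def)
  have fin: "finite I" and cont: "\<And>i. i \<in> I \<Longrightarrow> continuous_map (top_of_set (disk (k i))) X (\<Phi> i)"
    and un: "(\<Union>i\<in>I. \<Phi> i ` odisk (k i)) = topspace X"
    using cw unfolding cw_structure_def by auto
  have "(\<Union>i\<in>I. \<Phi> i ` disk (k i)) = topspace X"
  proof
    show "(\<Union>i\<in>I. \<Phi> i ` disk (k i)) \<subseteq> topspace X"
      using cont continuous_map_image_subset_topspace by fastforce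
    show "topspace X \<subseteq> (\<Union>i\<in>I. \<Phi> i ` disk (k i))"
      unfolding un[symmetric] using od by blast
  qed
  moreover have "compactin X (\<Union>i\<in>I. \<Phi> i ` disk (k i))"
  proof (rule compactin_Union)
    show "finite ((\<lambda>i. \<Phi> i ` disk (k i)) ` I)" using fin by blast
    show "compactin X K" if "K \<in> (\<lambda>i. \<Phi> i ` disk (k i)) ` I" for K
      using that image_compactin[OF _ cont] compact_disk by (auto simp: compactin_subtopology)
  qed
  ultimately show "compact_space X" by (simp add: compact_space_def)
qed

section \<open>Inverse systems of compact spaces\<close>

lemma bonding_map_refl [simp]: "bonding_map s n n = id"
  by (cases n) simp_all

lemma bonding_map_trans:
  assumes "n \<le> m" "m \<le> k"
  shows "bonding_map s n k y = bonding_map s n m (bonding_map s m k y)"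
  using assms(2,1) by (induction k arbitrary: y rule: dec_induct) auto

lemma bonding_map_step:
  assumes "n < m" shows "bonding_map s n m y = s (Suc n) (bonding_map s (Suc n) m y)"
  using bonding_map_trans[of n "Suc n" m s y] assms by simp

text \<open>\<open>separating\<close> and \<open>thread\<close> identify \<open>L\<close> with the
  set of threads. Its topology is then right as well, because a continuous bijection from a compact
  space to a Hausdorff space is a homeomorphism. In this form total spaces of bundles can be checked
  to be instances directly.\<close>

locale inverse_system =
  fixes X :: "nat \<Rightarrow> 'c topology" and s :: "nat \<Rightarrow> 'c \<Rightarrow> 'c" and L :: "'x topology" and \<pi> :: "nat \<Rightarrow> 'x \<Rightarrow> 'c"
  assumes compact_X: "compact_space (X n)" and Hausdorff_X: "Hausdorff_space (X n)"
    and continuous_s: "continuous_map (X (Suc n)) (X n) (s (Suc n))"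
    and continuous_\<pi>: "continuous_map L (X n) (\<pi> n)"
    and compat: "x \<in> topspace L \<Longrightarrow> s (Suc n) (\<pi> (Suc n) x) = \<pi> n x"
    and separating: "x \<in> topspace L \<Longrightarrow> y \<in> topspace L \<Longrightarrow> (\<And>n. \<pi> n x = \<pi> n y) \<Longrightarrow> x = y"
    and thread: "(\<And>n. t n \<in> topspace (X n)) \<Longrightarrow> (\<And>n. s (Suc n) (t (Suc n)) = t n) \<Longrightarrow>
      \<exists>x\<in>topspace L. \<forall>n. \<pi> n x = t n"
    and compact_L: "compact_space L"
begin

lemma continuous_bonding_map: "n \<le> m \<Longrightarrow> continuous_map (X m) (X n) (bonding_map s n m)"
proof (induction m rule: dec_induct)
  case base then show ?case by simp
next
  case (step m)
  have "bonding_map s n (Suc m) = bonding_map s n m \<circ> s (Suc m)" using step by simp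
  then show ?case using continuous_map_compose[OF continuous_s step.IH] by metis
qed

lemma bonding_map_\<pi>: "n \<le> m \<Longrightarrow> x \<in> topspace L \<Longrightarrow> bonding_map s n m (\<pi> m x) = \<pi> n x"
  by (induction m rule: dec_induct) (simp_all add: compat)

lemma \<pi>_in: "x \<in> topspace L \<Longrightarrow> \<pi> n x \<in> topspace (X n)"
  using continuous_\<pi> by (auto simp: continuous_map_def)

lemma bonding_map_in: "n \<le> m \<Longrightarrow> y \<in> topspace (X m) \<Longrightarrow> bonding_map s n m y \<in> topspace (X n)"
  using continuous_bonding_map by (auto simp: continuous_map_def)

lemma \<pi>_eq_mono:
  assumes "n \<le> m" "x \<in> topspace L" "y \<in> topspace L" "\<pi> m x = \<pi> m y"
  shows "\<pi> n x = \<pi> n y"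
  using assms bonding_map_\<pi> by metis

lemma Hausdorff_L: "Hausdorff_space L"
  unfolding Hausdorff_space_def
proof (intro allI impI, elim conjE)
  fix x y assume xy: "x \<in> topspace L" "y \<in> topspace L" "x \<noteq> y"
  then obtain n where "\<pi> n x \<noteq> \<pi> n y" using separating by blast
  then obtain U V where UV: "openin (X n) U" "openin (X n) V" "\<pi> n x \<in> U" "\<pi> n y \<in> V" "disjnt U V"
    using Hausdorff_X[of n] \<pi>_in xy unfolding Hausdorff_space_def by meson
  let ?U = "{x \<in> topspace L. \<pi> n x \<in> U}" and ?V = "{x \<in> topspace L. \<pi> n x \<in> V}"
  have "openin L ?U" "openin L ?V" using openin_continuous_map_preimage[OF continuous_\<pi>] UV by blast+
  moreover have "x \<in> ?U" "y \<in> ?V" "disjnt ?U ?V" using xy UV by (auto simp: disjnt_iff)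
  ultimately show "\<exists>U V. openin L U \<and> openin L V \<and> x \<in> U \<and> y \<in> V \<and> disjnt U V" by blast
qed

text \<open>If every later stage had a point over \<open>C\<close>, the sets \<open>T k\<close> of
  families that are compatible up to \<open>k\<close> and hit \<open>C\<close> would be nonempty,
  closed and decreasing in a compact product; a common element would be a thread through
  \<open>C\<close>. This is how a closed condition that fails on \<open>L\<close> is made to fail on
  a whole stage.\<close>

lemma vanishing_stage:
  assumes C: "closedin (X n) C" and e: "\<And>x. x \<in> topspace L \<Longrightarrow> \<pi> n x \<notin> C"
  obtains m where "n \<le> m" "\<And>y. y \<in> topspace (X m) \<Longrightarrow> bonding_map s n m y \<notin> C"
proof (rule ccontr)
  note finish = that
  assume "\<not> thesis"
  then have ne: "\<exists>y\<in>topspace (X m). bonding_map s n m y \<in> C" if "n \<le> m" for m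
    using finish[of m] that by blast
  let ?P = "product_topology X UNIV"
  define T where "T k = {t \<in> topspace ?P. t n \<in> C \<and> (\<forall>j<k. s (Suc j) (t (Suc j)) = t j)}" for k
  have cl: "closedin ?P (T k)" for k
  proof -
    have "closedin ?P {t \<in> topspace ?P. t n \<in> C}"
      by (rule closedin_continuous_map_preimage[OF continuous_map_product_projection[of n UNIV X] C]) simp
    moreover have "closedin ?P {t \<in> topspace ?P. s (Suc j) (t (Suc j)) = t j}" for j
    proof (rule closedin_continuous_maps_eq[OF Hausdorff_X])
      show "continuous_map ?P (X j) (\<lambda>t. t j)" by (rule continuous_map_product_projection) simp
      have "continuous_map ?P (X (Suc j)) (\<lambda>t. t (Suc j))" by (rule continuous_map_product_projection) simp
      from continuous_map_compose[OF this continuous_s] show "continuous_map ?P (X j) (\<lambda>t. s (Suc j) (t (Suc j)))"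
        by (simp add: o_def)
    qed
    moreover have "T k = {t \<in> topspace ?P. t n \<in> C} \<inter> (\<Inter>j\<in>{..<k}. {t \<in> topspace ?P. s (Suc j) (t (Suc j)) = t j})"
      if "k > 0" using that unfolding T_def by auto
    moreover have "T 0 = {t \<in> topspace ?P. t n \<in> C}" unfolding T_def by simp
    ultimately show ?thesis
      by (cases "k = 0") (auto intro!: closedin_Int closedin_Inter simp del: topspace_product_topology)
  qed
  have nonempty: "T k \<noteq> {}" for k
  proof -
    have Xne: "\<exists>z. z \<in> topspace (X j)" for j
    proof -
      obtain y where "y \<in> topspace (X (max n j))" using ne[of "max n j"] by auto
      then show ?thesis using bonding_map_in[of j "max n j"] by auto
    qed
    then obtain z where z: "\<And>j. z j \<in> topspace (X j)" by metis
    obtain y where y: "y \<in> topspace (X (max n k))" "bonding_map s n (max n k) y \<in> C" using ne[of "max n k"] by auto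
    \<comment> \<open>Up to the stage of \<open>y\<close> the family consists of images of
      \<open>y\<close>; beyond it there is no condition yet, and arbitrary points \<open>z j\<close>
      fill up.\<close>
    define t where "t j = (if j \<le> max n k then bonding_map s j (max n k) y else z j)" for j
    have "t \<in> T k"
      unfolding T_def
    proof (intro CollectI conjI allI impI)
      show "t \<in> topspace ?P" using y(1) z bonding_map_in by (auto simp: t_def)
      show "t n \<in> C" using y(2) by (simp add: t_def)
      fix j assume "j < k"
      then have "j < max n k" "Suc j \<le> max n k" "j \<le> max n k" by simp_all
      then show "s (Suc j) (t (Suc j)) = t j"
        using bonding_map_step[of j "max n k" s y] unfolding t_def by (simp only: if_True)
    qed
    then show ?thesis by blast
  qed
  have "compact_space ?P" using compact_X by (simp add: compact_space_product_topology)
  moreover have "decseq T" unfolding decseq_def T_def by auto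
  ultimately have "(\<Inter>k. T k) \<noteq> {}" using compact_space_imp_nest[of ?P T] cl nonempty by blast
  then obtain t where t: "\<And>k. t \<in> T k" by blast
  have "t j \<in> topspace (X j)" for j using t[of 0] unfolding T_def by auto
  moreover have "s (Suc j) (t (Suc j)) = t j" for j using t[of "Suc j"] unfolding T_def by auto
  ultimately obtain x where "x \<in> topspace L" "\<And>j. \<pi> j x = t j" using thread by blast
  then show False using e t[of 0] unfolding T_def by force
qed

text \<open>Otherwise the closed sets of pairs in \<open>K \<times> K'\<close> with equal images at
  stage \<open>m\<close> are nonempty and decreasing, and a pair lying in all of them would be a
  common point of \<open>K\<close> and \<open>K'\<close>.\<close>

lemma separating_stage:
  assumes K: "closedin L K" and K': "closedin L K'" and dis: "K \<inter> K' = {}"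
  obtains m where "\<pi> m ` K \<inter> \<pi> m ` K' = {}"
proof (rule ccontr)
  assume n: "\<not> thesis"
  let ?P = "prod_topology L L"
  define Z where "Z m = {z \<in> topspace ?P. \<pi> m (fst z) = \<pi> m (snd z)} \<inter> K \<times> K'" for m
  have "closedin ?P (Z m)" for m
  proof -
    have "closedin ?P {z \<in> topspace ?P. (\<pi> m \<circ> fst) z = (\<pi> m \<circ> snd) z}"
      by (rule closedin_continuous_maps_eq[OF Hausdorff_X[of m]])
        (intro continuous_map_compose[OF _ continuous_\<pi>] continuous_map_fst continuous_map_snd)+
    moreover have "closedin ?P (K \<times> K')" using K K' by (simp add: closedin_prod_Times_iff)
    ultimately show ?thesis unfolding Z_def by (auto simp: o_def)
  qed
  moreover have "Z m \<noteq> {}" for m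
  proof -
    have "\<pi> m ` K \<inter> \<pi> m ` K' \<noteq> {}" using n that by blast
    then obtain x y where "x \<in> K" "y \<in> K'" "\<pi> m x = \<pi> m y" by blast
    then have "(x, y) \<in> Z m" using closedin_subset[OF K] closedin_subset[OF K'] unfolding Z_def by auto
    then show ?thesis by blast
  qed
  moreover have "decseq Z" unfolding decseq_def Z_def using \<pi>_eq_mono by (fastforce simp: mem_Times_iff)
  moreover have "compact_space ?P" using compact_L by (simp add: compact_space_prod_topology)
  ultimately have "(\<Inter>m. Z m) \<noteq> {}" using compact_space_imp_nest[of ?P Z] by blast
  then obtain z where z: "\<And>m. z \<in> Z m" by blast
  then have "fst z = snd z" using separating unfolding Z_def by (auto simp: mem_Times_iff)
  then show False using z[of 0] dis unfolding Z_def by auto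
qed

lemma separating_opens:
  assumes K: "closedin L K" and K': "closedin L K'" and dis: "K \<inter> K' = {}"
  obtains m A B where "openin (X m) A" "openin (X m) B" "disjnt A B" "\<pi> m ` K \<subseteq> A" "\<pi> m ` K' \<subseteq> B"
proof -
  obtain m where m: "\<pi> m ` K \<inter> \<pi> m ` K' = {}" using separating_stage[OF assms] by blast
  have "compactin (X m) (\<pi> m ` K)" "compactin (X m) (\<pi> m ` K')"
    using image_compactin[OF closedin_compact_space[OF compact_L] continuous_\<pi>] K K' by blast+
  then obtain A B where "openin (X m) A" "openin (X m) B" "\<pi> m ` K \<subseteq> A" "\<pi> m ` K' \<subseteq> B" "disjnt A B"
    using Hausdorff_space_compact_separation[OF Hausdorff_X] m by (metis disjnt_def)
  then show ?thesis using that by blast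
qed

text \<open>At some stage the images of \<open>S\<close> and of its complement lie in disjoint open
  sets \<open>A\<close> and \<open>B\<close>, but these need not cover that stage. The closed
  remainder is missed by \<open>L\<close>, hence by the image of a later stage \<open>m\<close>,
  where the preimage of \<open>A\<close> becomes clopen.\<close>

lemma clopen_from_stage:
  assumes S: "openin L S" "closedin L S"
  obtains m S' where "openin (X m) S'" "closedin (X m) S'" "\<And>x. x \<in> topspace L \<Longrightarrow> x \<in> S \<longleftrightarrow> \<pi> m x \<in> S'"
proof -
  have "closedin L (topspace L - S)" using S(1) by blast
  then obtain n A B where AB: "openin (X n) A" "openin (X n) B" "disjnt A B" "\<pi> n ` S \<subseteq> A" "\<pi> n ` (topspace L - S) \<subseteq> B"
    using separating_opens[OF S(2)] by blast
  have "closedin (X n) (topspace (X n) - (A \<union> B))" using AB by (intro closedin_diff) auto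
  moreover have "\<pi> n x \<notin> topspace (X n) - (A \<union> B)" if "x \<in> topspace L" for x using AB(4,5) that by blast
  ultimately obtain m where m: "n \<le> m" "\<And>y. y \<in> topspace (X m) \<Longrightarrow> bonding_map s n m y \<notin> topspace (X n) - (A \<union> B)"
    using vanishing_stage by blast
  let ?S = "{y \<in> topspace (X m). bonding_map s n m y \<in> A}"
  have "openin (X m) ?S" by (rule openin_continuous_map_preimage[OF continuous_bonding_map[OF m(1)] AB(1)])
  moreover have "closedin (X m) ?S"
  proof -
    have eq: "?S = topspace (X m) - {y \<in> topspace (X m). bonding_map s n m y \<in> B}"
      using m bonding_map_in AB(3) by (auto simp: disjnt_iff)
    have "openin (X m) {y \<in> topspace (X m). bonding_map s n m y \<in> B}"
      by (rule openin_continuous_map_preimage[OF continuous_bonding_map[OF m(1)] AB(2)])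
    then show ?thesis unfolding eq by (rule closedin_diff[OF closedin_topspace])
  qed
  moreover have "x \<in> S \<longleftrightarrow> \<pi> m x \<in> ?S" if x: "x \<in> topspace L" for x
    using x AB(3-5) bonding_map_\<pi>[OF m(1) x] \<pi>_in[OF x] by (auto simp: disjnt_iff)
  ultimately show ?thesis using that by blast
qed

text \<open>The closed set \<open>C\<close> between \<open>O'\<close> and the preimage condition is
  there for overlaps that must be closed at a stage before \<open>vanishing_stage\<close> can be
  applied to them.\<close>

lemma basic_neighbourhood:
  assumes U: "openin L U" "x \<in> U"
  obtains m O' C where "openin (X m) O'" "closedin (X m) C" "O' \<subseteq> C" "\<pi> m x \<in> O'"
    "\<And>y. y \<in> topspace L \<Longrightarrow> \<pi> m y \<in> C \<Longrightarrow> y \<in> U"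
proof -
  have xL: "x \<in> topspace L" using U openin_subset by blast
  have "closedin L {x}" by (rule closedin_Hausdorff_singleton[OF Hausdorff_L xL])
  moreover have "closedin L (topspace L - U)" using U(1) by blast
  moreover have "{x} \<inter> (topspace L - U) = {}" using U(2) by blast
  ultimately obtain m A B where AB: "openin (X m) A" "openin (X m) B" "disjnt A B" "\<pi> m ` {x} \<subseteq> A" "\<pi> m ` (topspace L - U) \<subseteq> B"
    by (rule separating_opens)
  show ?thesis
  proof (rule that[of m A "topspace (X m) - B"])
    show "A \<subseteq> topspace (X m) - B" using AB openin_subset by (fastforce simp: disjnt_iff)
    show "y \<in> U" if "y \<in> topspace L" "\<pi> m y \<in> topspace (X m) - B" for y using that AB(5) by blast
  qed (use AB in auto)
qed

lemma connected_limit: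
  assumes "\<And>n. connected_space (X n)"
  shows "connected_space L"
  unfolding connected_space_clopen_in
proof (intro allI impI, elim conjE)
  fix S assume "openin L S" "closedin L S"
  then obtain m S' where S': "openin (X m) S'" "closedin (X m) S'" "\<And>x. x \<in> topspace L \<Longrightarrow> x \<in> S \<longleftrightarrow> \<pi> m x \<in> S'"
    using clopen_from_stage by blast
  have "S' = {} \<or> S' = topspace (X m)" using assms S'(1,2) unfolding connected_space_clopen_in by blast
  then show "S = {} \<or> S = topspace L"
    using S'(3) \<pi>_in openin_subset[OF \<open>openin L S\<close>] by blast
qed

text \<open>Renumbering lets a bundle that is given at stage \<open>n\<close> be treated as one over
  stage 0.\<close>

lemma inverse_system_shift: "inverse_system (\<lambda>k. X (n + k)) (\<lambda>k. s (n + k)) L (\<lambda>k. \<pi> (n + k))"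
proof
  show "compact_space L" by (rule compact_L)
  show "compact_space (X (n + k))" "Hausdorff_space (X (n + k))" for k by (rule compact_X Hausdorff_X)+
  show "continuous_map (X (n + Suc k)) (X (n + k)) (s (n + Suc k))" for k using continuous_s[of "n + k"] by simp
  show "continuous_map L (X (n + k)) (\<pi> (n + k))" for k by (rule continuous_\<pi>)
  show "s (n + Suc k) (\<pi> (n + Suc k) x) = \<pi> (n + k) x" if "x \<in> topspace L" for k x
    using compat[OF that, of "n + k"] by simp
  show "x = y" if xy: "x \<in> topspace L" "y \<in> topspace L" and eq: "\<And>k. \<pi> (n + k) x = \<pi> (n + k) y" for x y
  proof (rule separating[OF xy])
    show "\<pi> j x = \<pi> j y" for j using \<pi>_eq_mono[of j "n + j" x y] xy eq[of j] by simp
  qed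
  show "\<exists>x\<in>topspace L. \<forall>k. \<pi> (n + k) x = t k"
    if t: "\<And>k. t k \<in> topspace (X (n + k))" "\<And>k. s (n + Suc k) (t (Suc k)) = t k" for t
  proof -
    \<comment> \<open>A thread that starts at stage \<open>n\<close> is completed downwards by
      bonding maps.\<close>
    define t' where "t' j = (if n \<le> j then t (j - n) else bonding_map s j n (t 0))" for j
    have "t' j \<in> topspace (X j)" for j
    proof (cases "n \<le> j")
      case True then show ?thesis using t(1)[of "j - n"] by (simp add: t'_def)
    next
      case False then show ?thesis using bonding_map_in[of j n "t 0"] t(1)[of 0] by (simp add: t'_def)
    qed
    moreover have "s (Suc j) (t' (Suc j)) = t' j" for j
    proof -
      consider "n \<le> j" | "Suc j = n" | "Suc j < n" by linarith
      then show ?thesis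
      proof cases
        case 1 then show ?thesis using t(2)[of "j - n"] by (simp add: t'_def Suc_diff_le)
      next
        case 2 then show ?thesis using bonding_map_step[of j n s "t 0"] by (auto simp: t'_def)
      next
        case 3 then show ?thesis using bonding_map_step[of j n s "t 0"] by (simp add: t'_def)
      qed
    qed
    ultimately obtain x where x: "x \<in> topspace L" "\<And>j. \<pi> j x = t' j" using thread by blast
    then have "\<pi> (n + k) x = t k" for k by (simp add: t'_def)
    then show ?thesis using x(1) by blast
  qed
qed

end

section \<open>Bundles over an inverse system\<close>

lemma gbundle_cong:
  assumes "\<And>x y. x \<in> topspace X \<Longrightarrow> y \<in> topspace X \<Longrightarrow> \<kappa> x y = \<kappa>' x y"
  shows "gbundle X G \<kappa> = gbundle X G \<kappa>'"
proof -
  have "openin (gbundle X G \<kappa>) S \<longleftrightarrow> openin (gbundle X G \<kappa>') S" for S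
  proof (cases "S \<subseteq> topspace X \<times> carrier G")
    case True
    have "(\<forall>y\<in>U. (y, g \<otimes>\<^bsub>G\<^esub> \<kappa> x y) \<in> S) \<longleftrightarrow> (\<forall>y\<in>U. (y, g \<otimes>\<^bsub>G\<^esub> \<kappa>' x y) \<in> S)"
      if "openin X U" "(x, g) \<in> S" for U x g
      using assms that openin_subset True by (metis (no_types, lifting) mem_Sigma_iff subsetD)
    then show ?thesis unfolding openin_gbundle by meson
  qed (simp add: openin_gbundle)
  then show ?thesis by (simp add: topology_eq)
qed

text \<open>The maps between pulled back bundles leave the fibre coordinate alone, so a thread of
  bundle points is a thread in the base together with one element of \<open>G\<close>. Compactness
  comes from finiteness of \<open>G\<close>.\<close>

lemma (in inverse_system) inverse_system_gbundle:
  assumes G: "group G" "finite (carrier G)" and c: "germ_cocycle (X 0) G \<kappa>"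
  defines "\<kappa>' \<equiv> \<lambda>n x y. \<kappa> (bonding_map s 0 n x) (bonding_map s 0 n y)"
  shows "inverse_system (\<lambda>n. gbundle (X n) G (\<kappa>' n)) (\<lambda>n e. (s n (fst e), snd e))
     (gbundle L G (\<lambda>x y. \<kappa> (\<pi> 0 x) (\<pi> 0 y))) (\<lambda>n e. (\<pi> n (fst e), snd e))"
proof
  have c': "germ_cocycle (X n) G (\<kappa>' n)" for n
    unfolding \<kappa>'_def by (rule germ_cocycle_pullback[OF c continuous_bonding_map]) simp
  have cL: "germ_cocycle L G (\<lambda>x y. \<kappa> (\<pi> 0 x) (\<pi> 0 y))" by (rule germ_cocycle_pullback[OF c continuous_\<pi>])
  have t: "topspace (gbundle (X n) G (\<kappa>' n)) = topspace (X n) \<times> carrier G" for n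
    by (rule topspace_gbundle[OF G(1) c'])
  have tL: "topspace (gbundle L G (\<lambda>x y. \<kappa> (\<pi> 0 x) (\<pi> 0 y))) = topspace L \<times> carrier G"
    by (rule topspace_gbundle[OF G(1) cL])
  show "compact_space (gbundle (X n) G (\<kappa>' n))" for n by (rule compact_space_gbundle[OF G(1) c' G(2) compact_X])
  show "compact_space (gbundle L G (\<lambda>x y. \<kappa> (\<pi> 0 x) (\<pi> 0 y)))" by (rule compact_space_gbundle[OF G(1) cL G(2) compact_L])
  show "Hausdorff_space (gbundle (X n) G (\<kappa>' n))" for n
    by (rule Hausdorff_space_covering[OF gbundle_covering[OF G(1) c'] Hausdorff_X])
  show "continuous_map (gbundle (X (Suc n)) G (\<kappa>' (Suc n))) (gbundle (X n) G (\<kappa>' n)) (\<lambda>e. (s (Suc n) (fst e), snd e))" for n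
    using continuous_map_gbundle_pullback[OF G(1) c'[of n] continuous_s[of n]] by (simp add: \<kappa>'_def)
  show "continuous_map (gbundle L G (\<lambda>x y. \<kappa> (\<pi> 0 x) (\<pi> 0 y))) (gbundle (X n) G (\<kappa>' n)) (\<lambda>e. (\<pi> n (fst e), snd e))" for n
  proof -
    have "gbundle L G (\<lambda>x y. \<kappa> (\<pi> 0 x) (\<pi> 0 y)) = gbundle L G (\<lambda>x y. \<kappa>' n (\<pi> n x) (\<pi> n y))"
      by (rule gbundle_cong) (simp add: \<kappa>'_def bonding_map_\<pi>)
    then show ?thesis using continuous_map_gbundle_pullback[OF G(1) c'[of n] continuous_\<pi>[of n]] by simp
  qed
  show "(s (Suc n) (fst (\<pi> (Suc n) (fst e), snd e)), snd (\<pi> (Suc n) (fst e), snd e)) = (\<pi> n (fst e), snd e)"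
    if "e \<in> topspace (gbundle L G (\<lambda>x y. \<kappa> (\<pi> 0 x) (\<pi> 0 y)))" for n e
    using that compat unfolding tL by auto
  show "e = f" if "e \<in> topspace (gbundle L G (\<lambda>x y. \<kappa> (\<pi> 0 x) (\<pi> 0 y)))"
    "f \<in> topspace (gbundle L G (\<lambda>x y. \<kappa> (\<pi> 0 x) (\<pi> 0 y)))"
    "\<And>n. (\<pi> n (fst e), snd e) = (\<pi> n (fst f), snd f)" for e f
    using that separating[of "fst e" "fst f"] unfolding tL by (auto simp: prod_eq_iff)
  show "\<exists>e\<in>topspace (gbundle L G (\<lambda>x y. \<kappa> (\<pi> 0 x) (\<pi> 0 y))). \<forall>n. (\<pi> n (fst e), snd e) = t n"
    if th: "\<And>n. t n \<in> topspace (gbundle (X n) G (\<kappa>' n))" "\<And>n. (s (Suc n) (fst (t (Suc n))), snd (t (Suc n))) = t n" for t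
  proof -
    have "fst (t n) \<in> topspace (X n)" "s (Suc n) (fst (t (Suc n))) = fst (t n)" for n
      using th(1)[of n] th(2)[of n] unfolding t by (auto simp: prod_eq_iff)
    then obtain x where x: "x \<in> topspace L" "\<And>n. \<pi> n x = fst (t n)" using thread[of "\<lambda>n. fst (t n)"] by blast
    have "snd (t n) = snd (t 0)" for n
    proof (induction n)
      case (Suc n) then show ?case using arg_cong[OF th(2)[of n], of snd] by simp
    qed simp
    then have "(\<pi> n x, snd (t 0)) = t n" for n using x(2)[of n] by (metis prod.collapse)
    moreover have "(x, snd (t 0)) \<in> topspace (gbundle L G (\<lambda>x y. \<kappa> (\<pi> 0 x) (\<pi> 0 y)))"
      using x(1) th(1)[of 0] unfolding tL t by auto
    ultimately show ?thesis by (intro bexI[of _ "(x, snd (t 0))"]) auto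
  qed
qed

lemma DirProd_projections_continuous:
  fixes G (structure)
  assumes "group G" and c: "germ_cocycle X G \<kappa>" and d: "germ_cocycle X G \<mu>"
  shows "continuous_map (gbundle X (G \<times>\<times> G) (\<lambda>x y. (\<kappa> x y, \<mu> x y))) (gbundle X G \<kappa>) (\<lambda>e. (fst e, fst (snd e)))"
    and "continuous_map (gbundle X (G \<times>\<times> G) (\<lambda>x y. (\<kappa> x y, \<mu> x y))) (gbundle X G \<mu>) (\<lambda>e. (fst e, snd (snd e)))"
proof -
  interpret group G by fact
  let ?E = "gbundle X (G \<times>\<times> G) (\<lambda>x y. (\<kappa> x y, \<mu> x y))"
  have GG: "group (G \<times>\<times> G)" by (rule DirProd_group[OF assms(1,1)])
  have cd: "germ_cocycle X (G \<times>\<times> G) (\<lambda>x y. (\<kappa> x y, \<mu> x y))" by (rule germ_cocycle_DirProd[OF c d])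
  have tE: "topspace ?E = topspace X \<times> (carrier G \<times> carrier G)" using topspace_gbundle[OF GG cd] by simp
  have nhd: "\<exists>U. openin X U \<and> x \<in> U \<and> (\<forall>y\<in>U. y \<in> topspace X \<and> \<kappa> x y \<in> carrier G \<and> \<mu> x y \<in> carrier G)"
    if x: "x \<in> topspace X" for x
  proof -
    obtain U V where U: "germ_nhd X G \<kappa> x U" and V: "germ_nhd X G \<mu> x V"
      using x c d unfolding germ_cocycle_def by blast
    have "openin X (U \<inter> V)" "x \<in> U \<inter> V" using U V unfolding germ_nhd_def by auto
    moreover have "y \<in> topspace X \<and> \<kappa> x y \<in> carrier G \<and> \<mu> x y \<in> carrier G" if y: "y \<in> U \<inter> V" for y
      using germ_nhdD(1)[OF c U, of y] germ_nhdD(1)[OF d V, of y] y openin_subset[OF calculation(1)] by blast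
    ultimately show ?thesis by blast
  qed
  show "continuous_map ?E (gbundle X G \<kappa>) (\<lambda>e. (fst e, fst (snd e)))"
    unfolding continuous_map_def
  proof (intro conjI allI impI)
    show "(\<lambda>e. (fst e, fst (snd e))) \<in> topspace ?E \<rightarrow> topspace (gbundle X G \<kappa>)"
      unfolding tE topspace_gbundle[OF assms(1) c] by auto
    fix S assume S: "openin (gbundle X G \<kappa>) S"
    show "openin ?E {e \<in> topspace ?E. (fst e, fst (snd e)) \<in> S}"
      unfolding openin_gbundle
    proof (intro conjI allI impI)
      show "{e \<in> topspace ?E. (fst e, fst (snd e)) \<in> S} \<subseteq> topspace X \<times> carrier (G \<times>\<times> G)" unfolding tE by auto
      fix x g assume xg: "(x, g) \<in> {e \<in> topspace ?E. (fst e, fst (snd e)) \<in> S}"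
      then obtain g1 g2 where g: "g = (g1, g2)" "x \<in> topspace X" "g1 \<in> carrier G" "g2 \<in> carrier G" "(x, g1) \<in> S"
        unfolding tE by auto
      obtain V where V: "openin X V" "x \<in> V" "\<forall>y\<in>V. (y, g1 \<otimes> \<kappa> x y) \<in> S" using S g(5) unfolding openin_gbundle by blast
      obtain U where U: "openin X U" "x \<in> U" "\<forall>y\<in>U. y \<in> topspace X \<and> \<kappa> x y \<in> carrier G \<and> \<mu> x y \<in> carrier G"
        using nhd[OF g(2)] by blast
      show "\<exists>U. openin X U \<and> x \<in> U \<and> (\<forall>y\<in>U. (y, g \<otimes>\<^bsub>G \<times>\<times> G\<^esub> (\<kappa> x y, \<mu> x y)) \<in> {e \<in> topspace ?E. (fst e, fst (snd e)) \<in> S})"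
        using U V g(1,3,4) unfolding tE by (intro exI[of _ "U \<inter> V"]) (auto simp: mult_DirProd)
    qed
  qed
  show "continuous_map ?E (gbundle X G \<mu>) (\<lambda>e. (fst e, snd (snd e)))"
    unfolding continuous_map_def
  proof (intro conjI allI impI)
    show "(\<lambda>e. (fst e, snd (snd e))) \<in> topspace ?E \<rightarrow> topspace (gbundle X G \<mu>)"
      unfolding tE topspace_gbundle[OF assms(1) d] by auto
    fix S assume S: "openin (gbundle X G \<mu>) S"
    show "openin ?E {e \<in> topspace ?E. (fst e, snd (snd e)) \<in> S}"
      unfolding openin_gbundle
    proof (intro conjI allI impI)
      show "{e \<in> topspace ?E. (fst e, snd (snd e)) \<in> S} \<subseteq> topspace X \<times> carrier (G \<times>\<times> G)" unfolding tE by auto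
      fix x g assume xg: "(x, g) \<in> {e \<in> topspace ?E. (fst e, snd (snd e)) \<in> S}"
      then obtain g1 g2 where g: "g = (g1, g2)" "x \<in> topspace X" "g1 \<in> carrier G" "g2 \<in> carrier G" "(x, g2) \<in> S"
        unfolding tE by auto
      obtain V where V: "openin X V" "x \<in> V" "\<forall>y\<in>V. (y, g2 \<otimes> \<mu> x y) \<in> S" using S g(5) unfolding openin_gbundle by blast
      obtain U where U: "openin X U" "x \<in> U" "\<forall>y\<in>U. y \<in> topspace X \<and> \<kappa> x y \<in> carrier G \<and> \<mu> x y \<in> carrier G"
        using nhd[OF g(2)] by blast
      show "\<exists>U. openin X U \<and> x \<in> U \<and> (\<forall>y\<in>U. (y, g \<otimes>\<^bsub>G \<times>\<times> G\<^esub> (\<kappa> x y, \<mu> x y)) \<in> {e \<in> topspace ?E. (fst e, snd (snd e)) \<in> S})"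
        using U V g(1,3,4) unfolding tE by (intro exI[of _ "U \<inter> V"]) (auto simp: mult_DirProd)
    qed
  qed
qed

lemma path_in_clopen:
  assumes S: "openin X S" "closedin X S" and l: "pathin X l" "l 0 \<in> S"
  shows "l 1 \<in> S"
proof -
  have "connectedin X (l ` {0..1})" by (rule path_connectedin_imp_connectedin[OF path_connectedin_path_image[OF l(1)]])
  then have "l ` {0..1} \<subseteq> S \<or> disjnt (l ` {0..1}) S" by (rule connectedin_clopen_cases[OF _ S(2,1)])
  moreover have "l 0 \<in> l ` {0..1}" "l 1 \<in> l ` {0..1}" by auto
  ultimately show ?thesis using l(2) unfolding disjnt_iff by blast
qed

context inverse_system
begin

lemma gbundle_limit_connected:
  assumes "group G" "finite (carrier G)" and "germ_cocycle (X 0) G \<kappa>"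
    and "\<And>n. connected_space (gbundle (X n) G (\<lambda>x y. \<kappa> (bonding_map s 0 n x) (bonding_map s 0 n y)))"
  shows "connected_space (gbundle L G (\<lambda>x y. \<kappa> (\<pi> 0 x) (\<pi> 0 y)))"
  using inverse_system.connected_limit[OF inverse_system_gbundle[OF assms(1-3)] assms(4)] .

text \<open>The map from the bundle over \<open>L\<close> to the one over \<open>X n\<close> need
  not be onto. But a nonempty clopen set in the latter projects onto the connected space
  \<open>X n\<close> and so meets a fibre over the image of \<open>L\<close>; a nonempty proper
  clopen set would therefore pull back to another such set.\<close>

lemma gbundle_stage_connected:
  assumes G: "group G" "finite (carrier G)" and c: "germ_cocycle (X 0) G \<kappa>"
    and con: "connected_space (gbundle L G (\<lambda>x y. \<kappa> (\<pi> 0 x) (\<pi> 0 y)))"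
    and X: "connected_space (X n)" and ne: "topspace L \<noteq> {}"
  shows "connected_space (gbundle (X n) G (\<lambda>x y. \<kappa> (bonding_map s 0 n x) (bonding_map s 0 n y)))"
proof -
  let ?B = "gbundle (X n) G (\<lambda>x y. \<kappa> (bonding_map s 0 n x) (bonding_map s 0 n y))"
  let ?L = "gbundle L G (\<lambda>x y. \<kappa> (\<pi> 0 x) (\<pi> 0 y))"
  interpret B: inverse_system "\<lambda>n. gbundle (X n) G (\<lambda>x y. \<kappa> (bonding_map s 0 n x) (bonding_map s 0 n y))"
    "\<lambda>n e. (s n (fst e), snd e)" ?L "\<lambda>n e. (\<pi> n (fst e), snd e)"
    by (rule inverse_system_gbundle[OF G c])
  have c': "germ_cocycle (X n) G (\<lambda>x y. \<kappa> (bonding_map s 0 n x) (bonding_map s 0 n y))"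
    by (rule germ_cocycle_pullback[OF c continuous_bonding_map]) simp
  have tB: "topspace ?B = topspace (X n) \<times> carrier G" by (rule topspace_gbundle[OF G(1) c'])
  have tL: "topspace ?L = topspace L \<times> carrier G"
    by (rule topspace_gbundle[OF G(1) germ_cocycle_pullback[OF c continuous_\<pi>]])
  have cov: "covering_map ?B (X n) fst" by (rule gbundle_covering[OF G(1) c'])
  have hits: "\<exists>e\<in>topspace ?L. (\<pi> n (fst e), snd e) \<in> S"
    if S: "openin ?B S" "closedin ?B S" and "S \<noteq> {}" for S
  proof -
    have "closedin (X n) (fst ` S)"
      using T1_Spaces.continuous_imp_closed_map[OF covering_map_continuous[OF cov] B.compact_X Hausdorff_X] S(2)
      unfolding closed_map_def by blast
    moreover have "openin (X n) (fst ` S)"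
    proof (subst openin_subopen, intro ballI)
      fix x assume "x \<in> fst ` S"
      then obtain g where g: "(x, g) \<in> S" by auto
      then obtain U where "openin (X n) U" "x \<in> U"
        "\<forall>y\<in>U. (y, g \<otimes>\<^bsub>G\<^esub> \<kappa> (bonding_map s 0 n x) (bonding_map s 0 n y)) \<in> S"
        using S(1) unfolding openin_gbundle by blast
      then show "\<exists>T. openin (X n) T \<and> x \<in> T \<and> T \<subseteq> fst ` S" by (intro exI[of _ U]) force
    qed
    ultimately have "fst ` S = topspace (X n)"
      using X \<open>S \<noteq> {}\<close> unfolding connected_space_clopen_in by blast
    moreover obtain x where x: "x \<in> topspace L" using ne by blast
    ultimately have "\<pi> n x \<in> fst ` S" using \<pi>_in by blast
    then obtain g where g: "(\<pi> n x, g) \<in> S" by auto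
    then have "g \<in> carrier G" using openin_subset[OF S(1)] unfolding tB by auto
    then show ?thesis using g x tL by (intro bexI[of _ "(x, g)"]) auto
  qed
  show ?thesis
    unfolding connected_space_clopen_in
  proof (intro allI impI, elim conjE)
    fix S assume S: "openin ?B S" "closedin ?B S"
    let ?T = "{e \<in> topspace ?L. (\<pi> n (fst e), snd e) \<in> S}"
    have "openin ?L ?T" "closedin ?L ?T"
      using openin_continuous_map_preimage[OF B.continuous_\<pi> S(1)] closedin_continuous_map_preimage[OF B.continuous_\<pi> S(2)] .
    then have "?T = {} \<or> ?T = topspace ?L" using con unfolding connected_space_clopen_in by blast
    moreover have "openin ?B (topspace ?B - S)" "closedin ?B (topspace ?B - S)" using S by (auto simp: openin_diff)
    ultimately show "S = {} \<or> S = topspace ?B"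
      using hits[OF S] hits[of "topspace ?B - S"] closedin_subset[OF S(2)] by blast
  qed
qed

text \<open>The graph of \<open>h\<close> is clopen in the fibre product over \<open>L\<close> and
  comes from a clopen \<open>S'\<close> at a stage \<open>n\<close>. A loop there lifts to the fibre
  product inside \<open>S'\<close>; its end shows how \<open>h\<close> relates the two monodromies,
  and injectivity of \<open>h\<close> identifies the kernels.\<close>

lemma equal_kernels_if_equiv_pullbacks:
  fixes G (structure)
  assumes G: "group G" "finite (carrier G)" and c: "germ_cocycle (X 0) G \<kappa>" and d: "germ_cocycle (X 0) G \<mu>"
    and eq: "cover_equiv (gbundle L G (\<lambda>x y. \<kappa> (\<pi> 0 x) (\<pi> 0 y)), fst) (gbundle L G (\<lambda>x y. \<mu> (\<pi> 0 x) (\<pi> 0 y)), fst)"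
    and \<omega>: "\<omega> \<in> topspace L"
    and m: "\<And>n. has_monodromy (X n) G (\<lambda>x y. \<kappa> (bonding_map s 0 n x) (bonding_map s 0 n y)) (\<pi> n \<omega>) (\<phi> n)"
    and m': "\<And>n. has_monodromy (X n) G (\<lambda>x y. \<mu> (bonding_map s 0 n x) (bonding_map s 0 n y)) (\<pi> n \<omega>) (\<psi> n)"
  obtains n where "\<And>q. q \<in> loops (X n) (\<pi> n \<omega>) \<Longrightarrow>
    \<phi> n (loop_class (X n) (\<pi> n \<omega>) q) = \<one>\<^bsub>G\<^esub> \<longleftrightarrow> \<psi> n (loop_class (X n) (\<pi> n \<omega>) q) = \<one>\<^bsub>G\<^esub>"
proof -
  interpret group G by fact
  let ?H = "G \<times>\<times> G" and ?\<nu> = "\<lambda>x y. (\<kappa> x y, \<mu> x y)"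
  have H: "group ?H" "finite (carrier ?H)" using DirProd_group[OF G(1,1)] G(2) by auto
  have cd: "germ_cocycle (X 0) ?H ?\<nu>" by (rule germ_cocycle_DirProd[OF c d])
  let ?P = "\<lambda>n. gbundle (X n) ?H (\<lambda>x y. ?\<nu> (bonding_map s 0 n x) (bonding_map s 0 n y))"
  let ?PL = "gbundle L ?H (\<lambda>x y. ?\<nu> (\<pi> 0 x) (\<pi> 0 y))"
  let ?L1 = "gbundle L G (\<lambda>x y. \<kappa> (\<pi> 0 x) (\<pi> 0 y))" and ?L2 = "gbundle L G (\<lambda>x y. \<mu> (\<pi> 0 x) (\<pi> 0 y))"
  interpret B: inverse_system ?P "\<lambda>n e. (s n (fst e), snd e)" ?PL "\<lambda>n e. (\<pi> n (fst e), snd e)"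
    by (rule inverse_system_gbundle[OF H cd])
  have cL: "germ_cocycle L G (\<lambda>x y. \<kappa> (\<pi> 0 x) (\<pi> 0 y))" "germ_cocycle L G (\<lambda>x y. \<mu> (\<pi> 0 x) (\<pi> 0 y))"
    by (rule germ_cocycle_pullback[OF c continuous_\<pi>] germ_cocycle_pullback[OF d continuous_\<pi>])+
  have cX: "germ_cocycle (X n) G (\<lambda>x y. \<kappa> (bonding_map s 0 n x) (bonding_map s 0 n y))"
    "germ_cocycle (X n) G (\<lambda>x y. \<mu> (bonding_map s 0 n x) (bonding_map s 0 n y))"
    "germ_cocycle (X n) ?H (\<lambda>x y. ?\<nu> (bonding_map s 0 n x) (bonding_map s 0 n y))" for n
    using germ_cocycle_pullback[OF c continuous_bonding_map[of 0 n]] germ_cocycle_pullback[OF d continuous_bonding_map[of 0 n]]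
      germ_cocycle_pullback[OF cd continuous_bonding_map[of 0 n]] by simp_all
  have tPL: "topspace ?PL = topspace L \<times> (carrier G \<times> carrier G)"
    using topspace_gbundle[OF H(1) germ_cocycle_pullback[OF cd continuous_\<pi>]] by simp
  have tL1: "topspace ?L1 = topspace L \<times> carrier G" "topspace ?L2 = topspace L \<times> carrier G"
    using topspace_gbundle[OF G(1) cL(1)] topspace_gbundle[OF G(1) cL(2)] .
  obtain h where h: "homeomorphic_map ?L1 ?L2 h" "\<And>e. e \<in> topspace ?L1 \<Longrightarrow> fst (h e) = fst e"
    using eq unfolding cover_equiv_def by auto
  define S where "S = {e \<in> topspace ?PL. h (fst e, fst (snd e)) = (fst e, snd (snd e))}"
  have pr: "continuous_map ?PL ?L1 (\<lambda>e. (fst e, fst (snd e)))" "continuous_map ?PL ?L2 (\<lambda>e. (fst e, snd (snd e)))"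
    using DirProd_projections_continuous[OF G(1) cL] by simp_all
  have ch: "continuous_map ?PL ?L2 (\<lambda>e. h (fst e, fst (snd e)))"
    using continuous_map_compose[OF pr(1) homeomorphic_imp_continuous_map[OF h(1)]] by (simp add: o_def)
  have fh: "fst (h (fst e, fst (snd e))) = fst (fst e, snd (snd e))" if "e \<in> topspace ?PL" for e
    using h(2)[of "(fst e, fst (snd e))"] that unfolding tPL tL1 by auto
  note agr = openin_continuous_map_agree[OF gbundle_covering[OF G(1) cL(2)] ch pr(2) fh]
  have oS: "openin ?PL S" unfolding S_def by (rule agr(1))
  have "topspace ?PL - S = {e \<in> topspace ?PL. h (fst e, fst (snd e)) \<noteq> (fst e, snd (snd e))}"
    unfolding S_def by blast
  then have "openin ?PL (topspace ?PL - S)" using agr(2) by simp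
  moreover have "S \<subseteq> topspace ?PL" unfolding S_def by blast
  ultimately have cS: "closedin ?PL S" unfolding closedin_def by blast
  obtain n S' where S': "openin (?P n) S'" "closedin (?P n) S'"
    "\<And>e. e \<in> topspace ?PL \<Longrightarrow> e \<in> S \<longleftrightarrow> (\<pi> n (fst e), snd e) \<in> S'"
    using B.clopen_from_stage[OF oS cS] by blast
  let ?b = "\<pi> n \<omega>"
  have b1: "(\<omega>, \<one>) \<in> topspace ?L1" using \<omega> tL1 by simp
  then have "h (\<omega>, \<one>) \<in> topspace ?L2" using homeomorphic_imp_surjective_map[OF h(1)] by blast
  \<comment> \<open>\<open>h\<close> need not preserve the coordinate \<open>\<one>\<close> over
    \<open>\<omega>\<close>; the shift \<open>g0\<close> is carried along and drops out of the
    kernels.\<close>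
  then obtain g0 where g0: "h (\<omega>, \<one>) = (\<omega>, g0)" "g0 \<in> carrier G" using h(2)[OF b1] unfolding tL1 by auto
  have start: "(?b, (\<one>, g0)) \<in> S'"
    using S'(3)[of "(\<omega>, (\<one>, g0))"] g0 \<omega> unfolding S_def tPL by simp
  have key: "h (\<omega>, \<phi> n (loop_class (X n) ?b q)) = (\<omega>, g0 \<otimes> \<psi> n (loop_class (X n) ?b q)) \<and>
      \<phi> n (loop_class (X n) ?b q) \<in> carrier G \<and> \<psi> n (loop_class (X n) ?b q) \<in> carrier G"
    if q: "q \<in> loops (X n) ?b" for q
  proof -
    let ?u = "\<phi> n (loop_class (X n) ?b q)" and ?v = "\<psi> n (loop_class (X n) ?b q)"
    have qp: "pathin (X n) q" "q 0 = ?b" using q by (auto simp: loops_def)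
    have e: "(?b, (\<one>, g0)) \<in> topspace (?P n)" using start openin_subset[OF S'(1)] by blast
    have f: "fst (?b, (\<one>, g0)) = q 0" using qp by simp
    obtain l where l: "pathin (?P n) l" "\<And>t. t \<in> {0..1} \<Longrightarrow> fst (l t) = q t" "l 0 = (?b, (\<one>, g0))"
      using path_lift[OF gbundle_covering[OF H(1) cX(3)] qp(1) e f] by blast
    \<comment> \<open>A path that starts in the clopen set \<open>S'\<close> cannot leave
      it.\<close>
    have l1: "l 1 \<in> S'" by (rule path_in_clopen[OF S'(1,2) l(1)]) (simp add: l(3) start)
    note prn = DirProd_projections_continuous[OF G(1) cX(1,2)[of n]]
    have "((\<lambda>e. (fst e, fst (snd e))) \<circ> l) 1 = (?b, \<one> \<otimes> ?u)"
      by (rule monodromy_lift[OF G(1) cX(1) m q pathin_compose[OF l(1) prn(1)]]) (use l in auto)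
    moreover have "((\<lambda>e. (fst e, snd (snd e))) \<circ> l) 1 = (?b, g0 \<otimes> ?v)"
      by (rule monodromy_lift[OF G(1) cX(2) m' q pathin_compose[OF l(1) prn(2)]]) (use l in auto)
    moreover obtain l0 where "pathin (gbundle (X n) G (\<lambda>x y. \<kappa> (bonding_map s 0 n x) (bonding_map s 0 n y))) l0" "l0 1 = (?b, ?u)"
      using m[of n] q unfolding has_monodromy_def by blast
    then have u: "?u \<in> carrier G" using pathin_in[of _ l0 1] topspace_gbundle[OF G(1) cX(1)] by fastforce
    moreover obtain l0 where "pathin (gbundle (X n) G (\<lambda>x y. \<mu> (bonding_map s 0 n x) (bonding_map s 0 n y))) l0" "l0 1 = (?b, ?v)"
      using m'[of n] q unfolding has_monodromy_def by blast
    then have v: "?v \<in> carrier G" using pathin_in[of _ l0 1] topspace_gbundle[OF G(1) cX(2)] by fastforce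
    ultimately have "l 1 = (?b, (?u, g0 \<otimes> ?v))" by (simp add: prod_eq_iff)
    then have "(\<omega>, (?u, g0 \<otimes> ?v)) \<in> S" using l1 S'(3)[of "(\<omega>, (?u, g0 \<otimes> ?v))"] \<omega> u v g0(2) unfolding tPL by simp
    then show ?thesis using u v unfolding S_def by simp
  qed
  have inj: "inj_on h (topspace ?L1)" by (rule homeomorphic_imp_injective_map[OF h(1)])
  show ?thesis
  proof (rule that)
    fix q assume q: "q \<in> loops (X n) ?b"
    let ?u = "\<phi> n (loop_class (X n) ?b q)" and ?v = "\<psi> n (loop_class (X n) ?b q)"
    note k = key[OF q]
    show "?u = \<one> \<longleftrightarrow> ?v = \<one>"
    proof
      assume "?u = \<one>"
      then have "g0 = g0 \<otimes> ?v" using k g0(1) by simp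
      then show "?v = \<one>" using k g0(2) by (metis l_cancel_one')
    next
      assume "?v = \<one>"
      then have "h (\<omega>, ?u) = h (\<omega>, \<one>)" using k g0 by simp
      moreover have "(\<omega>, ?u) \<in> topspace ?L1" using k \<omega> tL1 by simp
      ultimately show "?u = \<one>" using inj b1 unfolding inj_on_def by blast
    qed
  qed
qed

end

section \<open>Regular covers of an inverse limit come from a stage\<close>

text \<open>The action is the inverse of an isomorphism from the deck group onto \<open>G\<close>.
  Regularity makes it transitive on fibres, and uniqueness of lifts on the connected space
  \<open>E\<close> makes it free.\<close>

lemma regular_cover_action:
  fixes G (structure)
  assumes "group G" and C: "(E, p) \<in> regular_covers X G"
  obtains act where "\<And>g. g \<in> carrier G \<Longrightarrow> continuous_map E E (act g)"
    and "\<And>g e. g \<in> carrier G \<Longrightarrow> e \<in> topspace E \<Longrightarrow> p (act g e) = p e"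
    and "\<And>g h e. g \<in> carrier G \<Longrightarrow> h \<in> carrier G \<Longrightarrow> e \<in> topspace E \<Longrightarrow> act (g \<otimes> h) e = act g (act h e)"
    and "\<And>e. e \<in> topspace E \<Longrightarrow> act \<one> e = e"
    and "\<And>e e'. e \<in> topspace E \<Longrightarrow> e' \<in> topspace E \<Longrightarrow> p e = p e' \<Longrightarrow> \<exists>g\<in>carrier G. act g e = e'"
    and "\<And>g h e. g \<in> carrier G \<Longrightarrow> h \<in> carrier G \<Longrightarrow> e \<in> topspace E \<Longrightarrow> act g e = act h e \<Longrightarrow> g = h"
proof -
  interpret group G by fact
  let ?D = "deck_transformations (E, p)" and ?A = "deck_group (E, p)"
  have con: "connected_space E" and cov: "covering_map E X p" and reg: "is_regular (E, p)" and isoG: "?A \<cong> G"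
    using C unfolding regular_covers_def is_cover_def by auto
  have carr: "carrier ?A = ?D" by (simp add: deck_group_def)
  obtain f where f: "f \<in> hom ?A G" "bij_betw f ?D (carrier G)"
    using isoG unfolding is_iso_def iso_def carr by blast
  define act where "act = inv_into ?D f"
  have aD: "act g \<in> ?D" and fa: "f (act g) = g" if "g \<in> carrier G" for g
    using that f(2) unfolding act_def by (auto simp: bij_betw_def inv_into_into f_inv_into_f)
  have af: "act (f d) = d" if "d \<in> ?D" for d using that f(2) unfolding act_def by (simp add: bij_betw_def)
  have hD: "homeomorphic_map E E d" "d \<in> extensional (topspace E)" "\<And>e. e \<in> topspace E \<Longrightarrow> p (d e) = p e"
    if "d \<in> ?D" for d using that unfolding deck_transformations_def by auto
  have inE: "d e \<in> topspace E" if "d \<in> ?D" "e \<in> topspace E" for d e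
    using homeomorphic_imp_surjective_map[OF hD(1)[OF that(1)]] that(2) by blast
  have bij: "d \<in> Bij (topspace E)" if "d \<in> ?D" for d
    using hD[OF that] homeomorphic_imp_injective_map homeomorphic_imp_surjective_map
    unfolding Bij_def bij_betw_def by blast
  have mult: "d \<otimes>\<^bsub>?A\<^esub> d' = compose (topspace E) d d'" if "d \<in> ?D" "d' \<in> ?D" for d d'
    using bij[OF that(1)] bij[OF that(2)] by (simp add: deck_group_def BijGroup_def)
  have compD: "compose (topspace E) d d' \<in> ?D" if d: "d \<in> ?D" "d' \<in> ?D" for d d'
  proof -
    have "homeomorphic_map E E (compose (topspace E) d d')"
      by (rule homeomorphic_map_eq[OF homeomorphic_map_compose[OF hD(1)[OF d(2)] hD(1)[OF d(1)]]]) (simp add: compose_def)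
    then show ?thesis using hD(3)[OF d(1)] hD(3)[OF d(2)] inE[OF d(2)]
      unfolding deck_transformations_def by (auto simp: compose_def)
  qed
  have uniq: "d = d'" if d: "d \<in> ?D" "d' \<in> ?D" and eq: "d e = d' e" "e \<in> topspace E" for d d' e
  proof (rule extensionalityI[OF hD(2)[OF d(1)] hD(2)[OF d(2)]])
    show "d y = d' y" if "y \<in> topspace E" for y
      by (rule lift_unique[OF cov homeomorphic_imp_continuous_map[OF hD(1)[OF d(1)]]
            homeomorphic_imp_continuous_map[OF hD(1)[OF d(2)]] _ con eq(2,1) that])
        (use hD(3)[OF d(1)] hD(3)[OF d(2)] in simp)
  qed
  have A3: "act (g \<otimes> h) e = act g (act h e)" if g: "g \<in> carrier G" "h \<in> carrier G" "e \<in> topspace E" for g h e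
  proof -
    have "f (compose (topspace E) (act g) (act h)) = g \<otimes> h"
      using hom_mult[OF f(1), of "act g" "act h"] aD g fa mult unfolding carr by simp
    then have "act (g \<otimes> h) = compose (topspace E) (act g) (act h)"
      using af[OF compD[OF aD[OF g(1)] aD[OF g(2)]]] by simp
    then show ?thesis using g(3) by (simp add: compose_def)
  qed
  show ?thesis
  proof (rule that[of act])
    show "continuous_map E E (act g)" if "g \<in> carrier G" for g
      using homeomorphic_imp_continuous_map[OF hD(1)[OF aD[OF that]]] .
    show "p (act g e) = p e" if "g \<in> carrier G" "e \<in> topspace E" for g e using hD(3)[OF aD[OF that(1)] that(2)] .
    show "act (g \<otimes> h) e = act g (act h e)" if "g \<in> carrier G" "h \<in> carrier G" "e \<in> topspace E" for g h e using A3[OF that] .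
    \<comment> \<open>\<open>act \<one>\<close> is idempotent and injective.\<close>
    show "act \<one> e = e" if e: "e \<in> topspace E" for e
    proof -
      have "act \<one> (act \<one> e) = act \<one> e" using A3[of \<one> \<one> e] e by simp
      then show ?thesis
        using homeomorphic_imp_injective_map[OF hD(1)[OF aD[OF one_closed]]] inE[OF aD[OF one_closed] e] e
        unfolding inj_on_def by blast
    qed
    show "\<exists>g\<in>carrier G. act g e = e'" if e: "e \<in> topspace E" "e' \<in> topspace E" "p e = p e'" for e e'
    proof -
      obtain d where d: "d \<in> ?D" "d e = e'" using reg e unfolding is_regular_def by auto
      then have "act (f d) e = e'" using af by simp
      moreover have "f d \<in> carrier G" using d(1) f(2) by (auto simp: bij_betw_def)
      ultimately show ?thesis by blast
    qed
    show "g = h" if "g \<in> carrier G" "h \<in> carrier G" "e \<in> topspace E" "act g e = act h e" for g h e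
      using uniq[OF aD[OF that(1)] aD[OF that(2)] that(4,3)] fa that(1,2) by metis
  qed
qed

lemma openin_nhd_ball:
  assumes "finite A" "x \<in> topspace X" "\<And>a. a \<in> A \<Longrightarrow> \<exists>V. openin X V \<and> x \<in> V \<and> P a V"
    and mono: "\<And>a V W. P a V \<Longrightarrow> W \<subseteq> V \<Longrightarrow> P a W"
  shows "\<exists>V. openin X V \<and> x \<in> V \<and> (\<forall>a\<in>A. P a V)"
  using assms(1,3)
proof (induction A rule: finite_induct)
  case empty then show ?case using assms(2) by (intro exI[of _ "topspace X"]) auto
next
  case (insert a A)
  obtain V where V: "openin X V" "x \<in> V" "\<forall>b\<in>A. P b V" using insert by blast
  obtain W where W: "openin X W" "x \<in> W" "P a W" using insert.prems by blast
  have "\<forall>b\<in>insert a A. P b (V \<inter> W)" using mono V(3) W(3) by (metis inf_le1 inf_le2 insert_iff)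
  then show ?case using V W by (intro exI[of _ "V \<inter> W"]) auto
qed

context inverse_system
begin

text \<open>A principal cover is trivial over the members of a finite closed cover \<open>K\<close>. Near every
  point \<open>x\<close> the transition functions between the members of \<open>K\<close> that contain \<open>x\<close> are constant,
  which gives a finite open cover with constant transition functions. Such a cover and its nerve
  are already present at a finite stage.\<close>

lemma principal_cover_from_stage:
  fixes G (structure)
  assumes G: "group G" and p: "covering_map E L p"
    and act1: "\<And>g. g \<in> carrier G \<Longrightarrow> continuous_map E E (act g)"
    and act2: "\<And>g e. g \<in> carrier G \<Longrightarrow> e \<in> topspace E \<Longrightarrow> p (act g e) = p e"
    and act3: "\<And>g h e. g \<in> carrier G \<Longrightarrow> h \<in> carrier G \<Longrightarrow> e \<in> topspace E \<Longrightarrow> act (g \<otimes> h) e = act g (act h e)"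
    and act5: "\<And>e e'. e \<in> topspace E \<Longrightarrow> e' \<in> topspace E \<Longrightarrow> p e = p e' \<Longrightarrow> \<exists>g\<in>carrier G. act g e = e'"
    and act6: "\<And>g h e. g \<in> carrier G \<Longrightarrow> h \<in> carrier G \<Longrightarrow> e \<in> topspace E \<Longrightarrow> act g e = act h e \<Longrightarrow> g = h"
  obtains k \<kappa> where "germ_cocycle (X k) G \<kappa>" "cover_equiv (E, p) (gbundle L G (\<lambda>x y. \<kappa> (\<pi> k x) (\<pi> k y)), fst)"
proof -
  interpret group G by fact
  have actE: "act g e \<in> topspace E" if "g \<in> carrier G" "e \<in> topspace E" for g e
    using act1[OF that(1)] that(2) by (auto simp: continuous_map_def)
  have fin_sub: "\<exists>F. finite F \<and> F \<subseteq> topspace L \<and> topspace L \<subseteq> (\<Union>x\<in>F. I x)"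
    if I: "\<And>x. x \<in> topspace L \<Longrightarrow> openin L (I x) \<and> x \<in> I x" for I :: "'x \<Rightarrow> 'x set"
  proof -
    have "(\<forall>V\<in>I ` topspace L. openin L V) \<and> topspace L \<subseteq> \<Union>(I ` topspace L)" using I by blast
    then obtain \<K> where K: "finite \<K>" "\<K> \<subseteq> I ` topspace L" "topspace L \<subseteq> \<Union>\<K>"
      using compact_L unfolding compact_space_alt by meson
    obtain F where "F \<subseteq> topspace L" "finite F" "\<K> = I ` F" using finite_subset_image[OF K(1,2)] by blast
    then show ?thesis using K(3) by blast
  qed
  \<comment> \<open>Each point gets a section over an open \<open>U\<close> and room
    \<open>I \<subseteq> K \<subseteq> U\<close> with \<open>I\<close> open and \<open>K\<close>
    closed. The sets \<open>I\<close> will cover \<open>L\<close>; the sets \<open>K\<close> decide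
    which transition functions matter near a point.\<close>
  have "\<exists>U t I K. openin L U \<and> continuous_map (subtopology L U) E t \<and> (\<forall>y\<in>U. p (t y) = y) \<and>
      openin L I \<and> closedin L K \<and> x \<in> I \<and> I \<subseteq> K \<and> K \<subseteq> U" if x: "x \<in> topspace L" for x
  proof -
    have "x \<in> p ` topspace E" using p x by (simp add: covering_map_def)
    then obtain e where e: "e \<in> topspace E" "p e = x" by blast
    obtain U sec where U: "p e \<in> U" and t: "trivializing E L p U sec"
      using covering_map_trivializing[OF p covering_map_in[OF p e(1)]] by blast
    note tr = trivializingD[OF t]
    obtain m O' C where mC: "openin (X m) O'" "closedin (X m) C" "O' \<subseteq> C" "\<pi> m x \<in> O'"
      "\<And>y. y \<in> topspace L \<Longrightarrow> \<pi> m y \<in> C \<Longrightarrow> y \<in> U" using basic_neighbourhood[OF tr(1), of x] U e(2) by blast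
    let ?I = "{y \<in> topspace L. \<pi> m y \<in> O'}" and ?K = "{y \<in> topspace L. \<pi> m y \<in> C}"
    have "openin L ?I" "closedin L ?K"
      using openin_continuous_map_preimage[OF continuous_\<pi> mC(1)] closedin_continuous_map_preimage[OF continuous_\<pi> mC(2)] .
    moreover have "x \<in> ?I" "?I \<subseteq> ?K" "?K \<subseteq> U" using x mC(3-5) by auto
    moreover have "continuous_map (subtopology L U) E (sec e)" "\<forall>y\<in>U. p (sec e y) = y" "openin L U"
      using tr(1) tr(2)[OF e(1) U] tr(3)[OF e(1) U] by blast+
    ultimately show ?thesis
      by - (intro exI[of _ U] exI[of _ "sec e"] exI[of _ ?I] exI[of _ ?K] conjI; assumption)
  qed
  then obtain U t I K where UK: "\<And>x. x \<in> topspace L \<Longrightarrow> openin L (U x) \<and> continuous_map (subtopology L (U x)) E (t x) \<and>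
      (\<forall>y\<in>U x. p (t x y) = y) \<and> openin L (I x) \<and> closedin L (K x) \<and> x \<in> I x \<and> I x \<subseteq> K x \<and> K x \<subseteq> U x"
    by metis
  have "openin L (I x) \<and> x \<in> I x" if "x \<in> topspace L" for x
    using UK[OF that] by simp
  from fin_sub[OF this] obtain F where F: "finite F" "F \<subseteq> topspace L" "topspace L \<subseteq> (\<Union>x\<in>F. I x)"
    by blast
  have UF: "openin L (U a)" "continuous_map (subtopology L (U a)) E (t a)" "\<And>y. y \<in> U a \<Longrightarrow> p (t a y) = y"
    "openin L (I a)" "closedin L (K a)" "I a \<subseteq> K a" "K a \<subseteq> U a" if "a \<in> F" for a
    using UK[of a] F(2) that by blast+
  have tE: "t a y \<in> topspace E" if "a \<in> F" "y \<in> U a" for a y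
  proof -
    have "y \<in> topspace (subtopology L (U a))" using that openin_subset[OF UF(1)[OF that(1)]] by auto
    then show ?thesis using UF(2)[OF that(1)] by (auto simp: continuous_map_def)
  qed
  \<comment> \<open>On \<open>D a b g\<close> the two sections differ by the constant
    \<open>g\<close>. These sets are open and cover the overlap of \<open>U a\<close> and
    \<open>U b\<close>.\<close>
  define D where "D a b g = {y \<in> U a \<inter> U b. t a y = act g (t b y)}" for a b g
  have oD: "openin L (D a b g)" if ab: "a \<in> F" "b \<in> F" and g: "g \<in> carrier G" for a b g
  proof -
    let ?Y = "subtopology L (U a \<inter> U b)"
    have oU: "openin L (U a \<inter> U b)" using UF(1) ab by blast
    have tY: "topspace ?Y = U a \<inter> U b" using openin_subset[OF oU] by auto
    have 1: "continuous_map ?Y E (t a)" by (rule continuous_map_from_subtopology_mono[OF UF(2)[OF ab(1)]]) blast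
    have "continuous_map ?Y E (t b)" by (rule continuous_map_from_subtopology_mono[OF UF(2)[OF ab(2)]]) blast
    then have 2: "continuous_map ?Y E (\<lambda>y. act g (t b y))"
      using continuous_map_compose[OF _ act1[OF g]] by (fastforce simp: o_def)
    have "openin ?Y {y \<in> topspace ?Y. t a y = act g (t b y)}"
      by (rule openin_continuous_map_agree(1)[OF p 1 2]) (use UF(3) ab act2[OF g] tE tY in simp)
    then show ?thesis unfolding tY D_def by (rule openin_trans_full[OF _ oU])
  qed
  have exD: "\<exists>g\<in>carrier G. y \<in> D a b g" if ab: "a \<in> F" "b \<in> F" "y \<in> U a" "y \<in> U b" for a b y
  proof -
    have "p (t b y) = p (t a y)" using UF(3)[OF ab(1,3)] UF(3)[OF ab(2,4)] by simp
    then obtain g where g: "g \<in> carrier G" "act g (t b y) = t a y"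
      using act5[OF tE[OF ab(2,4)] tE[OF ab(1,3)]] by blast
    then have "y \<in> D a b g" using ab(3,4) unfolding D_def by simp
    then show ?thesis using g(1) by blast
  qed
  \<comment> \<open>A small neighbourhood of \<open>x\<close> meets only those of the finitely many
    closed sets \<open>K a\<close> that contain \<open>x\<close>, and on it all transition functions
    between these are constant.\<close>
  have "\<exists>V i. openin L V \<and> x \<in> V \<and> i \<in> F \<and> V \<subseteq> I i \<and> (\<forall>a\<in>F. V \<inter> K a \<noteq> {} \<longrightarrow> x \<in> K a) \<and>
      (\<forall>a\<in>F. \<forall>b\<in>F. x \<in> K a \<longrightarrow> x \<in> K b \<longrightarrow> (\<exists>g\<in>carrier G. V \<subseteq> D a b g))" if x: "x \<in> topspace L" for x
  proof -
    obtain i where i: "i \<in> F" "x \<in> I i" using F(3) x by blast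
    have "\<exists>V. openin L V \<and> x \<in> V \<and> (\<forall>a\<in>F. V \<inter> K a \<noteq> {} \<longrightarrow> x \<in> K a)"
    proof (rule openin_nhd_ball[OF F(1) x])
      show "\<exists>V. openin L V \<and> x \<in> V \<and> (V \<inter> K a \<noteq> {} \<longrightarrow> x \<in> K a)" if a: "a \<in> F" for a
      proof (cases "x \<in> K a")
        case True then show ?thesis using x openin_topspace by blast
      next
        case False
        then show ?thesis using UF(5)[OF a] x by (intro exI[of _ "topspace L - K a"]) auto
      qed
    qed blast
    then obtain V1 where V1: "openin L V1" "x \<in> V1" "\<forall>a\<in>F. V1 \<inter> K a \<noteq> {} \<longrightarrow> x \<in> K a" by blast
    have "\<exists>V. openin L V \<and> x \<in> V \<and> (\<forall>c\<in>F \<times> F. x \<in> K (fst c) \<longrightarrow> x \<in> K (snd c) \<longrightarrow> (\<exists>g\<in>carrier G. V \<subseteq> D (fst c) (snd c) g))"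
    proof (rule openin_nhd_ball[OF _ x])
      show "finite (F \<times> F)" using F(1) by simp
      show "\<exists>V. openin L V \<and> x \<in> V \<and> (x \<in> K (fst c) \<longrightarrow> x \<in> K (snd c) \<longrightarrow> (\<exists>g\<in>carrier G. V \<subseteq> D (fst c) (snd c) g))"
        if c: "c \<in> F \<times> F" for c
      proof (cases "x \<in> K (fst c) \<and> x \<in> K (snd c)")
        case True
        have cF: "fst c \<in> F" "snd c \<in> F" using c by auto
        then have "x \<in> U (fst c)" "x \<in> U (snd c)" using True UF(7) by blast+
        then obtain g where "g \<in> carrier G" "x \<in> D (fst c) (snd c) g" using exD[OF cF] by blast
        then show ?thesis using oD[OF cF] by blast
      next
        case False then show ?thesis using x openin_topspace by blast
      qed
    qed (meson subset_trans)
    then obtain V2 where V2: "openin L V2" "x \<in> V2"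
      "\<forall>c\<in>F \<times> F. x \<in> K (fst c) \<longrightarrow> x \<in> K (snd c) \<longrightarrow> (\<exists>g\<in>carrier G. V2 \<subseteq> D (fst c) (snd c) g)" by blast
    let ?V = "I i \<inter> V1 \<inter> V2"
    have "openin L ?V" "x \<in> ?V" "?V \<subseteq> I i" using V1(1,2) V2(1,2) UF(4)[OF i(1)] i(2) by blast+
    moreover have "\<forall>a\<in>F. ?V \<inter> K a \<noteq> {} \<longrightarrow> x \<in> K a" using V1(3) by blast
    moreover have "\<exists>g\<in>carrier G. ?V \<subseteq> D a b g" if ab: "a \<in> F" "b \<in> F" "x \<in> K a" "x \<in> K b" for a b
    proof -
      have "\<exists>g\<in>carrier G. V2 \<subseteq> D a b g" using V2(3)[rule_format, of "(a, b)"] ab by simp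
      then show ?thesis by blast
    qed
    then have "\<forall>a\<in>F. \<forall>b\<in>F. x \<in> K a \<longrightarrow> x \<in> K b \<longrightarrow> (\<exists>g\<in>carrier G. ?V \<subseteq> D a b g)" by simp
    ultimately show ?thesis
      using i(1) by - (intro exI[of _ ?V] exI[of _ i] conjI; assumption)
  qed
  then obtain V i where Vi: "\<And>x. x \<in> topspace L \<Longrightarrow> openin L (V x) \<and> x \<in> V x \<and> i x \<in> F \<and> V x \<subseteq> I (i x) \<and>
      (\<forall>a\<in>F. V x \<inter> K a \<noteq> {} \<longrightarrow> x \<in> K a) \<and>
      (\<forall>a\<in>F. \<forall>b\<in>F. x \<in> K a \<longrightarrow> x \<in> K b \<longrightarrow> (\<exists>g\<in>carrier G. V x \<subseteq> D a b g))" by metis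
  note ViD = Vi[THEN conjunct1]
    Vi[THEN conjunct2, THEN conjunct1]
    Vi[THEN conjunct2, THEN conjunct2, THEN conjunct1]
    Vi[THEN conjunct2, THEN conjunct2, THEN conjunct2, THEN conjunct1]
    Vi[THEN conjunct2, THEN conjunct2, THEN conjunct2, THEN conjunct2, THEN conjunct1]
    Vi[THEN conjunct2, THEN conjunct2, THEN conjunct2, THEN conjunct2, THEN conjunct2]
  \<comment> \<open>If \<open>V x\<close> meets \<open>V y\<close>, it meets \<open>K (i y)\<close>;
    hence \<open>x\<close> lies in \<open>K (i y)\<close>, and the transition function between
    \<open>i y\<close> and \<open>i x\<close> is constant on all of \<open>V x\<close>. For disjoint
    sets any element will do, and \<open>\<one>\<close> is taken.\<close>
  have trans: "\<exists>g\<in>carrier G. \<forall>z\<in>V x \<inter> V y. t (i x) z = act g (t (i y) z)"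
    if xy: "x \<in> topspace L" "y \<in> topspace L" for x y
  proof (cases "V x \<inter> V y = {}")
    case True then show ?thesis using one_closed by blast
  next
    case False
    have ix: "i x \<in> F" "i y \<in> F" "x \<in> V x" using ViD xy by simp_all
    have VK: "V y \<subseteq> K (i y)" "V x \<subseteq> K (i x)"
      using ViD(4)[OF xy(2)] UF(6)[OF ix(2)] ViD(4)[OF xy(1)] UF(6)[OF ix(1)] by blast+
    then have "V x \<inter> K (i y) \<noteq> {}" using False by blast
    then have "x \<in> K (i y)" using ViD(5)[OF xy(1)] ix(2) by blast
    moreover have "x \<in> K (i x)" using VK(2) ix(3) by blast
    ultimately obtain g where "g \<in> carrier G" "V x \<subseteq> D (i x) (i y) g" using ViD(6)[OF xy(1)] ix(1,2) by blast
    then show ?thesis unfolding D_def by blast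
  qed
  define c where "c x y = (SOME g. g \<in> carrier G \<and> (\<forall>z\<in>V x \<inter> V y. t (i x) z = act g (t (i y) z)))" for x y
  have c: "c x y \<in> carrier G \<and> (\<forall>z\<in>V x \<inter> V y. t (i x) z = act (c x y) (t (i y) z))"
    if xy: "x \<in> topspace L" "y \<in> topspace L" for x y
    unfolding c_def by (rule someI_ex) (use trans[OF xy] in blast)
  have VU: "z \<in> U (i x)" "i x \<in> F" if "x \<in> topspace L" "z \<in> V x" for x z
    using Vi[OF that(1)] UF(6,7) that(2) by blast+
  \<comment> \<open>The identity is read off from the free action at a point over \<open>z\<close>,
    so the three sets must have a point in common; \<open>Bad\<close> below takes care of this at a
    finite stage.\<close>
  have cc: "c x w = c x y \<otimes> c y w"
    if xyw: "x \<in> topspace L" "y \<in> topspace L" "w \<in> topspace L" and z: "z \<in> V x" "z \<in> V y" "z \<in> V w" for x y w z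
  proof -
    have e: "t (i w) z \<in> topspace E" using tE VU[OF xyw(3) z(3)] by blast
    have "act (c x w) (t (i w) z) = t (i x) z" using c[OF xyw(1,3)] z by auto
    also have "\<dots> = act (c x y) (t (i y) z)" using c[OF xyw(1,2)] z by auto
    also have "\<dots> = act (c x y) (act (c y w) (t (i w) z))" using c[OF xyw(2,3)] z by auto
    also have "\<dots> = act (c x y \<otimes> c y w) (t (i w) z)" using act3 c[OF xyw(1,2)] c[OF xyw(2,3)] e by simp
    finally show ?thesis using act6[OF _ _ e] c[OF xyw(1,2)] c[OF xyw(2,3)] c[OF xyw(1,3)] by blast
  qed
  have "\<exists>m O' C. openin (X m) O' \<and> closedin (X m) C \<and> O' \<subseteq> C \<and> \<pi> m x \<in> O' \<and> (\<forall>y\<in>topspace L. \<pi> m y \<in> C \<longrightarrow> y \<in> V x)"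
    if x: "x \<in> topspace L" for x
    using basic_neighbourhood[of "V x" x] Vi[OF x] by metis
  then obtain m O' C where mC: "\<And>x. x \<in> topspace L \<Longrightarrow> openin (X (m x)) (O' x) \<and> closedin (X (m x)) (C x) \<and>
      O' x \<subseteq> C x \<and> \<pi> (m x) x \<in> O' x \<and> (\<forall>y\<in>topspace L. \<pi> (m x) y \<in> C x \<longrightarrow> y \<in> V x)" by metis
  obtain F2 where F2: "finite F2" "F2 \<subseteq> topspace L" "topspace L \<subseteq> (\<Union>x\<in>F2. {y \<in> topspace L. \<pi> (m x) y \<in> O' x})"
  proof -
    have "openin L {y \<in> topspace L. \<pi> (m x) y \<in> O' x} \<and> x \<in> {y \<in> topspace L. \<pi> (m x) y \<in> O' x}" if x: "x \<in> topspace L" for x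
      using openin_continuous_map_preimage[OF continuous_\<pi>] mC[OF x] x by blast
    then show ?thesis using fin_sub[of "\<lambda>x. {y \<in> topspace L. \<pi> (m x) y \<in> O' x}"] that by blast
  qed
  \<comment> \<open>The finitely many neighbourhoods are moved to a common stage.\<close>
  obtain M where M: "\<And>x. x \<in> F2 \<Longrightarrow> m x \<le> M" using F2(1) finite_nat_set_iff_bounded_le[of "m ` F2"] by auto
  define OM where "OM x = {y \<in> topspace (X M). bonding_map s (m x) M y \<in> O' x}" for x
  define CM where "CM x = {y \<in> topspace (X M). bonding_map s (m x) M y \<in> C x}" for x
  have oOM: "openin (X M) (OM x)" and cCM: "closedin (X M) (CM x)" and OC: "OM x \<subseteq> CM x" if x: "x \<in> F2" for x
    using openin_continuous_map_preimage[OF continuous_bonding_map[OF M[OF x]]]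
      closedin_continuous_map_preimage[OF continuous_bonding_map[OF M[OF x]]] mC[of x] F2(2) x
    unfolding OM_def CM_def by blast+
  have CV: "y \<in> V x" if "x \<in> F2" "y \<in> topspace L" "\<pi> M y \<in> CM x" for x y
    using that bonding_map_\<pi>[OF M[OF that(1)] that(2)] mC[of x] F2(2) unfolding CM_def by auto
  have OL: "\<exists>x\<in>F2. \<pi> M y \<in> OM x" if y: "y \<in> topspace L" for y
  proof -
    obtain x where x: "x \<in> F2" "\<pi> (m x) y \<in> O' x" using F2(3) y by blast
    then have "\<pi> M y \<in> OM x" unfolding OM_def using bonding_map_\<pi>[OF M[OF x(1)] y] \<pi>_in[OF y] by simp
    then show ?thesis using x(1) by blast
  qed
  \<comment> \<open>The obstructions at stage \<open>M\<close>: points outside the cover by the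
    \<open>OM\<close>, and points in triple overlaps of the \<open>CM\<close> whose counterparts
    \<open>V\<close> in \<open>L\<close> have no common point. \<open>Bad\<close> is closed and
    missed by \<open>L\<close>, so some later stage \<open>k\<close> misses it too.\<close>
  define Bad where "Bad = (topspace (X M) - (\<Union>x\<in>F2. OM x)) \<union>
      (\<Union>(x, y, w)\<in>{(x, y, w). x \<in> F2 \<and> y \<in> F2 \<and> w \<in> F2 \<and> V x \<inter> V y \<inter> V w = {}}. CM x \<inter> CM y \<inter> CM w)"
  have "closedin (X M) Bad"
    unfolding Bad_def
  proof (rule closedin_Un)
    have "openin (X M) (\<Union>x\<in>F2. OM x)" using oOM by blast
    then show "closedin (X M) (topspace (X M) - (\<Union>x\<in>F2. OM x))" by (rule closedin_diff[OF closedin_topspace])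
    have "finite (F2 \<times> F2 \<times> F2)" using F2(1) by simp
    then have "finite {(x, y, w). x \<in> F2 \<and> y \<in> F2 \<and> w \<in> F2 \<and> V x \<inter> V y \<inter> V w = {}}"
      by (rule rev_finite_subset) auto
    then show "closedin (X M) (\<Union>(x, y, w)\<in>{(x, y, w). x \<in> F2 \<and> y \<in> F2 \<and> w \<in> F2 \<and> V x \<inter> V y \<inter> V w = {}}. CM x \<inter> CM y \<inter> CM w)"
      by (intro closedin_Union) (auto intro!: closedin_Int cCM)
  qed
  moreover have "\<pi> M y \<notin> Bad" if y: "y \<in> topspace L" for y
    using OL[OF y] CV[OF _ y] unfolding Bad_def by blast
  ultimately obtain k where k: "M \<le> k" "\<And>y. y \<in> topspace (X k) \<Longrightarrow> bonding_map s M k y \<notin> Bad"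
    using vanishing_stage by blast
  let ?\<beta> = "bonding_map s M k"
  \<comment> \<open>A choice without any continuity, as germ cocycles permit.\<close>
  define \<iota> where "\<iota> y = (SOME x. x \<in> F2 \<and> ?\<beta> y \<in> OM x)" for y
  have \<iota>: "\<iota> y \<in> F2 \<and> ?\<beta> y \<in> OM (\<iota> y)" if y: "y \<in> topspace (X k)" for y
    unfolding \<iota>_def
  proof (rule someI_ex)
    have "?\<beta> y \<in> topspace (X M)" by (rule bonding_map_in[OF k(1) y])
    then show "\<exists>x. x \<in> F2 \<and> ?\<beta> y \<in> OM x" using k(2)[OF y] unfolding Bad_def by blast
  qed
  have F2L: "x \<in> topspace L" if "x \<in> F2" for x using F2(2) that by blast
  define \<kappa> where "\<kappa> y z = c (\<iota> y) (\<iota> z)" for y z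
  have coc: "germ_cocycle (X k) G \<kappa>"
    unfolding germ_cocycle_def
  proof
    fix y assume y: "y \<in> topspace (X k)"
    let ?U = "\<lambda>y. {z \<in> topspace (X k). ?\<beta> z \<in> OM (\<iota> y)}"
    have oU: "openin (X k) (?U y)" if "y \<in> topspace (X k)" for y
      using openin_continuous_map_preimage[OF continuous_bonding_map[OF k(1)] oOM] \<iota>[OF that] by blast
    have "germ_nhd (X k) G \<kappa> y (?U y)"
      unfolding germ_nhd_def
    proof (intro conjI ballI)
      show "openin (X k) (?U y)" by (rule oU[OF y])
      show "y \<in> ?U y" using y \<iota>[OF y] by blast
      fix z assume z: "z \<in> ?U y"
      then have zX: "z \<in> topspace (X k)" by blast
      have L: "\<iota> y \<in> topspace L" "\<iota> z \<in> topspace L" using \<iota>[OF y] \<iota>[OF zX] F2L by blast+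
      show "\<kappa> y z \<in> carrier G" unfolding \<kappa>_def using c[OF L] by blast
      have "\<kappa> y w = \<kappa> y z \<otimes> \<kappa> z w" if w: "w \<in> ?U y \<inter> ?U z" for w
      proof -
        have wX: "w \<in> topspace (X k)" using w by blast
        have "?\<beta> w \<in> CM (\<iota> y) \<inter> CM (\<iota> z) \<inter> CM (\<iota> w)" using w \<iota>[OF y] \<iota>[OF zX] \<iota>[OF wX] OC by blast
        then have "V (\<iota> y) \<inter> V (\<iota> z) \<inter> V (\<iota> w) \<noteq> {}"
          using k(2)[OF wX] \<iota>[OF y] \<iota>[OF zX] \<iota>[OF wX] unfolding Bad_def by blast
        then obtain v where "v \<in> V (\<iota> y)" "v \<in> V (\<iota> z)" "v \<in> V (\<iota> w)" by blast
        then show ?thesis unfolding \<kappa>_def using cc[OF L F2L] \<iota>[OF wX] by blast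
      qed
      moreover have "openin (X k) (?U y \<inter> ?U z)" using oU[OF y] oU[OF zX] by (rule openin_Int)
      moreover have "z \<in> ?U y \<inter> ?U z" using z \<iota>[OF zX] by blast
      ultimately show "\<exists>W. openin (X k) W \<and> z \<in> W \<and> (\<forall>w\<in>W. \<kappa> y w = \<kappa> y z \<otimes> \<kappa> z w)" by blast
    qed
    then show "\<exists>U. germ_nhd (X k) G \<kappa> y U" by blast
  qed
  let ?B = "gbundle L G (\<lambda>x y. \<kappa> (\<pi> k x) (\<pi> k y))"
  have cL: "germ_cocycle L G (\<lambda>x y. \<kappa> (\<pi> k x) (\<pi> k y))" by (rule germ_cocycle_pullback[OF coc continuous_\<pi>])
  have tB: "topspace ?B = topspace L \<times> carrier G" by (rule topspace_gbundle[OF G cL])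
  define a where "a z = \<iota> (\<pi> k z)" for z
  have aV: "a z \<in> topspace L \<and> z \<in> V (a z)" if z: "z \<in> topspace L" for z
  proof -
    have "a z \<in> F2" "?\<beta> (\<pi> k z) \<in> OM (a z)" unfolding a_def using \<iota>[OF \<pi>_in[OF z]] by blast+
    moreover from this have "\<pi> M z \<in> CM (a z)" using bonding_map_\<pi>[OF k(1) z] OC by auto
    ultimately show ?thesis using CV[OF _ z] F2L by blast
  qed
  \<comment> \<open>The point chosen in each fibre of \<open>E\<close>; it may jump with the index
    \<open>a z\<close>.\<close>
  define \<tau> where "\<tau> z = t (i (a z)) z" for z
  have \<tau>: "\<tau> z \<in> topspace E" "p (\<tau> z) = z" if z: "z \<in> topspace L" for z
  proof -
    have "z \<in> U (i (a z))" "i (a z) \<in> F" using VU aV[OF z] by blast+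
    then show "\<tau> z \<in> topspace E" "p (\<tau> z) = z" unfolding \<tau>_def using tE UF(3) by blast+
  qed
  define h where "h e = act (snd e) (\<tau> (fst e))" for e
  have "continuous_map ?B E h"
    unfolding continuous_map_def
  proof (intro conjI allI impI)
    show "h \<in> topspace ?B \<rightarrow> topspace E" using actE \<tau> unfolding h_def tB by auto
    fix Q assume Q: "openin E Q"
    show "openin ?B {e \<in> topspace ?B. h e \<in> Q}"
      unfolding openin_gbundle
    proof (intro conjI allI impI)
      show "{e \<in> topspace ?B. h e \<in> Q} \<subseteq> topspace L \<times> carrier G" unfolding tB by blast
      fix z g assume zg: "(z, g) \<in> {e \<in> topspace ?B. h e \<in> Q}"
      then have z: "z \<in> topspace L" "g \<in> carrier G" "act g (\<tau> z) \<in> Q" unfolding tB h_def by auto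
      let ?x = "a z"
      have x: "?x \<in> topspace L" "z \<in> V ?x" using aV[OF z(1)] by blast+
      have oV: "openin L (V ?x)" using Vi[OF x(1)] by blast
      have VUx: "V ?x \<subseteq> U (i ?x)" "i ?x \<in> F" using VU[OF x(1)] x(2) by blast+
      have "continuous_map (subtopology L (V ?x)) E (t (i ?x))"
        by (rule continuous_map_from_subtopology_mono[OF UF(2)[OF VUx(2)] VUx(1)])
      then have "continuous_map (subtopology L (V ?x)) E (act g \<circ> t (i ?x))"
        by (rule continuous_map_compose[OF _ act1[OF z(2)]])
      then have "openin (subtopology L (V ?x)) {y \<in> topspace (subtopology L (V ?x)). (act g \<circ> t (i ?x)) y \<in> Q}"
        by (rule openin_continuous_map_preimage[OF _ Q])
      moreover have "topspace (subtopology L (V ?x)) = V ?x" using openin_subset[OF oV] by auto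
      ultimately have oW: "openin L {y \<in> V ?x. (act g \<circ> t (i ?x)) y \<in> Q}"
        using openin_trans_full[OF _ oV] by metis
      moreover have "z \<in> {y \<in> V ?x. (act g \<circ> t (i ?x)) y \<in> Q}" using x(2) z(3) by (simp add: \<tau>_def)
      \<comment> \<open>Along the sheet through \<open>(z, g)\<close> the jumps of
        \<open>\<tau>\<close> are compensated by \<open>\<kappa>\<close>, so there \<open>h\<close>
        follows the continuous map \<open>act g \<circ> t (i ?x)\<close>.\<close>
      moreover have "(y, g \<otimes> \<kappa> (\<pi> k z) (\<pi> k y)) \<in> {e \<in> topspace ?B. h e \<in> Q}"
        if y: "y \<in> {y \<in> V ?x. (act g \<circ> t (i ?x)) y \<in> Q}" for y
      proof -
        have yL: "y \<in> topspace L" using y openin_subset[OF oV] by blast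
        have \<kappa>y: "\<kappa> (\<pi> k z) (\<pi> k y) = c ?x (a y)" unfolding \<kappa>_def a_def ..
        have cy: "c ?x (a y) \<in> carrier G" "t (i ?x) y = act (c ?x (a y)) (\<tau> y)"
          using c[OF x(1), of "a y"] aV[OF yL] y unfolding \<tau>_def by blast+
        have "h (y, g \<otimes> c ?x (a y)) = act g (act (c ?x (a y)) (\<tau> y))"
          unfolding h_def fst_conv snd_conv by (rule act3[OF z(2) cy(1) \<tau>(1)[OF yL]])
        also have "\<dots> \<in> Q" using y unfolding cy(2)[symmetric] by simp
        finally show ?thesis using yL z(2) cy(1) unfolding \<kappa>y tB by simp
      qed
      ultimately show "\<exists>W. openin L W \<and> z \<in> W \<and> (\<forall>y\<in>W. (y, g \<otimes> \<kappa> (\<pi> k z) (\<pi> k y)) \<in> {e \<in> topspace ?B. h e \<in> Q})"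
        by blast
    qed
  qed
  moreover have ph: "p (h e) = fst e" if "e \<in> topspace ?B" for e
    using that act2 \<tau> unfolding h_def tB by auto
  moreover have "bij_betw h (topspace ?B) (topspace E)"
    unfolding bij_betw_def
  proof
    show "inj_on h (topspace ?B)"
    proof (rule inj_onI)
      fix e f assume e: "e \<in> topspace ?B" and f: "f \<in> topspace ?B" and eq: "h e = h f"
      have "fst e = fst f" using ph[OF e] ph[OF f] eq by simp
      moreover from this have "snd e = snd f" using act6[of "snd e" "snd f" "\<tau> (fst e)"] eq e f \<tau> unfolding h_def tB by auto
      ultimately show "e = f" by (simp add: prod_eq_iff)
    qed
    show "h ` topspace ?B = topspace E"
    proof (intro equalityI subsetI)
      fix e assume "e \<in> h ` topspace ?B" then show "e \<in> topspace E" using actE \<tau> unfolding h_def tB by auto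
    next
      fix e assume e: "e \<in> topspace E"
      have z: "p e \<in> topspace L" using covering_map_in[OF p e] .
      obtain g where g: "g \<in> carrier G" "act g (\<tau> (p e)) = e" using act5[OF \<tau>(1)[OF z] e] \<tau>(2)[OF z] by blast
      then have "h (p e, g) = e" by (simp add: h_def)
      moreover have "(p e, g) \<in> topspace ?B" using z g(1) tB by simp
      ultimately show "e \<in> h ` topspace ?B" by (metis image_eqI)
    qed
  qed
  ultimately have "homeomorphic_map ?B E h"
    by (intro covering_bijective_imp_homeomorphic[OF gbundle_covering[OF G cL] p])
  then have "cover_equiv (?B, fst) (E, p)" unfolding cover_equiv_def using ph by auto
  then show ?thesis using that[OF coc] cover_equiv_sym by blast
qed

end

section \<open>Covers of the limit and surjections onto the group\<close>

lemma compose_loop_concat: "f \<circ> loop_concat p q = loop_concat (f \<circ> p) (f \<circ> q)"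
  by (auto simp: loop_concat_def)

lemma induced_hom_in_hom:
  assumes f: "continuous_map X Y f" "f a = b"
  shows "induced_hom Y b f \<in> hom (fundamental_group X a) (fundamental_group Y b)"
proof (rule homI)
  fix x assume "x \<in> carrier (fundamental_group X a)"
  then obtain p where p: "p \<in> loops X a" "x = loop_class X a p" unfolding carrier_fundamental_group by blast
  then show "induced_hom Y b f x \<in> carrier (fundamental_group Y b)"
    using induced_hom_loop_class[OF f p(1)] loops_compose[OF f p(1)] unfolding carrier_fundamental_group by simp
next
  fix x y assume "x \<in> carrier (fundamental_group X a)" "y \<in> carrier (fundamental_group X a)"
  then obtain p q where p: "p \<in> loops X a" "x = loop_class X a p" and q: "q \<in> loops X a" "y = loop_class X a q"
    unfolding carrier_fundamental_group by blast
  show "induced_hom Y b f (x \<otimes>\<^bsub>fundamental_group X a\<^esub> y) =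
      induced_hom Y b f x \<otimes>\<^bsub>fundamental_group Y b\<^esub> induced_hom Y b f y"
    unfolding p(2) q(2) fundamental_group_mult[OF p(1) q(1)] induced_hom_loop_class[OF f p(1)]
      induced_hom_loop_class[OF f q(1)] induced_hom_loop_class[OF f loops_concat[OF p(1) q(1)]]
      fundamental_group_mult[OF loops_compose[OF f p(1)] loops_compose[OF f q(1)]] compose_loop_concat ..
qed

lemma bonding_map_shift: "bonding_map (\<lambda>k. s (n + k)) j k = bonding_map s (n + j) (n + k)"
proof (induction k)
  case 0 then show ?case by (cases n) auto
qed (auto simp: fun_eq_iff)

text \<open>The point \<open>\<omega>\<close> lies over all base points and links the fibres over
  \<open>b n\<close> at the stages with one fibre over the limit.\<close>

locale approximant_system = inverse_system X s L \<pi> + group G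
  for X :: "nat \<Rightarrow> 'c topology" and s and L :: "'x topology" and \<pi> and G :: "('g, 'm) monoid_scheme" (structure) +
  fixes b :: "nat \<Rightarrow> 'c" and \<omega> :: 'x
  assumes finite_G: "finite (carrier G)" and connected_X: "connected_space (X n)"
    and locally_contractible_X: "locally_contractible (X n)"
    and \<omega>_in: "\<omega> \<in> topspace L" and \<pi>_\<omega>: "\<pi> n \<omega> = b n"
begin

abbreviation "pushed \<equiv> pushed_hom X s b"
abbreviation "reps \<equiv> sur_reps X s b G"
abbreviation "\<pi>\<^sub>1 n \<equiv> fundamental_group (X n) (b n)"

lemma group_G: "group G" ..

lemma lpc: "locally_path_connected_space (X n)"
  by (rule locally_contractible_imp_locally_path_connected[OF locally_contractible_X])

lemma path_connected_X: "path_connected_space (X n)"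
  using path_connected_eq_connected_space[OF lpc] connected_X by blast

lemma b_in: "b n \<in> topspace (X n)"
  using \<pi>_in[OF \<omega>_in, of n] \<pi>_\<omega> by simp

lemma bonding_map_b: "n \<le> m \<Longrightarrow> bonding_map s n m (b m) = b n"
  using bonding_map_\<pi>[OF _ \<omega>_in] \<pi>_\<omega> by metis

lemma topspace_L_ne: "topspace L \<noteq> {}"
  using \<omega>_in by blast

lemma repsD:
  assumes "(n, \<phi>) \<in> reps"
  shows "\<phi> \<in> hom (\<pi>\<^sub>1 n) G" "n \<le> m \<Longrightarrow> pushed n m \<phi> \<in> hom (\<pi>\<^sub>1 m) G"
    "n \<le> m \<Longrightarrow> pushed n m \<phi> ` carrier (\<pi>\<^sub>1 m) = carrier G"
  using assms unfolding sur_reps_def epi_def by auto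

definition pull :: "nat \<Rightarrow> nat \<Rightarrow> ('c \<Rightarrow> 'c \<Rightarrow> 'g) \<Rightarrow> 'c \<Rightarrow> 'c \<Rightarrow> 'g" where
  "pull n m \<kappa> = (\<lambda>x y. \<kappa> (bonding_map s n m x) (bonding_map s n m y))"

definition limit_cover :: "nat \<Rightarrow> ('c \<Rightarrow> 'c \<Rightarrow> 'g) \<Rightarrow> ('x \<times> 'g) topology \<times> ('x \<times> 'g \<Rightarrow> 'x)" where
  "limit_cover n \<kappa> = (gbundle L G (\<lambda>x y. \<kappa> (\<pi> n x) (\<pi> n y)), fst)"

lemma germ_cocycle_pull: "germ_cocycle (X n) G \<kappa> \<Longrightarrow> n \<le> m \<Longrightarrow> germ_cocycle (X m) G (pull n m \<kappa>)"
  unfolding pull_def by (rule germ_cocycle_pullback[OF _ continuous_bonding_map])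

text \<open>The two cocycles on \<open>L\<close> coincide, so the covers are equal and not merely
  equivalent. Representatives at different stages can thus be compared at a common one.\<close>

lemma limit_cover_pull: "n \<le> m \<Longrightarrow> limit_cover m (pull n m \<kappa>) = limit_cover n \<kappa>"
  unfolding limit_cover_def pull_def by (auto intro!: gbundle_cong simp: bonding_map_\<pi>)

lemma has_monodromy_pull:
  assumes "germ_cocycle (X n) G \<kappa>" "has_monodromy (X n) G \<kappa> (b n) \<phi>" "n \<le> m"
  shows "has_monodromy (X m) G (pull n m \<kappa>) (b m) (pushed n m \<phi>)"
  unfolding pull_def pushed_hom_def
  by (rule has_monodromy_pullback[OF group_G assms(1,2) continuous_bonding_map[OF assms(3)] bonding_map_b[OF assms(3)] b_in])

text \<open>Connectedness reaches the limit from all later stages together, and each single stage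
  from the limit; this matches the demand that a representative stay surjective at all later
  stages.\<close>

lemma inverse_system_gbundle_from:
  assumes "germ_cocycle (X n) G \<kappa>"
  shows "(\<And>k. connected_space (gbundle (X (n + k)) G (pull n (n + k) \<kappa>))) \<Longrightarrow> connected_space (fst (limit_cover n \<kappa>))"
    and "connected_space (fst (limit_cover n \<kappa>)) \<Longrightarrow> connected_space (gbundle (X (n + k)) G (pull n (n + k) \<kappa>))"
proof -
  interpret S: inverse_system "\<lambda>k. X (n + k)" "\<lambda>k. s (n + k)" L "\<lambda>k. \<pi> (n + k)" by (rule inverse_system_shift)
  have c: "germ_cocycle (X (n + 0)) G \<kappa>" using assms by simp
  show "connected_space (fst (limit_cover n \<kappa>))"
    if "\<And>k. connected_space (gbundle (X (n + k)) G (pull n (n + k) \<kappa>))"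
    using S.gbundle_limit_connected[OF group_G finite_G c] that
    by (simp add: bonding_map_shift pull_def limit_cover_def)
  show "connected_space (gbundle (X (n + k)) G (pull n (n + k) \<kappa>))"
    if "connected_space (fst (limit_cover n \<kappa>))"
    using S.gbundle_stage_connected[OF group_G finite_G c _ connected_X topspace_L_ne, of k] that
    by (simp add: bonding_map_shift pull_def limit_cover_def)
qed

lemma cover_of_hom_pull:
  assumes c: "germ_cocycle (X n) G \<kappa>" and m: "has_monodromy (X n) G \<kappa> (b n) \<phi>" and r: "(n, \<phi>) \<in> reps" and nm: "n \<le> m"
  shows "connected_space (gbundle (X m) G (pull n m \<kappa>))"
    and "cover_of_hom (X m) (b m) G (pushed n m \<phi>) (gbundle (X m) G (pull n m \<kappa>), fst)"
proof -
  show con: "connected_space (gbundle (X m) G (pull n m \<kappa>))"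
    by (rule gbundle_connected_if_surj[OF group_G germ_cocycle_pull[OF c nm] has_monodromy_pull[OF c m nm] path_connected_X b_in])
      (use repsD(3)[OF r nm] in blast)
  show "cover_of_hom (X m) (b m) G (pushed n m \<phi>) (gbundle (X m) G (pull n m \<kappa>), fst)"
    by (rule cover_of_hom_gbundle[OF group_G germ_cocycle_pull[OF c nm] has_monodromy_pull[OF c m nm] b_in con])
qed

lemma limit_cover_regular:
  assumes "germ_cocycle (X n) G \<kappa>" "has_monodromy (X n) G \<kappa> (b n) \<phi>" "(n, \<phi>) \<in> reps"
  shows "limit_cover n \<kappa> \<in> regular_covers L G"
proof -
  have "connected_space (fst (limit_cover n \<kappa>))"
    by (rule inverse_system_gbundle_from(1)[OF assms(1)]) (rule cover_of_hom_pull(1)[OF assms], simp)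
  then show ?thesis
    using gbundle_regular_cover[OF group_G germ_cocycle_pullback[OF assms(1) continuous_\<pi>] _ topspace_L_ne]
    unfolding limit_cover_def by simp
qed

lemma limit_cover_equiv_pullback:
  assumes "germ_cocycle (X n) G \<kappa>" "cover_equiv (gbundle (X n) G \<kappa>, fst) (F, r)"
  shows "cover_equiv (limit_cover n \<kappa>) (pullback_cover L (\<pi> n) (F, r))"
  unfolding limit_cover_def
  by (rule cover_equiv_trans[OF gbundle_pullback_equiv[OF group_G assms(1) continuous_\<pi>] cover_equiv_pullback[OF assms(2)]])

lemma limit_cover_equiv:
  assumes "germ_cocycle (X n) G \<kappa>" "germ_cocycle (X n) G \<mu>" "cover_equiv (gbundle (X n) G \<kappa>, fst) (gbundle (X n) G \<mu>, fst)"
  shows "cover_equiv (limit_cover n \<kappa>) (limit_cover n \<mu>)"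
  using cover_equiv_trans[OF limit_cover_equiv_pullback[OF assms(1,3)]
      cover_equiv_sym[OF limit_cover_equiv_pullback[OF assms(2) cover_equiv_refl]]] .

text \<open>Cocycles with a given monodromy are far from unique. One is picked here;
  \<open>rep_cover_unique\<close> shows that the choice does not affect the cover up to
  equivalence.\<close>

definition cocycle_of :: "nat \<times> ((real \<Rightarrow> 'c) set \<Rightarrow> 'g) \<Rightarrow> 'c \<Rightarrow> 'c \<Rightarrow> 'g" where
  "cocycle_of r = (SOME \<kappa>. germ_cocycle (X (fst r)) G \<kappa> \<and> has_monodromy (X (fst r)) G \<kappa> (b (fst r)) (snd r))"

definition rep_cover :: "nat \<times> ((real \<Rightarrow> 'c) set \<Rightarrow> 'g) \<Rightarrow> ('x \<times> 'g) topology \<times> ('x \<times> 'g \<Rightarrow> 'x)" where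
  "rep_cover r = limit_cover (fst r) (cocycle_of r)"

lemma cocycle_of:
  assumes "(n, \<phi>) \<in> reps"
  shows "germ_cocycle (X n) G (cocycle_of (n, \<phi>))" "has_monodromy (X n) G (cocycle_of (n, \<phi>)) (b n) \<phi>"
proof -
  obtain \<kappa> where "germ_cocycle (X n) G \<kappa>" "has_monodromy (X n) G \<kappa> (b n) \<phi>"
    using ex_cocycle_with_monodromy[OF group_G repsD(1)[OF assms] path_connected_X lpc
        locally_contractible_imp_semilocally_simply_connected[OF locally_contractible_X] b_in] by blast
  then have "\<exists>\<kappa>. germ_cocycle (X (fst (n, \<phi>))) G \<kappa> \<and> has_monodromy (X (fst (n, \<phi>))) G \<kappa> (b (fst (n, \<phi>))) (snd (n, \<phi>))"
    by auto
  from someI_ex[OF this] show "germ_cocycle (X n) G (cocycle_of (n, \<phi>))" "has_monodromy (X n) G (cocycle_of (n, \<phi>)) (b n) \<phi>"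
    unfolding cocycle_of_def by auto
qed

lemma rep_cover_regular: "r \<in> reps \<Longrightarrow> rep_cover r \<in> regular_covers L G"
  using limit_cover_regular[OF cocycle_of] unfolding rep_cover_def by (metis fst_conv surj_pair)

lemma rep_cover_unique:
  assumes r: "(n, \<phi>) \<in> reps" and c: "germ_cocycle (X n) G \<kappa>" "has_monodromy (X n) G \<kappa> (b n) \<phi>"
  shows "cover_equiv (limit_cover n \<kappa>) (rep_cover (n, \<phi>))"
proof -
  have "cover_equiv (gbundle (X n) G (pull n n \<kappa>), fst) (gbundle (X n) G (pull n n (cocycle_of (n, \<phi>))), fst)"
    by (rule cover_of_hom_unique[OF cover_of_hom_pull(2)[OF c r order_refl] cover_of_hom_pull(2)[OF cocycle_of[OF r] r order_refl] lpc]) simp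
  then show ?thesis
    using limit_cover_equiv[OF c(1) cocycle_of(1)[OF r]] unfolding rep_cover_def by (simp add: pull_def)
qed

text \<open>A cover \<open>D\<close> belonging to \<open>\<phi>\<close> is unique up to equivalence
  and pullback respects equivalence, so the condition in \<open>corresponds\<close> reduces to the
  standard choice \<open>rep_cover\<close>.\<close>

lemma cover_of_hom_rep_iff:
  fixes C :: "'e topology \<times> ('e \<Rightarrow> 'x)"
  assumes r: "(n, \<phi>) \<in> reps"
  shows "(\<exists>D :: ('c \<times> 'g) topology \<times> ('c \<times> 'g \<Rightarrow> 'c). cover_of_hom (X n) (b n) G \<phi> D \<and> cover_equiv C (pullback_cover L (\<pi> n) D))
    \<longleftrightarrow> cover_equiv C (rep_cover (n, \<phi>))"
proof -
  let ?\<kappa> = "cocycle_of (n, \<phi>)"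
  note c = cocycle_of[OF r]
  have "connected_space (gbundle (X n) G ?\<kappa>)"
    using cover_of_hom_pull(1)[OF c r order_refl] by (simp add: pull_def)
  then have coh: "cover_of_hom (X n) (b n) G \<phi> (gbundle (X n) G ?\<kappa>, fst)"
    by (rule cover_of_hom_gbundle[OF group_G c b_in])
  have eq: "cover_equiv (rep_cover (n, \<phi>)) (pullback_cover L (\<pi> n) D)"
    if "cover_of_hom (X n) (b n) G \<phi> D" for D :: "('c \<times> 'g) topology \<times> ('c \<times> 'g \<Rightarrow> 'c)"
  proof -
    obtain F r where D: "D = (F, r)" by fastforce
    have "cover_equiv (gbundle (X n) G ?\<kappa>, fst) (F, r)"
      using cover_of_hom_unique[OF coh that lpc refl] D by simp
    then show ?thesis using limit_cover_equiv_pullback[OF c(1)] D by (simp add: rep_cover_def)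
  qed
  show ?thesis
  proof
    assume "\<exists>D :: ('c \<times> 'g) topology \<times> ('c \<times> 'g \<Rightarrow> 'c). cover_of_hom (X n) (b n) G \<phi> D \<and> cover_equiv C (pullback_cover L (\<pi> n) D)"
    then show "cover_equiv C (rep_cover (n, \<phi>))" using eq cover_equiv_sym cover_equiv_trans by blast
  next
    assume "cover_equiv C (rep_cover (n, \<phi>))"
    then show "\<exists>D :: ('c \<times> 'g) topology \<times> ('c \<times> 'g \<Rightarrow> 'c). cover_of_hom (X n) (b n) G \<phi> D \<and> cover_equiv C (pullback_cover L (\<pi> n) D)"
      using eq[OF coh] coh cover_equiv_trans by blast
  qed
qed

definition same_kernel :: "nat \<times> ((real \<Rightarrow> 'c) set \<Rightarrow> 'g) \<Rightarrow> nat \<times> ((real \<Rightarrow> 'c) set \<Rightarrow> 'g) \<Rightarrow> nat \<Rightarrow> bool" where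
  "same_kernel r r' N \<longleftrightarrow> fst r \<le> N \<and> fst r' \<le> N \<and>
     (\<forall>x\<in>carrier (\<pi>\<^sub>1 N). pushed (fst r) N (snd r) x = \<one> \<longleftrightarrow> pushed (fst r') N (snd r') x = \<one>)"

text \<open>An equivalence over the limit is brought to a stage after both cocycles have been moved
  to \<open>max n m\<close>. Conversely, equal kernels give equivalent covers of stage
  \<open>N\<close>, which are pulled back to the limit.\<close>

lemma rep_cover_equiv_iff:
  assumes r: "r \<in> reps" and r': "r' \<in> reps"
  shows "cover_equiv (rep_cover r) (rep_cover r') \<longleftrightarrow> (\<exists>N. same_kernel r r' N)"
proof -
  obtain n \<phi> m \<psi> where rr: "r = (n, \<phi>)" "r' = (m, \<psi>)" by fastforce
  note c = cocycle_of[OF r[unfolded rr]] and d = cocycle_of[OF r'[unfolded rr]]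
  let ?\<kappa> = "cocycle_of (n, \<phi>)" and ?\<mu> = "cocycle_of (m, \<psi>)"
  show ?thesis
  proof
    assume eq: "cover_equiv (rep_cover r) (rep_cover r')"
    let ?N = "max n m"
    have N: "n \<le> ?N" "m \<le> ?N" by simp_all
    interpret S: inverse_system "\<lambda>k. X (?N + k)" "\<lambda>k. s (?N + k)" L "\<lambda>k. \<pi> (?N + k)" by (rule inverse_system_shift)
    have 1: "germ_cocycle (X (?N + 0)) G (pull n ?N ?\<kappa>)" "germ_cocycle (X (?N + 0)) G (pull m ?N ?\<mu>)"
      using germ_cocycle_pull[OF c(1) N(1)] germ_cocycle_pull[OF d(1) N(2)] by simp_all
    have "cover_equiv (limit_cover ?N (pull n ?N ?\<kappa>)) (limit_cover ?N (pull m ?N ?\<mu>))"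
      using eq limit_cover_pull[OF N(1)] limit_cover_pull[OF N(2)] unfolding rr rep_cover_def by simp
    then have 2: "cover_equiv (gbundle L G (\<lambda>x y. pull n ?N ?\<kappa> (\<pi> (?N + 0) x) (\<pi> (?N + 0) y)), fst)
        (gbundle L G (\<lambda>x y. pull m ?N ?\<mu> (\<pi> (?N + 0) x) (\<pi> (?N + 0) y)), fst)"
      unfolding limit_cover_def by simp
    have pp: "(\<lambda>x y. pull j ?N \<nu> (bonding_map (\<lambda>k. s (?N + k)) 0 k x) (bonding_map (\<lambda>k. s (?N + k)) 0 k y)) = pull j (?N + k) \<nu>"
      if "j \<le> ?N" for j k \<nu>
      unfolding pull_def bonding_map_shift using bonding_map_trans[OF that, of "?N + k" s] by (simp add: fun_eq_iff)
    have 3: "has_monodromy (X (?N + k)) G (\<lambda>x y. pull n ?N ?\<kappa> (bonding_map (\<lambda>k. s (?N + k)) 0 k x) (bonding_map (\<lambda>k. s (?N + k)) 0 k y))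
        (\<pi> (?N + k) \<omega>) (pushed n (?N + k) \<phi>)" for k
      unfolding pp[OF N(1)] \<pi>_\<omega> by (rule has_monodromy_pull[OF c]) simp
    have 4: "has_monodromy (X (?N + k)) G (\<lambda>x y. pull m ?N ?\<mu> (bonding_map (\<lambda>k. s (?N + k)) 0 k x) (bonding_map (\<lambda>k. s (?N + k)) 0 k y))
        (\<pi> (?N + k) \<omega>) (pushed m (?N + k) \<psi>)" for k
      unfolding pp[OF N(2)] \<pi>_\<omega> by (rule has_monodromy_pull[OF d]) simp
    obtain k where "\<And>q. q \<in> loops (X (?N + k)) (b (?N + k)) \<Longrightarrow>
        pushed n (?N + k) \<phi> (loop_class (X (?N + k)) (b (?N + k)) q) = \<one> \<longleftrightarrow>
        pushed m (?N + k) \<psi> (loop_class (X (?N + k)) (b (?N + k)) q) = \<one>"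
      using S.equal_kernels_if_equiv_pullbacks[OF group_G finite_G 1 2 \<omega>_in 3 4] unfolding \<pi>_\<omega> by blast
    then have "same_kernel r r' (?N + k)"
      unfolding same_kernel_def rr carrier_fundamental_group by auto
    then show "\<exists>N. same_kernel r r' N" ..
  next
    assume "\<exists>N. same_kernel r r' N"
    then obtain N where N: "n \<le> N" "m \<le> N" and
      k: "\<And>x. x \<in> carrier (\<pi>\<^sub>1 N) \<Longrightarrow> pushed n N \<phi> x = \<one> \<longleftrightarrow> pushed m N \<psi> x = \<one>"
      unfolding same_kernel_def rr by auto
    have "kernel (\<pi>\<^sub>1 N) G (pushed n N \<phi>) = kernel (\<pi>\<^sub>1 N) G (pushed m N \<psi>)"
      unfolding kernel_def using k by blast
    then have "cover_equiv (gbundle (X N) G (pull n N ?\<kappa>), fst) (gbundle (X N) G (pull m N ?\<mu>), fst)"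
      using cover_of_hom_unique[OF cover_of_hom_pull(2)[OF c r[unfolded rr] N(1)] cover_of_hom_pull(2)[OF d r'[unfolded rr] N(2)] lpc] by blast
    then have "cover_equiv (limit_cover N (pull n N ?\<kappa>)) (limit_cover N (pull m N ?\<mu>))"
      by (rule limit_cover_equiv[OF germ_cocycle_pull[OF c(1) N(1)] germ_cocycle_pull[OF d(1) N(2)]])
    then show "cover_equiv (rep_cover r) (rep_cover r')"
      unfolding rr rep_cover_def limit_cover_pull[OF N(1)] limit_cover_pull[OF N(2)] by simp
  qed
qed

text \<open>The points of \<open>C\<close> may have any type. \<open>C\<close> has a cocycle at some
  stage \<open>k\<close>, and its monodromy is surjective at all later stages, because connectedness
  of the cover of the limit passes to the bundles there.\<close>

lemma regular_cover_equiv_rep_cover: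
  fixes C :: "'e topology \<times> ('e \<Rightarrow> 'x)"
  assumes C: "C \<in> regular_covers L G"
  shows "\<exists>r\<in>reps. cover_equiv C (rep_cover r)"
proof -
  obtain E p where Ep: "C = (E, p)" by fastforce
  have E: "connected_space E" "covering_map E L p" using C unfolding Ep regular_covers_def is_cover_def by auto
  obtain act where act: "\<And>g. g \<in> carrier G \<Longrightarrow> continuous_map E E (act g)"
    "\<And>g e. g \<in> carrier G \<Longrightarrow> e \<in> topspace E \<Longrightarrow> p (act g e) = p e"
    "\<And>g h e. g \<in> carrier G \<Longrightarrow> h \<in> carrier G \<Longrightarrow> e \<in> topspace E \<Longrightarrow> act (g \<otimes> h) e = act g (act h e)"
    "\<And>e e'. e \<in> topspace E \<Longrightarrow> e' \<in> topspace E \<Longrightarrow> p e = p e' \<Longrightarrow> \<exists>g\<in>carrier G. act g e = e'"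
    "\<And>g h e. g \<in> carrier G \<Longrightarrow> h \<in> carrier G \<Longrightarrow> e \<in> topspace E \<Longrightarrow> act g e = act h e \<Longrightarrow> g = h"
    by (rule regular_cover_action[OF group_G C[unfolded Ep]]) (rule that; assumption)
  have "\<exists>k \<kappa>. germ_cocycle (X k) G \<kappa> \<and> cover_equiv (E, p) (limit_cover k \<kappa>)"
    unfolding limit_cover_def
    by (rule principal_cover_from_stage[OF group_G E(2), of act]; (fact act | blast))
  then obtain k \<kappa> where k: "germ_cocycle (X k) G \<kappa>" "cover_equiv (E, p) (limit_cover k \<kappa>)" by blast
  have con: "connected_space (fst (limit_cover k \<kappa>))"
  proof -
    obtain h where h: "homeomorphic_map E (fst (limit_cover k \<kappa>)) h"
      using k(2) unfolding cover_equiv_def limit_cover_def by auto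
    have "E homeomorphic_space fst (limit_cover k \<kappa>)" using h homeomorphic_map_imp_homeomorphic_space by blast
    then show ?thesis using E(1) homeomorphic_connected_space by blast
  qed
  obtain \<phi> where \<phi>: "\<phi> \<in> hom (\<pi>\<^sub>1 k) G" "has_monodromy (X k) G \<kappa> (b k) \<phi>"
    using ex_monodromy[OF group_G k(1) b_in] by blast
  have "pushed k m \<phi> \<in> epi (\<pi>\<^sub>1 m) G" if km: "k \<le> m" for m
  proof -
    have hom: "pushed k m \<phi> \<in> hom (\<pi>\<^sub>1 m) G"
      unfolding pushed_hom_def
      by (rule Group.hom_compose[OF induced_hom_in_hom[OF continuous_bonding_map[OF km] bonding_map_b[OF km]] \<phi>(1)])
    have "connected_space (gbundle (X m) G (pull k m \<kappa>))"
      using inverse_system_gbundle_from(2)[OF k(1) con, of "m - k"] km by simp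
    then have "carrier G \<subseteq> pushed k m \<phi> ` carrier (\<pi>\<^sub>1 m)"
      by (rule surj_if_gbundle_connected[OF group_G germ_cocycle_pull[OF k(1) km] has_monodromy_pull[OF k(1) \<phi>(2) km] lpc b_in])
    moreover have "pushed k m \<phi> ` carrier (\<pi>\<^sub>1 m) \<subseteq> carrier G" using hom unfolding hom_def by auto
    ultimately show ?thesis using hom unfolding epi_def by blast
  qed
  then have r: "(k, \<phi>) \<in> reps" unfolding sur_reps_def using \<phi>(1) by blast
  then show ?thesis
    using cover_equiv_trans[OF k(2) rep_cover_unique[OF r k(1) \<phi>(2)]] unfolding Ep by blast
qed

end

section \<open>Kernels, automorphisms and orbits\<close>

lemma hom_loop_rev:
  fixes G (structure)
  assumes "group G" and \<phi>: "\<phi> \<in> hom (fundamental_group X a) G" and a: "a \<in> topspace X" and q: "q \<in> loops X a"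
  shows "\<phi> (loop_class X a (path_rev q)) = inv (\<phi> (loop_class X a q))"
proof -
  interpret group G by fact
  have qr: "path_rev q \<in> loops X a" by (rule loops_rev[OF q])
  have c: "(\<lambda>_. a) \<in> loops X a" by (rule loops_const[OF a])
  have car: "loop_class X a p \<in> carrier (fundamental_group X a)" if "p \<in> loops X a" for p
    using that by (simp add: carrier_fundamental_group)
  have G: "\<phi> (loop_class X a p) \<in> carrier G" if "p \<in> loops X a" for p
    using \<phi> car[OF that] unfolding hom_def by blast
  have m: "\<phi> (loop_class X a (loop_concat p p')) = \<phi> (loop_class X a p) \<otimes> \<phi> (loop_class X a p')"
    if "p \<in> loops X a" "p' \<in> loops X a" for p p'
    using hom_mult[OF \<phi> car[OF that(1)] car[OF that(2)]] fundamental_group_mult[OF that] by simp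
  have "loop_concat (\<lambda>_. a) (\<lambda>_. a) = (\<lambda>_. a)" by (simp add: loop_concat_def)
  then have "\<phi> (loop_class X a (\<lambda>_. a)) = \<one>" using m[OF c c] G[OF c] by (metis r_cancel_one')
  moreover have "path_homotopic X a a (loop_concat q (path_rev q)) (\<lambda>_. a)"
    using path_homotopic_rev[of X q] q by (simp add: loops_def)
  then have "loop_class X a (loop_concat q (path_rev q)) = loop_class X a (\<lambda>_. a)" by (rule loop_class_eqI)
  ultimately have "\<phi> (loop_class X a q) \<otimes> \<phi> (loop_class X a (path_rev q)) = \<one>" using m[OF q qr] by simp
  then show ?thesis using inv_equality[OF _ G[OF qr] G[OF q]] inv_inv[OF G[OF q]] G[OF q] G[OF qr]
    by (metis inv_comm inv_equality)
qed

text \<open>\<open>ker\<close> is applied to the class of \<open>p\<close> followed by the reverse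
  of \<open>q\<close>; a homomorphism is trivial there exactly if its values at \<open>x\<close> and
  \<open>y\<close> are equal.\<close>

lemma hom_eq_iff_of_kernels:
  fixes G (structure)
  assumes "group G" and \<phi>: "\<phi> \<in> hom (fundamental_group X a) G" and \<psi>: "\<psi> \<in> hom (fundamental_group X a) G"
    and a: "a \<in> topspace X"
    and ker: "\<And>x. x \<in> carrier (fundamental_group X a) \<Longrightarrow> \<phi> x = \<one> \<longleftrightarrow> \<psi> x = \<one>"
    and x: "x \<in> carrier (fundamental_group X a)" and y: "y \<in> carrier (fundamental_group X a)"
  shows "\<phi> x = \<phi> y \<longleftrightarrow> \<psi> x = \<psi> y"
proof -
  interpret group G by fact
  obtain p q where p: "p \<in> loops X a" "x = loop_class X a p" and q: "q \<in> loops X a" "y = loop_class X a q"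
    using x y unfolding carrier_fundamental_group by blast
  let ?z = "loop_class X a (loop_concat p (path_rev q))"
  have z: "?z \<in> carrier (fundamental_group X a)"
    using loops_concat[OF p(1) loops_rev[OF q(1)]] by (simp add: carrier_fundamental_group)
  have r: "loop_class X a (path_rev q) \<in> carrier (fundamental_group X a)"
    using loops_rev[OF q(1)] by (simp add: carrier_fundamental_group)
  have key: "\<theta> x = \<theta> y \<longleftrightarrow> \<theta> ?z = \<one>" if \<theta>: "\<theta> \<in> hom (fundamental_group X a) G" for \<theta>
  proof -
    have G: "\<theta> x \<in> carrier G" "\<theta> y \<in> carrier G" using \<theta> x y unfolding hom_def by blast+
    have "\<theta> ?z = \<theta> x \<otimes> inv \<theta> y"
      using hom_mult[OF \<theta> x r] fundamental_group_mult[OF p(1) loops_rev[OF q(1)]]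
        hom_loop_rev[OF assms(1) \<theta> a q(1)] p(2) q(2) by simp
    moreover have "\<theta> x \<otimes> inv \<theta> y = \<one> \<longleftrightarrow> \<theta> x = \<theta> y"
    proof
      assume "\<theta> x \<otimes> inv \<theta> y = \<one>"
      then show "\<theta> x = \<theta> y" using G by (metis inv_equality inv_inv inv_closed)
    qed (use G in simp)
    ultimately show ?thesis by simp
  qed
  show ?thesis using key[OF \<phi>] key[OF \<psi>] ker[OF z] by blast
qed

context approximant_system
begin

abbreviation "rel \<equiv> sur_rel X s b G"

lemma pushed_trans:
  assumes "n \<le> N" "N \<le> M" and x: "x \<in> carrier (\<pi>\<^sub>1 M)"
  shows "induced_hom (X N) (b N) (bonding_map s N M) x \<in> carrier (\<pi>\<^sub>1 N)"
    and "pushed n M \<phi> x = pushed n N \<phi> (induced_hom (X N) (b N) (bonding_map s N M) x)"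
proof -
  obtain q where q: "q \<in> loops (X M) (b M)" "x = loop_class (X M) (b M) q"
    using x unfolding carrier_fundamental_group by blast
  note f = continuous_bonding_map[OF assms(2)] bonding_map_b[OF assms(2)]
  note g = continuous_bonding_map[OF assms(1)] bonding_map_b[OF assms(1)]
  note h = continuous_bonding_map[OF le_trans[OF assms(1,2)]] bonding_map_b[OF le_trans[OF assms(1,2)]]
  have l: "bonding_map s N M \<circ> q \<in> loops (X N) (b N)" by (rule loops_compose[OF f q(1)])
  show "induced_hom (X N) (b N) (bonding_map s N M) x \<in> carrier (\<pi>\<^sub>1 N)"
    using induced_hom_loop_class[OF f q(1)] l unfolding q(2) carrier_fundamental_group by simp
  have "bonding_map s n M \<circ> q = bonding_map s n N \<circ> (bonding_map s N M \<circ> q)"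
    using bonding_map_trans[OF assms(1,2), of s] by (auto simp: fun_eq_iff)
  then show "pushed n M \<phi> x = pushed n N \<phi> (induced_hom (X N) (b N) (bonding_map s N M) x)"
    unfolding pushed_hom_def q(2) comp_apply[of \<phi>]
    using induced_hom_loop_class[OF f q(1)] induced_hom_loop_class[OF g l] induced_hom_loop_class[OF h q(1)] by simp
qed

lemma equiv_rel: "equiv reps rel"
proof (rule equivI)
  show "rel \<subseteq> reps \<times> reps" unfolding sur_rel_def by auto
  show "refl_on reps rel" unfolding refl_on_def sur_rel_def by auto
  show "sym rel"
  proof (rule symI)
    fix r r' assume "(r, r') \<in> rel"
    then show "(r', r) \<in> rel" unfolding sur_rel_def by auto
  qed
  show "trans rel"
  proof (rule transI)
    fix r1 r2 r3 assume 12: "(r1, r2) \<in> rel" and 23: "(r2, r3) \<in> rel"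
    obtain n1 \<phi>1 n2 \<phi>2 n3 \<phi>3 where r: "r1 = (n1, \<phi>1)" "r2 = (n2, \<phi>2)" "r3 = (n3, \<phi>3)" by (metis surj_pair)
    obtain N where N: "n1 \<le> N" "n2 \<le> N" "\<And>x. x \<in> carrier (\<pi>\<^sub>1 N) \<Longrightarrow> pushed n1 N \<phi>1 x = pushed n2 N \<phi>2 x"
      and R: "r1 \<in> reps"
      using 12 unfolding r sur_rel_def by auto
    obtain M where M: "n2 \<le> M" "n3 \<le> M" "\<And>x. x \<in> carrier (\<pi>\<^sub>1 M) \<Longrightarrow> pushed n2 M \<phi>2 x = pushed n3 M \<phi>3 x"
      and R': "r3 \<in> reps"
      using 23 unfolding r sur_rel_def by auto
    \<comment> \<open>Agreement at a stage persists at later ones by \<open>pushed_trans\<close>, so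
      both agreements hold at the larger stage.\<close>
    let ?K = "max N M"
    have NK: "N \<le> ?K" "M \<le> ?K" by simp_all
    have "pushed n1 ?K \<phi>1 x = pushed n3 ?K \<phi>3 x" if x: "x \<in> carrier (\<pi>\<^sub>1 ?K)" for x
    proof -
      have "pushed n1 ?K \<phi>1 x = pushed n2 ?K \<phi>2 x"
        using pushed_trans(2)[OF N(1) NK(1) x, of \<phi>1] pushed_trans(2)[OF N(2) NK(1) x, of \<phi>2] N(3)[OF pushed_trans(1)[OF N(1) NK(1) x]] by simp
      also have "\<dots> = pushed n3 ?K \<phi>3 x"
        using pushed_trans(2)[OF M(1) NK(2) x, of \<phi>2] pushed_trans(2)[OF M(2) NK(2) x, of \<phi>3] M(3)[OF pushed_trans(1)[OF M(1) NK(2) x]] by simp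
      finally show ?thesis .
    qed
    moreover have "n1 \<le> ?K" "n3 \<le> ?K" using N(1) M(2) by auto
    ultimately show "(r1, r3) \<in> rel" using R R' unfolding r sur_rel_def by auto
  qed
qed

definition cover_class :: "nat \<times> ((real \<Rightarrow> 'c) set \<Rightarrow> 'g) \<Rightarrow> (nat \<times> ((real \<Rightarrow> 'c) set \<Rightarrow> 'g)) set" where
  "cover_class r = {r' \<in> reps. cover_equiv (rep_cover r) (rep_cover r')}"

lemma rel_imp_cover_equiv:
  assumes "(r, r') \<in> rel"
  shows "cover_equiv (rep_cover r) (rep_cover r')"
proof -
  obtain n \<phi> m \<psi> where r: "r = (n, \<phi>)" "r' = (m, \<psi>)" by fastforce
  obtain N where "n \<le> N" "m \<le> N" "\<And>x. x \<in> carrier (\<pi>\<^sub>1 N) \<Longrightarrow> pushed n N \<phi> x = pushed m N \<psi> x"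
    and R: "r \<in> reps" "r' \<in> reps"
    using assms unfolding r sur_rel_def by auto
  then have "same_kernel r r' N" unfolding same_kernel_def r by simp
  then show ?thesis using rep_cover_equiv_iff[OF R] by blast
qed

lemma pushed_comp: "pushed n N (\<alpha> \<circ> \<phi>) = \<alpha> \<circ> pushed n N \<phi>"
  by (simp add: pushed_hom_def o_assoc)

lemma autD:
  assumes "\<alpha> \<in> auto G"
  shows "\<alpha> \<in> hom G G" "bij_betw \<alpha> (carrier G) (carrier G)"
  using assms unfolding auto_def Bij_def by auto

text \<open>Composition with an automorphism changes neither surjectivity nor the kernel, hence not
  the equivalence class of the cover.\<close>

lemma aut_comp_rep:
  assumes r: "(n, \<phi>) \<in> reps" and \<alpha>: "\<alpha> \<in> auto G"
  shows "(n, \<alpha> \<circ> \<phi>) \<in> reps" and "cover_equiv (rep_cover (n, \<phi>)) (rep_cover (n, \<alpha> \<circ> \<phi>))"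
proof -
  note a = autD[OF \<alpha>]
  have "pushed n m (\<alpha> \<circ> \<phi>) \<in> epi (\<pi>\<^sub>1 m) G" if nm: "n \<le> m" for m
  proof -
    have "\<alpha> \<circ> pushed n m \<phi> \<in> hom (\<pi>\<^sub>1 m) G" by (rule Group.hom_compose[OF repsD(2)[OF r nm] a(1)])
    moreover have "(\<alpha> \<circ> pushed n m \<phi>) ` carrier (\<pi>\<^sub>1 m) = carrier G"
      unfolding image_comp[symmetric] repsD(3)[OF r nm] using a(2) by (simp add: bij_betw_def)
    ultimately show ?thesis unfolding pushed_comp epi_def by blast
  qed
  moreover have "\<alpha> \<circ> \<phi> \<in> hom (\<pi>\<^sub>1 n) G" by (rule Group.hom_compose[OF repsD(1)[OF r] a(1)])
  ultimately show R: "(n, \<alpha> \<circ> \<phi>) \<in> reps" unfolding sur_reps_def by blast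
  have "\<alpha> \<one> = \<one>" using hom_one[OF a(1)] by simp
  then have one: "\<alpha> g = \<one> \<longleftrightarrow> g = \<one>" if "g \<in> carrier G" for g
    using a(2) that one_closed unfolding bij_betw_def inj_on_def by metis
  have "same_kernel (n, \<phi>) (n, \<alpha> \<circ> \<phi>) n"
    unfolding same_kernel_def fst_conv snd_conv pushed_comp
    using one repsD(2)[OF r order_refl] unfolding hom_def by auto
  then show "cover_equiv (rep_cover (n, \<phi>)) (rep_cover (n, \<alpha> \<circ> \<phi>))" using rep_cover_equiv_iff[OF r R] by blast
qed

text \<open>Where the kernels agree, sending \<open>pushed n N \<phi> x\<close> to
  \<open>pushed m N \<psi> x\<close> is well defined and injective; it is onto because
  \<open>\<psi>\<close> stays surjective. The two homomorphisms are matched at stage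
  \<open>N\<close>, which is what \<open>sur_rel\<close> asks for.\<close>

lemma ex_aut_if_cover_equiv:
  assumes r: "(n, \<phi>) \<in> reps" and r': "r' \<in> reps" and eq: "cover_equiv (rep_cover (n, \<phi>)) (rep_cover r')"
  obtains \<alpha> where "\<alpha> \<in> auto G" "((n, \<alpha> \<circ> \<phi>), r') \<in> rel"
proof -
  obtain m \<psi> where rr: "r' = (m, \<psi>)" by fastforce
  obtain N where N: "n \<le> N" "m \<le> N" and
    k: "\<And>x. x \<in> carrier (\<pi>\<^sub>1 N) \<Longrightarrow> pushed n N \<phi> x = \<one> \<longleftrightarrow> pushed m N \<psi> x = \<one>"
  proof -
    obtain N where "same_kernel (n, \<phi>) r' N" using eq rep_cover_equiv_iff[OF r r'] by blast
    then show ?thesis using that unfolding same_kernel_def rr by auto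
  qed
  let ?P = "pushed n N \<phi>" and ?Q = "pushed m N \<psi>"
  note P = repsD(2,3)[OF r N(1)] and Q = repsD(2,3)[OF r'[unfolded rr] N(2)]
  have iff: "?P x = ?P y \<longleftrightarrow> ?Q x = ?Q y" if "x \<in> carrier (\<pi>\<^sub>1 N)" "y \<in> carrier (\<pi>\<^sub>1 N)" for x y
    by (rule hom_eq_iff_of_kernels[OF group_G P(1) Q(1) b_in k that])
  \<comment> \<open>The restriction is there because members of \<open>auto G\<close> are
    extensional.\<close>
  define \<alpha> where "\<alpha> = restrict (\<lambda>g. ?Q (SOME x. x \<in> carrier (\<pi>\<^sub>1 N) \<and> ?P x = g)) (carrier G)"
  have \<alpha>: "\<alpha> (?P x) = ?Q x" if x: "x \<in> carrier (\<pi>\<^sub>1 N)" for x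
  proof -
    define y where "y = (SOME y. y \<in> carrier (\<pi>\<^sub>1 N) \<and> ?P y = ?P x)"
    have y: "y \<in> carrier (\<pi>\<^sub>1 N) \<and> ?P y = ?P x" unfolding y_def by (rule someI_ex) (use x in blast)
    have "?P x \<in> carrier G" using P(1) x unfolding hom_def by blast
    then have "\<alpha> (?P x) = ?Q y" by (simp add: \<alpha>_def y_def)
    then show ?thesis using iff[of y x] y x by simp
  qed
  have sur: "\<exists>x\<in>carrier (\<pi>\<^sub>1 N). ?P x = g" if "g \<in> carrier G" for g using P(2) that by (metis image_iff)
  have QG: "?Q x \<in> carrier G" if "x \<in> carrier (\<pi>\<^sub>1 N)" for x using Q(1) that unfolding hom_def by blast
  have "\<alpha> \<in> hom G G"
  proof (rule homI)
    fix g assume "g \<in> carrier G"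
    then show "\<alpha> g \<in> carrier G" using sur \<alpha> QG by metis
  next
    fix g h assume "g \<in> carrier G" "h \<in> carrier G"
    then obtain x y where x: "x \<in> carrier (\<pi>\<^sub>1 N)" "?P x = g" and y: "y \<in> carrier (\<pi>\<^sub>1 N)" "?P y = h" using sur by meson
    have xy: "x \<otimes>\<^bsub>\<pi>\<^sub>1 N\<^esub> y \<in> carrier (\<pi>\<^sub>1 N)"
    proof -
      obtain p q where "p \<in> loops (X N) (b N)" "x = loop_class (X N) (b N) p" "q \<in> loops (X N) (b N)" "y = loop_class (X N) (b N) q"
        using x(1) y(1) unfolding carrier_fundamental_group by blast
      then show ?thesis using fundamental_group_mult loops_concat unfolding carrier_fundamental_group by (metis imageI)
    qed
    have "\<alpha> (g \<otimes> h) = ?Q (x \<otimes>\<^bsub>\<pi>\<^sub>1 N\<^esub> y)" using \<alpha>[OF xy] hom_mult[OF P(1) x(1) y(1)] x(2) y(2) by simp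
    also have "\<dots> = \<alpha> g \<otimes> \<alpha> h" using hom_mult[OF Q(1) x(1) y(1)] \<alpha>[OF x(1)] \<alpha>[OF y(1)] x(2) y(2) by simp
    finally show "\<alpha> (g \<otimes> h) = \<alpha> g \<otimes> \<alpha> h" .
  qed
  moreover have "bij_betw \<alpha> (carrier G) (carrier G)"
    unfolding bij_betw_def
  proof
    show "inj_on \<alpha> (carrier G)"
    proof (rule inj_onI)
      fix g h assume g: "g \<in> carrier G" "h \<in> carrier G" "\<alpha> g = \<alpha> h"
      then obtain x y where x: "x \<in> carrier (\<pi>\<^sub>1 N)" "?P x = g" and y: "y \<in> carrier (\<pi>\<^sub>1 N)" "?P y = h" using sur by meson
      have "?Q x = ?Q y" using \<alpha>[OF x(1)] \<alpha>[OF y(1)] x(2) y(2) g(3) by simp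
      then show "g = h" using iff[OF x(1) y(1)] x(2) y(2) by simp
    qed
    show "\<alpha> ` carrier G = carrier G"
    proof (intro equalityI subsetI)
      fix g assume "g \<in> \<alpha> ` carrier G" then show "g \<in> carrier G" using sur \<alpha> QG by (metis imageE)
    next
      fix g assume "g \<in> carrier G"
      then obtain x where x: "x \<in> carrier (\<pi>\<^sub>1 N)" "?Q x = g" using Q(2) by (metis image_iff)
      have "?P x \<in> carrier G" using P(1) x(1) unfolding hom_def by blast
      then show "g \<in> \<alpha> ` carrier G" using \<alpha>[OF x(1)] x(2) by (metis imageI)
    qed
  qed
  moreover have "\<alpha> \<in> extensional (carrier G)" by (simp add: \<alpha>_def)
  ultimately have A: "\<alpha> \<in> auto G" unfolding auto_def Bij_def by blast
  have "\<forall>x\<in>carrier (\<pi>\<^sub>1 N). pushed n N (\<alpha> \<circ> \<phi>) x = pushed m N \<psi> x"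
    unfolding pushed_comp using \<alpha> by simp
  then have "((n, \<alpha> \<circ> \<phi>), r') \<in> rel"
    unfolding sur_rel_def rr using aut_comp_rep(1)[OF r A] r'[unfolded rr] N by blast
  with A show ?thesis using that by blast
qed

text \<open>\<open>aut_action\<close> works on every representative of a class at once; all of them
  lead to the same class, so the union collapses.\<close>

lemma aut_action_class:
  assumes r: "(n, \<phi>) \<in> reps" and \<alpha>: "\<alpha> \<in> auto G"
  shows "aut_action X s b G \<alpha> (rel `` {(n, \<phi>)}) = rel `` {(n, \<alpha> \<circ> \<phi>)}"
proof -
  have R: "(n, \<alpha> \<circ> \<phi>) \<in> reps" by (rule aut_comp_rep(1)[OF assms])
  have one: "rel `` {(m, \<alpha> \<circ> \<psi>)} = rel `` {(n, \<alpha> \<circ> \<phi>)}" if eq: "((n, \<phi>), (m, \<psi>)) \<in> rel" for m \<psi>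
  proof -
    obtain N where "n \<le> N" "m \<le> N" "\<forall>x\<in>carrier (\<pi>\<^sub>1 N). pushed n N \<phi> x = pushed m N \<psi> x" and m: "(m, \<psi>) \<in> reps"
      using eq unfolding sur_rel_def by auto
    then have "((n, \<alpha> \<circ> \<phi>), (m, \<alpha> \<circ> \<psi>)) \<in> rel"
      unfolding sur_rel_def using R aut_comp_rep(1)[OF m \<alpha>] by (auto simp: pushed_comp)
    then show ?thesis using equiv_class_eq[OF equiv_rel] by blast
  qed
  have "aut_action X s b G \<alpha> (rel `` {(n, \<phi>)}) = (\<Union>r'\<in>rel `` {(n, \<phi>)}. rel `` {(fst r', \<alpha> \<circ> snd r')})"
    unfolding aut_action_def by (auto simp: case_prod_unfold)
  also have "\<dots> = (\<Union>r'\<in>rel `` {(n, \<phi>)}. rel `` {(n, \<alpha> \<circ> \<phi>)})"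
  proof (rule SUP_cong[OF refl])
    fix r' assume "r' \<in> rel `` {(n, \<phi>)}"
    then show "rel `` {(fst r', \<alpha> \<circ> snd r')} = rel `` {(n, \<alpha> \<circ> \<phi>)}" using one[of "fst r'" "snd r'"] by simp
  qed
  also have "\<dots> = rel `` {(n, \<alpha> \<circ> \<phi>)}" using equiv_class_self[OF equiv_rel r] by blast
  finally show ?thesis .
qed

text \<open>Automorphisms preserve kernels, and surjections with equal kernels at a stage differ by
  an automorphism. Orbits are therefore governed by equivalence of covers alone.\<close>

lemma orbit_eq:
  assumes r: "r \<in> reps"
  shows "orbit (AutoGroup G) (aut_action X s b G) (rel `` {r}) = (\<lambda>r'. rel `` {r'}) ` cover_class r"
proof -
  obtain n \<phi> where rr: "r = (n, \<phi>)" by fastforce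
  have "orbit (AutoGroup G) (aut_action X s b G) (rel `` {r}) = {rel `` {(n, \<alpha> \<circ> \<phi>)} |\<alpha>. \<alpha> \<in> auto G}"
    using aut_action_class[OF r[unfolded rr]] unfolding orbit_def AutoGroup_def rr by auto
  also have "\<dots> = (\<lambda>r'. rel `` {r'}) ` cover_class r"
  proof (intro equalityI subsetI)
    fix C assume "C \<in> {rel `` {(n, \<alpha> \<circ> \<phi>)} |\<alpha>. \<alpha> \<in> auto G}"
    then show "C \<in> (\<lambda>r'. rel `` {r'}) ` cover_class r"
      using aut_comp_rep[OF r[unfolded rr]] unfolding cover_class_def rr by blast
  next
    fix C assume "C \<in> (\<lambda>r'. rel `` {r'}) ` cover_class r"
    then obtain r' where r': "r' \<in> reps" "cover_equiv (rep_cover r) (rep_cover r')" "C = rel `` {r'}"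
      unfolding cover_class_def by blast
    obtain \<alpha> where \<alpha>: "\<alpha> \<in> auto G" "((n, \<alpha> \<circ> \<phi>), r') \<in> rel"
      using ex_aut_if_cover_equiv[OF r[unfolded rr] r'(1) r'(2)[unfolded rr]] by blast
    then have "C = rel `` {(n, \<alpha> \<circ> \<phi>)}" using equiv_class_eq[OF equiv_rel \<alpha>(2)] r'(3) by simp
    then show "C \<in> {rel `` {(n, \<alpha> \<circ> \<phi>)} |\<alpha>. \<alpha> \<in> auto G}" using \<alpha>(1) by blast
  qed
  finally show ?thesis .
qed

lemma cover_class_eq:
  assumes "cover_equiv (rep_cover r) (rep_cover r')"
  shows "cover_class r = cover_class r'"
  unfolding cover_class_def using assms cover_equiv_sym cover_equiv_trans by blast

text \<open>\<open>corresponds\<close> refers to an orbit only through its union; this identifies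
  that union.\<close>

lemma Union_orbit: "\<Union>((\<lambda>r'. rel `` {r'}) ` cover_class r) = cover_class r"
proof (intro equalityI subsetI)
  fix r'' assume "r'' \<in> \<Union>((\<lambda>r'. rel `` {r'}) ` cover_class r)"
  then obtain r' where r': "r' \<in> cover_class r" "(r', r'') \<in> rel" by blast
  then have "r'' \<in> reps" unfolding sur_rel_def by auto
  then show "r'' \<in> cover_class r"
    using r'(1) rel_imp_cover_equiv[OF r'(2)] cover_equiv_trans unfolding cover_class_def by blast
next
  fix r' assume r': "r' \<in> cover_class r"
  then have "r' \<in> rel `` {r'}" using equiv_class_self[OF equiv_rel] unfolding cover_class_def by blast
  then show "r' \<in> \<Union>((\<lambda>r'. rel `` {r'}) ` cover_class r)" using r' by blast
qed

lemma orbits_eq: "lim_Sur_mod_Aut X s b G = (\<lambda>r. (\<lambda>r'. rel `` {r'}) ` cover_class r) ` reps"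
proof -
  have "lim_Sur X s b G = (\<lambda>r. rel `` {r}) ` reps" unfolding lim_Sur_def quotient_def by blast
  then have "lim_Sur_mod_Aut X s b G = (\<lambda>r. orbit (AutoGroup G) (aut_action X s b G) (rel `` {r})) ` reps"
    unfolding orbits_def by (simp only: Setcompr_eq_image image_image)
  then show ?thesis using orbit_eq by simp
qed

text \<open>Orbits are indexed by \<open>cover_class\<close>, that is by equivalence of the assigned
  covers, which gives injectivity; surjectivity is
  \<open>regular_cover_equiv_rep_cover\<close>.\<close>

theorem parametrization:
  "bij_betw (\<lambda>c. {C \<in> regular_covers L G. \<exists>r\<in>\<Union>c. cover_equiv C (rep_cover r)})
     (lim_Sur_mod_Aut X s b G)
     ((regular_covers L G :: (('x \<times> 'g) topology \<times> ('x \<times> 'g \<Rightarrow> 'x)) set) // cover_equiv_rel L G)"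
proof -
  let ?RC = "regular_covers L G :: (('x \<times> 'g) topology \<times> ('x \<times> 'g \<Rightarrow> 'x)) set"
  let ?c = "\<lambda>r. (\<lambda>r'. rel `` {r'}) ` cover_class r"
  let ?F = "\<lambda>c. {C \<in> ?RC. \<exists>r\<in>\<Union>c. cover_equiv C (rep_cover r)}"
  have F: "?F (?c r) = {C \<in> ?RC. cover_equiv C (rep_cover r)}" if r: "r \<in> reps" for r
  proof -
    have "(\<exists>r'\<in>cover_class r. cover_equiv C (rep_cover r')) \<longleftrightarrow> cover_equiv C (rep_cover r)" for C :: "('x \<times> 'g) topology \<times> ('x \<times> 'g \<Rightarrow> 'x)"
      using r cover_equiv_refl cover_equiv_sym cover_equiv_trans unfolding cover_class_def by blast
    then show ?thesis unfolding Union_orbit by simp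
  qed
  have cls: "cover_equiv_rel L G `` {rep_cover r} = {C \<in> ?RC. cover_equiv C (rep_cover r)}" if r: "r \<in> reps" for r
    using rep_cover_regular[OF r] cover_equiv_sym unfolding cover_equiv_rel_def by blast
  have "inj_on ?F (lim_Sur_mod_Aut X s b G)"
  proof (rule inj_onI)
    fix c d assume "c \<in> lim_Sur_mod_Aut X s b G" "d \<in> lim_Sur_mod_Aut X s b G" and eq: "?F c = ?F d"
    then obtain r r' where r: "r \<in> reps" "c = ?c r" and r': "r' \<in> reps" "d = ?c r'" unfolding orbits_eq by blast
    have "rep_cover r \<in> ?F c" unfolding r(2) F[OF r(1)] using rep_cover_regular[OF r(1)] cover_equiv_refl by blast
    then have "rep_cover r \<in> {C \<in> ?RC. cover_equiv C (rep_cover r')}" unfolding eq r'(2) F[OF r'(1)] .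
    then have "cover_class r = cover_class r'" using cover_class_eq by blast
    then show "c = d" unfolding r(2) r'(2) by simp
  qed
  moreover have "?F ` lim_Sur_mod_Aut X s b G = ?RC // cover_equiv_rel L G"
  proof (intro equalityI subsetI)
    fix S assume "S \<in> ?F ` lim_Sur_mod_Aut X s b G"
    then obtain r where r: "r \<in> reps" "S = ?F (?c r)" unfolding orbits_eq by blast
    have "S = cover_equiv_rel L G `` {rep_cover r}" unfolding r(2) F[OF r(1)] cls[OF r(1)] ..
    then show "S \<in> ?RC // cover_equiv_rel L G" using rep_cover_regular[OF r(1)] by (metis quotientI)
  next
    fix S assume "S \<in> ?RC // cover_equiv_rel L G"
    then obtain C where C: "C \<in> ?RC" "S = cover_equiv_rel L G `` {C}" by (rule quotientE)
    obtain r where r: "r \<in> reps" "cover_equiv C (rep_cover r)" using regular_cover_equiv_rep_cover[OF C(1)] by blast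
    have "S = {D \<in> ?RC. cover_equiv D (rep_cover r)}"
      unfolding C(2) cover_equiv_rel_def using C(1) r(2) cover_equiv_sym cover_equiv_trans by blast
    then have "S = ?F (?c r)" unfolding F[OF r(1)] .
    moreover have "?c r \<in> lim_Sur_mod_Aut X s b G" unfolding orbits_eq using r(1) by blast
    ultimately show "S \<in> ?F ` lim_Sur_mod_Aut X s b G" by blast
  qed
  ultimately show ?thesis unfolding bij_betw_def by blast
qed

end

section \<open>The hull as an inverse system, and the conclusion\<close>

lemma inverse_limit_compact:
  assumes "\<And>n. compact_space (\<Gamma> n)" "\<And>n. Hausdorff_space (\<Gamma> n)" "\<And>n. continuous_map (\<Gamma> (Suc n)) (\<Gamma> n) (\<sigma> (Suc n))"
  shows "compact_space (inverse_limit \<Gamma> \<sigma>)"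
proof -
  let ?P = "product_topology \<Gamma> UNIV"
  have "closedin ?P {x \<in> topspace ?P. \<sigma> (Suc n) (x (Suc n)) = x n}" for n
  proof (rule closedin_continuous_maps_eq[OF assms(2)[of n]])
    show "continuous_map ?P (\<Gamma> n) (\<lambda>x. x n)" by (rule continuous_map_product_projection) simp
    have "continuous_map ?P (\<Gamma> (Suc n)) (\<lambda>x. x (Suc n))" by (rule continuous_map_product_projection) simp
    from continuous_map_compose[OF this assms(3)] show "continuous_map ?P (\<Gamma> n) (\<lambda>x. \<sigma> (Suc n) (x (Suc n)))"
      by (simp add: o_def)
  qed
  then have "closedin ?P (\<Inter>n. {x \<in> topspace ?P. \<sigma> (Suc n) (x (Suc n)) = x n})" by (intro closedin_INT) auto
  moreover have "(\<Inter>n. {x \<in> topspace ?P. \<sigma> (Suc n) (x (Suc n)) = x n}) = topspace ?P \<inter> {x. \<forall>n. \<sigma> (Suc n) (x (Suc n)) = x n}"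
    by auto
  moreover have "compact_space ?P" using assms(1) by (simp add: compact_space_product_topology)
  ultimately have "compactin ?P (topspace ?P \<inter> {x. \<forall>n. \<sigma> (Suc n) (x (Suc n)) = x n})"
    by (simp only: closedin_compact_space)
  then show ?thesis
    unfolding inverse_limit_def compactin_subspace by (simp only: subtopology_restrict)
qed

text \<open>Compactness of the hull is transported along the homeomorphism from the inverse limit, a
  closed subspace of a product of compact Hausdorff spaces.\<close>

lemma approximants_inverse_system:
  assumes ap: "approximants T \<Gamma> \<sigma> \<pi>"
  shows "inverse_system \<Gamma> \<sigma> (hull_topology T) \<pi>"
proof
  have cw: "finite_CW_complex (\<Gamma> n)" and cs: "continuous_map (\<Gamma> (Suc n)) (\<Gamma> n) (\<sigma> (Suc n))"
    and hom: "homeomorphic_map (hull_topology T) (inverse_limit \<Gamma> \<sigma>) (\<lambda>S n. \<pi> n S)" for n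
    using ap unfolding approximants_def by blast+
  have tl: "topspace (inverse_limit \<Gamma> \<sigma>) = {x. (\<forall>n. x n \<in> topspace (\<Gamma> n)) \<and> (\<forall>n. \<sigma> (Suc n) (x (Suc n)) = x n)}"
    unfolding inverse_limit_def by (auto simp: PiE_iff)
  note sur = homeomorphic_imp_surjective_map[OF hom]
  show "compact_space (\<Gamma> n)" "Hausdorff_space (\<Gamma> n)" for n by (rule finite_CW_complex_imp[OF cw])+
  show "continuous_map (\<Gamma> (Suc n)) (\<Gamma> n) (\<sigma> (Suc n))" for n by (rule cs)
  show "continuous_map (hull_topology T) (\<Gamma> n) (\<pi> n)" for n
  proof -
    have "continuous_map (inverse_limit \<Gamma> \<sigma>) (\<Gamma> n) (\<lambda>x. x n)"
      unfolding inverse_limit_def by (intro continuous_map_from_subtopology continuous_map_product_projection) simp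
    from continuous_map_compose[OF homeomorphic_imp_continuous_map[OF hom] this] show ?thesis by (simp add: o_def)
  qed
  show "\<sigma> (Suc n) (\<pi> (Suc n) S) = \<pi> n S" if "S \<in> topspace (hull_topology T)" for S n
  proof -
    have "(\<lambda>n. \<pi> n S) \<in> topspace (inverse_limit \<Gamma> \<sigma>)" using sur that by blast
    then show ?thesis unfolding tl by simp
  qed
  show "S = S'" if "S \<in> topspace (hull_topology T)" "S' \<in> topspace (hull_topology T)" "\<And>n. \<pi> n S = \<pi> n S'" for S S'
    using homeomorphic_imp_injective_map[OF hom] that unfolding inj_on_def by auto
  show "\<exists>S\<in>topspace (hull_topology T). \<forall>n. \<pi> n S = t n"
    if t: "\<And>n. t n \<in> topspace (\<Gamma> n)" "\<And>n. \<sigma> (Suc n) (t (Suc n)) = t n" for t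
  proof -
    have "t \<in> topspace (inverse_limit \<Gamma> \<sigma>)" unfolding tl using t by simp
    then have "t \<in> (\<lambda>S n. \<pi> n S) ` topspace (hull_topology T)" using sur by simp
    then show ?thesis by auto
  qed
  show "compact_space (hull_topology T)"
  proof -
    have "compact_space (inverse_limit \<Gamma> \<sigma>)"
      by (rule inverse_limit_compact) (use finite_CW_complex_imp[OF cw] cs in auto)
    then show ?thesis
      using homeomorphic_compact_space homeomorphic_map_imp_homeomorphic_space[OF hom] by blast
  qed
qed

text \<open>Fibres have the size of \<open>G\<close>, so covers whose points are pairs of a tiling
  and a group element suffice for the parametrization. The second half of the statement ensures that
  this choice of type loses no cover.\<close>

theorem theorem1p1:
  fixes G :: "('g, 'm) monoid_scheme"
    and T :: "('d::finite, 'l) tiling"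
    and \<Gamma> :: "nat \<Rightarrow> 'c topology"
    and \<sigma> :: "nat \<Rightarrow> 'c \<Rightarrow> 'c"
    and \<pi> :: "nat \<Rightarrow> ('d, 'l) tiling \<Rightarrow> 'c"
    and b :: "nat \<Rightarrow> 'c"
  assumes "group G" and "finite (carrier G)"
    and "is_tiling T" and "repetitive T" and "finite_local_complexity T"
    and "approximants T \<Gamma> \<sigma> \<pi>"
    and "compatible_base_points \<Gamma> \<sigma> b"
  shows
    "bij_betw
       (\<lambda>c. {C \<in> regular_covers (hull_topology T) G. corresponds T \<Gamma> \<pi> b G c C})
       (lim_Sur_mod_Aut \<Gamma> \<sigma> b G)
       ((regular_covers (hull_topology T) G
           :: ((('d, 'l) tiling \<times> 'g) topology \<times> (('d, 'l) tiling \<times> 'g \<Rightarrow> ('d, 'l) tiling)) set)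
         // cover_equiv_rel (hull_topology T) G)
     \<and>
     (\<forall>C' \<in> (regular_covers (hull_topology T) G
           :: ('e topology \<times> ('e \<Rightarrow> ('d, 'l) tiling)) set).
        \<exists>C \<in> (regular_covers (hull_topology T) G
           :: ((('d, 'l) tiling \<times> 'g) topology \<times> (('d, 'l) tiling \<times> 'g \<Rightarrow> ('d, 'l) tiling)) set).
          cover_equiv C' C)"
proof -
  let ?\<Omega> = "hull_topology T"
  interpret I: inverse_system \<Gamma> \<sigma> ?\<Omega> \<pi> by (rule approximants_inverse_system[OF assms(6)])
  have cw: "finite_CW_complex (\<Gamma> n)" "connected_space (\<Gamma> n)" for n
    using assms(6) unfolding approximants_def by blast+
  \<comment> \<open>Compatible base points form a thread, so they are the images of one tiling in
    the hull.\<close>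
  obtain \<omega> where \<omega>: "\<omega> \<in> topspace ?\<Omega>" "\<And>n. \<pi> n \<omega> = b n"
    using I.thread[of b] assms(7) unfolding compatible_base_points_def by blast
  interpret G: group G by fact
  interpret approximant_system \<Gamma> \<sigma> ?\<Omega> \<pi> G b \<omega>
    by unfold_locales (use assms(2) cw finite_CW_complex_imp(3)[OF cw(1)] \<omega> in auto)
  \<comment> \<open>\<open>Union_orbit\<close> shows that the union of an orbit consists of valid
    representatives, to each of which \<open>cover_of_hom_rep_iff\<close> applies.\<close>
  have corr: "corresponds T \<Gamma> \<pi> b G c C \<longleftrightarrow> (\<exists>r\<in>\<Union>c. cover_equiv C (rep_cover r))"
    if c: "c \<in> lim_Sur_mod_Aut \<Gamma> \<sigma> b G" for c and C :: "(('d, 'l) tiling \<times> 'g) topology \<times> (('d, 'l) tiling \<times> 'g \<Rightarrow> ('d, 'l) tiling)"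
  proof -
    obtain r where r: "c = (\<lambda>r'. rel `` {r'}) ` cover_class r" using c unfolding orbits_eq by blast
    have sub: "\<Union>c \<subseteq> reps" unfolding r Union_orbit by (auto simp: cover_class_def)
    show ?thesis
      unfolding corresponds_def case_prod_unfold
    proof (rule bex_cong[OF refl])
      fix r assume "r \<in> \<Union>c"
      then have "(fst r, snd r) \<in> reps" using sub by auto
      from cover_of_hom_rep_iff[OF this, of C]
      show "(\<exists>D :: ('c \<times> 'g) topology \<times> ('c \<times> 'g \<Rightarrow> 'c). cover_of_hom (\<Gamma> (fst r)) (b (fst r)) G (snd r) D \<and>
          cover_equiv C (pullback_cover ?\<Omega> (\<pi> (fst r)) D)) \<longleftrightarrow> cover_equiv C (rep_cover r)" by simp
    qed
  qed
  have "bij_betw (\<lambda>c. {C \<in> regular_covers ?\<Omega> G. corresponds T \<Gamma> \<pi> b G c C}) (lim_Sur_mod_Aut \<Gamma> \<sigma> b G)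
       ((regular_covers ?\<Omega> G
           :: ((('d, 'l) tiling \<times> 'g) topology \<times> (('d, 'l) tiling \<times> 'g \<Rightarrow> ('d, 'l) tiling)) set) // cover_equiv_rel ?\<Omega> G)"
    by (rule iffD1[OF bij_betw_cong parametrization]) (use corr in auto)
  moreover have "\<forall>C' \<in> (regular_covers ?\<Omega> G :: ('e topology \<times> ('e \<Rightarrow> ('d, 'l) tiling)) set).
        \<exists>C \<in> (regular_covers ?\<Omega> G
           :: ((('d, 'l) tiling \<times> 'g) topology \<times> (('d, 'l) tiling \<times> 'g \<Rightarrow> ('d, 'l) tiling)) set). cover_equiv C' C"
    using regular_cover_equiv_rep_cover rep_cover_regular by blast
  ultimately show ?thesis by blast
qed

end
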